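(* Let \(\mathcal V\to\Delta^*\) be an admissible variation of graded-polarized mixed Hodge structure with unipotent monodromy of type (I) or (II), with lifted period map \(F(z):U\to\mathcal M\), monodromy logarithm \(N\) and limiting Hodge filtration \(F_\infty\). Then the limiting grading \[Y_\infty=\lim_{\mathrm{Im}(z)\to\infty}e^{-zN}.Y_{(F(z),W)}=\lim_{\mathrm{Im}(z)\to\infty}\mathrm{Ad}(e^{-zN})Y_{(F(z),W)}\] exists and coincides with the grading \(Y(F_\infty,W,N)\).
   Context: Setting. \(V_{\mathbb Q}\) finite-dimensional over \(\mathbb Q\), \(V=V_{\mathbb Q}\otimes\mathbb C\), \(W\) an increasing rational filtration, \(Q=\{Q_k\}\) nondegenerate rational forms on \(Gr^W_k\) of parity \((-1)^k\); \(\mathcal M\) the classifying space of decreasing filtrations \(F\) (fixed \(\dim F^p\)) with \((F,W)\) a mixed Hodge structure graded-polarized by \(Q\); \(\mathfrak g_{\mathbb R}\) the real endomorphisms preserving \(W\) and infinitesimally preserving the \(Q_k\) on \(Gr^W\). Deligne bigrading of a mixed Hodge structure \((F,W')\): unique \(V=\bigoplus I^{p,q}\) with \(F^p=\bigoplus_{a\ge p}I^{a,b}\), \(W'_k=\bigoplus_{a+b\le k}I^{a,b}\), \(\overline{I^{p,q}}\equiv I^{q,p}\bmod\bigoplus_{r<q,s<p}I^{r,s}\). \(Y_{(F,W')}\) denotes the grading of \(W'\) acting as \(p+q\) on \(I^{p,q}\). Type (I)/(II): \(\dim I^{p,q}=0\) unless \(p+q\in\{k,k-1\}\) (I), resp.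 unless \(p+q=2k-1\) or \((p,q)\in\{(k,k),(k-1,k-1)\}\) (II), for some \(k\). Admissible variation with unipotent monodromy: lifted period map \(F:U\to\mathcal M\) (\(U\) upper half plane, \(s=e^{2\pi iz}\)), holomorphic horizontal, \(F(z+1)=e^N.F(z)\) with \(N\in\mathfrak g_{\mathbb R}\) nilpotent; \(F_\infty=\lim_{s\to0}e^{-zN}.F(z)\) exists and the relative weight filtration \({}^rW={}^rW(N,W)\) exists (unique increasing filtration with \(N({}^rW_k)\subset{}^rW_{k-2}\), \(N^j:Gr^{{}^rW}_{k+j}Gr^W_k\cong Gr^{{}^rW}_{k-j}Gr^W_k\)); \((F_\infty,{}^rW)\) is then a mixed Hodge structure. Definition of \(Y(F_\infty,W,N)\) (Deligne): with \({}^rY=Y_{(F_\infty,{}^rW)}\), it is the unique grading \(Y\) of \(W\) such that \([{}^rY,Y]=0\) and, writing \(N=N_0+N_{-1}+N_{-2}+\cdots\) with \([Y,N_{-j}]=-jN_{-j}\) and \(H={}^rY-Y\), there exists \(N_0^+\) with \((N_0,H,N_0^+)\) an \(\mathfrak{sl}_2\)-triple (\([H,N_0]=-2N_0\), \([H,N_0^+]=2N_0^+\), \([N_0^+,N_0]=H\)), \([N-N_0,N_0^+]=0\), and each \(N_{-j}\) (\(j>0\)) is a highest weight vector of weight \(j-2\) for the adjoint action of this triple. *)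

theory Defs
  imports "HOL-Analysis.Analysis"
begin

text \<open>Conventions. V_Q = Q^n (standard rational structure), V = C^n modelled as
  complex^'n; endomorphisms are matrices complex^'n^'n acting by *v.
  Subspaces are complex subspaces (vec.subspace / vec.span w.r.t. *s).
  Increasing filtrations are maps int => subspace, decreasing ones likewise.\<close>

type_synonym 'n cvec = "complex^'n::finite"
type_synonym 'n cmat = "complex^'n^'n"
type_synonym 'n filt = "int \<Rightarrow> (complex^'n::finite) set"

definition vcnj :: "complex^'n::finite \<Rightarrow> complex^'n" where
  "vcnj v = (\<chi> i. cnj (v$i))"

definition rat_vecs :: "(complex^'n::finite) set" where
  "rat_vecs = {v. \<forall>i. v$i \<in> \<rat>}"

definition real_vecs :: "(complex^'n::finite) set" where
  "real_vecs = {v. \<forall>i. v$i \<in> \<real>}"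

definition splus :: "(complex^'n::finite) set \<Rightarrow> (complex^'n) set \<Rightarrow> (complex^'n) set" where
  "splus A B = {a + b | a b. a \<in> A \<and> b \<in> B}"

definition rational_subspace :: "(complex^'n::finite) set \<Rightarrow> bool" where
  "rational_subspace S \<longleftrightarrow> vec.subspace S \<and> S = vec.span (S \<inter> rat_vecs)"

definition real_subspace :: "(complex^'n::finite) set \<Rightarrow> bool" where
  "real_subspace S \<longleftrightarrow> vec.subspace S \<and> S = vec.span (S \<inter> real_vecs)"

definition incr_filt :: "'n::finite filt \<Rightarrow> bool" where
  "incr_filt W \<longleftrightarrow> (\<forall>k. vec.subspace (W k)) \<and> (\<forall>k. W k \<subseteq> W (k+1))
     \<and> (\<exists>a. W a = {0}) \<and> (\<exists>b. W b = UNIV)"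

definition decr_filt :: "'n::finite filt \<Rightarrow> bool" where
  "decr_filt F \<longleftrightarrow> (\<forall>p. vec.subspace (F p)) \<and> (\<forall>p. F (p+1) \<subseteq> F p)
     \<and> (\<exists>a. F a = UNIV) \<and> (\<exists>b. F b = {0})"

definition rational_incr_filt :: "'n::finite filt \<Rightarrow> bool" where
  "rational_incr_filt W \<longleftrightarrow> incr_filt W \<and> (\<forall>k. rational_subspace (W k))"

definition real_incr_filt :: "'n::finite filt \<Rightarrow> bool" where
  "real_incr_filt W \<longleftrightarrow> incr_filt W \<and> (\<forall>k. real_subspace (W k))"

definition bil :: "complex^'n::finite^'n \<Rightarrow> complex^'n \<Rightarrow> complex^'n \<Rightarrow> complex" where
  "bil A u v = (\<Sum>i\<in>UNIV. \<Sum>j\<in>UNIV. u$i * A$i$j * v$j)"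

definition rat_matrix :: "complex^'n::finite^'n \<Rightarrow> bool" where
  "rat_matrix A \<longleftrightarrow> (\<forall>i j. A$i$j \<in> \<rat>)"

definition real_matrix :: "complex^'n::finite^'n \<Rightarrow> bool" where
  "real_matrix A \<longleftrightarrow> (\<forall>i j. A$i$j \<in> \<real>)"

text \<open>Q k is a rational bilinear form on V whose restriction to W_k descends to a
  nondegenerate form on Gr^W_k = W_k/W_{k-1}, of parity (-1)^k.\<close>
definition graded_forms :: "'n::finite filt \<Rightarrow> (int \<Rightarrow> complex^'n::finite^'n) \<Rightarrow> bool" where
  "graded_forms W Q \<longleftrightarrow> (\<forall>k. rat_matrix (Q k)
     \<and> (\<forall>u\<in>W k. \<forall>v\<in>W k. bil (Q k) u v = (if even k then 1 else -1) * bil (Q k) v u)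
     \<and> (\<forall>u\<in>W (k-1). \<forall>v\<in>W k. bil (Q k) u v = 0)
     \<and> (\<forall>u\<in>W k. (\<forall>v\<in>W k. bil (Q k) u v = 0) \<longrightarrow> u \<in> W (k-1)))"

text \<open>Mixed Hodge structure (F,W): W a real increasing filtration, F decreasing, and F
  induces on each Gr^W_k a pure Hodge structure of weight k:
  Gr_k = F^p Gr_k \<oplus> conj(F^{k-p+1} Gr_k).\<close>
definition is_mhs :: "'n::finite filt \<Rightarrow> 'n::finite filt \<Rightarrow> bool" where
  "is_mhs F W \<longleftrightarrow> real_incr_filt W \<and> decr_filt F \<and>
    (\<forall>k p. splus (splus (F p \<inter> W k) (vcnj ` (F (k-p+1) \<inter> W k))) (W (k-1)) = W k
         \<and> splus (F p \<inter> W k) (W (k-1)) \<inter> splus (vcnj ` (F (k-p+1) \<inter> W k)) (W (k-1)) = W (k-1))"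

definition graded_polarized :: "'n::finite filt \<Rightarrow> 'n::finite filt \<Rightarrow> (int \<Rightarrow> complex^'n::finite^'n) \<Rightarrow> bool" where
  "graded_polarized F W Q \<longleftrightarrow>
    (\<forall>k p. \<forall>u\<in>F p \<inter> W k. \<forall>v\<in>F (k-p+1) \<inter> W k. bil (Q k) u v = 0) \<and>
    (\<forall>k p q v. p + q = k \<longrightarrow>
        v \<in> splus (F p \<inter> W k) (W (k-1)) \<longrightarrow>
        v \<in> splus (vcnj ` (F q \<inter> W k)) (W (k-1)) \<longrightarrow> v \<notin> W (k-1) \<longrightarrow>
        Im (\<i> powi (p - q) * bil (Q k) v (vcnj v)) = 0 \<and>
        Re (\<i> powi (p - q) * bil (Q k) v (vcnj v)) > 0)"

definition in_M :: "'n::finite filt \<Rightarrow> (int \<Rightarrow> complex^'n::finite^'n) \<Rightarrow> (int \<Rightarrow> nat) \<Rightarrow> 'n::finite filt \<Rightarrow> bool" where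
  "in_M W Q fdim F \<longleftrightarrow> decr_filt F \<and> (\<forall>p. vec.dim (F p) = fdim p)
     \<and> is_mhs F W \<and> graded_polarized F W Q"

definition in_gR :: "'n::finite filt \<Rightarrow> (int \<Rightarrow> complex^'n::finite^'n) \<Rightarrow> complex^'n^'n \<Rightarrow> bool" where
  "in_gR W Q X \<longleftrightarrow> real_matrix X \<and> (\<forall>k. (\<lambda>v. X *v v) ` W k \<subseteq> W k)
     \<and> (\<forall>k. \<forall>u\<in>W k. \<forall>v\<in>W k. bil (Q k) (X *v u) v + bil (Q k) u (X *v v) = 0)"

fun mpow :: "complex^'n::finite^'n \<Rightarrow> nat \<Rightarrow> complex^'n^'n" where
  "mpow A 0 = mat 1"
| "mpow A (Suc k) = A ** mpow A k"

definition nilpotent_mat :: "complex^'n::finite^'n \<Rightarrow> bool" where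
  "nilpotent_mat A \<longleftrightarrow> (\<exists>k. mpow A k = 0)"

definition mbr :: "complex^'n::finite^'n \<Rightarrow> complex^'n^'n \<Rightarrow> complex^'n^'n" where
  "mbr A B = A ** B - B ** A"

definition csmult :: "complex \<Rightarrow> complex^'n::finite^'n \<Rightarrow> complex^'n^'n" where
  "csmult c A = (\<chi> i j. c * A$i$j)"

text \<open>Exponential of a nilpotent matrix (a nilpotent n x n matrix A has A^n = 0, so the
  truncated series is the exponential; it is only used on nilpotent matrices).\<close>
definition nil_exp :: "complex^'n::finite^'n \<Rightarrow> complex^'n^'n" where
  "nil_exp A = (\<Sum>k\<le>CARD('n). (1 / fact k) *\<^sub>R mpow A k)"

definition filt_act :: "complex^'n::finite^'n \<Rightarrow> 'n::finite filt \<Rightarrow> 'n filt" where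
  "filt_act g F = (\<lambda>p. (\<lambda>v. g *v v) ` F p)"

text \<open>Convergence of subspaces in the Grassmannian, along a filter: there are frames
  b_0,...,b_{d-1} spanning S(x) (eventually) and converging to a basis of S0.\<close>
definition subspace_tendsto :: "('a \<Rightarrow> (complex^'n::finite) set) \<Rightarrow> (complex^'n) set \<Rightarrow> 'a filter \<Rightarrow> bool" where
  "subspace_tendsto S S0 L \<longleftrightarrow>
    (\<exists>d b b0. vec.dim S0 = d \<and> vec.independent (b0 ` {..<d}) \<and> inj_on b0 {..<d}
       \<and> vec.span (b0 ` {..<d}) = S0
       \<and> (\<forall>i<d. ((\<lambda>x. b i x) \<longlongrightarrow> b0 i) L)
       \<and> (\<forall>\<^sub>F x in L. vec.span ((\<lambda>i. b i x) ` {..<d}) = S x))"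

definition filt_tendsto :: "('a \<Rightarrow> 'n::finite filt) \<Rightarrow> 'n::finite filt \<Rightarrow> 'a filter \<Rightarrow> bool" where
  "filt_tendsto F F0 L \<longleftrightarrow> decr_filt F0 \<and> (\<forall>p. subspace_tendsto (\<lambda>x. F x p) (F0 p) L)"

text \<open>Holomorphic horizontal map into the flag variety: locally each F^p is spanned by a
  frame of holomorphic vector-valued functions whose derivatives lie in F^{p-1}.\<close>
definition vderiv :: "(complex \<Rightarrow> complex^'n::finite) \<Rightarrow> complex \<Rightarrow> complex^'n" where
  "vderiv f z = (\<chi> j. deriv (\<lambda>w. f w $ j) z)"

definition hol_horizontal :: "(complex \<Rightarrow> 'n::finite filt) \<Rightarrow> complex set \<Rightarrow> bool" where
  "hol_horizontal F U \<longleftrightarrow> (\<forall>p. \<forall>z0\<in>U. \<exists>A (d::nat) b. open A \<and> z0 \<in> A \<and> A \<subseteq> U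
      \<and> (\<forall>i<d. \<forall>j. (\<lambda>w. b i w $ j) holomorphic_on A)
      \<and> (\<forall>z\<in>A. vec.independent ((\<lambda>i. b i z) ` {..<d}) \<and> inj_on (\<lambda>i. b i z) {..<d}
               \<and> vec.span ((\<lambda>i. b i z) ` {..<d}) = F z p
               \<and> (\<forall>i<d. vderiv (b i) z \<in> F z (p - 1))))"

definition deligne_bigrading :: "'n::finite filt \<Rightarrow> 'n::finite filt \<Rightarrow> (int \<Rightarrow> int \<Rightarrow> (complex^'n::finite) set) \<Rightarrow> bool" where
  "deligne_bigrading F W I \<longleftrightarrow>
     (\<forall>p q. vec.subspace (I p q)) \<and>
     finite {(p,q). I p q \<noteq> {0}} \<and>
     vec.span (\<Union>p q. I p q) = UNIV \<and>
     (\<Sum>(p,q)\<in>{(p,q). I p q \<noteq> {0}}. vec.dim (I p q)) = CARD('n) \<and>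
     (\<forall>p. F p = vec.span (\<Union>{I a b | a b. a \<ge> p})) \<and>
     (\<forall>k. W k = vec.span (\<Union>{I a b | a b. a + b \<le> k})) \<and>
     (\<forall>p q. vcnj ` I p q \<subseteq> vec.span (I q p \<union> \<Union>{I r s | r s. r < q \<and> s < p}))"

definition deligne_grading_of :: "'n::finite filt \<Rightarrow> 'n::finite filt \<Rightarrow> complex^'n::finite^'n \<Rightarrow> bool" where
  "deligne_grading_of F W Y \<longleftrightarrow> (\<exists>I. deligne_bigrading F W I
      \<and> (\<forall>p q. \<forall>v\<in>I p q. Y *v v = of_int (p + q) *s v))"

definition Y_FW :: "'n::finite filt \<Rightarrow> 'n::finite filt \<Rightarrow> complex^'n::finite^'n" where
  "Y_FW F W = (THE Y. deligne_grading_of F W Y)"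

definition type_I :: "'n::finite filt \<Rightarrow> 'n::finite filt \<Rightarrow> int \<Rightarrow> bool" where
  "type_I F W k \<longleftrightarrow> (\<exists>I. deligne_bigrading F W I \<and>
      (\<forall>p q. I p q \<noteq> {0} \<longrightarrow> p + q = k \<or> p + q = k - 1))"

definition type_II :: "'n::finite filt \<Rightarrow> 'n::finite filt \<Rightarrow> int \<Rightarrow> bool" where
  "type_II F W k \<longleftrightarrow> (\<exists>I. deligne_bigrading F W I \<and>
      (\<forall>p q. I p q \<noteq> {0} \<longrightarrow> p + q = 2*k - 1 \<or> (p,q) = (k,k) \<or> (p,q) = (k-1,k-1)))"

definition rel_weight_filt :: "complex^'n::finite^'n \<Rightarrow> 'n::finite filt \<Rightarrow> 'n::finite filt \<Rightarrow> bool" where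
  "rel_weight_filt N W M \<longleftrightarrow> incr_filt M \<and>
     (\<forall>k. (\<lambda>v. N *v v) ` M k \<subseteq> M (k - 2)) \<and>
     (\<forall>k j. let A  = splus (M (k + int j) \<inter> W k) (W (k-1));
               A' = splus (M (k + int j - 1) \<inter> W k) (W (k-1));
               B  = splus (M (k - int j) \<inter> W k) (W (k-1));
               B' = splus (M (k - int j - 1) \<inter> W k) (W (k-1))
           in (\<forall>v\<in>A. mpow N j *v v \<in> B' \<longrightarrow> v \<in> A')
            \<and> (\<forall>w\<in>B. \<exists>v\<in>A. w - mpow N j *v v \<in> B'))"

definition eigsp :: "complex^'n::finite^'n \<Rightarrow> int \<Rightarrow> (complex^'n) set" where
  "eigsp Y j = {v. Y *v v = of_int j *s v}"

definition is_grading :: "'n::finite filt \<Rightarrow> complex^'n::finite^'n \<Rightarrow> bool" where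
  "is_grading W Y \<longleftrightarrow> vec.span (\<Union>j. eigsp Y j) = UNIV
     \<and> (\<forall>k. W k = vec.span (\<Union>j\<in>{..k}. eigsp Y j))"

definition deligne_Y_cond :: "'n::finite filt \<Rightarrow> 'n::finite filt \<Rightarrow> complex^'n::finite^'n \<Rightarrow> 'n::finite filt \<Rightarrow> complex^'n^'n \<Rightarrow> bool" where
  "deligne_Y_cond Finf W N rW Y \<longleftrightarrow>
    (let rY = Y_FW Finf rW; H = rY - Y in
      is_grading W Y \<and> mbr rY Y = 0 \<and>
      (\<exists>K Nc Np. N = (\<Sum>j\<le>K. Nc j)
         \<and> (\<forall>j\<le>K. mbr Y (Nc j) = (- real j) *\<^sub>R Nc j)
         \<and> mbr H (Nc 0) = (-2) *\<^sub>R Nc 0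
         \<and> mbr H Np = 2 *\<^sub>R Np
         \<and> mbr Np (Nc 0) = H
         \<and> mbr (N - Nc 0) Np = 0
         \<and> (\<forall>j\<in>{1..K}. mbr Np (Nc j) = 0 \<and> mbr H (Nc j) = (real j - 2) *\<^sub>R Nc j)))"

definition Y_deligne :: "'n::finite filt \<Rightarrow> 'n::finite filt \<Rightarrow> complex^'n::finite^'n \<Rightarrow> 'n::finite filt \<Rightarrow> complex^'n^'n" where
  "Y_deligne Finf W N rW = (THE Y. deligne_Y_cond Finf W N rW Y)"

end

theory Submission
  imports Defs "HOL-Complex_Analysis.Complex_Analysis"
begin

text \<open>Write F~(z) = e^(-zN).F(z) and Y(z) = Ad(e^(-zN)) Y_(F(z),W).

  Semicontinuity of dim (F~(z)^p \<inter> W_m), together with an inequality for the degree of a real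
  subspace of a mixed Hodge structure in which equality characterises sub-mixed Hodge structures,
  shows that every W_m is a sub-mixed Hodge structure of (F_inf, rW). Hence there is a basis adapted
  to W and to the Deligne bigrading of (F_inf, rW) at once, labelled by (p,q,j) with j the weight for W.
  In coordinates N = N_0 + N_-1 + N_-2; trace duality for ad N_0 provides the sl2-triple and a change
  of basis that removes N_-1, after which Y = diag(j) is the grading Y(F_inf,W,N).

  It remains to see that Y(z) tends to diag(j). The difference is strictly lower triangular for j.
  It is asymptotically compatible with F_inf because Y(z) preserves F~(z), which disposes of the
  entries with p_k < p_i. Modulo W_(m-2), Y(z) also preserves the filtration e^(-zN).conj(F(z)).
  The projections onto F~(z) are periodic and holomorphic, so F~(z) tends to F_inf faster than any
  power of Im z and survives conjugation by e^(-2i Im(z) N); a Weyl element computation in the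
  sl2-triple then identifies the limit of the filtration e^(-zN).conj(F(z)) and disposes of the
  entries with j_k = j_i - 1 and p_k \<ge> p_i. For types (I) and (II) no further entries exist.\<close>

section \<open>Complex conjugation and coordinate subspaces\<close>

text \<open>A matrix entry from label \<open>i\<close> to label \<open>k\<close> that respects both
  the filtration by \<open>p\<close> and the filtration by \<open>j - p\<close> satisfies
  \<open>p k \<ge> p i\<close> and \<open>j k - p k \<ge> j i - p i\<close>; adding up gives
  \<open>j k \<ge> j i\<close>. This is why finding the limit of the conjugate filtration to be the
  one by \<open>j - p\<close> forces the strictly lower part of the grading to vanish. Since
  conjugation respects the grading only modulo two steps of W, the argument reaches
  \<open>j k = j i - 1\<close> only; a drop by two does not occur for type (I) and comes with
  \<open>p k < p i\<close> for type (II). The obstacle is that e^(-zN).conj(F(z)) is the conjugate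
  of F~(z) twisted by e^(-2i Im(z) N), whose entries grow polynomially. Convergence of F~(z) alone
  says nothing about it. The equality of degrees for W_m has a numerical source: N^l makes the
  weights of rW on Gr^W_k symmetric about k, so rW and W give W_m the same total weight.
  Horizontality enters through N F_inf^p \<subseteq> F_inf^(p-1).\<close>

no_notation fps_nth (infixl "$" 75)

lemma vcnj_nth [simp]: "vcnj v $ i = cnj (v $ i)"
  by (simp add: vcnj_def)

lemma vcnj_vcnj [simp]: "vcnj (vcnj v) = v"
  by (simp add: vec_eq_iff)

lemma vcnj_0 [simp]: "vcnj 0 = 0"
  by (simp add: vec_eq_iff)

lemma vcnj_add: "vcnj (u + v) = vcnj u + vcnj v"
  by (simp add: vec_eq_iff)

lemma vcnj_diff: "vcnj (u - v) = vcnj u - vcnj v"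
  by (simp add: vec_eq_iff)

lemma vcnj_smult: "vcnj (c *s v) = cnj c *s vcnj v"
  by (simp add: vec_eq_iff)

lemma vcnj_eq_0_iff [simp]: "vcnj v = 0 \<longleftrightarrow> v = 0"
  by (metis vcnj_0 vcnj_vcnj)

lemma subspace_vcnj_image:
  assumes "vec.subspace A"
  shows "vec.subspace (vcnj ` A)"
proof (rule vec.subspaceI)
  show "0 \<in> vcnj ` A" using vec.subspace_0[OF assms] by force
next
  fix x y assume "x \<in> vcnj ` A" "y \<in> vcnj ` A"
  then show "x + y \<in> vcnj ` A"
    using vec.subspace_add[OF assms] by (auto simp flip: vcnj_add)
next
  fix c x assume "x \<in> vcnj ` A"
  then obtain a where a: "a \<in> A" "x = vcnj a" by auto
  have "c *s x = vcnj (cnj c *s a)" by (simp add: a vcnj_smult)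
  then show "c *s x \<in> vcnj ` A" using vec.subspace_scale[OF assms a(1)] by blast
qed

lemma span_vcnj_image: "vec.span (vcnj ` A) = vcnj ` vec.span A"
proof
  show "vec.span (vcnj ` A) \<subseteq> vcnj ` vec.span A"
    by (rule vec.span_minimal) (auto intro: subspace_vcnj_image vec.span_base)
  have "vec.span A \<subseteq> vcnj ` vec.span (vcnj ` A)"
  proof (rule vec.span_minimal)
    show "A \<subseteq> vcnj ` vec.span (vcnj ` A)"
    proof
      fix a assume "a \<in> A"
      then have "vcnj a \<in> vec.span (vcnj ` A)" by (blast intro: vec.span_base)
      then show "a \<in> vcnj ` vec.span (vcnj ` A)" by (metis image_eqI vcnj_vcnj)
    qed
  qed (auto intro: subspace_vcnj_image)
  then show "vcnj ` vec.span A \<subseteq> vec.span (vcnj ` A)" by force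
qed

lemma independent_vcnj_image:
  assumes "vec.independent A"
  shows "vec.independent (vcnj ` A)"
  unfolding vec.dependent_def
proof
  have inj: "inj vcnj" by (metis injI vcnj_vcnj)
  assume "\<exists>a\<in>vcnj ` A. a \<in> vec.span (vcnj ` A - {a})"
  then obtain a where a: "a \<in> A" "vcnj a \<in> vec.span (vcnj ` A - {vcnj a})" by blast
  have "vcnj ` A - {vcnj a} = vcnj ` (A - {a})" using image_set_diff[OF inj, of A "{a}"] by simp
  then have "a \<in> vec.span (A - {a})" using a(2) span_vcnj_image[of "A - {a}"]
    by (metis (no_types, lifting) image_iff vcnj_vcnj)
  then show False using assms a(1) by (auto simp: vec.dependent_def)
qed

lemma dim_vcnj_image: "vec.dim (vcnj ` A) = vec.dim A"
proof -
  have inj: "inj vcnj" by (metis injI vcnj_vcnj)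
  obtain B where B: "B \<subseteq> A" "vec.independent B" "A \<subseteq> vec.span B" "card B = vec.dim A"
    using vec.basis_exists by blast
  have "vcnj ` A \<subseteq> vec.span (vcnj ` B)" using B(3) by (auto simp: span_vcnj_image)
  then have "vec.dim (vcnj ` A) = card (vcnj ` B)"
    using B independent_vcnj_image[OF B(2)] by (intro vec.dim_unique) auto
  also have "\<dots> = card B" by (intro card_image inj_on_subset[OF inj]) simp
  finally show ?thesis using B(4) by simp
qed

lemma real_subspace_vcnj:
  assumes "real_subspace S" "v \<in> S"
  shows "vcnj v \<in> S"
proof -
  have S: "vec.subspace S" "S = vec.span (S \<inter> real_vecs)" using assms(1) by (auto simp: real_subspace_def)
  have "vcnj x = x" if "x \<in> real_vecs" for x :: "complex^'n"
    using that by (auto simp: vec_eq_iff real_vecs_def Reals_cnj_iff)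
  then have "S \<inter> real_vecs \<subseteq> vcnj ` S" by force
  then have "vec.span (S \<inter> real_vecs) \<subseteq> vcnj ` S"
    by (rule vec.span_minimal) (rule subspace_vcnj_image[OF S(1)])
  then show ?thesis using S(2) assms(2) by force
qed

section \<open>Filtrations, and coordinate subspaces of a basis\<close>

lemma incr_filt_subspace: "incr_filt W \<Longrightarrow> vec.subspace (W k)"
  by (simp add: incr_filt_def)

lemma decr_filt_subspace: "decr_filt F \<Longrightarrow> vec.subspace (F p)"
  by (simp add: decr_filt_def)

lemma incr_filt_mono:
  assumes "incr_filt W" "a \<le> b"
  shows "W a \<subseteq> W b"
  using assms(2)
proof (induction b rule: int_ge_induct)
  case (step i)
  then show ?case using assms(1) unfolding incr_filt_def by (meson subset_trans)
qed simp

lemma decr_filt_mono: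
  assumes "decr_filt F" "a \<le> b"
  shows "F b \<subseteq> F a"
  using assms(2)
proof (induction b rule: int_ge_induct)
  case (step i)
  then show ?case using assms(1) unfolding decr_filt_def by (meson subset_trans)
qed simp

lemma incr_filt_bounds:
  assumes "incr_filt W"
  obtains a b where "a < b" "\<And>k. k \<le> a \<Longrightarrow> W k = {0}" "\<And>k. k \<ge> b \<Longrightarrow> W k = UNIV"
proof -
  obtain a b where ab: "W a = {0}" "W b = UNIV" using assms by (auto simp: incr_filt_def)
  have 1: "W k = {0}" if "k \<le> min a b - 1" for k
  proof -
    have "W k \<subseteq> W a" using that by (intro incr_filt_mono[OF assms]) simp
    then show ?thesis using ab(1) vec.subspace_0[OF incr_filt_subspace[OF assms]] by blast
  qed
  have 2: "W k = UNIV" if "k \<ge> b" for k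
    using incr_filt_mono[OF assms that] ab(2) by blast
  \<comment> \<open>Stepping below both indices gives \<open>a < b\<close> without having to know
    that \<open>{0} \<noteq> UNIV\<close>.\<close>
  show ?thesis by (rule that[of "min a b - 1" b]) (use 1 2 in auto)
qed

lemma decr_filt_bounds:
  assumes "decr_filt F"
  obtains a b where "a < b" "\<And>k. k \<le> a \<Longrightarrow> F k = UNIV" "\<And>k. k \<ge> b \<Longrightarrow> F k = {0}"
proof -
  obtain a b where ab: "F a = UNIV" "F b = {0}" using assms by (auto simp: decr_filt_def)
  have 1: "F k = {0}" if "k \<ge> max a b + 1" for k
  proof -
    have "F k \<subseteq> F b" using that by (intro decr_filt_mono[OF assms]) simp
    then show ?thesis using ab(2) vec.subspace_0[OF decr_filt_subspace[OF assms]] by blast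
  qed
  have 2: "F k = UNIV" if "k \<le> a" for k
    using decr_filt_mono[OF assms that] ab(1) by blast
  show ?thesis by (rule that[of a "max a b + 1"]) (use 1 2 in auto)
qed

text \<open>An image rather than a span of columns, so that membership is the vanishing of certain
  entries of \<open>matrix_inv B *v v\<close> and dimensions are numbers of labels. In an adapted
  basis both filtrations and their intersections take this form.\<close>

definition coord_span :: "complex^'n::finite^'n \<Rightarrow> ('n \<Rightarrow> bool) \<Rightarrow> (complex^'n) set" where
  "coord_span B P = (*v) B ` {x. \<forall>i. \<not> P i \<longrightarrow> x $ i = 0}"

lemma matrix_inv_mult:
  fixes B :: "complex^'n::finite^'n"
  assumes "invertible B"
  shows "matrix_inv B ** B = mat 1" "B ** matrix_inv B = mat 1"
  using assms unfolding invertible_def matrix_inv_def by (metis (mono_tags, lifting) someI_ex)+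

lemma matrix_inv_cancel:
  fixes B :: "complex^'n::finite^'n"
  assumes "invertible B"
  shows "matrix_inv B *v (B *v x) = x" "B *v (matrix_inv B *v x) = x"
  by (simp_all add: matrix_vector_mul_assoc matrix_inv_mult[OF assms])

lemma invertible_matrix_inv:
  fixes B :: "complex^'n::finite^'n"
  assumes "invertible B"
  shows "invertible (matrix_inv B)"
  using matrix_inv_mult[OF assms] unfolding invertible_def by blast

lemma matrix_vector_mult_smult: "A *v (c *s x) = c *s (A *v (x::complex^'n))"
  by (rule matrix_vector_mult_scaleR[unfolded scaleR_conv_of_real] | simp add: vector_scalar_commute)

lemma subspace_matrix_image:
  fixes A :: "complex^'n^'m"
  assumes "vec.subspace S"
  shows "vec.subspace ((*v) A ` S)"
  using assms matrix_vector_mul_linear_gen[of A] by (intro vec.linear_subspace_image) auto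

lemma dim_matrix_image:
  fixes A :: "complex^'n::finite^'n"
  assumes "invertible A"
  shows "vec.dim ((*v) A ` S) = vec.dim S"
proof (rule vec.dim_image_eq)
  show "inj_on ((*v) A) (vec.span S)"
    using matrix_inv_cancel(1)[OF assms] by (metis inj_onI)
qed auto

lemma coord_span_iff:
  assumes "invertible B"
  shows "v \<in> coord_span B P \<longleftrightarrow> (\<forall>i. \<not> P i \<longrightarrow> (matrix_inv B *v v) $ i = 0)"
  unfolding coord_span_def using matrix_inv_cancel[OF assms] by (auto simp: image_iff intro!: exI[of _ "matrix_inv B *v v"])

lemma subspace_coord_span: "vec.subspace (coord_span B P)"
  unfolding coord_span_def
  by (intro subspace_matrix_image) (auto intro!: vec.subspaceI)

lemma dim_coord_span:
  assumes "invertible B"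
  shows "vec.dim (coord_span B P) = card {i. P i}"
  unfolding coord_span_def dim_matrix_image[OF assms]
  using dim_substandard_cart[of "{i. P i}"] by simp

lemma coord_span_mono: "(\<And>i. P i \<Longrightarrow> Q i) \<Longrightarrow> coord_span B P \<subseteq> coord_span B Q"
  unfolding coord_span_def by auto

lemma matrix_vector_mult_column_sum:
  fixes B :: "complex^'n::finite^'n"
  shows "B *v x = (\<Sum>i\<in>UNIV. x $ i *s column i B)"
  by (simp add: matrix_mult_sum)

lemma matrix_vector_mult_axis:
  fixes B :: "complex^'n::finite^'n"
  shows "B *v axis i 1 = column i B"
  by (simp add: vec_eq_iff column_def matrix_vector_mult_def axis_def if_distrib cong: if_cong)

lemma column_in_coord_span: "P i \<Longrightarrow> column i B \<in> coord_span B P"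
  unfolding coord_span_def
  by (rule image_eqI[of _ _ "axis i 1"]) (auto simp: matrix_vector_mult_axis, auto simp: axis_def)

lemma coord_span_minimal:
  assumes "vec.subspace S" "\<And>i. P i \<Longrightarrow> column i B \<in> S"
  shows "coord_span B P \<subseteq> S"
proof
  fix v assume "v \<in> coord_span B P"
  then obtain x where x: "v = B *v x" "\<And>i. \<not> P i \<Longrightarrow> x $ i = 0" by (auto simp: coord_span_def)
  have "x $ i *s column i B \<in> S" for i
    by (cases "P i") (auto simp: x(2) assms vec.subspace_scale vec.subspace_0)
  then show "v \<in> S" unfolding x(1) matrix_vector_mult_column_sum by (intro vec.subspace_sum assms(1)) auto
qed

section \<open>Deligne pieces\<close>

text \<open>Deligne's formula for I^{p,q}, with its sum of lower conjugate terms replaced by one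
  congruence for each \<open>n\<close>: \<open>v\<close> lies in conj F^(q-n) modulo W_(p+q-n-2).
  Such congruences can be established one weight at a time.\<close>

definition deligne_piece :: "'n::finite filt \<Rightarrow> 'n filt \<Rightarrow> int \<Rightarrow> int \<Rightarrow> (complex^'n) set" where
  "deligne_piece F W p q = {v \<in> F p \<inter> W (p + q). \<forall>n::nat. \<exists>w\<in>F (q - int n). v - vcnj w \<in> W (p + q - int n - 2)}"

text \<open>Only the spanning half of opposedness is imposed on the graded pieces of
  \<open>S\<close>; the two filtrations meet trivially there because they do so in the ambient
  structure.\<close>

definition sub_mhs :: "'n::finite filt \<Rightarrow> 'n filt \<Rightarrow> (complex^'n) set \<Rightarrow> bool" where
  "sub_mhs F W S \<longleftrightarrow> vec.subspace S \<and> vcnj ` S \<subseteq> S \<and>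
     (\<forall>k p. \<forall>v\<in>W k \<inter> S. \<exists>x\<in>F p \<inter> W k \<inter> S. \<exists>y\<in>F (k - p + 1) \<inter> W k \<inter> S. v - x - vcnj y \<in> W (k - 1))"

lemma subspace_deligne_piece:
  assumes F: "decr_filt F" and W: "incr_filt W"
  shows "vec.subspace (deligne_piece F W p q)"
proof (rule vec.subspaceI)
  note sF = decr_filt_subspace[OF F] and sW = incr_filt_subspace[OF W]
  show "0 \<in> deligne_piece F W p q"
    unfolding deligne_piece_def using vec.subspace_0[OF sF] vec.subspace_0[OF sW] by (force intro!: bexI[of _ 0])
  fix x y assume x: "x \<in> deligne_piece F W p q" and y: "y \<in> deligne_piece F W p q"
  have "\<exists>w\<in>F (q - int n). x + y - vcnj w \<in> W (p + q - int n - 2)" for n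
  proof -
    obtain w w' where "w \<in> F (q - int n)" "x - vcnj w \<in> W (p + q - int n - 2)"
      "w' \<in> F (q - int n)" "y - vcnj w' \<in> W (p + q - int n - 2)"
      using x y unfolding deligne_piece_def by blast
    then show ?thesis
      using vec.subspace_add[OF sF] vec.subspace_add[OF sW, of "x - vcnj w" _ "y - vcnj w'"]
      by (intro bexI[of _ "w + w'"]) (auto simp: vcnj_add algebra_simps)
  qed
  then show "x + y \<in> deligne_piece F W p q"
    using x y vec.subspace_add[OF sF] vec.subspace_add[OF sW] by (auto simp: deligne_piece_def)
next
  note sF = decr_filt_subspace[OF F] and sW = incr_filt_subspace[OF W]
  fix c x assume x: "x \<in> deligne_piece F W p q"
  have "\<exists>w\<in>F (q - int n). c *s x - vcnj w \<in> W (p + q - int n - 2)" for n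
  proof -
    obtain w where "w \<in> F (q - int n)" "x - vcnj w \<in> W (p + q - int n - 2)"
      using x by (auto simp: deligne_piece_def)
    then show ?thesis
      using vec.subspace_scale[OF sF] vec.subspace_scale[OF sW, of "x - vcnj w" _ c]
      by (intro bexI[of _ "cnj c *s w"]) (auto simp: vcnj_smult vec.scale_right_diff_distrib)
  qed
  then show "c *s x \<in> deligne_piece F W p q"
    using x vec.subspace_scale[OF sF] vec.subspace_scale[OF sW] by (auto simp: deligne_piece_def)
qed

lemma deligne_piece_vcnj:
  assumes "v \<in> deligne_piece F W p q"
  shows "\<exists>w\<in>F q. v - vcnj w \<in> W (p + q - 2)"
proof -
  have "\<exists>w\<in>F (q - int 0). v - vcnj w \<in> W (p + q - int 0 - 2)"
    using assms unfolding deligne_piece_def by blast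
  then show ?thesis by simp
qed

locale mhs =
  fixes F W :: "'n::finite filt"
  assumes is_mhs: "is_mhs F W"
begin

lemma filtF: "decr_filt F" and filtW: "incr_filt W" and realW: "\<And>k. real_subspace (W k)"
  using is_mhs by (auto simp: is_mhs_def real_incr_filt_def)

lemmas sF = decr_filt_subspace[OF filtF]
lemmas sW = incr_filt_subspace[OF filtW]
lemmas monoF = subsetD[OF decr_filt_mono[OF filtF]]
lemmas monoW = subsetD[OF incr_filt_mono[OF filtW]]

lemma cnjW: "v \<in> W k \<Longrightarrow> vcnj v \<in> W k"
  by (rule real_subspace_vcnj[OF realW])

lemma cnjW_iff: "vcnj v \<in> W k \<longleftrightarrow> v \<in> W k"
  using cnjW by fastforce

abbreviation "D \<equiv> deligne_piece F W"

lemmas sD = subspace_deligne_piece[OF filtF filtW]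

text \<open>The uniqueness half of opposedness for single vectors. That \<open>y\<close> lies in
  \<open>W k\<close> comes for free: \<open>vcnj y\<close> differs from \<open>x\<close> by an
  element of \<open>W (k - 1)\<close>, and \<open>W k\<close> is stable under conjugation.\<close>

lemma opposed_Int:
  assumes x: "x \<in> F p" "x \<in> W k" and y: "y \<in> F (k - p + 1)" and xy: "x - vcnj y \<in> W (k - 1)"
  shows "x \<in> W (k - 1)"
proof -
  have W1: "x - vcnj y \<in> W k" using xy monoW[of "k - 1" k] by auto
  then have "vcnj y \<in> W k" using vec.subspace_diff[OF sW x(2) W1] by simp
  then have y': "y \<in> F (k - p + 1) \<inter> W k" using y cnjW_iff by blast
  have "x \<in> splus (vcnj ` (F (k - p + 1) \<inter> W k)) (W (k - 1))"
    unfolding splus_def using y' xy by (intro CollectI exI[of _ "vcnj y"] exI[of _ "x - vcnj y"]) auto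
  moreover have "x \<in> splus (F p \<inter> W k) (W (k - 1))"
    unfolding splus_def using x vec.subspace_0[OF sW] by (intro CollectI exI[of _ x] exI[of _ 0]) auto
  ultimately show ?thesis using is_mhs unfolding is_mhs_def by blast
qed

lemma sub_mhs_W: "sub_mhs F W (W m)"
  unfolding sub_mhs_def
proof (intro conjI allI ballI)
  show "vec.subspace (W m)" by (rule sW)
  show "vcnj ` W m \<subseteq> W m" using cnjW by auto
  fix k p v assume v: "v \<in> W k \<inter> W m"
  show "\<exists>x\<in>F p \<inter> W k \<inter> W m. \<exists>y\<in>F (k - p + 1) \<inter> W k \<inter> W m. v - x - vcnj y \<in> W (k - 1)"
  proof (cases "k \<le> m")
    case True
    have "v \<in> splus (splus (F p \<inter> W k) (vcnj ` (F (k-p+1) \<inter> W k))) (W (k-1))"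
      using v is_mhs unfolding is_mhs_def by blast
    then obtain x y z where "x \<in> F p \<inter> W k" "y \<in> F (k-p+1) \<inter> W k" "z \<in> W (k-1)" "v = x + vcnj y + z"
      unfolding splus_def by auto
    then show ?thesis using monoW[OF True] by (intro bexI[of _ x] bexI[of _ y]) auto
  next
    case False
    then have "v \<in> W (k - 1)" using v monoW[of m "k - 1"] by auto
    then show ?thesis using vec.subspace_0[OF sW] vec.subspace_0[OF sF] by (intro bexI[of _ 0]) auto
  qed
qed

text \<open>The weight can be lowered indefinitely. If \<open>v\<close> already lies in W_(p+q-1-n),
  the \<open>n\<close>-th congruence puts it in conj F^(q-n) modulo the next step, and p + (q-n)
  exceeds that weight by one, so opposedness applies again.\<close>

lemma deligne_piece_Int_W:
  assumes v: "v \<in> D p q" and "v \<in> W (p + q - 1)"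
  shows "v = 0"
proof -
  have *: "v \<in> W (p + q - 1 - int n)" for n
  proof (induction n)
    case (Suc n)
    obtain w where "w \<in> F (q - int n)" "v - vcnj w \<in> W (p + q - int n - 2)"
      using v by (auto simp: deligne_piece_def)
    moreover have "v \<in> F p" using v by (auto simp: deligne_piece_def)
    ultimately have "v \<in> W (p + q - 1 - int n - 1)"
      using Suc by (intro opposed_Int[of v p _ w]) (auto simp: algebra_simps)
    then show ?case by (simp add: algebra_simps)
  qed (use assms in simp)
  obtain a b where a: "\<And>k. k \<le> a \<Longrightarrow> W k = {0}" using incr_filt_bounds[OF filtW] by metis
  then show ?thesis using *[of "nat (p + q - 1 - a)"] a[of "p + q - 1 - int (nat (p + q - 1 - a))"] by auto
qed

text \<open>\<open>v\<close> is corrected by terms of lower weight. At stage \<open>n\<close> the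
  error \<open>v - f - vcnj w\<close> lies in W_(p+q-n-1); splitting it by opposedness in that
  weight gives a part in F^p, absorbed into \<open>f\<close>, and a conjugate part in F^(q-n),
  absorbed into \<open>w\<close>. The stages end when \<open>W\<close> vanishes, and they never
  leave \<open>S\<close>.\<close>

lemma deligne_piece_lift:
  assumes S: "sub_mhs F W S" and k: "k = p + q"
    and v: "v \<in> F p \<inter> W k \<inter> S" and w: "w \<in> F q \<inter> S" and vw: "v - vcnj w \<in> W (k - 1)"
  shows "\<exists>f\<in>F p \<inter> W (k - 1) \<inter> S. v - f \<in> D p q"
proof -
  have sS: "vec.subspace S" and cS: "\<And>x. x \<in> S \<Longrightarrow> vcnj x \<in> S" using S by (auto simp: sub_mhs_def)
  have *: "\<exists>f\<in>F p \<inter> W (k - 1) \<inter> S. (\<exists>w\<in>F (q - int n) \<inter> S. v - f - vcnj w \<in> W (k - int n - 1)) \<and>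
     (\<forall>m<n. \<exists>w\<in>F (q - int m). v - f - vcnj w \<in> W (k - int m - 2))" for n
  proof (induction n)
    case 0
    then show ?case using v w vw vec.subspace_0[OF sF] vec.subspace_0[OF sW] vec.subspace_0[OF sS]
      by (intro bexI[of _ 0]) auto
  next
    case (Suc n)
    then obtain f w where f: "f \<in> F p \<inter> W (k - 1) \<inter> S" and w: "w \<in> F (q - int n) \<inter> S"
      "v - f - vcnj w \<in> W (k - int n - 1)"
      and m: "\<And>m. m < n \<Longrightarrow> \<exists>w\<in>F (q - int m). v - f - vcnj w \<in> W (k - int m - 2)" by blast
    let ?l = "k - int n - 1"
    have "v - f - vcnj w \<in> W ?l \<inter> S"
      using w v f cS by (auto intro!: vec.subspace_diff[OF sS])
    then obtain x y where x: "x \<in> F p \<inter> W ?l \<inter> S" and y: "y \<in> F (?l - p + 1) \<inter> W ?l \<inter> S"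
      and z: "v - f - vcnj w - x - vcnj y \<in> W (?l - 1)" using S unfolding sub_mhs_def by blast
    have ey: "?l - p + 1 = q - int n" using k by simp
    have wy: "w + y \<in> F (q - int n) \<inter> S"
      using w y vec.subspace_add[OF sS] vec.subspace_add[OF sF] unfolding ey by auto
    have z': "v - (f + x) - vcnj (w + y) \<in> W (k - int n - 2)"
      using z by (simp add: vcnj_add algebra_simps)
    show ?case
    proof (rule bexI[of _ "f + x"], intro conjI allI impI)
      show "\<exists>w\<in>F (q - int (Suc n)) \<inter> S. v - (f + x) - vcnj w \<in> W (k - int (Suc n) - 1)"
        using wy z' monoF[of "q - int (Suc n)" "q - int n"] by (intro bexI[of _ "w + y"]) (auto simp: algebra_simps)
      show "f + x \<in> F p \<inter> W (k - 1) \<inter> S"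
        using f x monoW[of ?l "k-1" x] vec.subspace_add[OF sS] vec.subspace_add[OF sF] vec.subspace_add[OF sW] by auto
      fix m assume mn: "m < Suc n"
      show "\<exists>w\<in>F (q - int m). v - (f + x) - vcnj w \<in> W (k - int m - 2)"
      proof (cases "m = n")
        case True
        then show ?thesis using wy z' by blast
      next
        case False
        then have "m < n" using mn by simp
        then obtain u where u: "u \<in> F (q - int m)" "v - f - vcnj u \<in> W (k - int m - 2)" using m by blast
        have "x \<in> W (k - int m - 2)" using x monoW[of ?l "k - int m - 2" x] \<open>m < n\<close> by auto
        then have "v - f - vcnj u - x \<in> W (k - int m - 2)" using u vec.subspace_diff[OF sW] by blast
        then show ?thesis using u(1) by (intro bexI[of _ u]) (auto simp: algebra_simps)
      qed
    qed
  qed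
  obtain a b where a: "\<And>k. k \<le> a \<Longrightarrow> W k = {0}" using incr_filt_bounds[OF filtW] by metis
  define N where "N = nat (k - 1 - a)"
  have N: "W (k - int N - 1) = {0}" by (rule a) (simp add: N_def)
  obtain f w where f: "f \<in> F p \<inter> W (k - 1) \<inter> S" and w: "w \<in> F (q - int N)"
      "v - f - vcnj w \<in> W (k - int N - 1)"
    and m: "\<And>m. m < N \<Longrightarrow> \<exists>w\<in>F (q - int m). v - f - vcnj w \<in> W (k - int m - 2)"
    using *[of N] by blast
  have "\<exists>w\<in>F (q - int n). v - f - vcnj w \<in> W (k - int n - 2)" for n
  proof (cases "n < N")
    case False
    then show ?thesis using w N monoF[of "q - int n" "q - int N" w] vec.subspace_0[OF sW]
      by (intro bexI[of _ w]) auto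
  qed (use m in auto)
  then have "v - f \<in> D p q"
    using v f k vec.subspace_diff[OF sF] vec.subspace_diff[OF sW] monoW[of "k - 1" k]
    unfolding deligne_piece_def by auto
  then show ?thesis using f by blast
qed

text \<open>Double induction: upwards on the weight and, for fixed weight, downwards on the index of
  \<open>F\<close>, from where \<open>F\<close> vanishes. What separates a vector of F^p from
  F^(p+1) is lifted to a Deligne piece up to lower weight.\<close>

lemma deligne_pieces_span:
  assumes S: "sub_mhs F W S"
  shows "W k \<inter> S \<subseteq> vec.span (\<Union>{D a b \<inter> S | a b. a + b \<le> k})"
proof -
  have sS: "vec.subspace S" and cS: "\<And>x. x \<in> S \<Longrightarrow> vcnj x \<in> S" using S by (auto simp: sub_mhs_def)
  obtain a b where ab: "\<And>k. k \<le> a \<Longrightarrow> W k = {0}" using incr_filt_bounds[OF filtW] by metis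
  obtain c d where cd: "\<And>k. k \<le> c \<Longrightarrow> F k = UNIV" "\<And>k. k \<ge> d \<Longrightarrow> F k = {0}"
    using decr_filt_bounds[OF filtF] by metis
  let ?X = "\<lambda>k. vec.span (\<Union>{D a b \<inter> S | a b. a + b \<le> k})"
  have X0: "0 \<in> ?X k" for k by (rule vec.span_zero)
  have main: "W (a + int n) \<inter> S \<subseteq> ?X (a + int n)" for n
  proof (induction n)
    case 0
    then show ?case using ab[of a] X0 by auto
  next
    case (Suc n)
    let ?k = "a + int (Suc n)"
    have IHn: "W (?k - 1) \<inter> S \<subseteq> ?X (a + int n)" using Suc by simp
    have mono: "?X (a + int n) \<subseteq> ?X ?k"
    proof (intro vec.span_mono Union_mono subsetI)
      fix A assume "A \<in> {D x y \<inter> S | x y. x + y \<le> a + int n}"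
      then obtain x y where "A = D x y \<inter> S" "x + y \<le> a + int n" by blast
      then show "A \<in> {D x y \<inter> S | x y. x + y \<le> ?k}" by (intro CollectI exI[of _ x] exI[of _ y]) simp
    qed
    have "F (d - int m) \<inter> W ?k \<inter> S \<subseteq> ?X ?k" for m
    proof (induction m)
      case 0
      then show ?case using cd(2)[of d] X0 by auto
    next
      case (Suc m)
      let ?p = "d - int (Suc m)"
      show ?case
      proof
        fix v assume v: "v \<in> F ?p \<inter> W ?k \<inter> S"
        then obtain x y where x: "x \<in> F (?p + 1) \<inter> W ?k \<inter> S"
          and y: "y \<in> F (?k - (?p + 1) + 1) \<inter> W ?k \<inter> S" and z: "v - x - vcnj y \<in> W (?k - 1)"
          using S unfolding sub_mhs_def by (metis IntD1 IntD2 IntI)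
        have xX: "x \<in> ?X ?k" using Suc.IH x by (auto simp: algebra_simps)
        have vx: "v - x \<in> F ?p \<inter> W ?k \<inter> S"
          using v x monoF[of ?p "?p + 1" x] vec.subspace_diff[OF sS] vec.subspace_diff[OF sF] vec.subspace_diff[OF sW] by auto
        obtain f where f: "f \<in> F ?p \<inter> W (?k - 1) \<inter> S" "v - x - f \<in> D ?p (?k - ?p)"
        proof -
          have y': "y \<in> F (?k - ?p) \<inter> S" using y by (simp add: algebra_simps)
          show ?thesis
            using deligne_piece_lift[OF S _ vx y' z] that by fastforce
        qed
        have "f \<in> ?X ?k" using IHn f(1) mono by auto
        moreover have "v - x - f \<in> S" using v x f vec.subspace_diff[OF sS] by auto
        then have "v - x - f \<in> D ?p (?k - ?p) \<inter> S" using f(2) by simp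
        then have "v - x - f \<in> ?X ?k"
          by (intro vec.span_base UnionI[of "D ?p (?k - ?p) \<inter> S"] CollectI exI[of _ ?p] exI[of _ "?k - ?p"]) auto
        ultimately have "(v - x - f) + f + x \<in> ?X ?k" using xX by (intro vec.span_add)
        then show "v \<in> ?X ?k" by simp
      qed
    qed
    from this[of "nat (d - c)"] cd(1)[of "d - int (nat (d - c))"]
    show ?case by auto
  qed
  show ?thesis
  proof (cases "k \<le> a")
    case True
    then show ?thesis using ab[of k] X0 by auto
  next
    case False
    then show ?thesis using main[of "nat (k - a)"] by simp
  qed
qed

text \<open>Among the nonzero terms of weight above \<open>k\<close>, take the top weight
  \<open>K\<close> and in it the largest first index \<open>a\<close>. Every other term lies in conj
  F^(K-a+1) + W_(K-1), hence so does the extremal one; opposedness then lowers its weight.\<close>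

lemma deligne_pieces_indep_W:
  assumes fin: "finite L" and v: "\<And>l. l \<in> L \<Longrightarrow> v l \<in> D (fst l) (snd l)"
    and sum: "sum v L \<in> W k" and l: "l \<in> L" "fst l + snd l > k"
  shows "v l = 0"
proof (rule ccontr)
  assume nz: "v l \<noteq> 0"
  define L' where "L' = {l\<in>L. v l \<noteq> 0 \<and> fst l + snd l > k}"
  have L': "finite L'" "l \<in> L'" using fin l nz by (auto simp: L'_def)
  define K where "K = Max ((\<lambda>l. fst l + snd l) ` L')"
  define LK where "LK = {l\<in>L'. fst l + snd l = K}"
  have Kmax: "fst l + snd l \<le> K" if "l \<in> L'" for l using that L'(1) by (auto simp: K_def)
  have "K \<in> (\<lambda>l. fst l + snd l) ` L'" unfolding K_def using L' by (intro Max_in) auto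
  then obtain m0 where m0: "m0 \<in> L'" "K = fst m0 + snd m0" by blast
  then have LK: "finite LK" "m0 \<in> LK" "K > k" using L'(1) by (auto simp: LK_def) (auto simp: L'_def)
  define a where "a = Max (fst ` LK)"
  have "a \<in> fst ` LK" unfolding a_def using LK by (intro Max_in) auto
  then obtain m where m: "m \<in> LK" "fst m = a" by auto
  have amax: "fst l \<le> a" if "l \<in> LK" for l using that LK(1) by (auto simp: a_def)
  \<comment> \<open>The subspace conj F^(K-a+1) + W_(K-1), which is opposed to F^a in weight
    \<open>K\<close>.\<close>
  define T where "T = {x. \<exists>w\<in>F (K - a + 1). x - vcnj w \<in> W (K - 1)}"
  have sT: "vec.subspace T"
  proof (rule vec.subspaceI)
    show "0 \<in> T" unfolding T_def using vec.subspace_0[OF sF] vec.subspace_0[OF sW] by (force intro!: bexI[of _ 0])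
    fix x y assume "x \<in> T" "y \<in> T"
    then obtain w w' where "w \<in> F (K - a + 1)" "x - vcnj w \<in> W (K - 1)" "w' \<in> F (K - a + 1)" "y - vcnj w' \<in> W (K - 1)"
      by (auto simp: T_def)
    then show "x + y \<in> T" unfolding T_def
      using vec.subspace_add[OF sF] vec.subspace_add[OF sW, of "x - vcnj w" _ "y - vcnj w'"]
      by (auto intro!: bexI[of _ "w + w'"] simp: vcnj_add algebra_simps)
  next
    fix c x assume "x \<in> T"
    then obtain w where "w \<in> F (K - a + 1)" "x - vcnj w \<in> W (K - 1)" by (auto simp: T_def)
    then show "c *s x \<in> T" unfolding T_def
      using vec.subspace_scale[OF sF] vec.subspace_scale[OF sW, of "x - vcnj w" _ c]
      by (auto intro!: bexI[of _ "cnj c *s w"] simp: vcnj_smult vec.scale_right_diff_distrib)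
  qed
  have WT: "x \<in> T" if "x \<in> W (K - 1)" for x
    unfolding T_def using that vec.subspace_0[OF sF] by (auto intro!: bexI[of _ 0])
  have "v l \<in> T" if lm: "l \<in> L - {m}" for l
  proof (cases "l \<in> LK")
    case True
    have "fst l \<noteq> a" using that True m by (auto simp: LK_def prod_eq_iff)
    then have "snd l \<ge> K - a + 1" using amax[OF True] True by (auto simp: LK_def)
    moreover obtain w where "w \<in> F (snd l)" and "v l - vcnj w \<in> W (fst l + snd l - 2)"
      using deligne_piece_vcnj[OF v[of l]] lm by blast
    ultimately show ?thesis using True monoF[of "K - a + 1" "snd l" w] monoW[of "fst l + snd l - 2" "K - 1"]
      unfolding T_def LK_def by auto
  next
    case False
    have "v l \<in> W (fst l + snd l)" using v[of l] that by (auto simp: deligne_piece_def)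
    moreover have "v l = 0 \<or> fst l + snd l \<le> K - 1" using False that Kmax[of l] LK(3) by (fastforce simp: LK_def L'_def)
    ultimately have "v l \<in> W (K - 1)" using monoW vec.subspace_0[OF sW] by auto
    then show ?thesis by (rule WT)
  qed
  then have "sum v (L - {m}) \<in> T" by (intro vec.subspace_sum[OF sT]) auto
  moreover have "sum v L \<in> T" using WT sum monoW[of k "K - 1"] LK(3) by auto
  moreover have mL: "m \<in> L" using m by (auto simp: LK_def L'_def)
  then have "v m = sum v L - sum v (L - {m})" by (simp add: sum_diff1[OF fin])
  ultimately have "v m \<in> T" using vec.subspace_diff[OF sT] by simp
  then obtain w where w: "w \<in> F (K - a + 1)" "v m - vcnj w \<in> W (K - 1)" by (auto simp: T_def)
  have K: "fst m + snd m = K" using m by (auto simp: LK_def)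
  have vm: "v m \<in> D a (K - a)" using v[OF mL] m(2) K by (metis add_diff_cancel_left')
  then have "v m \<in> F a" "v m \<in> W K" by (auto simp: deligne_piece_def)
  then have "v m \<in> W (K - 1)" using w by (rule opposed_Int)
  then have "v m = 0" using deligne_piece_Int_W[OF vm] by simp
  then show False using m by (auto simp: LK_def L'_def)
qed

text \<open>Terms with first index at least \<open>p\<close> lie in F^p and may be dropped. The
  remaining ones of top weight \<open>K\<close> have first index below \<open>p\<close>, hence
  second index at least K-p+1, so the remaining sum lies in F^p and in conj F^(K-p+1) modulo
  W_(K-1). Opposedness lowers its weight, against independence with respect to
  \<open>W\<close>.\<close>

lemma deligne_pieces_indep_F:
  assumes fin: "finite L" and v: "\<And>l. l \<in> L \<Longrightarrow> v l \<in> D (fst l) (snd l)"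
    and sum: "sum v L \<in> F p" and l: "l \<in> L" "fst l < p"
  shows "v l = 0"
proof (rule ccontr)
  assume nz: "v l \<noteq> 0"
  define L' where "L' = {l\<in>L. v l \<noteq> 0 \<and> fst l < p}"
  have L': "finite L'" "l \<in> L'" "L' \<subseteq> L" using fin l nz by (auto simp: L'_def)
  define K where "K = Max ((\<lambda>l. fst l + snd l) ` L')"
  have Kmax: "fst l + snd l \<le> K" if "l \<in> L'" for l using that L'(1) by (auto simp: K_def)
  have "K \<in> (\<lambda>l. fst l + snd l) ` L'" unfolding K_def using L' by (intro Max_in) auto
  then obtain m where m: "m \<in> L'" "fst m + snd m = K" by auto
  have vF: "v l \<in> F (fst l)" "v l \<in> W (fst l + snd l)" if "l \<in> L" for l using v[OF that] by (auto simp: deligne_piece_def)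
  have "v l \<in> F p" if "l \<in> L - L'" for l
    using that vF(1)[of l] monoF[of p "fst l"] vec.subspace_0[OF sF] by (auto simp: L'_def)
  then have "sum v (L - L') \<in> F p" by (intro vec.subspace_sum[OF sF]) auto
  moreover have "sum v L' = sum v L - sum v (L - L')" using sum_diff[OF fin L'(3), of v] by simp
  ultimately have F': "sum v L' \<in> F p" using sum vec.subspace_diff[OF sF] by simp
  have W': "sum v L' \<in> W K" using vF(2) Kmax monoW L'(3) by (intro vec.subspace_sum[OF sW]) blast
  define T where "T = {x. \<exists>w\<in>F (K - p + 1). x - vcnj w \<in> W (K - 1)}"
  have sT: "\<exists>w\<in>F (K - p + 1). sum v M - vcnj w \<in> W (K - 1)" if "M \<subseteq> L'" for M
    using finite_subset[OF that L'(1)] that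
  proof (induction M rule: finite_induct)
    case empty
    then show ?case using vec.subspace_0[OF sF] vec.subspace_0[OF sW] by (auto intro!: bexI[of _ 0])
  next
    case (insert x M)
    then obtain w where w: "w \<in> F (K - p + 1)" "sum v M - vcnj w \<in> W (K - 1)" by auto
    have x: "x \<in> L'" using insert by auto
    have "\<exists>u\<in>F (K - p + 1). v x - vcnj u \<in> W (K - 1)"
    proof (cases "fst x + snd x = K")
      case True
      obtain u where "u \<in> F (snd x)" "v x - vcnj u \<in> W (fst x + snd x - 2)"
        using deligne_piece_vcnj[OF v[of x]] x L'(3) by blast
      then show ?thesis using True x monoF[of "K - p + 1" "snd x"] monoW[of "fst x + snd x - 2" "K - 1"]
        by (auto simp: L'_def)
    next
      case False
      then have "v x \<in> W (K - 1)" using vF(2)[of x] Kmax[OF x] x L'(3) monoW[of "fst x + snd x" "K - 1"] by auto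
      then show ?thesis using vec.subspace_0[OF sF] by (auto intro!: bexI[of _ 0])
    qed
    then obtain u where "u \<in> F (K - p + 1)" "v x - vcnj u \<in> W (K - 1)" by blast
    then show ?case using w insert(1,2) vec.subspace_add[OF sF] vec.subspace_add[OF sW, of "v x - vcnj u" _ "sum v M - vcnj w"]
      by (intro bexI[of _ "u + w"]) (auto simp: vcnj_add algebra_simps)
  qed
  obtain w where w: "w \<in> F (K - p + 1)" "sum v L' - vcnj w \<in> W (K - 1)" using sT by blast
  have "sum v L' \<in> W (K - 1)" using opposed_Int[OF F' W' w] .
  then have "v m = 0" using m L' v
    by (intro deligne_pieces_indep_W[of L' v "K - 1"]) auto
  then show False using m by (auto simp: L'_def)
qed

end

section \<open>Morphisms of type (-1,-1), and bases adapted to a filtration\<close>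

definition mcnj :: "complex^'n^'m \<Rightarrow> complex^'n^'m" where
  "mcnj A = (\<chi> i j. cnj (A $ i $ j))"

lemma vcnj_matrix_vector_mult: "vcnj (A *v v) = mcnj A *v vcnj v"
  by (simp add: vec_eq_iff matrix_vector_mult_def mcnj_def)

lemma mcnj_real: "real_matrix A \<Longrightarrow> mcnj A = A"
  by (simp add: vec_eq_iff mcnj_def real_matrix_def Reals_cnj_iff)

lemma deligne_piece_morphism:
  assumes "real_matrix N" and NF: "\<And>p v. v \<in> F p \<Longrightarrow> N *v v \<in> F (p - 1)"
    and NW: "\<And>k v. v \<in> W k \<Longrightarrow> N *v v \<in> W (k - 2)"
    and v: "v \<in> deligne_piece F W p q"
  shows "N *v v \<in> deligne_piece F W (p - 1) (q - 1)"
proof -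
  have "\<exists>w\<in>F (q - 1 - int n). N *v v - vcnj w \<in> W (p - 1 + (q - 1) - int n - 2)" for n
  proof -
    obtain w where w: "w \<in> F (q - int n)" "v - vcnj w \<in> W (p + q - int n - 2)"
      using v unfolding deligne_piece_def by blast
    have "N *v w \<in> F (q - 1 - int n)" using NF[OF w(1)] by (simp add: algebra_simps)
    moreover have "N *v v - vcnj (N *v w) \<in> W (p - 1 + (q - 1) - int n - 2)"
      using NW[OF w(2)] by (simp add: vcnj_matrix_vector_mult mcnj_real[OF assms(1)] matrix_vector_mult_diff_distrib algebra_simps)
    ultimately show ?thesis by blast
  qed
  moreover have "N *v v \<in> F (p - 1)" "N *v v \<in> W (p - 1 + (q - 1))"
    using v NF[of v p] NW[of v "p + q"] by (auto simp: deligne_piece_def algebra_simps)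
  ultimately show ?thesis by (simp add: deligne_piece_def)
qed

lemma adapted_level:
  assumes G: "incr_filt G" and "v \<noteq> 0"
  shows "\<exists>j. \<forall>m. v \<in> G m \<longleftrightarrow> j \<le> m"
proof -
  obtain a b where ab: "a < b" "\<And>k. k \<le> a \<Longrightarrow> G k = {0}" "\<And>k. k \<ge> b \<Longrightarrow> G k = UNIV"
    using incr_filt_bounds[OF G] by metis
  define n where "n = (LEAST n. v \<in> G (a + int n))"
  have ex: "v \<in> G (a + int (nat (b - a)))" using ab by auto
  have n: "v \<in> G (a + int n)" unfolding n_def by (rule LeastI[of "\<lambda>n. v \<in> G (a + int n)", OF ex])
  have "v \<in> G m \<longleftrightarrow> a + int n \<le> m" for m
  proof
    assume vm: "v \<in> G m"
    then have "m > a" using ab(2)[of m] assms(2) by (cases "m \<le> a") auto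
    then have "v \<in> G (a + int (nat (m - a)))" using vm by simp
    then have "n \<le> nat (m - a)" unfolding n_def by (rule Least_le)
    then show "a + int n \<le> m" using \<open>m > a\<close> by simp
  next
    assume "a + int n \<le> m"
    then show "v \<in> G m" using n incr_filt_mono[OF G] by blast
  qed
  then show ?thesis by blast
qed

text \<open>A basis of each step is extended to the next one by vectors of \<open>X\<close> only,
  which is possible because \<open>X\<close> spans every step.\<close>

lemma adapted_basis_set:
  assumes G: "incr_filt G" and X: "\<And>m. G m \<subseteq> vec.span (X \<inter> G m)"
  shows "\<exists>Bs. Bs \<subseteq> X \<and> vec.independent Bs \<and> (\<forall>m. vec.span (Bs \<inter> G m) = G m)"
proof -
  obtain a b where ab: "a < b" "\<And>k. k \<le> a \<Longrightarrow> G k = {0}" "\<And>k. k \<ge> b \<Longrightarrow> G k = UNIV"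
    using incr_filt_bounds[OF G] by metis
  have sub: "vec.span (A \<inter> G m) \<subseteq> G m" for A m
    by (rule vec.span_minimal) (auto intro: incr_filt_subspace[OF G])
  have "\<exists>Bs. Bs \<subseteq> X \<inter> G (a + int n) \<and> vec.independent Bs \<and> (\<forall>m\<le>a + int n. vec.span (Bs \<inter> G m) = G m)" for n
  proof (induction n)
    case 0
    have "vec.span ({} \<inter> G m) = G m" if "m \<le> a" for m using ab(2)[OF that] by simp
    then show ?case by (intro exI[of _ "{}"]) (auto simp: vec.independent_empty)
  next
    case (Suc n)
    then obtain Bs where Bs: "Bs \<subseteq> X \<inter> G (a + int n)" "vec.independent Bs"
      "\<And>m. m \<le> a + int n \<Longrightarrow> vec.span (Bs \<inter> G m) = G m" by blast
    let ?k = "a + int (Suc n)"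
    have "G (a + int n) \<subseteq> G ?k" by (rule incr_filt_mono[OF G]) simp
    then have "Bs \<subseteq> X \<inter> G ?k" using Bs(1) by blast
    then obtain Bs' where Bs': "Bs \<subseteq> Bs'" "Bs' \<subseteq> X \<inter> G ?k" "vec.independent Bs'" "X \<inter> G ?k \<subseteq> vec.span Bs'"
      using vec.maximal_independent_subset_extend[OF _ Bs(2)] by metis
    have "vec.span (Bs' \<inter> G m) = G m" if m: "m \<le> ?k" for m
    proof (cases "m = ?k")
      case True
      have "Bs' \<inter> G m = Bs'" using Bs'(2) True by blast
      moreover have "G m \<subseteq> vec.span Bs'" using X[of m] vec.span_minimal[OF Bs'(4)] True by auto
      ultimately show ?thesis using sub[of Bs' m] by auto
    next
      case False
      then have "vec.span (Bs \<inter> G m) = G m" using Bs(3) m by auto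
      moreover have "vec.span (Bs \<inter> G m) \<subseteq> vec.span (Bs' \<inter> G m)" by (rule vec.span_mono) (use Bs'(1) in blast)
      ultimately show ?thesis using sub[of Bs' m] by auto
    qed
    then show ?case using Bs' by blast
  qed
  then obtain Bs where Bs: "Bs \<subseteq> X" "vec.independent Bs" "\<And>m. m \<le> a + int (nat (b - a)) \<Longrightarrow> vec.span (Bs \<inter> G m) = G m"
    by (metis Int_subset_iff)
  have "vec.span (Bs \<inter> G m) = G m" for m
  proof (cases "m \<le> b")
    case False
    then show ?thesis using ab Bs(3)[of b] by simp
  qed (use Bs(3) ab(1) in simp)
  then show ?thesis using Bs by blast
qed

lemma coord_span_columns: "coord_span B P = vec.span {column i B | i. P i}"
proof
  show "coord_span B P \<subseteq> vec.span {column i B | i. P i}"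
    by (rule coord_span_minimal) (auto intro: vec.span_base)
  show "vec.span {column i B | i. P i} \<subseteq> coord_span B P"
    by (rule vec.span_minimal) (auto intro: column_in_coord_span subspace_coord_span)
qed

context mhs
begin

text \<open>Each \<open>G m\<close> is spanned by vectors from single Deligne pieces, so the adapted
  basis can be chosen among such vectors. With \<open>G\<close> the weight filtration of the
  structure itself this diagonalises its grading; with \<open>G\<close> a second filtration by
  sub-structures it gives a basis adapted to both.\<close>

lemma adapted_basis:
  assumes G: "incr_filt G" "\<And>m. sub_mhs F W (G m)"
  obtains B p q j where "invertible B" "\<And>i. column i B \<in> D (p i) (q i)"
    "\<And>m. G m = coord_span B (\<lambda>i. j i \<le> m)"
proof -
  obtain c d where cd: "\<And>k. k \<ge> d \<Longrightarrow> W k = UNIV" using incr_filt_bounds[OF filtW] by metis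
  let ?X = "\<Union>{D a b | a b. True}"
  have X: "G m \<subseteq> vec.span (?X \<inter> G m)" for m
  proof -
    have "G m \<subseteq> vec.span (\<Union>{D a b \<inter> G m | a b. a + b \<le> d})"
      using deligne_pieces_span[OF G(2), of d m] cd[of d] by simp
    also have "\<dots> \<subseteq> vec.span (?X \<inter> G m)" by (rule vec.span_mono) blast
    finally show ?thesis .
  qed
  obtain Bs where Bs: "Bs \<subseteq> ?X" "vec.independent Bs" "\<And>m. vec.span (Bs \<inter> G m) = G m"
    using adapted_basis_set[OF G(1) X] by blast
  obtain b where "G b = UNIV" using G(1) by (auto simp: incr_filt_def)
  then have span: "vec.span Bs = UNIV" using Bs(3)[of b] by simp
  then have "card Bs = CARD('n)"
    using Bs(2) vec.dim_span_eq_card_independent[OF Bs(2)] by (simp add: card_cart_basis)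
  then obtain f :: "'n \<Rightarrow> complex^'n" where f: "bij_betw f UNIV Bs"
    using finite_same_card_bij[of "UNIV :: 'n set" Bs] vec.finiteI_independent[OF Bs(2)] by auto
  have rf: "range f = Bs" using f by (simp add: bij_betw_def)
  define B where "B = (\<chi> i j. f j $ i)"
  have col: "column i B = f i" for i by (simp add: vec_eq_iff column_def B_def)
  have "columns B = Bs" using rf by (auto simp: columns_def col)
  then have "invertible B" using matrix_right_invertible_span_columns[of B] span
    by (auto simp: invertible_right_inverse)
  moreover have "\<exists>p q. f i \<in> D p q" for i using rf Bs(1) by blast
  then obtain p q where "\<And>i. f i \<in> D (p i) (q i)" by metis
  moreover have "f i \<noteq> 0" for i using rf Bs(2) vec.dependent_zero by (metis rangeI)
  then have "\<exists>j. \<forall>m. f i \<in> G m \<longleftrightarrow> j \<le> m" for i using adapted_level[OF G(1)] by blast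
  then obtain j where j: "\<And>i m. f i \<in> G m \<longleftrightarrow> j i \<le> m" by metis
  have "G m = coord_span B (\<lambda>i. j i \<le> m)" for m
  proof -
    have "{column i B | i. j i \<le> m} = Bs \<inter> G m" using rf j by (auto simp: col)
    then show ?thesis using Bs(3) by (simp add: coord_span_columns)
  qed
  ultimately show ?thesis using that col by metis
qed

definition cnj_plus :: "int \<Rightarrow> int \<Rightarrow> (complex^'n) set" where
  "cnj_plus q k = {x. \<exists>w\<in>F q. x - vcnj w \<in> W k}"

lemma subspace_cnj_plus: "vec.subspace (cnj_plus q k)"
proof (rule vec.subspaceI)
  show "0 \<in> cnj_plus q k"
    unfolding cnj_plus_def using vec.subspace_0[OF sF] vec.subspace_0[OF sW] by (force intro!: bexI[of _ 0])
  fix x y assume "x \<in> cnj_plus q k" "y \<in> cnj_plus q k"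
  then obtain w w' where "w \<in> F q" "x - vcnj w \<in> W k" "w' \<in> F q" "y - vcnj w' \<in> W k"
    by (auto simp: cnj_plus_def)
  then show "x + y \<in> cnj_plus q k" unfolding cnj_plus_def
    using vec.subspace_add[OF sF] vec.subspace_add[OF sW, of "x - vcnj w" _ "y - vcnj w'"]
    by (auto intro!: bexI[of _ "w + w'"] simp: vcnj_add algebra_simps)
next
  fix c x assume "x \<in> cnj_plus q k"
  then obtain w where "w \<in> F q" "x - vcnj w \<in> W k" by (auto simp: cnj_plus_def)
  then show "c *s x \<in> cnj_plus q k" unfolding cnj_plus_def
    using vec.subspace_scale[OF sF] vec.subspace_scale[OF sW, of "x - vcnj w" _ c]
    by (auto intro!: bexI[of _ "cnj c *s w"] simp: vcnj_smult vec.scale_right_diff_distrib)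
qed

lemma deligne_piece_iff: "v \<in> D p q \<longleftrightarrow> v \<in> F p \<and> v \<in> W (p + q) \<and> (\<forall>n. v \<in> cnj_plus (q - int n) (p + q - int n - 2))"
  by (auto simp: deligne_piece_def cnj_plus_def)

text \<open>This half gives uniqueness of the bigrading. A piece I^{r,s} with r < q and s < p either
  has r \<ge> q-n and lies in F^(q-n), or has r \<le> q-n-1 and s \<le> p-1 and lies in W_(p+q-n-2).
  This accounts for the shift by two in \<open>deligne_piece\<close>.\<close>

lemma deligne_bigrading_subset:
  assumes I: "deligne_bigrading F W I"
  shows "I p q \<subseteq> D p q"
proof
  fix v assume v: "v \<in> I p q"
  have IF: "I r s \<subseteq> F r" and IW: "I r s \<subseteq> W (r + s)" for r s
  proof -
    have "F r = vec.span (\<Union>{I a b | a b. a \<ge> r})" using I unfolding deligne_bigrading_def by blast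
    moreover have "I r s \<subseteq> \<Union>{I a b | a b. a \<ge> r}" by blast
    ultimately show "I r s \<subseteq> F r" by (metis (no_types, lifting) subset_trans vec.span_superset)
    have "W (r + s) = vec.span (\<Union>{I a b | a b. a + b \<le> r + s})" using I unfolding deligne_bigrading_def by blast
    moreover have "I r s \<subseteq> \<Union>{I a b | a b. a + b \<le> r + s}" by blast
    ultimately show "I r s \<subseteq> W (r + s)" by (metis (no_types, lifting) subset_trans vec.span_superset)
  qed
  have cv: "vcnj v \<in> vec.span (I q p \<union> \<Union>{I r s | r s. r < q \<and> s < p})"
    using I v unfolding deligne_bigrading_def by blast
  have "v \<in> cnj_plus (q - int n) (p + q - int n - 2)" for n
  proof -
    have "I q p \<union> \<Union>{I r s | r s. r < q \<and> s < p} \<subseteq> vcnj ` cnj_plus (q - int n) (p + q - int n - 2)"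
    proof
      fix x assume x: "x \<in> I q p \<union> \<Union>{I r s | r s. r < q \<and> s < p}"
      have "x \<in> F (q - int n) \<or> x \<in> W (p + q - int n - 2)"
      proof (cases "x \<in> I q p")
        case True
        then show ?thesis using IF[of q p] monoF[of "q - int n" q] by auto
      next
        case False
        then obtain r s where rs: "x \<in> I r s" "r < q" "s < p" using x by blast
        show ?thesis
        proof (cases "r \<ge> q - int n")
          case True
          then show ?thesis using IF[of r s] rs monoF by blast
        next
          case False
          then show ?thesis using IW[of r s] rs monoW[of "r + s" "p + q - int n - 2"] by auto
        qed
      qed
      then have "vcnj x \<in> cnj_plus (q - int n) (p + q - int n - 2)"
      proof
        assume "x \<in> F (q - int n)"
        then show ?thesis using vec.subspace_0[OF sW] by (auto simp: cnj_plus_def intro!: bexI[of _ x])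
      next
        assume "x \<in> W (p + q - int n - 2)"
        then show ?thesis using vec.subspace_0[OF sF] cnjW by (auto simp: cnj_plus_def intro!: bexI[of _ 0])
      qed
      then show "x \<in> vcnj ` cnj_plus (q - int n) (p + q - int n - 2)" by (metis image_eqI vcnj_vcnj)
    qed
    then have "vec.span (I q p \<union> \<Union>{I r s | r s. r < q \<and> s < p}) \<subseteq> vcnj ` cnj_plus (q - int n) (p + q - int n - 2)"
      by (rule vec.span_minimal) (intro subspace_vcnj_image subspace_cnj_plus)
    then have "vcnj v \<in> vcnj ` cnj_plus (q - int n) (p + q - int n - 2)" using cv by blast
    then show ?thesis by (metis (no_types, lifting) imageE vcnj_vcnj)
  qed
  then show "v \<in> D p q" using IF[of p q] IW[of p q] v by (auto simp: deligne_piece_iff)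
qed

end

section \<open>Bases adapted to a mixed Hodge structure\<close>

definition diagm :: "('n \<Rightarrow> complex) \<Rightarrow> complex^'n::finite^'n" where
  "diagm d = (\<chi> i j. if i = j then d i else 0)"

lemma diagm_mult_vec [simp]: "(diagm d *v x) $ i = d i * x $ i"
  by (simp add: diagm_def matrix_vector_mult_def if_distrib if_distribR cong: if_cong)

locale mhs_basis = mhs F W for F W :: "'n::finite filt" +
  fixes B :: "complex^'n^'n" and p q :: "'n \<Rightarrow> int"
  assumes inv: "invertible B" and col: "\<And>i. column i B \<in> D (p i) (q i)"
begin

abbreviation "Bi \<equiv> matrix_inv B"
lemmas Bi [simp] = matrix_inv_cancel[OF inv]
lemmas cs_iff = coord_span_iff[OF inv]

definition part :: "complex^'n \<Rightarrow> int \<times> int \<Rightarrow> complex^'n" where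
  "part x l = B *v (\<chi> i. if (p i, q i) = l then x $ i else 0)"

lemma part_D: "part x l \<in> D (fst l) (snd l)"
proof -
  have "part x l \<in> coord_span B (\<lambda>i. (p i, q i) = l)" unfolding part_def coord_span_def by auto
  moreover have "coord_span B (\<lambda>i. (p i, q i) = l) \<subseteq> D (fst l) (snd l)"
    by (rule coord_span_minimal[OF sD]) (use col in auto)
  ultimately show ?thesis by blast
qed

lemma part_0: "part x (p i, q i) = 0 \<Longrightarrow> x $ i = 0"
proof -
  assume "part x (p i, q i) = 0"
  then have "(\<chi> k. if (p k, q k) = (p i, q i) then x $ k else 0) = (0::complex^'n)"
    unfolding part_def by (metis Bi(1) matrix_vector_mult_0_right)
  from arg_cong[OF this, of "\<lambda>v. v $ i"] show "x $ i = 0" by simp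
qed

lemma part_sum: "(\<Sum>l\<in>range (\<lambda>i. (p i, q i)). part x l) = B *v x"
proof -
  have "(\<Sum>l\<in>range (\<lambda>i. (p i, q i)). part x l)
      = B *v (\<Sum>l\<in>range (\<lambda>i. (p i, q i)). (\<chi> i. if (p i, q i) = l then x $ i else 0))"
    unfolding part_def by (simp add: vec.linear_sum[OF matrix_vector_mul_linear_gen])
  also have "(\<Sum>l\<in>range (\<lambda>i. (p i, q i)). (\<chi> i. if (p i, q i) = l then x $ i else 0)) = x"
    by (simp add: vec_eq_iff sum_component)
  finally show ?thesis .
qed

lemma F_eq: "F a = coord_span B (\<lambda>i. p i \<ge> a)"
proof
  show "coord_span B (\<lambda>i. p i \<ge> a) \<subseteq> F a"
    by (rule coord_span_minimal[OF sF]) (use col monoF in \<open>auto simp: deligne_piece_def\<close>)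
  show "F a \<subseteq> coord_span B (\<lambda>i. p i \<ge> a)"
  proof
    fix v assume v: "v \<in> F a"
    have "(Bi *v v) $ i = 0" if "\<not> p i \<ge> a" for i
      by (rule part_0, rule deligne_pieces_indep_F[of "range (\<lambda>i. (p i, q i))" "part (Bi *v v)" a])
         (use that v part_D in \<open>auto simp: part_sum\<close>)
    then show "v \<in> coord_span B (\<lambda>i. p i \<ge> a)" by (simp add: cs_iff)
  qed
qed

lemma W_eq: "W k = coord_span B (\<lambda>i. p i + q i \<le> k)"
proof
  show "coord_span B (\<lambda>i. p i + q i \<le> k) \<subseteq> W k"
    by (rule coord_span_minimal[OF sW]) (use col monoW in \<open>auto simp: deligne_piece_def\<close>)
  show "W k \<subseteq> coord_span B (\<lambda>i. p i + q i \<le> k)"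
  proof
    fix v assume v: "v \<in> W k"
    have "(Bi *v v) $ i = 0" if "\<not> p i + q i \<le> k" for i
      by (rule part_0, rule deligne_pieces_indep_W[of "range (\<lambda>i. (p i, q i))" "part (Bi *v v)" k])
         (use that v part_D in \<open>auto simp: part_sum\<close>)
    then show "v \<in> coord_span B (\<lambda>i. p i + q i \<le> k)" by (simp add: cs_iff)
  qed
qed

lemma D_eq: "D a b = coord_span B (\<lambda>i. p i = a \<and> q i = b)"
proof
  show "coord_span B (\<lambda>i. p i = a \<and> q i = b) \<subseteq> D a b"
    by (rule coord_span_minimal[OF sD]) (use col in auto)
  show "D a b \<subseteq> coord_span B (\<lambda>i. p i = a \<and> q i = b)"
  proof
    fix v assume v: "v \<in> D a b"
    \<comment> \<open>The label \<open>(a, b)\<close> is added because it may belong to no basis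
      vector. Subtracting \<open>v\<close> there turns the decomposition of \<open>v\<close> into a
      relation with sum zero.\<close>
    let ?L = "insert (a, b) (range (\<lambda>i. (p i, q i)))"
    let ?f = "\<lambda>l. part (Bi *v v) l - (if l = (a, b) then v else 0)"
    have p0: "part (Bi *v v) (a, b) = 0" if "(a, b) \<notin> range (\<lambda>i. (p i, q i))"
    proof -
      have "(\<chi> i. if (p i, q i) = (a, b) then (Bi *v v) $ i else 0) = (0::complex^'n)"
        using that by (auto simp: vec_eq_iff)
      then show ?thesis unfolding part_def by simp
    qed
    have "sum (part (Bi *v v)) ?L = v"
      using p0 part_sum[of "Bi *v v"] by (cases "(a, b) \<in> range (\<lambda>i. (p i, q i))") (auto simp: insert_absorb)
    then have s0: "sum ?f ?L = 0" by (simp add: sum_subtractf)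
    have fD: "?f l \<in> D (fst l) (snd l)" for l
      using part_D[of "Bi *v v" l] v vec.subspace_diff[OF sD] by auto
    have "(Bi *v v) $ i = 0" if "\<not> (p i = a \<and> q i = b)" for i
    proof -
      have "?f (p i, q i) = 0"
        by (rule deligne_pieces_indep_W[of ?L ?f "p i + q i - 1"])
           (use fD in \<open>auto simp: s0 vec.subspace_0[OF sW]\<close>)
      then show ?thesis using that by (intro part_0) auto
    qed
    then show "v \<in> coord_span B (\<lambda>i. p i = a \<and> q i = b)" by (simp add: cs_iff)
  qed
qed

text \<open>The coordinates of \<open>vcnj v\<close> with \<open>p\<close>-label below
  \<open>b\<close> have \<open>q\<close>-label below \<open>a\<close>, by the congruences defining
  the piece. The rest, \<open>y\<close>, lies in F^b and satisfies the congruences for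
  \<open>(b, a)\<close>, because \<open>vcnj v\<close> and the removed part both do.\<close>

lemma vcnj_piece:
  assumes v: "v \<in> D a b"
  shows "vcnj v \<in> coord_span B (\<lambda>i. (p i = b \<and> q i = a) \<or> (p i < b \<and> q i < a))"
proof -
  let ?x = "Bi *v vcnj v"
  have low: "q i < a" if x: "?x $ i \<noteq> 0" and i: "p i < b" for i
  proof -
    \<comment> \<open>Chosen so that b - n = p i + 1. An element of F^(b-n) then has no coordinate
      at \<open>i\<close>, so the nonzero coordinate comes from the error term, whose weight is
      bounded.\<close>
    define n where "n = nat (b - p i - 1)"
    have n: "int n = b - p i - 1" using i by (simp add: n_def)
    obtain w where w: "w \<in> F (b - int n)" "v - vcnj w \<in> W (a + b - int n - 2)"
      using v unfolding deligne_piece_def by blast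
    have r: "vcnj v - w \<in> W (a + b - int n - 2)" using cnjW[OF w(2)] by (simp add: vcnj_diff)
    have "(Bi *v w) $ i = 0" using w(1) n by (simp add: F_eq cs_iff)
    then have "(Bi *v (vcnj v - w)) $ i \<noteq> 0" using x by (simp add: matrix_vector_mult_diff_distrib)
    then have "p i + q i \<le> a + b - int n - 2" using r unfolding W_eq cs_iff by blast
    then show ?thesis using n by simp
  qed
  define x' where "x' = (\<chi> i. if p i \<ge> b then ?x $ i else 0)"
  define y where "y = B *v x'"
  define l where "l = B *v (?x - x')"
  have yl: "vcnj v = y + l" unfolding y_def l_def by (simp flip: matrix_vector_right_distrib)
  have l: "l \<in> coord_span B (\<lambda>i. p i < b \<and> q i < a)"
    unfolding cs_iff l_def
  proof (intro allI impI)
    fix i assume "\<not> (p i < b \<and> q i < a)"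
    then show "(Bi *v (B *v (?x - x'))) $ i = 0" using low[of i] by (cases "p i \<ge> b") (auto simp: x'_def)
  qed
  have vW: "vcnj v \<in> W (a + b)" using v cnjW by (auto simp: deligne_piece_def)
  have lW: "l \<in> W (a + b)" using l unfolding W_eq by (auto simp: cs_iff)
  have "y \<in> W (a + b)" using vW lW yl vec.subspace_diff[OF sW, of "vcnj v" _ l] by simp
  moreover have "y \<in> F b" unfolding F_eq cs_iff y_def by (simp add: x'_def)
  moreover have "y \<in> cnj_plus (a - int n) (a + b - int n - 2)" for n
  proof -
    have "column i B \<in> cnj_plus (a - int n) (a + b - int n - 2)" if i: "p i < b \<and> q i < a" for i
    proof (cases "int n \<ge> a - q i")
      case True
      define m where "m = nat (int n - (a - q i))"
      have m: "int m = int n - (a - q i)" using True by (simp add: m_def)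
      obtain w where w: "w \<in> F (q i - int m)" "column i B - vcnj w \<in> W (p i + q i - int m - 2)"
        using col[of i] unfolding deligne_piece_def by blast
      have "w \<in> F (a - int n)" using w(1) m by simp
      moreover have "column i B - vcnj w \<in> W (a + b - int n - 2)"
        by (rule monoW[OF _ w(2)]) (use m i in simp)
      ultimately show ?thesis by (auto simp: cnj_plus_def)
    next
      case False
      have "column i B \<in> W (p i + q i)" using col[of i] by (simp add: deligne_piece_def)
      then have "column i B \<in> W (a + b - int n - 2)" by (rule monoW[rotated]) (use False i in simp)
      then show ?thesis using vec.subspace_0[OF sF] by (auto simp: cnj_plus_def intro!: bexI[of _ 0])
    qed
    then have "l \<in> cnj_plus (a - int n) (a + b - int n - 2)"
      using coord_span_minimal[OF subspace_cnj_plus, of "\<lambda>i. p i < b \<and> q i < a" B] l by blast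
    moreover have "v \<in> F (a - int n)" using v monoF[of "a - int n" a] by (auto simp: deligne_piece_def)
    then have "vcnj v \<in> cnj_plus (a - int n) (a + b - int n - 2)"
      using vec.subspace_0[OF sW] by (auto simp: cnj_plus_def intro!: bexI[of _ v])
    ultimately show ?thesis using yl vec.subspace_diff[OF subspace_cnj_plus, of "vcnj v" _ _ l]
      by (metis add_diff_cancel_right')
  qed
  ultimately have "y \<in> D b a" unfolding deligne_piece_iff add.commute[of b a] by blast
  then have "y \<in> coord_span B (\<lambda>i. (p i = b \<and> q i = a) \<or> (p i < b \<and> q i < a))"
    unfolding D_eq by (rule subsetD[OF coord_span_mono, rotated]) auto
  moreover have "l \<in> coord_span B (\<lambda>i. (p i = b \<and> q i = a) \<or> (p i < b \<and> q i < a))"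
    using l by (rule subsetD[OF coord_span_mono, rotated]) auto
  ultimately show ?thesis unfolding yl by (intro vec.subspace_add[OF subspace_coord_span])
qed

definition Ylab :: "complex^'n^'n" where
  "Ylab = B ** diagm (\<lambda>i. of_int (p i + q i)) ** Bi"

lemma Ylab_coord: "(Bi *v (Ylab *v v)) $ i = of_int (p i + q i) * (Bi *v v) $ i"
  by (simp add: Ylab_def flip: matrix_vector_mul_assoc)

lemma Ylab_piece:
  assumes "v \<in> D a b"
  shows "Ylab *v v = of_int (a + b) *s v"
proof -
  have "Bi *v (Ylab *v v) = Bi *v (of_int (a + b) *s v)"
    unfolding vec_eq_iff
  proof
    fix i
    show "(Bi *v (Ylab *v v)) $ i = (Bi *v (of_int (a + b) *s v)) $ i"
      using assms unfolding D_eq cs_iff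
      by (cases "p i = a \<and> q i = b") (auto simp: Ylab_coord matrix_vector_mult_smult simp del: of_int_add)
  qed
  then show ?thesis by (metis Bi(2))
qed

lemma deligne_bigrading_pieces: "deligne_bigrading F W D"
proof -
  have nz: "{(a, b). D a b \<noteq> {0}} = range (\<lambda>i. (p i, q i))"
  proof -
    have "(a, b) \<in> range (\<lambda>i. (p i, q i))" if "D a b \<noteq> {0}" for a b
    proof (rule ccontr)
      assume "(a, b) \<notin> range (\<lambda>i. (p i, q i))"
      then have "card {i. p i = a \<and> q i = b} = 0" by auto
      then have "vec.dim (D a b) = 0" using dim_coord_span[OF inv] by (simp add: D_eq)
      then show False using that vec.subspace_0[OF sD, of a b] by (auto simp: vec.dim_eq_0)
    qed
    moreover have "D (p i) (q i) \<noteq> {0}" for i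
    proof
      assume "D (p i) (q i) = {0}"
      then have "B *v axis i 1 = 0" using col[of i] by (simp add: matrix_vector_mult_axis)
      then have "axis i 1 = (0::complex^'n)" by (metis Bi(1) matrix_vector_mult_0_right)
      then show False by (simp add: axis_eq_0_iff)
    qed
    ultimately show ?thesis by auto
  qed
  have dims: "(\<Sum>(a, b)\<in>range (\<lambda>i. (p i, q i)). vec.dim (D a b)) = CARD('n)"
  proof -
    have "(\<Sum>(a, b)\<in>range (\<lambda>i. (p i, q i)). vec.dim (D a b)) = (\<Sum>l\<in>range (\<lambda>i. (p i, q i)). \<Sum>i\<in>{i\<in>UNIV. (p i, q i) = l}. 1)"
      by (rule sum.cong) (auto simp: D_eq dim_coord_span[OF inv])
    also have "\<dots> = (\<Sum>i\<in>(UNIV::'n set). 1)" by (rule sum.group) auto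
    finally show ?thesis by simp
  qed
  have colU: "column i B \<in> \<Union>{D a b | a b. R a b}" if "R (p i) (q i)" for i R
    using col[of i] that by blast
  show ?thesis unfolding deligne_bigrading_def
  proof (intro conjI allI)
    show "vec.subspace (D a b)" for a b by (rule sD)
    show "finite {(a, b). D a b \<noteq> {0}}" unfolding nz by simp
    show "(\<Sum>(a, b)\<in>{(a, b). D a b \<noteq> {0}}. vec.dim (D a b)) = CARD('n)" unfolding nz by (rule dims)
    have "coord_span B (\<lambda>i. True) \<subseteq> vec.span (\<Union>a b. D a b)"
      by (rule coord_span_minimal) (use col in \<open>auto intro: vec.span_base\<close>)
    moreover have "coord_span B (\<lambda>i. True) = UNIV" by (auto simp: cs_iff)
    ultimately show "vec.span (\<Union>a b. D a b) = UNIV" by auto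
    show "F x = vec.span (\<Union>{D a b | a b. a \<ge> x})" for x
    proof
      show "F x \<subseteq> vec.span (\<Union>{D a b | a b. a \<ge> x})"
        unfolding F_eq[of x] by (rule coord_span_minimal) (simp, rule vec.span_base, rule colU)
      show "vec.span (\<Union>{D a b | a b. a \<ge> x}) \<subseteq> F x"
        by (rule vec.span_minimal[OF _ sF]) (use monoF in \<open>auto simp: deligne_piece_def\<close>)
    qed
    show "W x = vec.span (\<Union>{D a b | a b. a + b \<le> x})" for x
    proof
      show "W x \<subseteq> vec.span (\<Union>{D a b | a b. a + b \<le> x})"
        unfolding W_eq[of x] by (rule coord_span_minimal) (simp, rule vec.span_base, rule colU)
      show "vec.span (\<Union>{D a b | a b. a + b \<le> x}) \<subseteq> W x"
        by (rule vec.span_minimal[OF _ sW]) (use monoW in \<open>auto simp: deligne_piece_def\<close>)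
    qed
    show "vcnj ` D a b \<subseteq> vec.span (D b a \<union> \<Union>{D r s | r s. r < b \<and> s < a})" for a b
    proof
      fix x assume "x \<in> vcnj ` D a b"
      then have "x \<in> coord_span B (\<lambda>i. (p i = b \<and> q i = a) \<or> (p i < b \<and> q i < a))"
        using vcnj_piece by blast
      moreover have "coord_span B (\<lambda>i. (p i = b \<and> q i = a) \<or> (p i < b \<and> q i < a))
        \<subseteq> vec.span (D b a \<union> \<Union>{D r s | r s. r < b \<and> s < a})"
        by (rule coord_span_minimal) (use col in \<open>auto intro!: vec.span_base\<close>)
      ultimately show "x \<in> vec.span (D b a \<union> \<Union>{D r s | r s. r < b \<and> s < a})" by blast
    qed
  qed
qed

lemma Y_FW_eq: "Y_FW F W = Ylab"
  unfolding Y_FW_def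
proof (rule the_equality)
  show "deligne_grading_of F W Ylab"
    unfolding deligne_grading_of_def using deligne_bigrading_pieces Ylab_piece by blast
  fix Y assume "deligne_grading_of F W Y"
  then obtain I where I: "deligne_bigrading F W I" and Y: "\<And>a b v. v \<in> I a b \<Longrightarrow> Y *v v = of_int (a + b) *s v"
    by (auto simp: deligne_grading_of_def)
  have "vec.span (\<Union>a b. I a b) \<subseteq> {v. Y *v v = Ylab *v v}"
  proof (rule vec.span_minimal)
    show "(\<Union>a b. I a b) \<subseteq> {v. Y *v v = Ylab *v v}"
      using Y Ylab_piece deligne_bigrading_subset[OF I] by force
    show "vec.subspace {v. Y *v v = Ylab *v v}"
      by (auto intro!: vec.subspaceI simp: matrix_vector_right_distrib matrix_vector_mult_smult)
  qed
  moreover have "vec.span (\<Union>a b. I a b) = UNIV" using I by (simp add: deligne_bigrading_def)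
  ultimately show "Y = Ylab" by (auto simp: matrix_eq)
qed

lemma Ylab_W:
  assumes "v \<in> W m"
  shows "Ylab *v v - of_int m *s v \<in> W (m - 1)"
  using assms unfolding W_eq cs_iff
  by (auto simp: matrix_vector_mult_diff_distrib Ylab_coord matrix_vector_mult_smult)
     (metis le_less of_int_add zle_diff1_eq)

lemma Ylab_F: "v \<in> F a \<Longrightarrow> Ylab *v v \<in> F a"
  unfolding F_eq cs_iff by (auto simp: Ylab_coord)

text \<open>Conjugation maps I^{p,q} into I^{q,p}, of the same weight, plus pieces I^{r,s} with r <
  q and s < p, of weight lower by at least two. Hence it commutes with the grading modulo two steps
  of \<open>W\<close>.\<close>

lemma Ylab_vcnj:
  assumes v: "v \<in> F b \<inter> W m"
  shows "\<exists>w\<in>F b \<inter> W m. Ylab *v vcnj v - vcnj w \<in> W (m - 2)"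
proof -
  let ?w = "Ylab *v v"
  have "v \<in> W m" using v by simp
  then have "Ylab *v v \<in> W m" unfolding W_eq cs_iff by (auto simp: Ylab_coord)
  then have w: "?w \<in> F b \<inter> W m" using v Ylab_F by auto
  let ?T = "{v. Ylab *v vcnj v - vcnj (Ylab *v v) \<in> W (m - 2)}"
  have sT: "vec.subspace ?T"
  proof (rule vec.subspaceI)
    show "0 \<in> ?T" using vec.subspace_0[OF sW] by simp
    fix x y assume "x \<in> ?T" "y \<in> ?T"
    then show "x + y \<in> ?T"
      using vec.subspace_add[OF sW, of "Ylab *v vcnj x - vcnj (Ylab *v x)" _ "Ylab *v vcnj y - vcnj (Ylab *v y)"]
      by (simp add: vcnj_add matrix_vector_right_distrib algebra_simps)
  next
    fix c x assume "x \<in> ?T"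
    then show "c *s x \<in> ?T"
      using vec.subspace_scale[OF sW, of "Ylab *v vcnj x - vcnj (Ylab *v x)" _ "cnj c"]
      by (simp add: vcnj_smult matrix_vector_mult_smult vec.scale_right_diff_distrib)
  qed
  have "W m \<subseteq> ?T" unfolding W_eq[of m]
  proof (rule coord_span_minimal[OF sT])
    fix i assume i: "p i + q i \<le> m"
    have Y: "Ylab *v column i B = of_int (p i + q i) *s column i B" using Ylab_piece[OF col[of i]] .
    have "(Bi *v vcnj (column i B)) $ k = 0 \<or> p k + q k = p i + q i \<or> p k + q k \<le> m - 2" for k
    proof -
      consider "(Bi *v vcnj (column i B)) $ k = 0" | "p k = q i \<and> q k = p i" | "p k < q i \<and> q k < p i"
        using vcnj_piece[OF col[of i]] unfolding cs_iff by blast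
      then show ?thesis by cases (use i in auto)
    qed
    then have "(Bi *v (Ylab *v vcnj (column i B) - of_int (p i + q i) *s vcnj (column i B))) $ k = 0"
      if "\<not> p k + q k \<le> m - 2" for k
      using that by (auto simp: matrix_vector_mult_diff_distrib Ylab_coord matrix_vector_mult_smult simp del: of_int_add)
    then show "column i B \<in> ?T" unfolding W_eq cs_iff by (simp add: Y vcnj_smult del: of_int_add)
  qed
  then show ?thesis using v w by blast
qed

end

lemma mhs_basis_exists:
  assumes "is_mhs F W"
  shows "\<exists>B p q. mhs_basis F W B p q"
proof -
  interpret mhs F W using assms by unfold_locales
  show ?thesis using adapted_basis[OF filtW sub_mhs_W] mhs_basis.intro mhs_axioms mhs_basis_axioms.intro by metis
qed

section \<open>Sub-mixed Hodge structures\<close>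

lemma subspace_splus:
  assumes "vec.subspace A" "vec.subspace B"
  shows "vec.subspace (splus A B)"
  unfolding splus_def by (rule vec.subspace_sums[OF assms])

lemma dim_splus:
  assumes "vec.subspace A" "vec.subspace B"
  shows "vec.dim (splus A B) + vec.dim (A \<inter> B) = vec.dim A + vec.dim B"
  unfolding splus_def by (rule vec.dim_sums_Int[OF assms])

lemma subspace_complement:
  assumes S: "vec.subspace S" and T: "vec.subspace T" and ST: "S \<subseteq> T"
  obtains C where "vec.subspace C" "C \<subseteq> T" "S \<inter> C = {0}" "splus S C = T" "vec.dim S + vec.dim C = vec.dim T"
proof -
  obtain Bs where Bs: "Bs \<subseteq> S" "vec.independent Bs" "S \<subseteq> vec.span Bs" "card Bs = vec.dim S"
    using vec.basis_exists by blast
  obtain Bt where Bt: "Bs \<subseteq> Bt" "Bt \<subseteq> T" "vec.independent Bt" "T \<subseteq> vec.span Bt"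
    using vec.maximal_independent_subset_extend[OF _ Bs(2)] Bs(1) ST by (metis subset_trans)
  let ?C = "vec.span (Bt - Bs)"
  have sS: "S = vec.span Bs" using Bs S vec.span_minimal by blast
  have sT: "T = vec.span Bt" using Bt T vec.span_minimal by blast
  have fin: "finite Bt" by (rule vec.finiteI_independent[OF Bt(3)])
  have "splus S ?C = vec.span (Bs \<union> (Bt - Bs))"
    unfolding sS splus_def vec.span_Un by auto
  then have sum: "splus S ?C = T" using Bt(1) sT by (simp add: Un_absorb1)
  have "vec.independent (Bt - Bs)" by (rule vec.independent_mono[OF Bt(3)]) auto
  then have "vec.dim ?C = card Bt - card Bs"
    using Bt(1) fin by (simp add: vec.dim_eq_card_independent card_Diff_subset finite_subset)
  moreover have "vec.dim T = card Bt" using Bt(3) by (simp add: sT vec.dim_eq_card_independent)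
  moreover have "card Bs \<le> card Bt" using Bt(1) fin by (simp add: card_mono)
  ultimately have dim: "vec.dim S + vec.dim ?C = vec.dim T" using Bs(4) by simp
  then have "vec.dim (S \<inter> ?C) = 0" using dim_splus[OF S, of ?C] sum by simp
  then have "S \<inter> ?C = {0}" using vec.subspace_0[OF S] vec.span_zero by auto
  moreover have "?C \<subseteq> T" unfolding sT by (rule vec.span_mono) auto
  ultimately show ?thesis using that[of ?C] sum dim by auto
qed

text \<open>\<open>f\<close> maps a complement of \<open>A'\<close> in \<open>A\<close>
  isomorphically onto a complement of \<open>B'\<close> in \<open>B\<close>.\<close>

lemma dim_quotient_iso:
  fixes f :: "complex^'n::finite^'n"
  assumes A: "vec.subspace A" "vec.subspace A'" "A' \<subseteq> A" and B: "vec.subspace B" "vec.subspace B'" "B' \<subseteq> B"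
    and f: "\<And>v. v \<in> A \<Longrightarrow> f *v v \<in> B" "\<And>v. v \<in> A' \<Longrightarrow> f *v v \<in> B'"
    and inj: "\<And>v. v \<in> A \<Longrightarrow> f *v v \<in> B' \<Longrightarrow> v \<in> A'"
    and surj: "\<And>w. w \<in> B \<Longrightarrow> \<exists>v\<in>A. w - f *v v \<in> B'"
  shows "int (vec.dim A) - int (vec.dim A') = int (vec.dim B) - int (vec.dim B')"
proof -
  obtain C where C: "vec.subspace C" "C \<subseteq> A" "A' \<inter> C = {0}" "splus A' C = A" "vec.dim A' + vec.dim C = vec.dim A"
    using subspace_complement[OF A(2,1,3)] by metis
  have sfC: "vec.subspace ((*v) f ` C)" by (rule subspace_matrix_image[OF C(1)])
  have "inj_on ((*v) f) C"
  proof (rule inj_onI)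
    fix x y assume xy: "x \<in> C" "y \<in> C" "f *v x = f *v y"
    then have "f *v (x - y) = 0" by (simp add: matrix_vector_mult_diff_distrib)
    then have "x - y \<in> A'" using inj[of "x - y"] xy C(1,2) vec.subspace_diff vec.subspace_0[OF B(2)]
      by (metis subsetD)
    moreover have "x - y \<in> C" using xy vec.subspace_diff[OF C(1)] by blast
    ultimately have "x - y \<in> {0}" using C(3) by blast
    then show "x = y" by simp
  qed
  then have dC: "vec.dim ((*v) f ` C) = vec.dim C"
    using C(1) by (intro vec.dim_image_eq) (auto simp: vec.span_eq_iff[THEN iffD2])
  have "B' \<inter> (*v) f ` C = {0}"
  proof -
    have "y = 0" if "y \<in> B'" "y = f *v c" "c \<in> C" for y c
    proof -
      have "c \<in> A'" using that inj C(2) by blast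
      then have "c \<in> {0}" using that C(3) by blast
      then show ?thesis using that by simp
    qed
    then show ?thesis using vec.subspace_0[OF B(2)] vec.subspace_0[OF sfC] by blast
  qed
  moreover have "splus B' ((*v) f ` C) = B"
  proof
    show "splus B' ((*v) f ` C) \<subseteq> B"
      unfolding splus_def using B(1,3) f(1) C(2) vec.subspace_add by blast
    show "B \<subseteq> splus B' ((*v) f ` C)"
    proof
      fix w assume "w \<in> B"
      then obtain v where v: "v \<in> A" "w - f *v v \<in> B'" using surj by blast
      obtain a c where ac: "v = a + c" "a \<in> A'" "c \<in> C" using v(1) C(4) unfolding splus_def by blast
      have "w - f *v c = (w - f *v v) + f *v a" by (simp add: ac(1) matrix_vector_right_distrib)
      then have "w - f *v c \<in> B'" using vec.subspace_add[OF B(2) v(2) f(2)[OF ac(2)]] by metis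
      then show "w \<in> splus B' ((*v) f ` C)" unfolding splus_def using ac(3)
        by (intro CollectI exI[of _ "w - f *v c"] exI[of _ "f *v c"]) auto
    qed
  qed
  ultimately have "vec.dim B = vec.dim B' + vec.dim C" using dim_splus[OF B(2) sfC] dC by simp
  then show ?thesis using C(5) by simp
qed

section \<open>Degrees of real subspaces of a mixed Hodge structure\<close>

lemma telescope_int:
  fixes u :: "int \<Rightarrow> int"
  assumes "a \<le> b"
  shows "(\<Sum>l\<in>{a+1..b}. u l - u (l - 1)) = u b - u a"
  using assms
proof (induction b rule: int_ge_induct)
  case (step i)
  have "{a+1..i+1} = insert (i+1) {a+1..i}" using step by auto
  then show ?case using step by simp
qed simp

lemma sum_reflect_int:
  fixes g :: "int \<Rightarrow> int"
  shows "(\<Sum>p\<in>{a..b}. g (c - p)) = (\<Sum>p\<in>{c-b..c-a}. g p)"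
  by (rule sum.reindex_bij_witness[of _ "\<lambda>p. c - p" "\<lambda>p. c - p"]) auto

text \<open>For a function equal to \<open>c\<close> far to the left and to 0 far to the right,
  moving the left end of the summation window changes the sum by multiples of \<open>c\<close>.
  Comparing two windows that differ by a weight \<open>l\<close> produces the term
  \<open>l * wdim S l\<close> of the degree formula.\<close>

lemma sum_step_function:
  fixes g :: "int \<Rightarrow> int"
  assumes "\<And>p. p \<le> -K \<Longrightarrow> g p = c" "\<And>p. p \<ge> K \<Longrightarrow> g p = 0" "a \<le> -K" "K \<le> b" "K > 0"
  shows "(\<Sum>p\<in>{a+1..b}. g p) = (\<Sum>p\<in>{1-K..K}. g p) + (-K-a) * c"
proof -
  have "{a+1..b} = {a+1..-K} \<union> ({1-K..K} \<union> {K+1..b})" using assms(3-5) by auto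
  moreover have "sum g ({1-K..K} \<union> {K+1..b}) = sum g {1-K..K} + sum g {K+1..b}"
    by (rule sum.union_disjoint) auto
  moreover have "sum g ({a+1..-K} \<union> ({1-K..K} \<union> {K+1..b})) = sum g {a+1..-K} + sum g ({1-K..K} \<union> {K+1..b})"
    by (rule sum.union_disjoint) (use assms(5) in auto)
  ultimately have "(\<Sum>p\<in>{a+1..b}. g p) = (\<Sum>p\<in>{a+1..-K}. g p) + ((\<Sum>p\<in>{1-K..K}. g p) + (\<Sum>p\<in>{K+1..b}. g p))"
    by simp
  moreover have "(\<Sum>p\<in>{K+1..b}. g p) = 0" using assms(2) by (intro sum.neutral) auto
  moreover have "(\<Sum>p\<in>{a+1..-K}. g p) = (\<Sum>p\<in>{a+1..-K}. c)" using assms(1) by (intro sum.cong) auto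
  ultimately show ?thesis using assms(3) by simp
qed

text \<open>Integer valued, so that differences of dimensions are genuine subtractions.\<close>

definition idim :: "(complex^'n::finite) set \<Rightarrow> int" where "idim A = int (vec.dim A)"

context mhs
begin

text \<open>The dimension of the step that F^p induces on Gr_l of \<open>S\<close>.\<close>

definition gdim :: "(complex^'n) set \<Rightarrow> int \<Rightarrow> int \<Rightarrow> int" where
  "gdim S p l = idim (F p \<inter> W l \<inter> S) - idim (F p \<inter> W (l - 1) \<inter> S)"

definition wdim :: "(complex^'n) set \<Rightarrow> int \<Rightarrow> int" where
  "wdim S l = idim (W l \<inter> S) - idim (W (l - 1) \<inter> S)"

text \<open>On Gr_l of \<open>S\<close> the steps F^p and conj F^(l-p+1) meet only in zero, by
  opposedness in the ambient structure, and conjugation preserves dimensions. So their dimensions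
  add up to at most that of Gr_l, with equality exactly when they span it.\<close>

lemma graded_defect:
  assumes S: "vec.subspace S" "vcnj ` S \<subseteq> S"
  shows "gdim S p l + gdim S (l - p + 1) l \<le> wdim S l"
    and "gdim S p l + gdim S (l - p + 1) l = wdim S l \<longleftrightarrow>
      (\<forall>v\<in>W l \<inter> S. \<exists>x\<in>F p \<inter> W l \<inter> S. \<exists>y\<in>F (l - p + 1) \<inter> W l \<inter> S. v - x - vcnj y \<in> W (l - 1))"
proof -
  let ?X = "F p \<inter> W l \<inter> S" and ?Y' = "F (l - p + 1) \<inter> W l \<inter> S" and ?Z = "W (l - 1) \<inter> S"
  let ?Y = "vcnj ` ?Y'" and ?V = "W l \<inter> S"
  have cS: "vcnj x \<in> S \<longleftrightarrow> x \<in> S" for x using S(2) vcnj_vcnj by (metis image_subset_iff)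
  have s: "vec.subspace ?X" "vec.subspace ?Y'" "vec.subspace ?Z" "vec.subspace ?V"
    using sF sW S(1) by (auto intro!: vec.subspace_inter)
  have sY: "vec.subspace ?Y" by (rule subspace_vcnj_image[OF s(2)])
  have WW: "W (l - 1) \<subseteq> W l" using monoW[of "l - 1" l] by auto
  have sXZ: "vec.subspace (splus ?X ?Z)" and sYZ: "vec.subspace (splus ?Y ?Z)"
    using s sY by (auto intro!: subspace_splus)
  let ?U = "splus (splus ?X ?Z) (splus ?Y ?Z)"
  have XZ: "idim (splus ?X ?Z) = idim ?Z + gdim S p l"
  proof -
    have "?X \<inter> ?Z = F p \<inter> W (l - 1) \<inter> S" using WW by auto
    then show ?thesis using dim_splus[OF s(1,3)] by (simp add: gdim_def idim_def)
  qed
  have YZ: "idim (splus ?Y ?Z) = idim ?Z + gdim S (l - p + 1) l"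
  proof -
    have "?Y \<inter> ?Z = vcnj ` (F (l - p + 1) \<inter> W (l - 1) \<inter> S)" using WW cS cnjW_iff by auto
    then show ?thesis using dim_splus[OF sY s(3)] by (simp add: gdim_def idim_def dim_vcnj_image)
  qed
  have "splus ?X ?Z \<inter> splus ?Y ?Z = ?Z"
  proof
    show "splus ?X ?Z \<inter> splus ?Y ?Z \<subseteq> ?Z"
    proof
      fix v assume v: "v \<in> splus ?X ?Z \<inter> splus ?Y ?Z"
      then obtain x z y z' where xy: "x \<in> ?X" "z \<in> ?Z" "v = x + z" "y \<in> ?Y'" "z' \<in> ?Z" "v = vcnj y + z'"
        unfolding splus_def by blast
      have "x - vcnj y = z' - z" using xy(3,6) by (simp add: algebra_simps)
      then have "x - vcnj y \<in> W (l - 1)" using xy(2,5) vec.subspace_diff[OF sW] by simp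
      then have "x \<in> W (l - 1)" using opposed_Int[of x p l y] xy(1,4) by auto
      then show "v \<in> ?Z" using xy vec.subspace_add[OF s(3)] by auto
    qed
    show "?Z \<subseteq> splus ?X ?Z \<inter> splus ?Y ?Z"
    proof
      fix z assume "z \<in> ?Z"
      then have "0 + z \<in> splus ?X ?Z" "0 + z \<in> splus ?Y ?Z"
        unfolding splus_def using vec.subspace_0[OF s(1)] vec.subspace_0[OF sY] by blast+
      then show "z \<in> splus ?X ?Z \<inter> splus ?Y ?Z" by simp
    qed
  qed
  then have U: "idim ?U = idim ?Z + gdim S p l + gdim S (l - p + 1) l"
    using dim_splus[OF sXZ sYZ] XZ YZ by (simp add: idim_def)
  have UV: "?U \<subseteq> ?V"
  proof -
    have cl: "splus A B \<subseteq> ?V" if "A \<subseteq> ?V" "B \<subseteq> ?V" for A B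
      unfolding splus_def using that vec.subspace_add[OF s(4)] by blast
    have Y: "?Y \<subseteq> ?V" using cnjW cS by auto
    have Z: "?Z \<subseteq> ?V" using WW by auto
    have "?X \<subseteq> ?V" by auto
    then show ?thesis by (intro cl Y Z)
  qed
  have sU: "vec.subspace ?U" by (rule subspace_splus[OF sXZ sYZ])
  have "idim ?U \<le> idim ?V" unfolding idim_def using vec.dim_subset[OF UV] by simp
  then show "gdim S p l + gdim S (l - p + 1) l \<le> wdim S l" using U by (simp add: wdim_def)
  have "gdim S p l + gdim S (l - p + 1) l = wdim S l \<longleftrightarrow> idim ?U = idim ?V" using U by (auto simp: wdim_def)
  also have "\<dots> \<longleftrightarrow> ?V \<subseteq> ?U"
  proof
    assume "idim ?U = idim ?V"
    then show "?V \<subseteq> ?U" using vec.subspace_dim_equal[OF sU s(4) UV] by (simp add: idim_def)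
  next
    assume "?V \<subseteq> ?U"
    then show "idim ?U = idim ?V" using UV by (metis subset_antisym)
  qed
  also have "\<dots> \<longleftrightarrow> (\<forall>v\<in>?V. \<exists>x\<in>?X. \<exists>y\<in>?Y'. v - x - vcnj y \<in> W (l - 1))"
  proof
    assume VU: "?V \<subseteq> ?U"
    show "\<forall>v\<in>?V. \<exists>x\<in>?X. \<exists>y\<in>?Y'. v - x - vcnj y \<in> W (l - 1)"
    proof
      fix v assume "v \<in> ?V"
      then have "v \<in> ?U" using VU by blast
      then obtain x z y z' where "x \<in> ?X" "z \<in> ?Z" "y \<in> ?Y'" "z' \<in> ?Z" "v = (x + z) + (vcnj y + z')"
        unfolding splus_def by blast
      moreover have "z + z' \<in> W (l - 1)" using \<open>z \<in> ?Z\<close> \<open>z' \<in> ?Z\<close> vec.subspace_add[OF sW] by blast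
      ultimately show "\<exists>x\<in>?X. \<exists>y\<in>?Y'. v - x - vcnj y \<in> W (l - 1)"
        by (intro bexI[of _ x] bexI[of _ y]) (auto simp: algebra_simps)
    qed
  next
    assume *: "\<forall>v\<in>?V. \<exists>x\<in>?X. \<exists>y\<in>?Y'. v - x - vcnj y \<in> W (l - 1)"
    show "?V \<subseteq> ?U"
    proof
      fix v assume v: "v \<in> ?V"
      then obtain x y where xy: "x \<in> ?X" "y \<in> ?Y'" "v - x - vcnj y \<in> W (l - 1)" using * by blast
      have "v - x - vcnj y \<in> S" using v xy cS vec.subspace_diff[OF S(1)] by auto
      then have z: "v - x - vcnj y \<in> ?Z" using xy by blast
      have "x + 0 \<in> splus ?X ?Z" unfolding splus_def using xy(1) vec.subspace_0[OF s(3)] by blast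
      moreover have "vcnj y + (v - x - vcnj y) \<in> splus ?Y ?Z" unfolding splus_def using xy(2) z by blast
      ultimately have "(x + 0) + (vcnj y + (v - x - vcnj y)) \<in> ?U" unfolding splus_def[of "splus ?X ?Z"] by blast
      then show "v \<in> ?U" by simp
    qed
  qed
  finally show "gdim S p l + gdim S (l - p + 1) l = wdim S l \<longleftrightarrow> (\<forall>v\<in>?V. \<exists>x\<in>?X. \<exists>y\<in>?Y'. v - x - vcnj y \<in> W (l - 1))" .
qed

text \<open>Summing the defect inequality over all p and l; the degree, i.e. the sum of the dimensions of
  the F p inside S, is largest exactly for sub-mixed Hodge structures.\<close>

lemma degree:
  fixes K :: int
  assumes S: "vec.subspace S" "vcnj ` S \<subseteq> S" and K: "K > 0"
    and FK: "\<And>p. p \<le> -K \<Longrightarrow> F p = UNIV" "\<And>p. p \<ge> K \<Longrightarrow> F p = {0}"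
    and WK: "\<And>l. l \<le> -K \<Longrightarrow> W l = {0}" "\<And>l. l \<ge> K \<Longrightarrow> W l = UNIV"
    and M: "M = 2 * K + 1"
  shows "2 * (\<Sum>p\<in>{1-M..M}. idim (F p \<inter> S)) \<le> 2 * M * idim S + (\<Sum>l\<in>{1-K..K}. l * wdim S l)"
    and "2 * (\<Sum>p\<in>{1-M..M}. idim (F p \<inter> S)) = 2 * M * idim S + (\<Sum>l\<in>{1-K..K}. l * wdim S l) \<longleftrightarrow> sub_mhs F W S"
proof -
  let ?A = "2 * (\<Sum>p\<in>{1-M..M}. idim (F p \<inter> S))"
  let ?B = "2 * M * idim S + (\<Sum>l\<in>{1-K..K}. l * wdim S l)"
  let ?e = "\<lambda>p l. wdim S l - gdim S p l - gdim S (l - p + 1) l"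
  have e0: "?e p l \<ge> 0" for p l using graded_defect(1)[OF S, of p l] by simp
  have z0: "idim ({0} \<inter> S) = 0" "idim (S \<inter> {0}) = 0" by (simp_all add: idim_def)
  have g1: "gdim S p l = wdim S l" if "p \<le> -K" for p l using FK(1)[OF that] by (simp add: gdim_def wdim_def)
  have g2: "gdim S p l = 0" if "p \<ge> K" for p l
    using FK(2)[OF that] vec.subspace_0[OF sW] vec.subspace_0[OF S(1)] by (simp add: gdim_def Int_absorb2 Int_assoc)
  have sg: "(\<Sum>l\<in>{1-K..K}. gdim S p l) = idim (F p \<inter> S)" for p
  proof -
    have "(\<Sum>l\<in>{-K+1..K}. gdim S p l) = idim (F p \<inter> W K \<inter> S) - idim (F p \<inter> W (-K) \<inter> S)"
      unfolding gdim_def using K by (intro telescope_int) simp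
    moreover have "F p \<inter> W (-K) \<inter> S \<subseteq> {0}" using WK(1) by auto
    then have "idim (F p \<inter> W (-K) \<inter> S) = 0" unfolding idim_def by (simp add: vec.dim_eq_0)
    ultimately show ?thesis using WK(2)[of K] by simp
  qed
  have sw: "(\<Sum>l\<in>{1-K..K}. wdim S l) = idim S"
  proof -
    have "(\<Sum>l\<in>{-K+1..K}. wdim S l) = idim (W K \<inter> S) - idim (W (-K) \<inter> S)"
      unfolding wdim_def using K by (intro telescope_int) simp
    then show ?thesis using WK(1)[of "-K"] WK(2)[of K] z0 by simp
  qed
  \<comment> \<open>The reflection of \<open>p\<close> to l+1-p moves the window by
    \<open>l\<close>, which costs \<open>l * wdim S l\<close>. The value M = 2K+1 keeps both ends of
    every shifted window outside the range where \<open>F\<close> varies.\<close>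
  have row: "(\<Sum>p\<in>{1-M..M}. gdim S (l - p + 1) l) = (\<Sum>p\<in>{1-M..M}. gdim S p l) - l * wdim S l"
    if l: "l \<in> {1-K..K}" for l
  proof -
    have 1: "(\<Sum>p\<in>{1-M..M}. gdim S (l + 1 - p) l) = (\<Sum>p\<in>{(l - M) + 1..l + M}. gdim S p l)"
      using sum_reflect_int[of "\<lambda>p. gdim S p l" "l + 1" "1 - M" M] by (simp add: algebra_simps)
    have 2: "(\<Sum>p\<in>{(l - M) + 1..l + M}. gdim S p l) = (\<Sum>p\<in>{1-K..K}. gdim S p l) + (-K-(l-M)) * wdim S l"
      by (rule sum_step_function) (use g1 g2 l M K in auto)
    have 3: "(\<Sum>p\<in>{-M + 1..M}. gdim S p l) = (\<Sum>p\<in>{1-K..K}. gdim S p l) + (-K-(-M)) * wdim S l"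
      by (rule sum_step_function) (use g1 g2 l M K in auto)
    show ?thesis using 1 2 3 by (simp add: algebra_simps)
  qed
  have "(\<Sum>p\<in>{1-M..M}. \<Sum>l\<in>{1-K..K}. ?e p l)
      = (\<Sum>l\<in>{1-K..K}. \<Sum>p\<in>{1-M..M}. ?e p l)" by (rule sum.swap)
  also have "\<dots> = (\<Sum>l\<in>{1-K..K}. 2 * M * wdim S l - 2 * (\<Sum>p\<in>{1-M..M}. gdim S p l) + l * wdim S l)"
  proof (rule sum.cong[OF refl])
    fix l assume l: "l \<in> {1-K..K}"
    show "(\<Sum>p\<in>{1-M..M}. ?e p l) = 2 * M * wdim S l - 2 * (\<Sum>p\<in>{1-M..M}. gdim S p l) + l * wdim S l"
    proof -
      have "(\<Sum>p\<in>{1-M..M}. wdim S l) = 2 * M * wdim S l" using M K by simp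
      then show ?thesis unfolding sum_subtractf row[OF l] by linarith
    qed
  qed
  also have "\<dots> = 2 * M * (\<Sum>l\<in>{1-K..K}. wdim S l) - 2 * (\<Sum>l\<in>{1-K..K}. \<Sum>p\<in>{1-M..M}. gdim S p l) + (\<Sum>l\<in>{1-K..K}. l * wdim S l)"
    by (simp add: sum.distrib sum_subtractf sum_distrib_left)
  also have "(\<Sum>l\<in>{1-K..K}. \<Sum>p\<in>{1-M..M}. gdim S p l) = (\<Sum>p\<in>{1-M..M}. idim (F p \<inter> S))"
    by (subst sum.swap) (simp add: sg)
  finally have tot: "(\<Sum>p\<in>{1-M..M}. \<Sum>l\<in>{1-K..K}. ?e p l) = ?B - ?A" by (simp add: sw)
  have "(\<Sum>p\<in>{1-M..M}. \<Sum>l\<in>{1-K..K}. ?e p l) \<ge> 0" by (intro sum_nonneg e0)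
  then show "?A \<le> ?B" using tot by simp
  have "?A = ?B \<longleftrightarrow> (\<Sum>p\<in>{1-M..M}. \<Sum>l\<in>{1-K..K}. ?e p l) = 0" using tot by auto
  also have "\<dots> \<longleftrightarrow> (\<forall>p\<in>{1-M..M}. \<forall>l\<in>{1-K..K}. ?e p l = 0)"
  proof -
    have inner: "(\<Sum>l\<in>{1-K..K}. ?e p l) = 0 \<longleftrightarrow> (\<forall>l\<in>{1-K..K}. ?e p l = 0)" for p
      by (rule sum_nonneg_eq_0_iff) (simp, rule e0)
    show ?thesis unfolding inner[symmetric]
      by (rule sum_nonneg_eq_0_iff) (simp, rule sum_nonneg, rule e0)
  qed
  \<comment> \<open>Outside the window the defect vanishes by itself: either Gr_l of
    \<open>S\<close> is zero, or one of the two filtration steps is everything and the other one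
    zero.\<close>
  also have "\<dots> \<longleftrightarrow> (\<forall>p l. ?e p l = 0)"
  proof
    assume *: "\<forall>p\<in>{1-M..M}. \<forall>l\<in>{1-K..K}. ?e p l = 0"
    have "?e p l = 0" for p l
    proof -
      have W0: "wdim S l = 0 \<and> gdim S p' l = 0" if "l \<notin> {1-K..K}" for p'
      proof (cases "l \<le> -K")
        case True
        then show ?thesis using WK(1) by (simp add: wdim_def gdim_def)
      next
        case False
        then show ?thesis using that WK(2) by (simp add: wdim_def gdim_def)
      qed
      show ?thesis
      proof (cases "l \<in> {1-K..K}")
        case l: True
        show ?thesis
        proof (cases "p \<in> {1-M..M}")
          case False
          then consider "p \<le> -M" | "p > M" by force
          then show ?thesis
          proof cases
            case 1
            then show ?thesis using g1[of p l] g2[of "l - p + 1" l] l M K by simp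
          next
            case 2
            then show ?thesis using g2[of p l] g1[of "l - p + 1" l] l M K by simp
          qed
        qed (use * l in blast)
      qed (use W0 in simp)
    qed
    then show "\<forall>p l. ?e p l = 0" by blast
  qed blast
  also have "\<dots> \<longleftrightarrow> (\<forall>p l. gdim S p l + gdim S (l - p + 1) l = wdim S l)" by (simp add: algebra_simps eq_commute)
  also have "\<dots> \<longleftrightarrow> sub_mhs F W S"
    unfolding graded_defect(2)[OF S] sub_mhs_def using S by blast
  finally show "?A = ?B \<longleftrightarrow> sub_mhs F W S" .
qed

end

text \<open>\<open>c l k\<close> is the dimension of Gr^M_l Gr^W_k, and N^j identifies the weights
  k+j and k-j of \<open>M\<close> on Gr^W_k.\<close>

lemma rel_weight_symmetric:
  assumes R: "rel_weight_filt N W M" and W: "incr_filt W" and NW: "\<And>k v. v \<in> W k \<Longrightarrow> N *v v \<in> W k"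
  defines "c \<equiv> (\<lambda>l k. idim (M l \<inter> W k) - idim (M (l - 1) \<inter> W k) - (idim (M l \<inter> W (k - 1)) - idim (M (l - 1) \<inter> W (k - 1))))"
  shows "c (k + int j) k = c (k - int j) k"
proof -
  note sW = incr_filt_subspace[OF W]
  have M: "incr_filt M" and NM: "\<And>k v. v \<in> M k \<Longrightarrow> N *v v \<in> M (k - 2)"
    using R by (auto simp: rel_weight_filt_def)
  note sM = incr_filt_subspace[OF M]
  let ?A = "\<lambda>l. splus (M l \<inter> W k) (W (k-1))"
  have WW: "W (k - 1) \<subseteq> W k" using incr_filt_mono[OF W] by simp
  have sI: "vec.subspace (M l \<inter> W k)" for l by (intro vec.subspace_inter sM sW)
  have sA: "vec.subspace (?A l)" for l by (rule subspace_splus[OF sI sW])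
  have dA: "idim (?A l) = idim (M l \<inter> W k) + idim (W (k - 1)) - idim (M l \<inter> W (k - 1))" for l
  proof -
    have "M l \<inter> W k \<inter> W (k - 1) = M l \<inter> W (k - 1)" using WW by blast
    then show ?thesis using dim_splus[OF sI sW, of l "k - 1"] by (simp add: idim_def)
  qed
  have cA: "c l k = idim (?A l) - idim (?A (l - 1))" for l by (simp add: c_def dA)
  have Npow: "mpow N n *v v \<in> M (l - 2 * int n) \<and> (v \<in> W i \<longrightarrow> mpow N n *v v \<in> W i)" if "v \<in> M l" for n l v i
  proof (induction n)
    case (Suc n)
    have "M (l - 2 * int n - 2) = M (l - 2 * int (Suc n))" by (simp add: algebra_simps)
    then show ?case using Suc NM[of "mpow N n *v v" "l - 2 * int n"] NW by (auto simp flip: matrix_vector_mul_assoc)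
  qed (use that in simp)
  have NpowW: "mpow N n *v v \<in> W i" if "v \<in> W i" for n v i
    by (induction n) (use that NW in \<open>auto simp flip: matrix_vector_mul_assoc\<close>)
  have f: "mpow N j *v v \<in> ?A (l - 2 * int j)" if vA: "v \<in> ?A l" for v l
  proof -
    obtain a b where ab: "v = a + b" "a \<in> M l \<inter> W k" "b \<in> W (k - 1)" using vA unfolding splus_def by blast
    have "mpow N j *v a \<in> M (l - 2 * int j) \<inter> W k" using Npow[of a l j] ab(2) by blast
    moreover have "mpow N j *v b \<in> W (k - 1)" using NpowW ab(3) by blast
    ultimately show ?thesis unfolding splus_def ab(1) matrix_vector_right_distrib by blast
  qed
  have mono: "?A (l - 1) \<subseteq> ?A l" for l unfolding splus_def using incr_filt_mono[OF M, of "l - 1" l] by fastforce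
  have R': "(\<forall>v\<in>?A (k + int j). mpow N j *v v \<in> ?A (k - int j - 1) \<longrightarrow> v \<in> ?A (k + int j - 1)) \<and>
     (\<forall>w\<in>?A (k - int j). \<exists>v\<in>?A (k + int j). w - mpow N j *v v \<in> ?A (k - int j - 1))"
    using R unfolding rel_weight_filt_def Let_def by blast
  have "int (vec.dim (?A (k + int j))) - int (vec.dim (?A (k + int j - 1))) = int (vec.dim (?A (k - int j))) - int (vec.dim (?A (k - int j - 1)))"
  proof (rule dim_quotient_iso[OF sA sA mono sA sA mono, where f = "mpow N j"])
    fix v assume "v \<in> ?A (k + int j)"
    from f[OF this] show "mpow N j *v v \<in> ?A (k - int j)" by (simp add: algebra_simps)
  next
    fix v assume "v \<in> ?A (k + int j - 1)"
    from f[OF this] show "mpow N j *v v \<in> ?A (k - int j - 1)" by (simp add: algebra_simps)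
  qed (use R' in blast)+
  then show ?thesis by (simp add: cA idim_def)
qed

text \<open>The weights of \<open>M\<close> on Gr^W_k are symmetric about \<open>k\<close>, so their
  average there is \<open>k\<close>. Adding one Gr^W_k at a time shows that \<open>M\<close> and
  \<open>W\<close> give \<open>W m\<close> the same total weight.\<close>

lemma rel_weight_degree:
  assumes R: "rel_weight_filt N W M" and W: "incr_filt W" and NW: "\<And>k v. v \<in> W k \<Longrightarrow> N *v v \<in> W k"
    and K: "K > 0" and WK: "\<And>l. l \<le> -K \<Longrightarrow> W l = {0}"
    and MK: "\<And>l. l \<le> -K \<Longrightarrow> M l = {0}" "\<And>l. l \<ge> K \<Longrightarrow> M l = UNIV"
    and m: "-K \<le> m" "m \<le> K"
  shows "(\<Sum>l\<in>{1-K..K}. l * (idim (M l \<inter> W m) - idim (M (l - 1) \<inter> W m))) = (\<Sum>j\<in>{1-K..m}. j * (idim (W j) - idim (W (j - 1))))"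
  using m
proof (induction m rule: int_ge_induct)
  case base
  have "W (-K) = {0}" using WK by simp
  moreover have "idim (A \<inter> {0}) = 0" for A :: "(complex^'a) set" by (simp add: idim_def)
  ultimately show ?case by simp
next
  case (step i)
  let ?k = "i + 1"
  define c where "c = (\<lambda>l k. idim (M l \<inter> W k) - idim (M (l - 1) \<inter> W k) - (idim (M l \<inter> W (k - 1)) - idim (M (l - 1) \<inter> W (k - 1))))"
  have sym: "c (?k + int j) ?k = c (?k - int j) ?k" for j
    unfolding c_def by (rule rel_weight_symmetric[OF R W NW])
  have symz: "c (?k + x) ?k = c (?k - x) ?k" for x
    by (cases "x \<ge> 0") (use sym[of "nat x"] sym[of "nat (-x)"] in auto)
  have c0: "c l ?k = 0" if "l \<notin> {1-K..K}" for l
  proof (cases "l \<le> -K")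
    case True
    then show ?thesis using MK(1) by (simp add: c_def)
  next
    case False
    then show ?thesis using that MK(2) by (simp add: c_def)
  qed
  have tele: "(\<Sum>l\<in>{1-K..K}. c l ?k) = idim (W ?k) - idim (W i)"
  proof -
    have "(\<Sum>l\<in>{-K+1..K}. c l ?k) = (\<Sum>l\<in>{-K+1..K}. (idim (M l \<inter> W ?k) - idim (M l \<inter> W i)) - (idim (M (l-1) \<inter> W ?k) - idim (M (l-1) \<inter> W i)))"
      by (rule sum.cong) (auto simp: c_def)
    also have "\<dots> = (idim (M K \<inter> W ?k) - idim (M K \<inter> W i)) - (idim (M (-K) \<inter> W ?k) - idim (M (-K) \<inter> W i))"
      using K by (intro telescope_int) simp
    moreover have "idim ({0} \<inter> A) = 0" for A :: "(complex^'a) set" by (simp add: idim_def)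
    ultimately show ?thesis using MK(1)[of "-K"] MK(2)[of K] by simp
  qed
  have "(\<Sum>l\<in>{1-K..K}. (l - ?k) * c l ?k) = 0"
  proof -
    \<comment> \<open>The window is enlarged to one that is symmetric about \<open>?k\<close>; the
      reflection of \<open>l\<close> to 2k-l then acts on it and reverses the sign of the
      sum.\<close>
    define R where "R = 2 * K + 1"
    have "(\<Sum>l\<in>{1-K..K}. (l - ?k) * c l ?k) = (\<Sum>l\<in>{?k-R..?k+R}. (l - ?k) * c l ?k)"
      by (rule sum.mono_neutral_left) (use c0 step K in \<open>auto simp: R_def\<close>)
    also have "\<dots> = (\<Sum>l\<in>{?k-R..?k+R}. - ((l - ?k) * c l ?k))"
    proof (rule sum.reindex_bij_witness[of _ "\<lambda>l. 2 * ?k - l" "\<lambda>l. 2 * ?k - l"])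
      fix l assume "l \<in> {?k-R..?k+R}"
      have "c (2 * ?k - l) ?k = c l ?k" using symz[of "l - ?k"] by (simp add: algebra_simps)
      then show "- ((2 * ?k - l - ?k) * c (2 * ?k - l) ?k) = (l - ?k) * c l ?k" by (simp add: algebra_simps)
    qed auto
    also have "\<dots> = - (\<Sum>l\<in>{?k-R..?k+R}. (l - ?k) * c l ?k)" by (rule sum_negf)
    finally have e: "(\<Sum>l\<in>{1-K..K}. (l - ?k) * c l ?k) = - (\<Sum>l\<in>{?k-R..?k+R}. (l - ?k) * c l ?k)" .
    have e2: "(\<Sum>l\<in>{1-K..K}. (l - ?k) * c l ?k) = (\<Sum>l\<in>{?k-R..?k+R}. (l - ?k) * c l ?k)"
      by (rule sum.mono_neutral_left) (use c0 step K in \<open>auto simp: R_def\<close>)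
    show ?thesis using e e2 by linarith
  qed
  then have w: "(\<Sum>l\<in>{1-K..K}. l * c l ?k) = ?k * (idim (W ?k) - idim (W i))"
    using tele by (simp add: sum_subtractf left_diff_distrib sum_distrib_left[symmetric])
  have "(\<Sum>l\<in>{1-K..K}. l * (idim (M l \<inter> W ?k) - idim (M (l - 1) \<inter> W ?k)))
     = (\<Sum>l\<in>{1-K..K}. l * (idim (M l \<inter> W i) - idim (M (l - 1) \<inter> W i)) + l * c l ?k)"
    by (rule sum.cong) (auto simp: c_def algebra_simps)
  also have "\<dots> = (\<Sum>j\<in>{1-K..i}. j * (idim (W j) - idim (W (j - 1)))) + ?k * (idim (W ?k) - idim (W i))"
    using step w by (simp add: sum.distrib)
  also have "{1-K..?k} = insert ?k {1-K..i}" using step by auto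
  then have "(\<Sum>j\<in>{1-K..i}. j * (idim (W j) - idim (W (j - 1)))) + ?k * (idim (W ?k) - idim (W i))
    = (\<Sum>j\<in>{1-K..?k}. j * (idim (W j) - idim (W (j - 1))))" by simp
  finally show ?case .
qed

text \<open>The degree bounds for \<open>W m\<close> in (F,W) and in (G,M) coincide, because the
  total weights do. The first bound is attained, since \<open>W m\<close> is a step of the weight
  filtration of (F,W). The degree for \<open>G\<close> is at least the one for \<open>F\<close>, so
  the second bound is attained as well, and every inequality of dimensions is an equality.\<close>

lemma weight_filtration_sub_mhs:
  assumes mhs1: "is_mhs G M" and mhs0: "is_mhs F W" and R: "rel_weight_filt N W M"
    and NW: "\<And>k v. v \<in> W k \<Longrightarrow> N *v v \<in> W k"
    and le: "\<And>p. vec.dim (F p \<inter> W m) \<le> vec.dim (G p \<inter> W m)"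
  shows "sub_mhs G M (W m)" and "vec.dim (F p \<inter> W m) = vec.dim (G p \<inter> W m)"
proof -
  interpret f: mhs F W by unfold_locales (rule mhs0)
  interpret g: mhs G M by unfold_locales (rule mhs1)
  obtain a1 b1 where 1: "\<And>k. k \<le> a1 \<Longrightarrow> W k = {0}" "\<And>k. k \<ge> b1 \<Longrightarrow> W k = UNIV" using incr_filt_bounds[OF f.filtW] by metis
  obtain a2 b2 where 2: "\<And>k. k \<le> a2 \<Longrightarrow> M k = {0}" "\<And>k. k \<ge> b2 \<Longrightarrow> M k = UNIV" using incr_filt_bounds[OF g.filtW] by metis
  obtain a3 b3 where 3: "\<And>k. k \<le> a3 \<Longrightarrow> F k = UNIV" "\<And>k. k \<ge> b3 \<Longrightarrow> F k = {0}" using decr_filt_bounds[OF f.filtF] by metis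
  obtain a4 b4 where 4: "\<And>k. k \<le> a4 \<Longrightarrow> G k = UNIV" "\<And>k. k \<ge> b4 \<Longrightarrow> G k = {0}" using decr_filt_bounds[OF g.filtF] by metis
  define K where "K = Max {1, -a1, -a2, -a3, -a4, b1, b2, b3, b4, m, -m}"
  have Kge: "x \<le> K" if "x \<in> {1, -a1, -a2, -a3, -a4, b1, b2, b3, b4, m, -m}" for x
    unfolding K_def using that by (intro Max_ge) auto
  have K: "K > 0" "-K \<le> m" "m \<le> K" using Kge[of 1] Kge[of m] Kge[of "-m"] by auto
  have WK: "\<And>l. l \<le> -K \<Longrightarrow> W l = {0}" "\<And>l. l \<ge> K \<Longrightarrow> W l = UNIV" using 1 Kge[of "-a1"] Kge[of b1] by auto
  have MK: "\<And>l. l \<le> -K \<Longrightarrow> M l = {0}" "\<And>l. l \<ge> K \<Longrightarrow> M l = UNIV" using 2 Kge[of "-a2"] Kge[of b2] by auto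
  have FK: "\<And>l. l \<le> -K \<Longrightarrow> F l = UNIV" "\<And>l. l \<ge> K \<Longrightarrow> F l = {0}" using 3 Kge[of "-a3"] Kge[of b3] by auto
  have GK: "\<And>l. l \<le> -K \<Longrightarrow> G l = UNIV" "\<And>l. l \<ge> K \<Longrightarrow> G l = {0}" using 4 Kge[of "-a4"] Kge[of b4] by auto
  define X where "X = 2 * K + 1"
  have S: "vec.subspace (W m)" "vcnj ` W m \<subseteq> W m" using f.sW f.cnjW by auto
  have eqF: "2 * (\<Sum>p\<in>{1-X..X}. idim (F p \<inter> W m)) = 2 * X * idim (W m) + (\<Sum>l\<in>{1-K..K}. l * f.wdim (W m) l)"
    using f.degree(2)[OF S K(1) FK WK X_def] f.sub_mhs_W by blast
  have "(\<Sum>l\<in>{1-K..K}. l * f.wdim (W m) l) = (\<Sum>j\<in>{1-K..m}. j * (idim (W j) - idim (W (j - 1))))"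
  proof -
    have "(\<Sum>l\<in>{1-K..K}. l * f.wdim (W m) l) = (\<Sum>l\<in>{1-K..m}. l * f.wdim (W m) l)"
    proof (rule sum.mono_neutral_right)
      show "\<forall>l\<in>{1-K..K} - {1-K..m}. l * f.wdim (W m) l = 0"
      proof
        fix l assume l: "l \<in> {1-K..K} - {1-K..m}"
        then have "W l \<inter> W m = W m" "W (l - 1) \<inter> W m = W m"
          using incr_filt_mono[OF f.filtW, of m l] incr_filt_mono[OF f.filtW, of m "l - 1"] by auto
        then show "l * f.wdim (W m) l = 0" by (simp add: f.wdim_def)
      qed
    qed (use K in auto)
    also have "\<dots> = (\<Sum>j\<in>{1-K..m}. j * (idim (W j) - idim (W (j - 1))))"
    proof (rule sum.cong[OF refl])
      fix l assume l: "l \<in> {1-K..m}"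
      then have "W l \<inter> W m = W l" "W (l - 1) \<inter> W m = W (l - 1)"
        using incr_filt_mono[OF f.filtW, of l m] incr_filt_mono[OF f.filtW, of "l - 1" m] by auto
      then show "l * f.wdim (W m) l = l * (idim (W l) - idim (W (l - 1)))" by (simp add: f.wdim_def)
    qed
    finally show ?thesis .
  qed
  also have "\<dots> = (\<Sum>l\<in>{1-K..K}. l * g.wdim (W m) l)"
    unfolding g.wdim_def by (rule rel_weight_degree[OF R f.filtW NW K(1) WK(1) MK K(2,3), symmetric])
  finally have eqF': "2 * (\<Sum>p\<in>{1-X..X}. idim (F p \<inter> W m)) = 2 * X * idim (W m) + (\<Sum>l\<in>{1-K..K}. l * g.wdim (W m) l)"
    using eqF by simp
  have leG: "2 * (\<Sum>p\<in>{1-X..X}. idim (G p \<inter> W m)) \<le> 2 * X * idim (W m) + (\<Sum>l\<in>{1-K..K}. l * g.wdim (W m) l)"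
    by (rule g.degree(1)[OF S K(1) GK MK X_def])
  have le': "idim (F p \<inter> W m) \<le> idim (G p \<inter> W m)" for p using le by (simp add: idim_def)
  then have leS: "(\<Sum>p\<in>{1-X..X}. idim (F p \<inter> W m)) \<le> (\<Sum>p\<in>{1-X..X}. idim (G p \<inter> W m))" by (intro sum_mono)
  then have eqS: "(\<Sum>p\<in>{1-X..X}. idim (F p \<inter> W m)) = (\<Sum>p\<in>{1-X..X}. idim (G p \<inter> W m))" using leG eqF' by simp
  then show "sub_mhs G M (W m)" using g.degree(2)[OF S K(1) GK MK X_def] eqF' by simp
  have "(\<Sum>p\<in>{1-X..X}. idim (G p \<inter> W m) - idim (F p \<inter> W m)) = 0" using eqS by (simp add: sum_subtractf)
  then have "\<forall>p\<in>{1-X..X}. idim (G p \<inter> W m) - idim (F p \<inter> W m) = 0"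
    by (subst (asm) sum_nonneg_eq_0_iff) (use le' in auto)
  moreover have "F p = G p" if "p \<notin> {1-X..X}"
  proof (cases "p \<le> -K")
    case True
    then show ?thesis using FK GK by simp
  next
    case False
    then have "p \<ge> K" using that by (auto simp: X_def)
    then show ?thesis using FK GK by simp
  qed
  ultimately show "vec.dim (F p \<inter> W m) = vec.dim (G p \<inter> W m)"
    by (cases "p \<in> {1-X..X}") (auto simp: idim_def)
qed

section \<open>Completion to sl2-triples\<close>

lemma matrix_add_rdist: "((A::complex^'n^'m) + B) ** C = A ** C + B ** (C::complex^'k^'n)"
  by (simp add: vec_eq_iff matrix_matrix_mult_def sum.distrib distrib_right)

lemma matrix_diff_ldist: "(A::complex^'n^'m) ** (B - C) = A ** B - A ** (C::complex^'k^'n)"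
  by (simp add: vec_eq_iff matrix_matrix_mult_def sum_subtractf right_diff_distrib)

lemma matrix_diff_rdist: "((A::complex^'n^'m) - B) ** C = A ** C - B ** (C::complex^'k^'n)"
  by (simp add: vec_eq_iff matrix_matrix_mult_def sum_subtractf left_diff_distrib)

lemma matrix_scaleR_left: "(c *\<^sub>R (A::complex^'n^'m)) ** B = c *\<^sub>R (A ** (B::complex^'k^'n))"
  by (simp add: vec_eq_iff matrix_matrix_mult_def scaleR_sum_right)

lemma matrix_scaleR_right: "(A::complex^'n^'m) ** (c *\<^sub>R B) = c *\<^sub>R (A ** (B::complex^'k^'n))"
  by (simp add: vec_eq_iff matrix_matrix_mult_def scaleR_sum_right)

lemmas mm_simps = matrix_add_ldistrib matrix_add_rdist matrix_diff_ldist matrix_diff_rdist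
  matrix_scaleR_left matrix_scaleR_right

lemma mbr_0 [simp]: "mbr A 0 = 0" "mbr 0 A = 0"
  by (simp_all add: mbr_def)

lemma mbr_add: "mbr A (B + C) = mbr A B + mbr A C"
  by (simp add: mbr_def mm_simps)

lemma mbr_scaleR: "mbr A (c *\<^sub>R B) = c *\<^sub>R mbr A B" "mbr (c *\<^sub>R A) B = c *\<^sub>R mbr A B"
  by (simp_all add: mbr_def mm_simps scaleR_diff_right)

lemma mbr_uminus: "mbr (- A) B = - mbr A B" "mbr A (- B) = - mbr A B"
  using mbr_scaleR(1)[of A "-1" B] mbr_scaleR(2)[of "-1" A B] by simp_all

lemma mbr_anticomm: "mbr A B = - mbr B A"
  by (simp add: mbr_def)

lemma mbr_jacobi: "mbr A (mbr B C) = mbr (mbr A B) C + mbr B (mbr A C)"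
  by (simp add: mbr_def mm_simps matrix_mul_assoc)

lemma mbr_diff_right: "mbr A (B - C) = mbr A B - mbr A C"
  by (simp add: mbr_def mm_simps)

text \<open>Lowering \<open>v\<close> repeatedly gives w_j with [e, w_(j+1)] = (j+1)(c-j) w_j, whose
  coefficients never vanish for c < 0. The w_j cannot all be nonzero, being eigenvectors of ad H
  with unbounded eigenvalues; one zero propagates back to \<open>v\<close>.\<close>

lemma highest_weight_nonneg:
  fixes e H f v :: "complex^'n::finite^'n" and c :: real
  assumes He: "mbr H e = 2 *\<^sub>R e" and Hf: "mbr H f = (-2) *\<^sub>R f" and ef: "mbr e f = H"
    and ev: "mbr e v = 0" and Hv: "mbr H v = c *\<^sub>R v" and c: "c < 0"
  shows "v = 0"
proof -
  define w where "w = (\<lambda>j. (mbr f ^^ j) v)"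
  have w0: "w 0 = v" and wS: "w (Suc j) = mbr f (w j)" for j by (simp_all add: w_def)
  have Hw: "mbr H (w j) = (c - 2 * real j) *\<^sub>R w j" for j
  proof (induction j)
    case (Suc j)
    have "mbr H (w (Suc j)) = mbr ((-2) *\<^sub>R f) (w j) + mbr f ((c - 2 * real j) *\<^sub>R w j)"
      unfolding wS mbr_jacobi[of H f] Hf Suc ..
    also have "\<dots> = (c - 2 * real (Suc j)) *\<^sub>R w (Suc j)"
      by (simp only: mbr_scaleR wS scaleR_add_left[symmetric]) simp
    finally show ?case .
  qed (simp add: w0 Hv)
  have ew: "mbr e (w (Suc j)) = ((real j + 1) * (c - real j)) *\<^sub>R w j" for j
  proof (induction j)
    case 0
    then show ?case using mbr_jacobi[of e f v] by (simp add: wS w0 ev ef Hv)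
  next
    case (Suc j)
    have "mbr e (w (Suc (Suc j))) = mbr H (w (Suc j)) + mbr f (((real j + 1) * (c - real j)) *\<^sub>R w j)"
      unfolding wS[of "Suc j"] mbr_jacobi[of e f] ef Suc ..
    also have "\<dots> = ((c - 2 * real (Suc j)) + (real j + 1) * (c - real j)) *\<^sub>R w (Suc j)"
      by (simp only: Hw mbr_scaleR wS[symmetric] scaleR_add_left[symmetric])
    also have "(c - 2 * real (Suc j)) + (real j + 1) * (c - real j) = (real (Suc j) + 1) * (c - real (Suc j))"
      by (simp add: algebra_simps)
    finally show ?case .
  qed
  have "linear (mbr H)" by (rule linearI) (simp_all add: mbr_add mbr_scaleR)
  then obtain C where C: "\<And>X. norm (mbr H X) \<le> C * norm X" using linear_bounded by blast
  obtain j where j: "real j > \<bar>C\<bar>" using reals_Archimedean2 by blast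
  have "w j = 0"
  proof (rule ccontr)
    assume nz: "w j \<noteq> 0"
    have "\<bar>c - 2 * real j\<bar> * norm (w j) \<le> C * norm (w j)" using C[of "w j"] by (simp add: Hw)
    then have "\<bar>c - 2 * real j\<bar> \<le> C" using nz by simp
    then show False using c j by linarith
  qed
  moreover have "w j = 0 \<Longrightarrow> v = 0" for j
  proof (induction j)
    case (Suc j)
    have "((real j + 1) * (c - real j)) *\<^sub>R w j = 0" using ew[of j] Suc by simp
    then show ?case using Suc c by auto
  qed (simp add: w0)
  ultimately show ?thesis by blast
qed

section \<open>Trace duality and homogeneous matrices\<close>

lemma trace_mult_expand: "trace (A ** B) = (\<Sum>i\<in>UNIV. \<Sum>j\<in>UNIV. A $ i $ j * B $ j $ i)"
  for A B :: "complex^'n::finite^'n"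
  by (simp add: trace_def matrix_matrix_mult_def)

lemma inner_matrix_trace:
  fixes z w :: "complex^'n::finite^'n"
  shows "inner z w = Re (trace (transpose (mcnj z) ** w))"
proof -
  have "inner z w = (\<Sum>i\<in>UNIV. \<Sum>j\<in>UNIV. Re (cnj (z $ i $ j) * w $ i $ j))"
    by (simp add: inner_vec_def inner_complex_def)
  also have "\<dots> = (\<Sum>j\<in>UNIV. \<Sum>i\<in>UNIV. Re (cnj (z $ i $ j) * w $ i $ j))" by (rule sum.swap)
  also have "\<dots> = Re (trace (transpose (mcnj z) ** w))"
    by (simp add: trace_mult_expand transpose_def mcnj_def)
  finally show ?thesis .
qed

lemma csmult_mult: "csmult c A ** B = csmult c (A ** B)" "A ** csmult c B = csmult c (A ** B)"
  by (simp_all add: vec_eq_iff csmult_def matrix_matrix_mult_def sum_distrib_left mult_ac)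

lemma trace_csmult: "trace (csmult c A) = c * trace A"
  by (simp add: trace_def csmult_def sum_distrib_left)

text \<open>The image of ad N is the annihilator of the centraliser of \<open>N\<close> under the
  trace form. The part \<open>z\<close> of \<open>T\<close> orthogonal to the image has an adjoint
  \<open>?Z\<close> that commutes with \<open>N\<close>, and the pairing of \<open>?Z\<close> with
  \<open>T\<close> is the squared norm of \<open>z\<close>.\<close>

lemma ad_range:
  fixes N T :: "complex^'n::finite^'n"
  assumes T: "\<And>Z. mbr N Z = 0 \<Longrightarrow> trace (Z ** T) = 0"
  shows "\<exists>X. mbr X N = T"
proof -
  let ?S = "range (\<lambda>X. mbr X N)"
  have lin: "linear (\<lambda>X. mbr X N)" by (rule linearI) (simp_all add: mbr_def mm_simps scaleR_diff_right)
  then have span: "span ?S = ?S" by (metis linear_subspace_image span_eq_iff subspace_UNIV)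
  obtain y z where y: "y \<in> ?S" and z: "\<And>w. w \<in> ?S \<Longrightarrow> orthogonal z w" and yz: "T = y + z"
    using orthogonal_subspace_decomp_exists[of ?S T] unfolding span by metis
  let ?Z = "transpose (mcnj z)"
  have orth: "trace (?Z ** mbr X N) = 0" for X
  proof -
    have "Re (trace (?Z ** mbr X N)) = 0"
      using z[of "mbr X N"] by (simp add: orthogonal_def inner_matrix_trace)
    \<comment> \<open>The inner product sees only the real part of the trace. The image is stable
      under multiplication by \<i>, and testing against such multiples yields the imaginary
      part.\<close>
    moreover have "mbr (csmult \<i> X) N = csmult \<i> (mbr X N)"
      by (simp add: mbr_def csmult_mult) (simp add: csmult_def vec_eq_iff algebra_simps)
    then have "csmult \<i> (mbr X N) \<in> ?S" by (metis rangeI)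
    then have "Re (trace (?Z ** csmult \<i> (mbr X N))) = 0"
      using z by (simp add: orthogonal_def inner_matrix_trace)
    then have "Im (trace (?Z ** mbr X N)) = 0" by (simp add: csmult_mult trace_csmult)
    ultimately show ?thesis by (simp add: complex_eq_iff)
  qed
  have "trace (X ** mbr N ?Z) = 0" for X
  proof -
    have "trace (X ** mbr N ?Z) = trace ((X ** N) ** ?Z) - trace (X ** (?Z ** N))"
      by (simp add: mbr_def mm_simps trace_sub matrix_mul_assoc)
    also have "trace ((X ** N) ** ?Z) = trace (?Z ** (X ** N))" by (rule trace_mul_sym)
    also have "trace (X ** (?Z ** N)) = trace (?Z ** (N ** X))"
      using trace_mul_sym[of X "?Z ** N"] by (simp add: matrix_mul_assoc)
    finally show ?thesis using orth[of X] by (simp add: mbr_def mm_simps trace_sub)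
  qed
  then have "inner (mbr N ?Z) (mbr N ?Z) = 0" by (simp add: inner_matrix_trace)
  then have "mbr N ?Z = 0" by simp
  then have "trace (?Z ** T) = 0" by (rule T)
  moreover have "trace (?Z ** y) = 0" using y orth by auto
  ultimately have "inner z z = 0" by (simp add: inner_matrix_trace yz matrix_add_ldistrib trace_add)
  then show ?thesis using y yz by auto
qed

text \<open>Degrees lie in any abelian group, so that one notion covers single labels, the weight
  \<open>h\<close> and the whole triple of labels. The entry in row \<open>k\<close> and column
  \<open>i\<close> maps label \<open>i\<close> to label \<open>k\<close>.\<close>

definition hom_deg :: "('n \<Rightarrow> 'a::ab_group_add) \<Rightarrow> 'a \<Rightarrow> complex^'n::finite^'n \<Rightarrow> bool" where
  "hom_deg d \<delta> A \<longleftrightarrow> (\<forall>k i. A $ k $ i \<noteq> 0 \<longrightarrow> d k = d i + \<delta>)"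

definition hom_part :: "('n \<Rightarrow> 'a::ab_group_add) \<Rightarrow> 'a \<Rightarrow> complex^'n::finite^'n \<Rightarrow> complex^'n^'n" where
  "hom_part d \<delta> A = (\<chi> k i. if d k = d i + \<delta> then A $ k $ i else 0)"

lemma hom_deg_hom_part: "hom_deg d \<delta> (hom_part d \<delta> A)"
  by (simp add: hom_deg_def hom_part_def)

lemma hom_part_id: "hom_deg d \<delta> A \<Longrightarrow> hom_part d \<delta> A = A"
  by (auto simp: hom_deg_def hom_part_def vec_eq_iff)

lemma hom_part_mult_right:
  assumes "hom_deg d \<nu> N"
  shows "hom_part d (\<delta> + \<nu>) (A ** N) = hom_part d \<delta> A ** N"
  unfolding vec_eq_iff
proof (intro allI)
  fix k i
  have t: "(if d k = d i + (\<delta> + \<nu>) then A $ k $ l * N $ l $ i else 0) = hom_part d \<delta> A $ k $ l * N $ l $ i" for l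
  proof (cases "N $ l $ i = 0")
    case False
    then have "d l = d i + \<nu>" using assms by (simp add: hom_deg_def)
    then show ?thesis by (simp add: hom_part_def ac_simps)
  qed simp
  have "hom_part d (\<delta> + \<nu>) (A ** N) $ k $ i = (\<Sum>l\<in>UNIV. if d k = d i + (\<delta> + \<nu>) then A $ k $ l * N $ l $ i else 0)"
    by (simp add: hom_part_def matrix_matrix_mult_def)
  then show "hom_part d (\<delta> + \<nu>) (A ** N) $ k $ i = (hom_part d \<delta> A ** N) $ k $ i"
    unfolding t by (simp add: matrix_matrix_mult_def)
qed

lemma hom_part_mult_left:
  assumes "hom_deg d \<nu> N"
  shows "hom_part d (\<delta> + \<nu>) (N ** A) = N ** hom_part d \<delta> A"
  unfolding vec_eq_iff
proof (intro allI)
  fix k i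
  have t: "(if d k = d i + (\<delta> + \<nu>) then N $ k $ l * A $ l $ i else 0) = N $ k $ l * hom_part d \<delta> A $ l $ i" for l
  proof (cases "N $ k $ l = 0")
    case False
    then have "d k = d l + \<nu>" using assms by (simp add: hom_deg_def)
    then show ?thesis by (auto simp: hom_part_def ac_simps)
  qed simp
  have "hom_part d (\<delta> + \<nu>) (N ** A) $ k $ i = (\<Sum>l\<in>UNIV. if d k = d i + (\<delta> + \<nu>) then N $ k $ l * A $ l $ i else 0)"
    by (simp add: hom_part_def matrix_matrix_mult_def)
  then show "hom_part d (\<delta> + \<nu>) (N ** A) $ k $ i = (N ** hom_part d \<delta> A) $ k $ i"
    unfolding t by (simp add: matrix_matrix_mult_def)
qed

lemma hom_part_0: "hom_part d \<delta> 0 = 0"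
  by (simp add: hom_part_def vec_eq_iff)

lemma hom_part_diff: "hom_part d \<delta> (A - B) = hom_part d \<delta> A - hom_part d \<delta> B"
  by (simp add: hom_part_def vec_eq_iff)

lemma hom_part_mbr:
  assumes "hom_deg d \<nu> N"
  shows "hom_part d (\<delta> + \<nu>) (mbr A N) = mbr (hom_part d \<delta> A) N"
    and "hom_part d (\<delta> + \<nu>) (mbr N A) = mbr N (hom_part d \<delta> A)"
  by (simp_all add: mbr_def hom_part_diff hom_part_mult_left[OF assms] hom_part_mult_right[OF assms])

lemma hom_deg_mult: "hom_deg d a A \<Longrightarrow> hom_deg d b B \<Longrightarrow> hom_deg d (a + b) (A ** B)"
  unfolding hom_deg_def
proof (intro allI impI)
  fix k i assume A: "\<forall>k i. A $ k $ i \<noteq> 0 \<longrightarrow> d k = d i + a" and B: "\<forall>k i. B $ k $ i \<noteq> 0 \<longrightarrow> d k = d i + b"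
    and "(A ** B) $ k $ i \<noteq> 0"
  then obtain l where "A $ k $ l * B $ l $ i \<noteq> 0" unfolding matrix_matrix_mult_def by (force elim: sum.not_neutral_contains_not_neutral)
  then have "d k = d l + a" "d l = d i + b" using A B by auto
  then show "d k = d i + (a + b)" by (simp add: algebra_simps)
qed

lemma hom_deg_diagm: "hom_deg d 0 (diagm h)"
  by (simp add: hom_deg_def diagm_def)

lemma diagm_mult: "(diagm h ** A) $ k $ i = h k * A $ k $ i" "(A ** diagm h) $ k $ i = A $ k $ i * h i"
  by (simp_all add: diagm_def matrix_matrix_mult_def if_distrib if_distribR cong: if_cong)

lemma mbr_diagm: "mbr (diagm h) A $ k $ i = (h k - h i) * A $ k $ i"
  by (simp add: mbr_def diagm_mult algebra_simps)

lemma trace_hom_part: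
  assumes "hom_deg d \<delta> T"
  shows "trace (hom_part d (- \<delta>) Z ** T) = trace (Z ** T)"
proof -
  have t: "hom_part d (- \<delta>) Z $ i $ j * T $ j $ i = Z $ i $ j * T $ j $ i" for i j
  proof (cases "T $ j $ i = 0")
    case False
    then have "d j = d i + \<delta>" using assms by (simp add: hom_deg_def)
    then show ?thesis by (simp add: hom_part_def)
  qed simp
  show ?thesis unfolding trace_mult_expand t ..
qed

text \<open>To be read with \<open>D\<close> and \<open>E\<close> as projections onto two spaces
  that \<open>P\<close> identifies, \<open>R\<close> being the inverse identification. As
  \<open>Z\<close> commutes with \<open>P\<close> and \<open>D\<close>, cyclicity of the trace moves
  it from one space to the other.\<close>

lemma trace_reflect:
  fixes Z P R D E :: "complex^'n::finite^'n"
  assumes "Z ** P = P ** Z" "Z ** D = D ** Z" "P ** R = E" "D ** R = R" "R ** (P ** D) = D"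
  shows "trace (Z ** D) = trace (Z ** E)"
proof -
  have "trace (Z ** D) = trace ((Z ** R) ** (P ** D))" using assms(5) by (simp flip: matrix_mul_assoc)
  also have "\<dots> = trace ((P ** D) ** (Z ** R))" by (rule trace_mul_sym)
  also have "(P ** D) ** (Z ** R) = P ** (D ** Z) ** R" by (simp add: matrix_mul_assoc)
  also have "\<dots> = (P ** Z) ** (D ** R)" by (simp add: matrix_mul_assoc flip: assms(2))
  also have "\<dots> = Z ** E" unfolding assms(4) assms(1)[symmetric] by (simp add: assms(3) flip: matrix_mul_assoc)
  finally show ?thesis .
qed

lemma mpow_commute: "Z ** N = N ** Z \<Longrightarrow> Z ** mpow N n = mpow N n ** Z"
proof (induction n)
  case (Suc n)
  have "Z ** mpow N (Suc n) = (N ** Z) ** mpow N n" using Suc(2) by (simp add: matrix_mul_assoc)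
  also have "\<dots> = mpow N (Suc n) ** Z" using Suc by (simp flip: matrix_mul_assoc)
  finally show ?case .
qed simp

lemma mpow_hom_deg: "hom_deg d a N \<Longrightarrow> hom_deg d (of_nat n * a) (mpow N n)" for a :: int
proof (induction n)
  case 0
  then show ?case by (simp add: hom_deg_def mat_def)
next
  case (Suc n)
  then show ?case using hom_deg_mult[of d a N "of_nat n * a" "mpow N n"] by (simp add: algebra_simps)
qed

text \<open>Powers of N identify the weight spaces h = s and h = -s compatibly with Z, so their
  contributions to the trace cancel.\<close>

lemma trace_weight_symmetric:
  fixes N Z :: "complex^'n::finite^'n" and h :: "'n \<Rightarrow> int"
  assumes N: "hom_deg h (-2) N"
    and inj: "\<And>s x. (\<And>i. h i \<noteq> int s \<Longrightarrow> x $ i = 0) \<Longrightarrow> mpow N s *v x = 0 \<Longrightarrow> x = 0"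
    and surj: "\<And>s i. h i = - int s \<Longrightarrow> \<exists>x. (\<forall>k. h k \<noteq> int s \<longrightarrow> x $ k = 0) \<and> mpow N s *v x = axis i 1"
    and Z: "mbr N Z = 0"
  shows "trace (Z ** diagm (\<lambda>i. of_int (h i))) = 0"
proof -
  \<comment> \<open>Only the degree zero part of \<open>Z\<close> pairs with a diagonal matrix, and
    it still commutes with \<open>N\<close> because \<open>N\<close> is homogeneous.\<close>
  define Y where "Y = hom_part h 0 Z"
  have Yh: "hom_deg h 0 Y" unfolding Y_def by (rule hom_deg_hom_part)
  have "mbr N Y = hom_part h (0 + -2) (mbr N Z)" unfolding Y_def by (rule hom_part_mbr(2)[OF N, symmetric])
  also have "\<dots> = 0" unfolding Z by (rule hom_part_0)
  finally have "mbr N Y = 0" .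
  then have YN: "Y ** N = N ** Y" by (simp add: mbr_def)
  define I where "I = (\<lambda>s. diagm (\<lambda>i. if h i = s then 1 else (0::complex)))"
  define t where "t = (\<lambda>s. trace (Y ** I s))"
  have sym: "t (int s) = t (- int s)" for s
  proof -
    let ?P = "mpow N s"
    have P: "hom_deg h (- 2 * int s) ?P" using mpow_hom_deg[OF N, of s] by (simp add: algebra_simps)
    obtain X where X: "\<And>i k. h i = - int s \<Longrightarrow> h k \<noteq> int s \<Longrightarrow> X i $ k = 0"
      "\<And>i. h i = - int s \<Longrightarrow> ?P *v X i = axis i 1" using surj[of _ s] by metis
    \<comment> \<open>Inverts N^s on the weight space h = -s, with values in the weight space h =
      s.\<close>
    define R where "R = (\<chi> k i. if h i = - int s then X i $ k else 0)"
    have R1: "?P ** R = I (- int s)"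
    proof -
      have "(?P ** R) $ k $ i = I (- int s) $ k $ i" for k i
      proof (cases "h i = - int s")
        case True
        have "(?P ** R) $ k $ i = (?P *v X i) $ k" by (simp add: matrix_matrix_mult_def matrix_vector_mult_def R_def True)
        then show ?thesis using X(2)[OF True] True by (auto simp: axis_def I_def diagm_def)
      next
        case False
        then show ?thesis by (simp add: matrix_matrix_mult_def R_def I_def diagm_def)
      qed
      then show ?thesis by (simp add: vec_eq_iff)
    qed
    have R2: "I (int s) ** R = R" using X(1) by (auto simp: vec_eq_iff I_def diagm_mult R_def)
    have PD: "I (- int s) ** (?P ** I (int s)) = ?P ** I (int s)"
    proof -
      have "?P $ k $ i = 0" if "h i = int s" "h k \<noteq> - int s" for k i
        using P that unfolding hom_deg_def by force
      then show ?thesis by (auto simp: vec_eq_iff I_def diagm_mult)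
    qed
    have R3: "R ** (?P ** I (int s)) = I (int s)"
    proof -
      \<comment> \<open>The defect takes values in weight \<open>s\<close> and is killed by N^s, so
        injectivity makes it zero.\<close>
      let ?E = "R ** (?P ** I (int s)) - I (int s)"
      have E1: "?P ** ?E = 0" using PD R1 by (simp add: mm_simps matrix_mul_assoc)
      have "I (int s) ** I (int s) = I (int s)" by (auto simp: vec_eq_iff I_def diagm_mult) (simp add: diagm_def)
      then have E2: "I (int s) ** ?E = ?E" using R2 by (simp add: mm_simps matrix_mul_assoc)
      have "column i ?E = 0" for i
      proof (rule inj[of s])
        fix k assume "h k \<noteq> int s"
        then show "column i ?E $ k = 0" using arg_cong[OF E2, of "\<lambda>A. A $ k $ i"] by (simp add: column_def I_def diagm_mult)
      next
        have "?P *v column i ?E = column i (?P ** ?E)" by (simp add: vec_eq_iff column_def matrix_vector_mult_def matrix_matrix_mult_def)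
        then show "?P *v column i ?E = 0" by (simp add: E1) (simp add: column_def vec_eq_iff)
      qed
      then show ?thesis by (simp add: column_def vec_eq_iff)
    qed
    have YI: "Y ** I (int s) = I (int s) ** Y" using Yh by (auto simp: vec_eq_iff I_def diagm_mult hom_deg_def) metis+
    show ?thesis unfolding t_def
      by (rule trace_reflect[OF mpow_commute[OF YN] YI R1 R2 R3])
  qed
  have symz: "t s = t (- s)" for s
    by (cases "s \<ge> 0") (use sym[of "nat s"] sym[of "nat (- s)"] in auto)
  have "trace (Z ** diagm (\<lambda>i. of_int (h i))) = trace (Y ** diagm (\<lambda>i. of_int (h i)))"
    unfolding Y_def using trace_hom_part[OF hom_deg_diagm, of h Z "\<lambda>i. of_int (h i)"] by simp
  also have "\<dots> = (\<Sum>i\<in>UNIV. of_int (h i) * Y $ i $ i)" by (simp add: trace_def diagm_mult mult.commute)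
  finally have 1: "trace (Z ** diagm (\<lambda>i. of_int (h i))) = (\<Sum>i\<in>UNIV. of_int (h i) * Y $ i $ i)" .
  define A where "A = range h \<union> uminus ` range h"
  have t: "t s = (\<Sum>i | h i = s. Y $ i $ i)" for s
    unfolding t_def trace_def I_def diagm_mult by (rule sum.mono_neutral_cong_right) auto
  have "(\<Sum>i\<in>UNIV. of_int (h i) * Y $ i $ i) = (\<Sum>s\<in>A. \<Sum>i\<in>{i\<in>UNIV. h i = s}. of_int (h i) * Y $ i $ i)"
    by (rule sum.group[symmetric]) (auto simp: A_def)
  also have "\<dots> = (\<Sum>s\<in>A. of_int s * t s)" by (rule sum.cong) (auto simp: t sum_distrib_left intro!: sum.cong)
  finally have 2: "(\<Sum>i\<in>UNIV. of_int (h i) * Y $ i $ i) = (\<Sum>s\<in>A. of_int s * t s)" .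
  have "(\<Sum>s\<in>A. of_int s * t s) = (\<Sum>s\<in>A. - (of_int s * t s))"
  proof (rule sum.reindex_bij_witness[of _ uminus uminus])
    fix s
    show "- (of_int (- s) * t (- s)) = of_int s * t s" using symz[of s] by simp
  qed (auto simp: A_def)
  then have "(\<Sum>s\<in>A. of_int s * t s) = - (\<Sum>s\<in>A. of_int s * t s)" by (simp add: sum_negf)
  then have "(\<Sum>s\<in>A. of_int s * t s) = 0" by simp
  then show ?thesis using 1 2 by simp
qed

text \<open>The last two hypotheses are the hard Lefschetz property of \<open>N\<close> for
  \<open>h\<close>. They make the diagonal matrix H of \<open>h\<close> pair to zero with the
  centraliser of \<open>N\<close>, so [X,N] = H is solvable by trace duality. Keeping only the part
  of degree opposite to \<open>N\<close> makes the solution homogeneous for the finer degree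
  \<open>d\<close> as well.\<close>

lemma sl2_completion:
  fixes N :: "complex^'n::finite^'n" and d :: "'n \<Rightarrow> 'a::ab_group_add" and h :: "'n \<Rightarrow> int"
  assumes Nd: "hom_deg d \<nu> N" and N: "hom_deg h (-2) N"
    and inj: "\<And>s x. (\<And>i. h i \<noteq> int s \<Longrightarrow> x $ i = 0) \<Longrightarrow> mpow N s *v x = 0 \<Longrightarrow> x = 0"
    and surj: "\<And>s i. h i = - int s \<Longrightarrow> \<exists>x. (\<forall>k. h k \<noteq> int s \<longrightarrow> x $ k = 0) \<and> mpow N s *v x = axis i 1"
  shows "\<exists>E. hom_deg d (- \<nu>) E \<and> mbr E N = diagm (\<lambda>i. of_int (h i))"
proof -
  have "trace (Z ** diagm (\<lambda>i. of_int (h i))) = 0" if Z: "mbr N Z = 0" for Z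
  proof (rule trace_weight_symmetric[OF N])
    fix s x assume "\<And>i. h i \<noteq> int s \<Longrightarrow> x $ i = 0" "mpow N s *v x = 0"
    then show "x = 0" by (rule inj)
  next
    fix s i assume "h i = - int s"
    then show "\<exists>x. (\<forall>k. h k \<noteq> int s \<longrightarrow> x $ k = 0) \<and> mpow N s *v x = axis i 1" by (rule surj)
  qed (rule Z)
  then obtain X where X: "mbr X N = diagm (\<lambda>i. of_int (h i))"
    using ad_range[of N "diagm (\<lambda>i. of_int (h i))"] by blast
  have "mbr (hom_part d (- \<nu>) X) N = hom_part d (- \<nu> + \<nu>) (mbr X N)" by (rule hom_part_mbr(1)[OF Nd, symmetric])
  also have "\<dots> = diagm (\<lambda>i. of_int (h i))" unfolding X by (simp add: hom_part_id[OF hom_deg_diagm])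
  finally show ?thesis using hom_deg_hom_part by blast
qed

text \<open>In the triple with \<open>N\<close> as raising operator and -H in the middle,
  \<open>Z\<close> is a highest weight vector of weight -s < 0.\<close>

lemma sl2_commuting_vanish:
  fixes N E Z :: "complex^'n::finite^'n" and h :: "'n \<Rightarrow> int"
  assumes N: "hom_deg h (-2) N" and E: "hom_deg h 2 E" and EN: "mbr E N = diagm (\<lambda>i. of_int (h i))"
    and Z: "hom_deg h s Z" "s > 0" and NZ: "mbr N Z = 0"
  shows "Z = 0"
proof -
  let ?H = "diagm (\<lambda>i. of_int (h i)) :: complex^'n^'n"
  have wt: "mbr ?H A = (of_int r :: real) *\<^sub>R A" if "hom_deg h r A" for A r
  proof -
    have "mbr ?H A $ k $ i = ((of_int r :: real) *\<^sub>R A) $ k $ i" for k i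
      using that by (cases "A $ k $ i = 0") (auto simp: mbr_diagm hom_deg_def scaleR_conv_of_real[where 'a = complex])
    then show ?thesis by (simp add: vec_eq_iff)
  qed
  show ?thesis
  proof (rule highest_weight_nonneg[of "- ?H" N E Z "- of_int s"])
    show "mbr (- ?H) N = 2 *\<^sub>R N" using wt[OF N] by (simp add: mbr_uminus)
    show "mbr (- ?H) E = (-2) *\<^sub>R E" using wt[OF E] by (simp add: mbr_uminus)
    show "mbr N E = - ?H" using EN mbr_anticomm[of N E] by simp
    show "mbr (- ?H) Z = (- of_int s) *\<^sub>R Z" using wt[OF Z(1)] by (simp add: mbr_uminus)
  qed (use Z NZ in auto)
qed

text \<open>Only elements of the centraliser of degree -\<tau> pair with \<open>T\<close>. They have
  weight 1 for \<open>h\<close> and commute with \<open>N\<close>, hence vanish, so \<open>T\<close>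
  lies in the image of ad N.\<close>

lemma sl2_solve:
  fixes N E T :: "complex^'n::finite^'n" and d :: "'n \<Rightarrow> 'a::ab_group_add" and h :: "'n \<Rightarrow> int"
  assumes Nd: "hom_deg d \<nu> N" and N: "hom_deg h (-2) N" and E: "hom_deg h 2 E" and EN: "mbr E N = diagm (\<lambda>i. of_int (h i))"
    and Td: "hom_deg d \<tau> T" and dh: "\<And>A. hom_deg d (- \<tau>) A \<Longrightarrow> hom_deg h 1 A"
  shows "\<exists>X. hom_deg d (\<tau> - \<nu>) X \<and> mbr X N = T"
proof -
  have "trace (Z ** T) = 0" if Z: "mbr N Z = 0" for Z
  proof -
    have "mbr N (hom_part d (- \<tau>) Z) = hom_part d (- \<tau> + \<nu>) (mbr N Z)" by (rule hom_part_mbr(2)[OF Nd, symmetric])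
    also have "\<dots> = 0" unfolding Z by (rule hom_part_0)
    finally have "hom_part d (- \<tau>) Z = 0"
      by (intro sl2_commuting_vanish[OF N E EN dh[OF hom_deg_hom_part]]) auto
    then show ?thesis using trace_hom_part[OF Td, of Z] by (simp add: trace_def)
  qed
  then obtain X where X: "mbr X N = T" using ad_range by blast
  have "mbr (hom_part d (\<tau> - \<nu>) X) N = hom_part d (\<tau> - \<nu> + \<nu>) (mbr X N)" by (rule hom_part_mbr(1)[OF Nd, symmetric])
  also have "\<dots> = T" unfolding X by (simp add: hom_part_id[OF Td])
  finally show ?thesis using hom_deg_hom_part by blast
qed

lemma matrix_vector_mult_column: "A *v column i B = column i (A ** B)" for A B :: "complex^'n::finite^'n"
  by (simp add: vec_eq_iff column_def matrix_vector_mult_def matrix_matrix_mult_def)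

lemma mat_vec_zero:
  fixes A :: "complex^'n::finite^'n"
  shows "(\<And>l. A $ k $ l * x $ l = 0) \<Longrightarrow> (A *v x) $ k = 0"
  unfolding matrix_vector_mult_def by (simp only: vec_lambda_beta) (rule sum.neutral, blast)

lemma mat_mat_zero:
  fixes A B :: "complex^'n::finite^'n"
  shows "(\<And>l. A $ k $ l * B $ l $ i = 0) \<Longrightarrow> (A ** B) $ k $ i = 0"
  unfolding matrix_matrix_mult_def by (simp only: vec_lambda_beta) (rule sum.neutral, blast)

lemma mat_vec_cong:
  fixes A A' :: "complex^'n::finite^'n"
  shows "(\<And>l. A $ k $ l * x $ l = A' $ k $ l * x' $ l) \<Longrightarrow> (A *v x) $ k = (A' *v x') $ k"
  unfolding matrix_vector_mult_def by (simp only: vec_lambda_beta)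

section \<open>The grading of the limit mixed Hodge structure\<close>

locale limit_mhs = mhs_basis G M B p q for G M :: "'n::finite filt" and B p q +
  fixes W :: "'n filt" and N :: "complex^'n^'n" and j :: "'n \<Rightarrow> int"
  assumes filtW0: "incr_filt W" and cnjW0: "\<And>k v. v \<in> W k \<Longrightarrow> vcnj v \<in> W k"
    and W0_eq: "\<And>m. W m = coord_span B (\<lambda>i. j i \<le> m)"
    and Nreal: "real_matrix N" and NW: "\<And>k v. v \<in> W k \<Longrightarrow> N *v v \<in> W k"
    and NG: "\<And>a v. v \<in> G a \<Longrightarrow> N *v v \<in> G (a - 1)"
    and rel: "rel_weight_filt N W M"
begin

lemmas sW0 = incr_filt_subspace[OF filtW0]
lemmas monoW0 = subsetD[OF incr_filt_mono[OF filtW0]]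

lemma NM: "v \<in> M k \<Longrightarrow> N *v v \<in> M (k - 2)"
  using rel by (auto simp: rel_weight_filt_def)

definition co :: "complex^'n^'n \<Rightarrow> complex^'n^'n" where "co A = Bi ** A ** B"
definition un :: "complex^'n^'n \<Rightarrow> complex^'n^'n" where "un A = B ** A ** Bi"

lemmas BiB [simp] = matrix_inv_mult[OF inv]

lemma co_un [simp]: "co (un A) = A"
proof -
  have "co (un A) = (Bi ** B) ** A ** (Bi ** B)" by (simp only: co_def un_def matrix_mul_assoc)
  then show ?thesis by simp
qed

lemma un_co [simp]: "un (co A) = A"
proof -
  have "un (co A) = (B ** Bi) ** A ** (B ** Bi)" by (simp only: co_def un_def matrix_mul_assoc)
  then show ?thesis by simp
qed

lemma co_mult: "co (X ** Y) = co X ** co Y"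
proof -
  have "co X ** co Y = Bi ** X ** (B ** Bi) ** Y ** B" by (simp only: co_def matrix_mul_assoc)
  then show ?thesis by (simp add: co_def matrix_mul_assoc)
qed

lemma un_mult: "un (X ** Y) = un X ** un Y"
  by (metis co_mult co_un un_co)

lemma co_diff: "co (X - Y) = co X - co Y"
  by (simp add: co_def mm_simps)

lemma un_diff: "un (X - Y) = un X - un Y"
  by (simp add: un_def mm_simps)

lemma un_add: "un (X + Y) = un X + un Y"
  by (simp add: un_def mm_simps)

lemma un_scaleR: "un (c *\<^sub>R X) = c *\<^sub>R un X"
  by (simp add: un_def mm_simps)

lemma un_0 [simp]: "un 0 = 0"
  by (simp add: un_def)

lemma co_0 [simp]: "co 0 = 0"
  by (simp add: co_def)

lemma co_mbr: "co (mbr X Y) = mbr (co X) (co Y)"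
  by (simp add: mbr_def co_diff co_mult)

lemma un_mbr: "mbr (un X) (un Y) = un (mbr X Y)"
  by (simp add: mbr_def un_diff un_mult)

lemma co_vec: "Bi *v (A *v v) = co A *v (Bi *v v)"
proof -
  have "co A ** Bi = Bi ** A ** (B ** Bi)" by (simp only: co_def matrix_mul_assoc)
  then show ?thesis by (simp add: matrix_vector_mul_assoc)
qed

lemma un_vec: "Bi *v (un A *v v) = A *v (Bi *v v)"
  by (simp add: co_vec)

lemma Bi_column: "Bi *v column i B = axis i 1"
  by (simp flip: matrix_vector_mult_axis)

lemma co_entry: "(Bi *v (A *v column i B)) $ k = co A $ k $ i"
  by (simp add: co_vec Bi_column matrix_vector_mult_axis) (simp add: column_def)

lemma col_W: "column i B \<in> W (j i)"
  unfolding W0_eq by (rule column_in_coord_span) simp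

definition n :: "complex^'n^'n" where "n = co N"

text \<open>\<open>N\<close> is a morphism of type (-1,-1) of the limit structure, so it shifts
  \<open>p\<close> and \<open>q\<close> exactly; \<open>W\<close> it merely preserves.\<close>

lemma n_entry: "n $ k $ i \<noteq> 0 \<Longrightarrow> p k = p i - 1 \<and> q k = q i - 1 \<and> j k \<le> j i"
proof -
  assume nz: "n $ k $ i \<noteq> 0"
  have "N *v column i B \<in> D (p i - 1) (q i - 1)"
    by (rule deligne_piece_morphism[OF Nreal NG NM col])
  then have "p k = p i - 1 \<and> q k = q i - 1"
    using nz unfolding D_eq cs_iff n_def co_entry by blast
  moreover have "N *v column i B \<in> W (j i)" by (rule NW[OF col_W])
  then have "j k \<le> j i" using nz unfolding W0_eq cs_iff n_def co_entry by blast
  ultimately show ?thesis by blast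
qed

definition n0 :: "complex^'n^'n" where "n0 = hom_part j 0 n"
text \<open>The eigenvalues of rY - Y once Y is diag(j), that is, the weights of the
  sl2-triple.\<close>

definition h :: "'n \<Rightarrow> int" where "h i = p i + q i - j i"
definition d :: "'n \<Rightarrow> int \<times> int \<times> int" where "d i = (p i, q i, j i)"

lemma n0_entry: "n0 $ k $ i \<noteq> 0 \<Longrightarrow> p k = p i - 1 \<and> q k = q i - 1 \<and> j k = j i"
  using n_entry[of k i] by (auto simp: n0_def hom_part_def split: if_splits)

lemma n0_d: "hom_deg d (-1, -1, 0) n0"
  unfolding hom_deg_def d_def using n0_entry by auto

lemma n0_h: "hom_deg h (-2) n0"
  unfolding hom_deg_def h_def using n0_entry by auto

lemma n0_j: "hom_deg j 0 n0"
  unfolding n0_def by (rule hom_deg_hom_part)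

lemma n0_pow_j: "mpow n0 s $ k $ i \<noteq> 0 \<Longrightarrow> j k = j i"
  using mpow_hom_deg[OF n0_j, of s] by (auto simp: hom_deg_def)

lemma n0_pow_h: "mpow n0 s $ k $ i \<noteq> 0 \<Longrightarrow> h k = h i - 2 * int s"
  using mpow_hom_deg[OF n0_h, of s] unfolding hom_deg_def by fastforce

text \<open>As \<open>n\<close> never raises \<open>j\<close>, a path between equal
  \<open>j\<close>-labels uses entries of \<open>n0\<close> only. So powers of \<open>n0\<close> are
  the powers of the map that \<open>N\<close> induces on the graded pieces of
  \<open>W\<close>.\<close>

lemma n_pow:
  "(mpow n s $ k $ i \<noteq> 0 \<longrightarrow> p k + q k = p i + q i - 2 * int s \<and> j k \<le> j i) \<and>
   (j k = j i \<longrightarrow> mpow n s $ k $ i = mpow n0 s $ k $ i)"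
proof (induction s arbitrary: k i)
  case 0
  then show ?case by (simp add: mat_def)
next
  case (Suc s)
  have e: "mpow n (Suc s) $ k $ i = (\<Sum>l\<in>UNIV. n $ k $ l * mpow n s $ l $ i)"
    "mpow n0 (Suc s) $ k $ i = (\<Sum>l\<in>UNIV. n0 $ k $ l * mpow n0 s $ l $ i)"
    by (simp_all add: matrix_matrix_mult_def)
  have "p k + q k = p i + q i - 2 * int (Suc s) \<and> j k \<le> j i" if nz: "mpow n (Suc s) $ k $ i \<noteq> 0"
  proof -
    obtain l where "n $ k $ l * mpow n s $ l $ i \<noteq> 0"
      using nz mat_mat_zero[of n k "mpow n s" i] by auto
    then show ?thesis using n_entry[of k l] Suc[of l i] by auto
  qed
  moreover have "n $ k $ l * mpow n s $ l $ i = n0 $ k $ l * mpow n0 s $ l $ i" if ki: "j k = j i" for l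
  proof (cases "n $ k $ l * mpow n s $ l $ i = 0")
    case True
    show ?thesis
    proof (cases "j l = j i")
      case True
      then have "n0 $ k $ l = n $ k $ l" using ki by (simp add: n0_def hom_part_def)
      then show ?thesis using \<open>n $ k $ l * mpow n s $ l $ i = 0\<close> Suc[of l i] True by auto
    next
      case False
      then have "mpow n0 s $ l $ i = 0" using n0_pow_j by blast
      then show ?thesis using True by simp
    qed
  next
    case False
    then have "j k \<le> j l" "j l \<le> j i" using n_entry[of k l] Suc[of l i] by auto
    then have "j l = j i" using ki by simp
    then show ?thesis using ki Suc[of l i] by (simp add: n0_def hom_part_def)
  qed
  ultimately show ?case unfolding e by auto
qed

lemma n_pow_co: "Bi *v (mpow N s *v v) = mpow n s *v (Bi *v v)"
proof (induction s)
  case (Suc s)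
  then show ?case by (simp add: co_vec n_def flip: matrix_vector_mul_assoc)
qed simp

text \<open>Injectivity of N^s on Gr^M_(m+s) Gr^W_m, in coordinates. Since \<open>n0\<close>
  preserves \<open>j\<close>, a vector of weight \<open>s\<close> can be cut down to one level j =
  m, where h = s means p + q = m + s.\<close>

lemma n0_pow_inj:
  assumes x: "\<And>i. h i \<noteq> int s \<Longrightarrow> x $ i = 0" and 0: "mpow n0 s *v x = 0"
  shows "x = 0"
proof -
  have "x $ i = 0" for i
  proof (rule ccontr)
    assume nz: "x $ i \<noteq> 0"
    define m where "m = j i"
    have hi: "p i + q i = m + int s" using x[of i] nz unfolding h_def m_def by fastforce
    define y where "y = (\<chi> k. if j k = m then x $ k else 0)"
    define v where "v = B *v y"
    have By: "Bi *v v = y" by (simp add: v_def)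
    have hy: "p k + q k = m + int s \<and> j k = m" if "y $ k \<noteq> 0" for k
    proof -
      have "j k = m" "x $ k \<noteq> 0" using that by (auto simp: y_def split: if_splits)
      then show ?thesis using x[of k] unfolding h_def by fastforce
    qed
    have "v \<in> M (m + int s) \<inter> W m" unfolding W_eq W0_eq cs_iff Int_iff By using hy by force
    then have vA: "v \<in> splus (M (m + int s) \<inter> W m) (W (m - 1))"
      unfolding splus_def using vec.subspace_0[OF sW0] by (intro CollectI exI[of _ v] exI[of _ 0]) auto
    have "(mpow n s *v y) $ k = 0" if "\<not> j k \<le> m - 1" for k
    proof (cases "j k = m")
      case True
      have "mpow n s $ k $ l * y $ l = mpow n0 s $ k $ l * x $ l" for l
      proof (cases "j l = m")
        case T: True
        then show ?thesis using n_pow[of s k l] True by (simp add: y_def)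
      next
        case False
        then have "mpow n0 s $ k $ l = 0" using n0_pow_j[of s k l] True by metis
        then show ?thesis using False by (simp add: y_def)
      qed
      then have "(mpow n s *v y) $ k = (mpow n0 s *v x) $ k" by (rule mat_vec_cong)
      then show ?thesis using 0 by simp
    next
      case False
      have "mpow n s $ k $ l * y $ l = 0" for l
        using n_pow[of s k l] hy[of l] False that by force
      then show ?thesis by (rule mat_vec_zero)
    qed
    then have Nv: "mpow N s *v v \<in> W (m - 1)" unfolding W0_eq cs_iff n_pow_co By by blast
    have "mpow N s *v v \<in> splus (M (m - int s - 1) \<inter> W m) (W (m - 1))"
      unfolding splus_def using Nv vec.subspace_0[OF sW] vec.subspace_0[OF sW0]
      by (intro CollectI exI[of _ 0] exI[of _ "mpow N s *v v"]) auto
    then have "v \<in> splus (M (m + int s - 1) \<inter> W m) (W (m - 1))"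
      using rel vA unfolding rel_weight_filt_def Let_def by blast
    then obtain a b where ab: "v = a + b" "a \<in> M (m + int s - 1)" "b \<in> W (m - 1)" unfolding splus_def by blast
    have "(Bi *v a) $ i = 0" using ab(2) hi unfolding W_eq cs_iff by auto
    moreover have "(Bi *v b) $ i = 0" using ab(3) m_def unfolding W0_eq cs_iff by auto
    ultimately have "y $ i = 0" using By ab(1) by (metis add.right_neutral matrix_vector_right_distrib vector_add_component)
    then show False using nz by (simp add: y_def m_def)
  qed
  then show ?thesis by (simp add: vec_eq_iff)
qed

text \<open>Surjectivity of N^s onto Gr^M_(m-s) Gr^W_m. The preimage provided by the relative weight
  filtration is truncated to the labels with j = m and p + q = m + s; other coordinates do not reach
  the entries that matter.\<close>

lemma n0_pow_surj:
  assumes i: "h i = - int s"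
  shows "\<exists>x. (\<forall>k. h k \<noteq> int s \<longrightarrow> x $ k = 0) \<and> mpow n0 s *v x = axis i 1"
proof -
  define m where "m = j i"
  have hi: "p i + q i = m - int s" using i by (simp add: h_def m_def)
  let ?w = "column i B"
  have "?w \<in> M (m - int s) \<inter> W m"
    using hi col_W[of i] col[of i] by (auto simp: m_def deligne_piece_def)
  then have "?w \<in> splus (M (m - int s) \<inter> W m) (W (m - 1))"
    unfolding splus_def using vec.subspace_0[OF sW0] by (intro CollectI exI[of _ ?w] exI[of _ 0]) auto
  then obtain v where v: "v \<in> splus (M (m + int s) \<inter> W m) (W (m - 1))"
    and wv: "?w - mpow N s *v v \<in> splus (M (m - int s - 1) \<inter> W m) (W (m - 1))"
    using rel unfolding rel_weight_filt_def Let_def by blast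
  let ?y = "Bi *v v"
  define x where "x = (\<chi> k. if j k = m \<and> p k + q k = m + int s then ?y $ k else 0)"
  have vW: "v \<in> W m"
    using v monoW0[of "m - 1" m] vec.subspace_add[OF sW0] unfolding splus_def by auto
  have y0: "?y $ k = 0" if "j k > m" for k using vW that unfolding W0_eq cs_iff by auto
  obtain a b where ab: "?w - mpow N s *v v = a + b" "a \<in> M (m - int s - 1)" "b \<in> W (m - 1)"
    using wv unfolding splus_def by blast
  have "(mpow n0 s *v x) $ k = axis i 1 $ k" for k
  proof (cases "j k = m \<and> p k + q k = m - int s")
    case True
    have "(Bi *v a) $ k = 0" using ab(2) True unfolding W_eq cs_iff by auto
    moreover have "(Bi *v b) $ k = 0" using ab(3) True unfolding W0_eq cs_iff by auto
    ultimately have "(Bi *v (?w - mpow N s *v v)) $ k = 0" unfolding ab(1) by (simp add: matrix_vector_right_distrib)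
    then have "axis i 1 $ k = (mpow n s *v ?y) $ k"
      by (simp add: matrix_vector_mult_diff_distrib Bi_column n_pow_co)
    also have "\<dots> = (mpow n0 s *v x) $ k"
    proof -
      have "mpow n s $ k $ l * ?y $ l = mpow n0 s $ k $ l * x $ l" for l
      proof (cases "j l = m \<and> p l + q l = m + int s")
        case T: True
        then show ?thesis using n_pow[of s k l] True by (simp add: x_def)
      next
        case F: False
        then have "x $ l = 0" by (simp only: x_def vec_lambda_beta if_False)
        moreover have "mpow n s $ k $ l = 0 \<or> ?y $ l = 0"
          using n_pow[of s k l] True F y0[of l] by force
        ultimately show ?thesis by auto
      qed
      then show ?thesis by (rule mat_vec_cong)
    qed
    finally show ?thesis by simp
  next
    case False
    then have "axis i 1 $ k = (0::complex)" using hi by (auto simp: axis_def m_def)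
    moreover have "mpow n0 s $ k $ l * x $ l = 0" for l
    proof (rule ccontr)
      assume "mpow n0 s $ k $ l * x $ l \<noteq> 0"
      then have nz: "mpow n0 s $ k $ l \<noteq> 0" "x $ l \<noteq> 0" by auto
      have "j l = m \<and> p l + q l = m + int s" using nz(2) by (auto simp: x_def split: if_splits)
      then show False using n0_pow_j[OF nz(1)] n0_pow_h[OF nz(1)] False by (auto simp: h_def)
    qed
    ultimately show ?thesis using mat_vec_zero by metis
  qed
  then show ?thesis by (intro exI[of _ x]) (auto simp: x_def h_def vec_eq_iff)
qed

lemma sl2_exists: "\<exists>E. hom_deg d (1, 1, 0) E \<and> hom_deg h 2 E \<and> mbr E n0 = diagm (\<lambda>i. of_int (h i))"
proof -
  have "\<exists>E. hom_deg d (- (-1, -1, 0)) E \<and> mbr E n0 = diagm (\<lambda>i. of_int (h i))"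
  proof (rule sl2_completion[OF n0_d n0_h])
    fix s x assume "\<And>i. h i \<noteq> int s \<Longrightarrow> x $ i = 0" "mpow n0 s *v x = 0"
    then show "x = 0" by (rule n0_pow_inj)
  qed (rule n0_pow_surj)
  then obtain E where E: "hom_deg d (- (-1, -1, 0)) E" "mbr E n0 = diagm (\<lambda>i. of_int (h i))" by blast
  then have "hom_deg h 2 E" unfolding hom_deg_def d_def h_def by force
  then show ?thesis using E by auto
qed

text \<open>Conjugation by 1 + X changes the part of \<open>n\<close> of \<open>j\<close>-degree -1
  by -[X,n0], so X has to solve [X,n0] = n1. It can be taken of tridegree (0,0,-1); the new columns
  then stay in the same Deligne pieces and in the same steps of \<open>W\<close>, and all labels
  persist.\<close>

lemma basis_without_weight_minus_1:
  "\<exists>B'. limit_mhs G M B' p q W N j \<and> (\<forall>k i. j k = j i - 1 \<longrightarrow> (matrix_inv B' ** N ** B') $ k $ i = 0)"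
proof -
  obtain E where E: "hom_deg d (1, 1, 0) E" "hom_deg h 2 E" "mbr E n0 = diagm (\<lambda>i. of_int (h i))"
    using sl2_exists by blast
  define n1 where "n1 = hom_part j (-1) n"
  have n1: "hom_deg d (-1, -1, -1) n1"
    unfolding hom_deg_def d_def n1_def hom_part_def using n_entry by auto
  \<comment> \<open>The tridegree opposite to that of \<open>n1\<close> is (1,1,1), on which h = p +
    q - j equals 1.\<close>
  have "hom_deg h 1 A" if "hom_deg d (- (-1, -1, -1)) A" for A
    using that unfolding hom_deg_def d_def h_def by force
  then obtain X where X: "hom_deg d ((-1, -1, -1) - (-1, -1, 0)) X" "mbr X n0 = n1"
    using sl2_solve[OF n0_d n0_h E(2,3) n1] by blast
  have Xe: "p k = p i \<and> q k = q i \<and> j k = j i - 1" if "X $ k $ i \<noteq> 0" for k i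
    using X(1) that unfolding hom_deg_def d_def by force
  have ker: "x = 0" if "(mat 1 + X) *v x = 0" for x
  proof (rule ccontr)
    assume "x \<noteq> 0"
    then have ne: "j ` {i. x $ i \<noteq> 0} \<noteq> {}" by (auto simp: vec_eq_iff)
    define J where "J = Max (j ` {i. x $ i \<noteq> 0})"
    have "J \<in> j ` {i. x $ i \<noteq> 0}" unfolding J_def using ne by (intro Max_in) auto
    then obtain k where k: "x $ k \<noteq> 0" "j k = J" by auto
    have "X $ k $ l * x $ l = 0" for l
    proof (cases "X $ k $ l = 0")
      case False
      then have "j l = J + 1" using Xe[of k l] k by simp
      then have "x $ l = 0" unfolding J_def by (metis (mono_tags, lifting) Max_ge finite finite_imageI imageI mem_Collect_eq not_less less_add_one)
      then show ?thesis by simp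
    qed simp
    then have "(X *v x) $ k = 0" by (rule mat_vec_zero)
    moreover have "((mat 1 + X) *v x) $ k = 0" using that by simp
    ultimately show False using k by (simp add: matrix_vector_mult_add_rdistrib)
  qed
  have invX: "invertible (mat 1 + X)"
    using ker matrix_left_invertible_ker[of "mat 1 + X"] by (auto simp: invertible_left_inverse)
  define B' where "B' = B ** (mat 1 + X)"
  have inv': "invertible B'" unfolding B'_def by (rule invertible_mult[OF inv invX])
  have col': "column i B' = column i B + B *v column i X" for i
    by (simp add: B'_def matrix_add_ldistrib matrix_vector_mult_column) (simp add: vec_eq_iff column_def)
  have BX: "B *v column i X \<in> coord_span B (\<lambda>k. p k = p i \<and> q k = q i \<and> j k = j i - 1)" for i
    unfolding cs_iff using Xe[of _ i] by (auto simp: column_def)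
  have D': "column i B' \<in> D (p i) (q i)" for i
  proof -
    have "coord_span B (\<lambda>k. p k = p i \<and> q k = q i \<and> j k = j i - 1) \<subseteq> D (p i) (q i)"
      unfolding D_eq by (rule coord_span_mono) simp
    then show ?thesis unfolding col' using BX col vec.subspace_add[OF sD] by blast
  qed
  have W'': "column i B' \<in> W (j i)" for i
  proof -
    have "coord_span B (\<lambda>k. p k = p i \<and> q k = q i \<and> j k = j i - 1) \<subseteq> W (j i)"
      unfolding W0_eq by (rule coord_span_mono) simp
    then show ?thesis unfolding col' using BX col_W vec.subspace_add[OF sW0] by blast
  qed
  have W': "W m = coord_span B' (\<lambda>i. j i \<le> m)" for m
  proof -
    have "coord_span B' (\<lambda>i. j i \<le> m) \<subseteq> W m"
      by (rule coord_span_minimal[OF sW0]) (use W'' monoW0 in blast)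
    moreover have "vec.dim (coord_span B' (\<lambda>i. j i \<le> m)) = vec.dim (W m)"
      unfolding W0_eq dim_coord_span[OF inv] dim_coord_span[OF inv'] ..
    ultimately show ?thesis
      using vec.subspace_dim_equal[OF subspace_coord_span sW0] by (metis order_refl)
  qed
  have L: "limit_mhs G M B' p q W N j"
    by unfold_locales (use inv' D' filtW0 cnjW0 W' Nreal NW NG rel in auto)
  interpret l: limit_mhs G M B' p q W N j by (rule L)
  have "B ** ((mat 1 + X) ** l.n) = B' ** matrix_inv B' ** N ** B'"
    by (simp only: B'_def[symmetric] l.n_def l.co_def matrix_mul_assoc)
  also have "\<dots> = N ** B'" using matrix_inv_mult(2)[OF inv'] by simp
  also have "\<dots> = N ** B ** (mat 1 + X)" by (simp only: B'_def matrix_mul_assoc)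
  also have "\<dots> = B ** (n ** (mat 1 + X))"
  proof -
    have "B ** n = (B ** Bi) ** N ** B" by (simp only: n_def co_def matrix_mul_assoc)
    then show ?thesis by (simp add: matrix_mul_assoc)
  qed
  finally have "Bi ** (B ** ((mat 1 + X) ** l.n)) = Bi ** (B ** (n ** (mat 1 + X)))" by simp
  then have eq: "(mat 1 + X) ** l.n = n ** (mat 1 + X)" by (simp add: matrix_mul_assoc)
  \<comment> \<open>To be compared in \<open>j\<close>-degree 0, where \<open>n\<close> does not
    change, and in \<open>j\<close>-degree -1, where only \<open>n0\<close> meets
    \<open>X\<close>.\<close>
  have ent: "l.n $ k $ i + (\<Sum>m\<in>UNIV. X $ k $ m * l.n $ m $ i) = n $ k $ i + (\<Sum>m\<in>UNIV. n $ k $ m * X $ m $ i)" for k i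
    using arg_cong[OF eq, of "\<lambda>A. A $ k $ i"] by (simp add: mm_simps) (simp add: matrix_matrix_mult_def)
  have deg0: "l.n $ k $ i = n $ k $ i" if ki: "j k = j i" for k i
  proof -
    have "X $ k $ m * l.n $ m $ i = 0" for m using Xe[of k m] l.n_entry[of m i] ki by force
    then have a: "(\<Sum>m\<in>UNIV. X $ k $ m * l.n $ m $ i) = 0" by (intro sum.neutral) blast
    have "n $ k $ m * X $ m $ i = 0" for m using Xe[of m i] n_entry[of k m] ki by force
    then have "(\<Sum>m\<in>UNIV. n $ k $ m * X $ m $ i) = 0" by (intro sum.neutral) blast
    then show ?thesis using ent[of k i] a by simp
  qed
  have "l.n $ k $ i = 0" if ki: "j k = j i - 1" for k i
  proof -
    have a: "X $ k $ m * l.n $ m $ i = X $ k $ m * n0 $ m $ i" for m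
      using Xe[of k m] deg0[of m i] ki by (cases "X $ k $ m = 0") (auto simp: n0_def hom_part_def)
    have b: "n $ k $ m * X $ m $ i = n0 $ k $ m * X $ m $ i" for m
      using Xe[of m i] ki by (cases "X $ m $ i = 0") (auto simp: n0_def hom_part_def)
    have "l.n $ k $ i = n $ k $ i - mbr X n0 $ k $ i"
      using ent[of k i] unfolding a b by (simp add: mbr_def matrix_matrix_mult_def algebra_simps)
    then show ?thesis unfolding X(2) using ki by (simp add: n1_def hom_part_def)
  qed
  then have "\<forall>k i. j k = j i - 1 \<longrightarrow> (matrix_inv B' ** N ** B') $ k $ i = 0" by (simp add: l.n_def l.co_def)
  then show ?thesis using L by blast
qed

end

text \<open>The last two assumptions are all that is used of type (I) or (II).\<close>

locale good_basis = limit_mhs G M B p q W N j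
  for G M :: "'n::finite filt" and B p q and W :: "'n filt" and N :: "complex^'n^'n" and j :: "'n \<Rightarrow> int" +
  assumes no1: "\<And>k i. j k = j i - 1 \<Longrightarrow> n $ k $ i = 0"
    and width: "\<And>k i. j i - j k \<le> 2"
    and level: "\<And>k i. j k = j i - 2 \<Longrightarrow> p k < p i \<and> (\<forall>l. j l = j i \<longrightarrow> p l = p i) \<and> (\<forall>l. j l = j k \<longrightarrow> p l = p k)"
begin

section \<open>Deligne's conditions for diag(j), and uniqueness of the grading\<close>

definition E :: "complex^'n^'n" where
  "E = (SOME E. hom_deg d (1, 1, 0) E \<and> hom_deg h 2 E \<and> mbr E n0 = diagm (\<lambda>i. of_int (h i)))"

lemma E_d: "hom_deg d (1, 1, 0) E" and E_h: "hom_deg h 2 E" and E_n0: "mbr E n0 = diagm (\<lambda>i. of_int (h i))"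
  using someI_ex[OF sl2_exists] unfolding E_def[symmetric] by auto

lemma E_entry: "E $ k $ i \<noteq> 0 \<Longrightarrow> p k = p i + 1 \<and> q k = q i + 1 \<and> j k = j i"
  using E_d by (auto simp: hom_deg_def d_def)

definition Y :: "complex^'n^'n" where "Y = un (diagm (\<lambda>i. of_int (j i)))"

definition n2 :: "complex^'n^'n" where "n2 = hom_part j (-2) n"

lemma n_split: "n = n0 + n2"
proof -
  have "n $ k $ i = n0 $ k $ i + n2 $ k $ i" for k i
  proof (cases "n $ k $ i = 0")
    case False
    then have "j k \<le> j i" using n_entry by blast
    moreover have "j k \<noteq> j i - 1" using no1 False by blast
    ultimately consider "j k = j i" | "j k = j i - 2" using width[of i k] by fastforce
    then show ?thesis by cases (auto simp: n0_def n2_def hom_part_def)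
  qed (simp add: n0_def n2_def hom_part_def)
  then show ?thesis by (simp add: vec_eq_iff)
qed

lemma n2_entry: "n2 $ k $ i \<noteq> 0 \<Longrightarrow> p k = p i - 1 \<and> q k = q i - 1 \<and> j k = j i - 2"
  using n_entry[of k i] by (auto simp: n2_def hom_part_def split: if_splits)

text \<open>On each of two levels that differ by two, \<open>p\<close> is constant, whereas
  \<open>n0\<close> lowers \<open>p\<close> and keeps \<open>j\<close>. So \<open>n0\<close>
  vanishes there, and the diagonal of [E,n0] gives h = 0.\<close>

lemma level_weight:
  assumes "j k = j i - 2"
  shows "p i + q i = j i" "p k + q k = j k"
proof -
  have pc: "p x = p y" if "j x = j y" "j y = j i \<or> j y = j k" for x y
    using level[OF assms] that by metis
  have 0: "n0 $ b $ a = 0" "n0 $ a $ b = 0" if ja: "j a = j i \<or> j a = j k" for a b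
  proof -
    show "n0 $ b $ a = 0"
    proof (rule ccontr)
      assume "n0 $ b $ a \<noteq> 0"
      then have "p b = p a - 1" "j b = j a" using n0_entry by blast+
      then show False using pc[of b a] ja by simp
    qed
    show "n0 $ a $ b = 0"
    proof (rule ccontr)
      assume "n0 $ a $ b \<noteq> 0"
      then have "p a = p b - 1" "j b = j a" using n0_entry[of a b] by simp_all
      then show False using pc[of b a] ja by simp
    qed
  qed
  have "h a = 0" if "j a = j i \<or> j a = j k" for a
  proof -
    have "mbr E n0 $ a $ a = 0" using 0[OF that] by (simp add: mbr_def matrix_matrix_mult_def)
    then show ?thesis by (simp add: E_n0 diagm_def)
  qed
  then show "p i + q i = j i" "p k + q k = j k" by (auto simp: h_def)
qed

text \<open>Both products vanish separately: \<open>E\<close> raises \<open>p\<close> within a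
  level, but \<open>p\<close> is constant on the two levels that \<open>n2\<close> connects.\<close>

lemma mbr_E_n2: "mbr E n2 = 0"
proof -
  have "E $ k $ l * n2 $ l $ i = 0" "n2 $ k $ l * E $ l $ i = 0" for k l i
  proof -
    show "E $ k $ l * n2 $ l $ i = 0"
    proof (rule ccontr)
      assume "E $ k $ l * n2 $ l $ i \<noteq> 0"
      then have "E $ k $ l \<noteq> 0" "n2 $ l $ i \<noteq> 0" by auto
      then have "p k = p l + 1" "j k = j l" "j l = j i - 2" using E_entry n2_entry by blast+
      moreover from this have "p k = p l" using level[of l i] by blast
      ultimately show False by simp
    qed
    show "n2 $ k $ l * E $ l $ i = 0"
    proof (rule ccontr)
      assume "n2 $ k $ l * E $ l $ i \<noteq> 0"
      then have "E $ l $ i \<noteq> 0" "n2 $ k $ l \<noteq> 0" by auto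
      then have "p l = p i + 1" "j l = j i" "j k = j l - 2" using E_entry n2_entry by blast+
      moreover from this have "p i = p l" using level[of k l] by metis
      ultimately show False by simp
    qed
  qed
  then have "(E ** n2) $ k $ i = 0" "(n2 ** E) $ k $ i = 0" for k i by (intro mat_mat_zero; blast)+
  then show ?thesis by (simp add: vec_eq_iff mbr_def)
qed

lemma eigsp_Y: "eigsp Y m = coord_span B (\<lambda>i. j i = m)"
proof -
  have "v \<in> eigsp Y m \<longleftrightarrow> v \<in> coord_span B (\<lambda>i. j i = m)" for v
  proof -
    have "v \<in> eigsp Y m \<longleftrightarrow> Bi *v (Y *v v) = Bi *v (of_int m *s v)"
      unfolding eigsp_def by (metis (mono_tags, lifting) Bi(2) mem_Collect_eq)
    also have "\<dots> \<longleftrightarrow> (\<forall>i. of_int (j i) * (Bi *v v) $ i = of_int m * (Bi *v v) $ i)"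
      unfolding Y_def un_vec matrix_vector_mult_smult by (simp add: vec_eq_iff)
    also have "\<dots> \<longleftrightarrow> v \<in> coord_span B (\<lambda>i. j i = m)" unfolding cs_iff by auto
    finally show ?thesis .
  qed
  then show ?thesis by blast
qed

lemma is_grading_Y: "is_grading W Y"
  unfolding is_grading_def eigsp_Y
proof (intro conjI allI)
  have "coord_span B (\<lambda>i. True) \<subseteq> vec.span (\<Union>m. coord_span B (\<lambda>i. j i = m))"
    by (rule coord_span_minimal) (auto intro!: vec.span_base column_in_coord_span)
  moreover have "coord_span B (\<lambda>i. True) = UNIV" by (auto simp: cs_iff)
  ultimately show "vec.span (\<Union>m. coord_span B (\<lambda>i. j i = m)) = UNIV" by auto
  fix k
  show "W k = vec.span (\<Union>m\<in>{..k}. coord_span B (\<lambda>i. j i = m))"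
  proof
    show "W k \<subseteq> vec.span (\<Union>m\<in>{..k}. coord_span B (\<lambda>i. j i = m))"
      unfolding W0_eq by (rule coord_span_minimal) (auto intro!: vec.span_base column_in_coord_span)
    show "vec.span (\<Union>m\<in>{..k}. coord_span B (\<lambda>i. j i = m)) \<subseteq> W k"
      unfolding W0_eq by (rule vec.span_minimal[OF _ subspace_coord_span]) (auto simp: cs_iff)
  qed
qed

lemma rY: "Y_FW G M = un (diagm (\<lambda>i. of_int (p i + q i)))"
  by (simp add: Y_FW_eq Ylab_def un_def)

lemma diagm_weight:
  fixes A :: "complex^'n^'n"
  assumes "\<And>k i. A $ k $ i \<noteq> 0 \<Longrightarrow> f k - f i = c"
  shows "mbr (diagm (\<lambda>i. of_int (f i))) A = (of_int c :: real) *\<^sub>R A"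
proof -
  have "mbr (diagm (\<lambda>i. of_int (f i))) A $ k $ i = ((of_int c :: real) *\<^sub>R A) $ k $ i" for k i
    using assms[of k i] by (cases "A $ k $ i = 0") (auto simp: mbr_diagm scaleR_conv_of_real[where 'a = complex] simp flip: of_int_diff)
  then show ?thesis by (simp add: vec_eq_iff)
qed

lemma deligne_Y_cond_Y: "deligne_Y_cond G W N M Y"
proof -
  have H: "un (diagm (\<lambda>i. of_int (p i + q i))) - Y = un (diagm (\<lambda>i. of_int (h i)))"
  proof -
    have "diagm (\<lambda>i. of_int (p i + q i)) - diagm (\<lambda>i. of_int (j i)) = (diagm (\<lambda>i. of_int (h i)) :: complex^'n^'n)"
      by (simp add: vec_eq_iff diagm_def h_def)
    then show ?thesis by (simp add: Y_def flip: un_diff)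
  qed
  \<comment> \<open>There is no term in degree one, by the choice of the basis. N_-2 must have
    weight 2 - 2 = 0, and indeed \<open>n2\<close> lowers p + q and \<open>j\<close> by two
    each.\<close>
  define Nc where "Nc = (\<lambda>l::nat. if l = 0 then un n0 else if l = 2 then un n2 else 0)"
  have N: "N = un n0 + un n2" by (metis n_def n_split un_add un_co)
  have "(\<Sum>l\<le>2. Nc l) = un n0 + un n2" by (simp add: Nc_def numeral_2_eq_2)
  then have sumN: "N = (\<Sum>l\<le>2. Nc l)" using N by metis
  have 1: "mbr Y (Nc l) = (- real l) *\<^sub>R Nc l" for l
  proof -
    have "mbr Y (un n0) = 0"
      unfolding Y_def un_mbr using diagm_weight[of n0 j 0] n0_entry by simp
    moreover have "mbr Y (un n2) = (-2) *\<^sub>R un n2"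
      unfolding Y_def un_mbr using diagm_weight[of n2 j "-2"] n2_entry by (simp add: un_scaleR del: scaleR_minus_left)
    ultimately show ?thesis by (simp add: Nc_def)
  qed
  have 2: "mbr (un (diagm (\<lambda>i. of_int (h i)))) (un n0) = (-2) *\<^sub>R un n0"
    unfolding un_mbr using diagm_weight[of n0 h "-2"] n0_h by (simp add: hom_deg_def un_scaleR del: scaleR_minus_left)
  have 3: "mbr (un (diagm (\<lambda>i. of_int (h i)))) (un E) = 2 *\<^sub>R un E"
    unfolding un_mbr using diagm_weight[of E h 2] E_h by (simp add: hom_deg_def un_scaleR)
  have 4: "mbr (un E) (un n0) = un (diagm (\<lambda>i. of_int (h i)))" by (simp add: un_mbr E_n0)
  have 5: "mbr (un E) (un n2) = 0" by (simp add: un_mbr mbr_E_n2)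
  have 6: "mbr (un (diagm (\<lambda>i. of_int (h i)))) (un n2) = 0"
    unfolding un_mbr using diagm_weight[of n2 h 0] n2_entry by (simp add: h_def)
  have 7: "mbr (N - un n0) (un E) = 0" using 5 mbr_anticomm[of "un n2" "un E"] N
    by (metis add_diff_cancel_left' neg_equal_zero neg_0_equal_iff_equal)
  have rYY: "mbr (un (diagm (\<lambda>i. of_int (p i + q i)))) Y = 0"
    unfolding Y_def un_mbr
    using diagm_weight[of "diagm (\<lambda>i. of_int (j i))" "\<lambda>i. p i + q i" 0] by (simp add: diagm_def split: if_splits)
  show ?thesis
    unfolding deligne_Y_cond_def Let_def rY H
  proof (intro conjI exI[of _ "2::nat"] exI[of _ Nc] exI[of _ "un E"])
    show "is_grading W Y" by (rule is_grading_Y)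
    show "\<forall>l\<le>2. mbr Y (Nc l) = (- real l) *\<^sub>R Nc l" using 1 by blast
    show "\<forall>l\<in>{1..2}. mbr (un E) (Nc l) = 0 \<and> mbr (un (diagm (\<lambda>i. of_int (h i)))) (Nc l) = (real l - 2) *\<^sub>R Nc l"
      using 5 6 by (auto simp: Nc_def)
  qed (use sumN 2 3 4 7 rYY in \<open>simp_all add: Nc_def\<close>)
qed

text \<open>In coordinates Y' is diag(j) + \<delta>, where \<delta> strictly lowers \<open>j\<close>
  because Y' grades \<open>W\<close>, and preserves p + q because Y' commutes with rY. For Y' the
  component N_-1 is a highest weight vector of weight -1, hence zero; this makes the part of
  \<delta> of degree -1 commute with \<open>n0\<close>, and having positive weight it vanishes. A
  part of degree -2 would change p + q, by \<open>level_weight\<close>.\<close>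

lemma deligne_Y_cond_unique:
  assumes "deligne_Y_cond G W N M Y'"
  shows "Y' = Y"
proof -
  let ?rY = "un (diagm (\<lambda>i. of_int (p i + q i)))"
  define H where "H = ?rY - Y'"
  obtain K Nc Np where gr: "is_grading W Y'" and comm: "mbr ?rY Y' = 0" and Nsum: "N = (\<Sum>l\<le>K. Nc l)"
    and deg: "\<And>l. l \<le> K \<Longrightarrow> mbr Y' (Nc l) = (- real l) *\<^sub>R Nc l"
    and H0: "mbr H (Nc 0) = (-2) *\<^sub>R Nc 0" and Hp: "mbr H Np = 2 *\<^sub>R Np" and ef: "mbr Np (Nc 0) = H"
    and hw: "\<And>l. l \<in> {1..K} \<Longrightarrow> mbr Np (Nc l) = 0 \<and> mbr H (Nc l) = (real l - 2) *\<^sub>R Nc l"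
    using assms unfolding deligne_Y_cond_def Let_def rY H_def by blast
  have Wk: "W k = vec.span (\<Union>l\<in>{..k}. eigsp Y' l)" for k using gr by (simp add: is_grading_def)
  have eW: "eigsp Y' l \<subseteq> W k" if "l \<le> k" for l k
  proof -
    have "eigsp Y' l \<subseteq> (\<Union>l\<in>{..k}. eigsp Y' l)" using that by blast
    then show ?thesis unfolding Wk by (rule subset_trans) (rule vec.span_superset)
  qed
  define \<delta> where "\<delta> = co Y' - diagm (\<lambda>i. of_int (j i))"
  have YW: "Y' *v v - of_int m *s v \<in> W (m - 1)" if "v \<in> W m" for v m
  proof -
    have "vec.span (\<Union>l\<in>{..m}. eigsp Y' l) \<subseteq> {v. Y' *v v - of_int m *s v \<in> W (m - 1)}"
    proof (rule vec.span_minimal)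
      show "vec.subspace {v. Y' *v v - of_int m *s v \<in> W (m - 1)}"
      proof (rule vec.subspaceI)
        show "0 \<in> {v. Y' *v v - of_int m *s v \<in> W (m - 1)}" using vec.subspace_0[OF sW0] by simp
        fix x y assume "x \<in> {v. Y' *v v - of_int m *s v \<in> W (m - 1)}" "y \<in> {v. Y' *v v - of_int m *s v \<in> W (m - 1)}"
        then show "x + y \<in> {v. Y' *v v - of_int m *s v \<in> W (m - 1)}"
          using vec.subspace_add[OF sW0, of "Y' *v x - of_int m *s x" _ "Y' *v y - of_int m *s y"]
          by (simp add: matrix_vector_right_distrib vec.scale_right_distrib algebra_simps)
      next
        fix c x assume "x \<in> {v. Y' *v v - of_int m *s v \<in> W (m - 1)}"
        then show "c *s x \<in> {v. Y' *v v - of_int m *s v \<in> W (m - 1)}"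
          using vec.subspace_scale[OF sW0, of "Y' *v x - of_int m *s x" _ c]
          by (simp add: matrix_vector_mult_smult vec.scale_right_diff_distrib mult.commute)
      qed
      show "(\<Union>l\<in>{..m}. eigsp Y' l) \<subseteq> {v. Y' *v v - of_int m *s v \<in> W (m - 1)}"
      proof (intro subsetI CollectI)
        fix v assume "v \<in> (\<Union>l\<in>{..m}. eigsp Y' l)"
        then obtain l where l: "l \<le> m" "v \<in> eigsp Y' l" by auto
        show "Y' *v v - of_int m *s v \<in> W (m - 1)"
        proof (cases "l = m")
          case True
          then show ?thesis using l(2) vec.subspace_0[OF sW0] by (simp add: eigsp_def)
        next
          case False
          then have "v \<in> W (m - 1)" using l eW[of l "m - 1"] by auto
          then have "of_int l *s v - of_int m *s v \<in> W (m - 1)"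
            using vec.subspace_diff[OF sW0] vec.subspace_scale[OF sW0] by blast
          then show ?thesis using l(2) by (simp add: eigsp_def)
        qed
      qed
    qed
    then show ?thesis using that Wk by blast
  qed
  have d1: "j k < j i" if nz: "\<delta> $ k $ i \<noteq> 0" for k i
  proof (rule ccontr)
    assume ki: "\<not> j k < j i"
    have "Y' *v column i B - of_int (j i) *s column i B \<in> W (j i - 1)" by (rule YW[OF col_W])
    then have "(Bi *v (Y' *v column i B - of_int (j i) *s column i B)) $ k = 0"
      using ki unfolding W0_eq cs_iff by auto
    then have "co Y' $ k $ i = of_int (j i) * axis i 1 $ k"
      by (simp add: matrix_vector_mult_diff_distrib matrix_vector_mult_smult co_entry Bi_column)
    then have "\<delta> $ k $ i = 0" by (auto simp: \<delta>_def diagm_def axis_def)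
    then show False using nz by simp
  qed
  have d2: "p k + q k = p i + q i" if nz: "\<delta> $ k $ i \<noteq> 0" for k i
  proof -
    have "mbr (diagm (\<lambda>i. of_int (p i + q i))) (co Y') = 0" using comm co_mbr[of ?rY Y'] by simp
    then have "(of_int (p k + q k) - of_int (p i + q i)) * co Y' $ k $ i = 0"
      using mbr_diagm[of "\<lambda>i. of_int (p i + q i)" "co Y'" k i] by simp
    moreover have "k \<noteq> i" using d1[OF nz] by auto
    then have "co Y' $ k $ i \<noteq> 0" using nz by (simp add: \<delta>_def diagm_def)
    ultimately show ?thesis by (simp flip: of_int_add of_int_diff)
  qed
  have Nc1: "Nc 1 = 0" if "1 \<le> K"
    using highest_weight_nonneg[of H Np "Nc 0" "Nc 1" "-1"] Hp H0 ef hw[of 1] that by simp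
  \<comment> \<open>N_-l enters [Y',N] with coefficient -l: nothing for l = 0, zero for l = 1
    because N_-1 vanishes, and a drop by at least two otherwise.\<close>
  have "mbr Y' N *v v \<in> W (m - 2)" if v: "v \<in> W m" for v m
  proof -
    have tm: "(- real l) *\<^sub>R (Nc l *v v) \<in> W (m - 2)" if l: "l \<le> K" for l
    proof -
      consider "l = 0" | "l = 1" | "l \<ge> 2" by linarith
      then show ?thesis
      proof cases
        case 1
        then show ?thesis using vec.subspace_0[OF sW0] by simp
      next
        case 2
        then show ?thesis using Nc1 l vec.subspace_0[OF sW0] by simp
      next
        case 3
        have "vec.span (\<Union>a\<in>{..m}. eigsp Y' a) \<subseteq> {v. Nc l *v v \<in> W (m - 2)}"
        proof (rule vec.span_minimal)
          show "vec.subspace {v. Nc l *v v \<in> W (m - 2)}"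
            by (rule vec.subspaceI) (use vec.subspace_0[OF sW0] vec.subspace_add[OF sW0] vec.subspace_scale[OF sW0] in
               \<open>auto simp: matrix_vector_right_distrib matrix_vector_mult_smult\<close>)
          show "(\<Union>a\<in>{..m}. eigsp Y' a) \<subseteq> {v. Nc l *v v \<in> W (m - 2)}"
          proof (intro subsetI CollectI)
            fix v assume "v \<in> (\<Union>a\<in>{..m}. eigsp Y' a)"
            then obtain a where a: "a \<le> m" "Y' *v v = of_int a *s v" by (auto simp: eigsp_def)
            have "Y' *v (Nc l *v v) = (mbr Y' (Nc l)) *v v + Nc l *v (Y' *v v)"
              by (simp add: mbr_def matrix_vector_mult_diff_rdistrib matrix_vector_mul_assoc)
            also have "\<dots> = of_int (a - int l) *s (Nc l *v v)"
              unfolding deg[OF l] a(2) matrix_vector_mult_smult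
              by (simp add: vec_eq_iff matrix_vector_mult_def scaleR_conv_of_real[where 'a = complex] sum_distrib_left sum_negf algebra_simps)
            finally have "Nc l *v v \<in> eigsp Y' (a - int l)" by (simp add: eigsp_def)
            then show "Nc l *v v \<in> W (m - 2)" using eW[of "a - int l" "m - 2"] a(1) 3 by auto
          qed
        qed
        then have "Nc l *v v \<in> W (m - 2)" using v Wk by blast
        moreover have "(- real l) *\<^sub>R (Nc l *v v) = of_real (- real l) *s (Nc l *v v)"
          by (simp add: vec_eq_iff scaleR_conv_of_real[where 'a = complex])
        ultimately show ?thesis using vec.subspace_scale[OF sW0] by metis
      qed
    qed
    have mb: "mbr Y' (\<Sum>l\<in>A. Nc l) = (\<Sum>l\<in>A. mbr Y' (Nc l))" if "finite A" for A
      using that by (induction A rule: finite_induct) (auto simp: mbr_add)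
    have vs: "(\<Sum>l\<in>A. X l) *v v = (\<Sum>l\<in>A. X l *v v)" if "finite A" for A and X :: "nat \<Rightarrow> complex^'n^'n"
      using that by (induction A rule: finite_induct) (auto simp: matrix_vector_mult_add_rdistrib)
    have "mbr Y' N *v v = (\<Sum>l\<le>K. mbr Y' (Nc l) *v v)" unfolding Nsum using mb vs by simp
    also have "\<dots> = (\<Sum>l\<le>K. (- real l) *\<^sub>R (Nc l *v v))"
      by (rule sum.cong[OF refl]) (simp add: deg scaleR_matrix_vector_assoc, simp add: vec_eq_iff matrix_vector_mult_def scaleR_sum_right sum_negf)
    also have "\<dots> \<in> W (m - 2)" by (rule vec.subspace_sum[OF sW0]) (use tm in simp)
    finally show ?thesis .
  qed
  then have "mbr Y' N *v column i B \<in> W (j i - 2)" for i using col_W by blast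
  then have z: "mbr (co Y') n $ k $ i = 0" if "j k = j i - 1" for k i
    using that co_entry[of "mbr Y' N" i k] unfolding W0_eq cs_iff co_mbr n_def by force
  define \<delta>1 where "\<delta>1 = hom_part j (-1) \<delta>"
  have "mbr \<delta>1 n0 $ k $ i = 0" for k i
  proof (cases "j k = j i - 1")
    case True
    have "co Y' = diagm (\<lambda>i. of_int (j i)) + \<delta>" by (simp add: \<delta>_def)
    then have "mbr (co Y') n $ k $ i = mbr (diagm (\<lambda>i. of_int (j i))) n $ k $ i + mbr \<delta> n $ k $ i"
      by (simp add: mbr_def mm_simps)
    then have "mbr \<delta> n $ k $ i = 0" using z[OF True] no1[OF True] by (simp add: mbr_diagm)
    moreover have "\<delta> $ k $ l * n $ l $ i = \<delta>1 $ k $ l * n0 $ l $ i" for l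
    proof (cases "j l = j i")
      case True
      then show ?thesis using \<open>j k = j i - 1\<close> by (simp add: \<delta>1_def n0_def hom_part_def)
    next
      case False
      then have "n0 $ l $ i = 0" by (simp add: n0_def hom_part_def)
      moreover have "\<delta> $ k $ l = 0 \<or> n $ l $ i = 0" using d1[of k l] n_entry[of l i] False True by force
      ultimately show ?thesis by auto
    qed
    moreover have "n $ k $ l * \<delta> $ l $ i = n0 $ k $ l * \<delta>1 $ l $ i" for l
    proof (cases "j l = j k")
      case T: True
      then show ?thesis using True by (simp add: \<delta>1_def n0_def hom_part_def)
    next
      case False
      then have "n0 $ k $ l = 0" by (simp add: n0_def hom_part_def)
      moreover have "n $ k $ l = 0 \<or> \<delta> $ l $ i = 0" using d1[of l i] n_entry[of k l] False True by force
      ultimately show ?thesis by auto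
    qed
    ultimately show ?thesis by (simp add: mbr_def matrix_matrix_mult_def)
  next
    case False
    have "\<delta>1 $ k $ l * n0 $ l $ i = 0" "n0 $ k $ l * \<delta>1 $ l $ i = 0" for l
      using False by (auto simp: \<delta>1_def n0_def hom_part_def)
    then have "(\<delta>1 ** n0) $ k $ i = 0" "(n0 ** \<delta>1) $ k $ i = 0" by (intro mat_mat_zero; blast)+
    then show ?thesis by (simp add: mbr_def)
  qed
  then have "mbr \<delta>1 n0 = 0" by (simp add: vec_eq_iff)
  then have \<delta>1n: "mbr n0 \<delta>1 = 0" using mbr_anticomm[of n0 \<delta>1] by simp
  have \<delta>1h: "hom_deg h 1 \<delta>1"
    unfolding hom_deg_def \<delta>1_def hom_part_def h_def using d2 by auto
  have \<delta>1: "\<delta>1 = 0" by (rule sl2_commuting_vanish[OF n0_h E_h E_n0 \<delta>1h _ \<delta>1n]) simp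
  have "\<delta> $ k $ i = 0" for k i
  proof (rule ccontr)
    assume nz: "\<delta> $ k $ i \<noteq> 0"
    then have "j k < j i" by (rule d1)
    moreover have "j k \<noteq> j i - 1"
      using nz arg_cong[OF \<delta>1, of "\<lambda>A. A $ k $ i"] by (auto simp: \<delta>1_def hom_part_def)
    ultimately have ki: "j k = j i - 2" using width[of i k] by simp
    show False using level_weight[OF ki] d2[OF nz] ki by simp
  qed
  then have "co Y' = diagm (\<lambda>i. of_int (j i))" by (simp add: \<delta>_def vec_eq_iff)
  then show ?thesis unfolding Y_def by (metis un_co)
qed

lemma Y_deligne_eq: "Y_deligne G W N M = Y"
  unfolding Y_deligne_def using deligne_Y_cond_Y deligne_Y_cond_unique by (rule the_equality)

end

section \<open>Exponentials of nilpotent matrices\<close>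

lemma mpow_add: "mpow A (a + b) = mpow A a ** mpow A b"
  by (induction a) (simp_all add: matrix_mul_assoc)

lemma mpow_csmult: "mpow (csmult c A) k = csmult (c ^ k) (mpow A k)"
  by (induction k) (simp_all add: csmult_mult, simp_all add: csmult_def vec_eq_iff mult_ac)

lemma csmult_nth [simp]: "csmult c A $ i $ j = c * A $ i $ j"
  by (simp add: csmult_def)

lemma nilpotent_csmult: "nilpotent_mat A \<Longrightarrow> nilpotent_mat (csmult c A)"
  unfolding nilpotent_mat_def mpow_csmult by (auto simp: vec_eq_iff)

text \<open>The kernels of the powers of \<open>A\<close> grow strictly in dimension until they
  stabilise, which by nilpotency happens only at the whole space. So the sum truncated at
  \<open>CARD('n)\<close> is the full exponential.\<close>

lemma nilpotent_mpow_0: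
  fixes A :: "complex^'n::finite^'n"
  assumes "nilpotent_mat A" "k \<ge> CARD('n)"
  shows "mpow A k = 0"
proof -
  obtain m where m: "mpow A m = 0" using assms(1) by (auto simp: nilpotent_mat_def)
  let ?K = "\<lambda>i. {v. mpow A i *v v = 0}"
  have sK: "vec.subspace (?K i)" for i
    by (auto intro!: vec.subspaceI simp: matrix_vector_right_distrib matrix_vector_mult_smult)
  have KS: "?K i \<subseteq> ?K (Suc i)" for i by (auto simp flip: matrix_vector_mul_assoc)
  have stab: "?K (Suc (i + l)) = ?K (i + l)" if "?K (Suc i) = ?K i" for i l
  proof (induction l)
    case (Suc l)
    have eq: "v \<in> ?K (Suc a) \<longleftrightarrow> A *v v \<in> ?K a" for v a
    proof -
      have "mpow A (Suc a) = mpow A a ** A" using mpow_commute[of A A a] by simp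
      then show ?thesis by (simp add: matrix_vector_mul_assoc)
    qed
    show ?case using Suc eq by (auto simp del: mpow.simps)
  qed (use that in simp)
  have "?K i = UNIV \<or> vec.dim (?K i) \<ge> i" for i
  proof (induction i)
    case (Suc i)
    show ?case
    proof (cases "?K i = UNIV")
      case True
      then show ?thesis using KS[of i] by blast
    next
      case False
      have "?K (Suc i) \<noteq> ?K i"
      proof
        assume e: "?K (Suc i) = ?K i"
        have "?K (i + l) = ?K i" for l
          by (induction l) (use stab[OF e] in \<open>simp_all del: mpow.simps\<close>)
        moreover have "mpow A (i + m) = 0" by (simp add: mpow_add m)
        then have "?K (i + m) = UNIV" by simp
        ultimately show False using False by blast
      qed
      then have "vec.dim (?K i) < vec.dim (?K (Suc i))"
        using KS[of i] vec.subspace_dim_equal[OF sK sK KS, of i] by (metis not_le)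
      then show ?thesis using Suc False by linarith
    qed
  qed simp
  from this[of "CARD('n)"] have "?K (CARD('n)) = UNIV"
    using vec.subspace_dim_equal[OF sK vec.subspace_UNIV, of "CARD('n)"] by (auto simp: card_cart_basis)
  then have "mpow A (CARD('n)) = 0" by (auto simp: matrix_eq)
  moreover obtain l where "k = CARD('n) + l" using assms(2) le_Suc_ex by blast
  ultimately show ?thesis by (simp add: mpow_add)
qed

lemma nilpotent_hom_deg:
  fixes f :: "'n::finite \<Rightarrow> int"
  assumes A: "hom_deg f c A" and c: "c \<noteq> 0"
  shows "nilpotent_mat A"
proof -
  define R where "R = (\<Sum>i\<in>UNIV. \<bar>f i\<bar>)"
  have fR: "\<bar>f i\<bar> \<le> R" for i unfolding R_def by (rule member_le_sum) auto
  define k where "k = nat (2 * R + 1)"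
  have k: "int k > 2 * R" unfolding k_def by simp
  have "mpow A k $ a $ b = 0" for a b
  proof (rule ccontr)
    assume "mpow A k $ a $ b \<noteq> 0"
    then have "f a = f b + int k * c" using mpow_hom_deg[OF A, of k] by (simp add: hom_deg_def)
    then have "\<bar>int k * c\<bar> \<le> 2 * R" using fR[of a] fR[of b] by linarith
    moreover have "\<bar>int k * c\<bar> \<ge> int k" using c mult_left_mono[of 1 "\<bar>c\<bar>" "int k"] by (simp add: abs_mult)
    ultimately show False using k by linarith
  qed
  then show ?thesis unfolding nilpotent_mat_def by (intro exI[of _ k]) (simp add: vec_eq_iff)
qed

lemma nil_exp_eq:
  fixes A :: "complex^'n::finite^'n"
  assumes "nilpotent_mat A" "K \<ge> CARD('n)"
  shows "nil_exp A = (\<Sum>k\<le>K. (1 / fact k) *\<^sub>R mpow A k)"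
  unfolding nil_exp_def
  by (rule sum.mono_neutral_left) (use assms nilpotent_mpow_0[OF assms(1)] in auto)

lemma matrix_sum_mult: "(\<Sum>k\<in>S. f k) ** B = (\<Sum>k\<in>S. f k ** (B :: complex^'n::finite^'n))"
  by (induction S rule: infinite_finite_induct) (auto simp: matrix_add_rdist)

lemma matrix_mult_sum_right: "B ** (\<Sum>k\<in>S. f k) = (\<Sum>k\<in>S. (B :: complex^'n::finite^'n) ** f k)"
  by (induction S rule: infinite_finite_induct) (auto simp: matrix_add_ldistrib)

text \<open>This is exp(A) B exp(-A) = exp(ad A) B in the case where the series of ad A stops after
  the quadratic term, as it does in the adjoint action of sl2 on itself.\<close>

lemma nil_exp_intertwine:
  fixes A B C D :: "complex^'n::finite^'n"
  assumes A: "nilpotent_mat A" and C: "mbr A B = C" and D: "mbr A C = D" and 0: "mbr A D = 0"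
  shows "nil_exp A ** B = (B + C + (1/2) *\<^sub>R D) ** nil_exp A"
proof -
  \<comment> \<open>\<open>a i k\<close> is the coefficient A^(k-i)/(k-i)!. The shift by
    \<open>i\<close> lets all three sums run over the same \<open>k\<close>, so that the identity
    holds term by term and can be proved by induction on \<open>k\<close>.\<close>
  define a where "a = (\<lambda>i k. if k < i then 0 else (1 / fact (k - i)) *\<^sub>R mpow A (k - i))"
  have AB: "A ** B = B ** A + C" "A ** C = C ** A + D" "A ** D = D ** A"
    using C D 0 by (auto simp: mbr_def)
  have Aa: "A ** a i k = (real (Suc k) - real i) *\<^sub>R a i (Suc k)" for i k
  proof (cases "k < i")
    case True
    then show ?thesis by (cases "Suc k = i") (auto simp: a_def)
  next
    case False
    then have "Suc k - i = Suc (k - i)" "real (Suc k) - real i = real (Suc (k - i))" by auto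
    then show ?thesis using False by (simp add: a_def mm_simps del: of_nat_Suc)
  qed
  have key: "a 0 k ** B = B ** a 0 k + C ** a 1 k + (1/2) *\<^sub>R (D ** a 2 k)" for k
  proof (induction k)
    case 0
    then show ?case by (simp add: a_def)
  next
    case (Suc k)
    have "(real k + 1) *\<^sub>R (a 0 (Suc k) ** B) = A ** (a 0 k ** B)"
      using Aa[of 0 k] by (simp add: matrix_mul_assoc matrix_scaleR_left add.commute)
    also have "\<dots> = (A ** B) ** a 0 k + (A ** C) ** a 1 k + (1/2) *\<^sub>R ((A ** D) ** a 2 k)"
      unfolding Suc by (simp add: mm_simps matrix_mul_assoc)
    also have "\<dots> = B ** (A ** a 0 k) + C ** a 0 k + C ** (A ** a 1 k) + D ** a 1 k + (1/2) *\<^sub>R (D ** (A ** a 2 k))"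
      unfolding AB by (simp add: mm_simps matrix_mul_assoc)
    also have "B ** (A ** a 0 k) = (real k + 1) *\<^sub>R (B ** a 0 (Suc k))"
      unfolding Aa by (simp add: mm_simps add.commute)
    also have "C ** (A ** a 1 k) = real k *\<^sub>R (C ** a 1 (Suc k))"
      unfolding Aa by (simp add: mm_simps)
    also have "D ** (A ** a 2 k) = (real k - 1) *\<^sub>R (D ** a 2 (Suc k))"
      unfolding Aa by (simp add: mm_simps)
    also have "a 0 k = a 1 (Suc k)" by (simp add: a_def)
    also have "a 1 k = a 2 (Suc k)" by (simp add: a_def)
    also have "(real k + 1) *\<^sub>R (B ** a 0 (Suc k)) + C ** a 1 (Suc k) + real k *\<^sub>R (C ** a 1 (Suc k))
         + D ** a 2 (Suc k) + (1/2) *\<^sub>R ((real k - 1) *\<^sub>R (D ** a 2 (Suc k)))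
       = (real k + 1) *\<^sub>R (B ** a 0 (Suc k) + C ** a 1 (Suc k) + (1/2) *\<^sub>R (D ** a 2 (Suc k)))"
      by (simp add: vec_eq_iff scaleR_conv_of_real[where 'a = complex] field_simps)
    finally show ?case by (simp del: scaleR_right_distrib)
  qed
  have shift: "nil_exp A = (\<Sum>k\<le>CARD('n) + 2. a i k)" if "i \<le> 2" for i
  proof -
    have "(\<Sum>k\<le>CARD('n) + 2. a i k) = (\<Sum>k\<in>{i..CARD('n) + 2}. (1 / fact (k - i)) *\<^sub>R mpow A (k - i))"
      by (rule sum.mono_neutral_cong_right) (auto simp: a_def)
    also have "\<dots> = (\<Sum>k\<le>CARD('n) + 2 - i. (1 / fact k) *\<^sub>R mpow A k)"
      by (rule sum.reindex_bij_witness[of _ "\<lambda>k. k + i" "\<lambda>k. k - i"]) (use that in auto)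
    also have "\<dots> = nil_exp A" by (rule nil_exp_eq[symmetric, OF A]) (use that in simp)
    finally show ?thesis ..
  qed
  have "nil_exp A = (\<Sum>k\<le>CARD('n) + 2. a 0 k)" by (rule shift) simp
  then have "nil_exp A ** B = (\<Sum>k\<le>CARD('n) + 2. a 0 k ** B)" by (simp only: matrix_sum_mult)
  also have "\<dots> = B ** nil_exp A + C ** nil_exp A + (1/2) *\<^sub>R (D ** nil_exp A)"
    unfolding key sum.distrib scaleR_sum_right[symmetric] matrix_mult_sum_right[symmetric]
    using shift[of 0] shift[of 1] shift[of 2] by (metis le_numeral_extra(3) one_le_numeral order_refl zero_le_numeral)
  finally show ?thesis by (simp add: mm_simps)
qed

lemma nil_exp_commute:
  assumes "nilpotent_mat A" "mbr A B = 0"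
  shows "nil_exp A ** B = B ** nil_exp A"
  using nil_exp_intertwine[OF assms, of 0] by simp

definition nexp :: "complex^'n::finite^'n \<Rightarrow> complex \<Rightarrow> complex^'n^'n" where
  "nexp A z = nil_exp (csmult z A)"

lemma nexp_entry:
  fixes A :: "complex^'n::finite^'n"
  shows "nexp A z $ k $ i = (\<Sum>l\<le>CARD('n). z ^ l / fact l * mpow A l $ k $ i)"
  unfolding nexp_def nil_exp_def mpow_csmult
  by (simp add: scaleR_conv_of_real[where 'a = complex] field_simps)

lemma nexp_0 [simp]: "nexp A 0 = mat 1"
proof -
  have "nexp A 0 $ k $ i = mat 1 $ k $ i" for k i
  proof -
    have "nexp A 0 $ k $ i = (\<Sum>l\<in>{0}. 0 ^ l / fact l * mpow A l $ k $ i)"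
      unfolding nexp_entry by (rule sum.mono_neutral_right) auto
    then show ?thesis by simp
  qed
  then show ?thesis by (simp add: vec_eq_iff)
qed

lemma nexp_deriv:
  fixes A :: "complex^'n::finite^'n"
  assumes A: "nilpotent_mat A"
  shows "((\<lambda>z. nexp A z $ k $ i) has_field_derivative (A ** nexp A z) $ k $ i) (at z)"
proof -
  let ?f = "\<lambda>l z. z ^ l / fact l * mpow A l $ k $ i"
  have "((\<lambda>z. \<Sum>l\<le>CARD('n). ?f l z) has_field_derivative (\<Sum>l\<le>CARD('n). of_nat l * z ^ (l - 1) / fact l * mpow A l $ k $ i)) (at z)"
    by (rule DERIV_sum) (auto intro!: derivative_eq_intros)
  also have "(\<Sum>l\<le>CARD('n). of_nat l * z ^ (l - 1) / fact l * mpow A l $ k $ i)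
      = (\<Sum>l\<in>{1..CARD('n)}. of_nat l * z ^ (l - 1) / fact l * mpow A l $ k $ i)"
    by (rule sum.mono_neutral_right) auto
  also have "\<dots> = (\<Sum>l\<in>{..<CARD('n)}. z ^ l / fact l * mpow A (Suc l) $ k $ i)"
    by (rule sum.reindex_bij_witness[of _ Suc "\<lambda>l. l - 1"]) (auto simp: fact_reduce field_simps simp del: mpow.simps)
  also have "\<dots> = (\<Sum>l\<le>CARD('n). z ^ l / fact l * mpow A (Suc l) $ k $ i)"
    by (rule sum.mono_neutral_left) (use nilpotent_mpow_0[OF A] in \<open>auto simp del: mpow.simps simp: not_less\<close>)
  also have "\<dots> = (A ** nexp A z) $ k $ i"
  proof -
    have "(A ** nexp A z) $ k $ i = (\<Sum>m\<in>UNIV. \<Sum>l\<le>CARD('n). A $ k $ m * (z ^ l / fact l * mpow A l $ m $ i))"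
      by (simp add: matrix_matrix_mult_def nexp_entry sum_distrib_left)
    also have "\<dots> = (\<Sum>l\<le>CARD('n). \<Sum>m\<in>UNIV. A $ k $ m * (z ^ l / fact l * mpow A l $ m $ i))" by (rule sum.swap)
    also have "\<dots> = (\<Sum>l\<le>CARD('n). z ^ l / fact l * mpow A (Suc l) $ k $ i)"
      by (simp add: matrix_matrix_mult_def sum_distrib_left mult_ac)
    finally show ?thesis by simp
  qed
  finally show ?thesis by (simp add: nexp_entry)
qed

lemma nexp_comm:
  assumes A: "nilpotent_mat A"
  shows "nexp A z ** A = A ** nexp A z"
  unfolding nexp_def
  by (rule nil_exp_commute[OF nilpotent_csmult[OF A]]) (simp add: mbr_def csmult_mult)

text \<open>The product has derivative zero in \<open>z\<close>, hence equals its value at z = 0.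
  The inverse and the addition law are both consequences.\<close>

lemma nexp_cancel_add:
  fixes A :: "complex^'n::finite^'n"
  assumes A: "nilpotent_mat A"
  shows "nexp A (- z) ** nexp A (z + w) = nexp A w"
proof -
  have "(nexp A (- z) ** nexp A (z + w)) $ k $ i = nexp A w $ k $ i" for k i
  proof -
    let ?f = "\<lambda>z. \<Sum>l\<in>UNIV. nexp A (- z) $ k $ l * nexp A (z + w) $ l $ i"
    have "(?f has_field_derivative 0) (at z)" for z
    proof -
      have d1: "((\<lambda>z. nexp A (- z) $ k $ l) has_field_derivative - (A ** nexp A (- z)) $ k $ l) (at z)" for l
      proof -
        have "((\<lambda>z. nexp A (- z) $ k $ l) has_field_derivative (A ** nexp A (- z)) $ k $ l * (- 1)) (at z)"
          by (rule DERIV_chain2[where g = uminus, OF nexp_deriv[OF A]]) (auto intro!: derivative_eq_intros)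
        then show ?thesis by simp
      qed
      have d2: "((\<lambda>z. nexp A (z + w) $ l $ i) has_field_derivative (A ** nexp A (z + w)) $ l $ i) (at z)" for l
      proof -
        have "((\<lambda>z. nexp A (z + w) $ l $ i) has_field_derivative (A ** nexp A (z + w)) $ l $ i * 1) (at z)"
          by (rule DERIV_chain2[where g = "\<lambda>z. z + w", OF nexp_deriv[OF A]]) (auto intro!: derivative_eq_intros)
        then show ?thesis by simp
      qed
      have "(?f has_field_derivative (\<Sum>l\<in>UNIV. - (A ** nexp A (- z)) $ k $ l * nexp A (z + w) $ l $ i +
          (A ** nexp A (z + w)) $ l $ i * nexp A (- z) $ k $ l)) (at z)"
        by (rule DERIV_sum) (rule DERIV_mult[OF d1 d2])
      also have "(\<Sum>l\<in>UNIV. - (A ** nexp A (- z)) $ k $ l * nexp A (z + w) $ l $ i + (A ** nexp A (z + w)) $ l $ i * nexp A (- z) $ k $ l)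
        = (nexp A (- z) ** (A ** nexp A (z + w))) $ k $ i - ((A ** nexp A (- z)) ** nexp A (z + w)) $ k $ i"
        by (simp only: matrix_matrix_mult_def[of "nexp A (- z)" "A ** nexp A (z + w)"]
             matrix_matrix_mult_def[of "A ** nexp A (- z)" "nexp A (z + w)"] vec_lambda_beta sum.distrib)
           (simp add: sum_negf mult.commute)
      also have "\<dots> = 0" using nexp_comm[OF A, of "- z"] by (simp add: matrix_mul_assoc)
      finally show ?thesis .
    qed
    then obtain c where c: "\<And>z. ?f z = c"
      using has_field_derivative_zero_constant[of UNIV ?f] by auto
    have "?f 0 = nexp A w $ k $ i"
      by (simp add: mat_def if_distrib if_distribR cong: if_cong)
    then show ?thesis using c[of z] c[of 0] by (simp add: matrix_matrix_mult_def)
  qed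
  then show ?thesis by (simp add: vec_eq_iff)
qed

lemma nexp_inverse:
  assumes A: "nilpotent_mat A"
  shows "nexp A (- z) ** nexp A z = mat 1" "nexp A z ** nexp A (- z) = mat 1"
  using nexp_cancel_add[OF A, of z 0] nexp_cancel_add[OF A, of "- z" 0] by simp_all

lemma nexp_add:
  assumes A: "nilpotent_mat A"
  shows "nexp A (z + w) = nexp A z ** nexp A w"
proof -
  have "nexp A z ** nexp A w = (nexp A z ** nexp A (- z)) ** nexp A (z + w)"
    by (simp only: nexp_cancel_add[OF A, of z w, symmetric] matrix_mul_assoc)
  then show ?thesis by (simp add: nexp_inverse[OF A])
qed

lemma invertible_nexp: "nilpotent_mat A \<Longrightarrow> invertible (nexp A z)"
  unfolding invertible_def using nexp_inverse by blast

lemma mcnj_nexp: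
  assumes "real_matrix A"
  shows "mcnj (nexp A z) = nexp A (cnj z)"
proof -
  have "mcnj (mpow A l) = mpow A l" for l
  proof (induction l)
    case 0
    then show ?case by (simp add: mcnj_def mat_def vec_eq_iff)
  next
    case (Suc l)
    have "mcnj (A ** mpow A l) = mcnj A ** mcnj (mpow A l)"
      by (simp add: mcnj_def matrix_matrix_mult_def vec_eq_iff)
    then show ?case using Suc mcnj_real[OF assms] by simp
  qed
  then have "cnj (mpow A l $ k $ i) = mpow A l $ k $ i" for l k i
    by (metis mcnj_def vec_lambda_beta)
  then show ?thesis by (simp add: vec_eq_iff mcnj_def nexp_entry)
qed

lemma nexp_vec:
  fixes A :: "complex^'n::finite^'n"
  shows "nexp A z *v v = (\<Sum>l\<le>CARD('n). (z ^ l / fact l) *s (mpow A l *v v))"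
proof -
  have "(nexp A z *v v) $ k = (\<Sum>l\<le>CARD('n). (z ^ l / fact l) *s (mpow A l *v v)) $ k" for k
  proof -
    have "(nexp A z *v v) $ k = (\<Sum>i\<in>UNIV. \<Sum>l\<le>CARD('n). z ^ l / fact l * mpow A l $ k $ i * v $ i)"
      by (simp add: matrix_vector_mult_def nexp_entry sum_distrib_right)
    also have "\<dots> = (\<Sum>l\<le>CARD('n). \<Sum>i\<in>UNIV. z ^ l / fact l * mpow A l $ k $ i * v $ i)" by (rule sum.swap)
    finally show ?thesis by (simp add: matrix_vector_mult_def sum_distrib_left mult_ac)
  qed
  then show ?thesis by (simp add: vec_eq_iff)
qed

lemma nil_exp_preserves:
  fixes A :: "complex^'n::finite^'n"
  assumes S: "vec.subspace S" and A: "\<And>v. v \<in> S \<Longrightarrow> A *v v \<in> S" and v: "v \<in> S"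
  shows "nexp A z *v v \<in> S"
proof -
  have "mpow A l *v v \<in> S" for l
    by (induction l) (use A v in \<open>auto simp flip: matrix_vector_mul_assoc\<close>)
  then show ?thesis unfolding nexp_vec by (intro vec.subspace_sum[OF S] vec.subspace_scale[OF S])
qed

section \<open>Limits of matrices, and the Weyl element\<close>

lemma tendsto_matrixI:
  fixes f :: "'a \<Rightarrow> complex^'n::finite^'m::finite"
  shows "(\<And>i j. ((\<lambda>x. f x $ i $ j) \<longlongrightarrow> A $ i $ j) F) \<Longrightarrow> (f \<longlongrightarrow> A) F"
  by (intro vec_tendstoI)

lemma tendsto_matrix_nth:
  fixes f :: "'a \<Rightarrow> complex^'n::finite^'m::finite"
  shows "(f \<longlongrightarrow> A) F \<Longrightarrow> ((\<lambda>x. f x $ i $ j) \<longlongrightarrow> A $ i $ j) F"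
  by (intro tendsto_vec_nth)

lemma tendsto_matrix_mult:
  fixes f :: "'a \<Rightarrow> complex^'n::finite^'m::finite" and g :: "'a \<Rightarrow> complex^'k::finite^'n"
  assumes "(f \<longlongrightarrow> A) F" "(g \<longlongrightarrow> B) F"
  shows "((\<lambda>x. f x ** g x) \<longlongrightarrow> A ** B) F"
  by (rule tendsto_matrixI) (simp add: matrix_matrix_mult_def,
     intro tendsto_sum tendsto_mult tendsto_matrix_nth[OF assms(1)] tendsto_matrix_nth[OF assms(2)])

lemma nexp_tendsto_1:
  assumes "(f \<longlongrightarrow> 0) F"
  shows "((\<lambda>x. nexp A (f x)) \<longlongrightarrow> mat 1) F"
proof -
  have "((\<lambda>x. nexp A (f x)) \<longlongrightarrow> nexp A 0) F"
    by (rule tendsto_matrixI) (unfold nexp_entry, intro tendsto_sum tendsto_mult tendsto_divide tendsto_power assms tendsto_const, auto)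
  then show ?thesis by simp
qed

lemma mbr_csmult: "mbr (csmult c A) B = csmult c (mbr A B)" "mbr A (csmult c B) = csmult c (mbr A B)"
  by (simp_all add: mbr_def csmult_mult) (simp_all add: vec_eq_iff algebra_simps)

text \<open>w represents the Weyl group element of the triple, which acts on H by -1.\<close>

lemma weyl_intertwine:
  fixes e f H :: "complex^'n::finite^'n"
  assumes e: "nilpotent_mat e" and f: "nilpotent_mat f" and x: "x \<noteq> 0"
    and ef: "mbr e f = H" and He: "mbr H e = 2 *\<^sub>R e" and Hf: "mbr H f = (-2) *\<^sub>R f"
  defines "w \<equiv> nexp e (- 1 / x) ** nexp f x ** nexp e (- 1 / x)"
  shows "w ** H = - (H ** w)"
proof -
  let ?a = "nexp e (- 1 / x)" and ?b = "nexp f x" and ?c = "csmult (2 / x) e"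
  have fe: "mbr f e = - H" using mbr_anticomm[of f e] ef by simp
  have eH: "mbr e H = (-2) *\<^sub>R e" using mbr_anticomm[of e H] He by simp
  have fH: "mbr f H = 2 *\<^sub>R f" using mbr_anticomm[of f H] Hf by simp
  have ee: "mbr e e = 0" "mbr f f = 0" by (simp_all add: mbr_def)
  have A1: "mbr (csmult (- 1 / x) e) H = ?c"
    unfolding mbr_csmult eH using x by (simp add: vec_eq_iff scaleR_conv_of_real[where 'a = complex])
  have A2: "mbr (csmult (- 1 / x) e) ?c = 0" unfolding mbr_csmult ee by (simp add: vec_eq_iff)
  \<comment> \<open>The three factors of \<open>w\<close> carry \<open>H\<close> to H + (2/x) e,
    then to (2/x) e - H, and finally to -H.\<close>
  have 1: "?a ** H = (H + ?c) ** ?a"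
    using nil_exp_intertwine[OF nilpotent_csmult[OF e] A1 A2] by (simp add: nexp_def)
  have B1: "mbr (csmult x f) (H + ?c) = csmult (2 * x) f - 2 *\<^sub>R H"
    unfolding mbr_add mbr_csmult fH fe using x by (simp add: vec_eq_iff scaleR_conv_of_real[where 'a = complex])
  have B2: "mbr (csmult x f) (csmult (2 * x) f - 2 *\<^sub>R H) = csmult (- 4 * x) f"
    unfolding mbr_diff_right mbr_csmult mbr_scaleR ee fH by (simp add: vec_eq_iff scaleR_conv_of_real[where 'a = complex])
  have B3: "mbr (csmult x f) (csmult (- 4 * x) f) = 0" unfolding mbr_csmult ee by (simp add: vec_eq_iff)
  have "?b ** (H + ?c) = (H + ?c + (csmult (2 * x) f - 2 *\<^sub>R H) + (1/2) *\<^sub>R csmult (- 4 * x) f) ** ?b"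
    using nil_exp_intertwine[OF nilpotent_csmult[OF f] B1 B2 B3] by (simp add: nexp_def)
  also have "H + ?c + (csmult (2 * x) f - 2 *\<^sub>R H) + (1/2) *\<^sub>R csmult (- 4 * x) f = ?c - H"
    by (simp add: vec_eq_iff scaleR_conv_of_real[where 'a = complex])
  finally have 2: "?b ** (H + ?c) = (?c - H) ** ?b" .
  have C1: "mbr (csmult (- 1 / x) e) (?c - H) = - ?c" unfolding mbr_diff_right A1 A2 by simp
  have C2: "mbr (csmult (- 1 / x) e) (- ?c) = 0" unfolding mbr_uminus A2 by simp
  have 3: "?a ** (?c - H) = (- H) ** ?a"
    using nil_exp_intertwine[OF nilpotent_csmult[OF e] C1 C2] by (simp add: nexp_def)
  have "w ** H = ?a ** (?b ** (?a ** H))" by (simp only: w_def matrix_mul_assoc)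
  also have "\<dots> = ?a ** ((?b ** (H + ?c)) ** ?a)" unfolding 1 by (simp only: matrix_mul_assoc)
  also have "\<dots> = (?a ** (?c - H)) ** ?b ** ?a" unfolding 2 by (simp only: matrix_mul_assoc)
  also have "\<dots> = (- H) ** w" unfolding 3 by (simp only: w_def matrix_mul_assoc)
  also have "\<dots> = - (H ** w)" using matrix_scaleR_left[of "-1" H w] by simp
  finally show ?thesis .
qed

section \<open>Limits of periodic holomorphic families of subspaces\<close>

text \<open>There is no restriction on the real part, so limits along this filter are uniform in Re
  z.\<close>

abbreviation Im_top :: "complex filter" where "Im_top \<equiv> filtercomap Im at_top"

lemma eventually_Im_top: "eventually P Im_top \<longleftrightarrow> (\<exists>y0. \<forall>z. Im z > y0 \<longrightarrow> P z)"
proof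
  assume "eventually P Im_top"
  then obtain Q where Q: "eventually Q at_top" "\<And>z. Q (Im z) \<Longrightarrow> P z" by (auto simp: eventually_filtercomap)
  then obtain y0 where "\<And>y. y \<ge> y0 \<Longrightarrow> Q y" by (auto simp: eventually_at_top_linorder)
  then show "\<exists>y0. \<forall>z. Im z > y0 \<longrightarrow> P z" using Q(2) by (meson less_imp_le)
next
  assume "\<exists>y0. \<forall>z. Im z > y0 \<longrightarrow> P z"
  then obtain y0 where "\<And>z. Im z > y0 \<Longrightarrow> P z" by blast
  then show "eventually P Im_top"
    unfolding eventually_filtercomap by (intro exI[of _ "\<lambda>y. y > y0"]) (auto simp: eventually_gt_at_top)
qed

lemma Im_top_neq_bot: "Im_top \<noteq> bot"
proof
  assume "Im_top = bot"
  then have "eventually (\<lambda>_. False) Im_top" by simp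
  then obtain y0 where "\<And>z. Im z > y0 \<Longrightarrow> False" unfolding eventually_Im_top by blast
  from this[of "Complex 0 (y0 + 1)"] show False by simp
qed

lemma filterlim_Im_top: "filterlim Im at_top Im_top"
  by (rule filterlim_filtercomap)

lemma open_upper: "open {z. Im z > y0}"
  by (rule open_halfspace_Im_gt)

lemma periodic_int:
  assumes per: "\<And>z. Im z > y0 \<Longrightarrow> f (z + 1) = f z" and z: "Im z > y0"
  shows "f (z + of_int n) = f z"
proof -
  have nat: "f (w + of_nat m) = f w" if "Im w > y0" for w m
  proof (induction m)
    case (Suc m)
    have "f (w + of_nat (Suc m)) = f ((w + of_nat m) + 1)" by (simp add: algebra_simps)
    also have "\<dots> = f w" using per[of "w + of_nat m"] that Suc by simp
    finally show ?case .
  qed simp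
  show ?thesis
  proof (cases "n \<ge> 0")
    case True
    then show ?thesis using nat[OF z, of "nat n"] by simp
  next
    case False
    then have "f ((z + of_int n) + of_nat (nat (- n))) = f (z + of_int n)" using z by (intro nat) simp
    then show ?thesis using False by simp
  qed
qed

text \<open>Through the coordinate s = exp (2 pi i z), a periodic function tending to 0 extends
  holomorphically over s = 0 and vanishes there; hence it is O(exp (-2 pi Im z)).\<close>

lemma periodic_decay:
  fixes f :: "complex \<Rightarrow> complex"
  assumes hol: "f holomorphic_on {z. Im z > y0}"
    and per: "\<And>z. Im z > y0 \<Longrightarrow> f (z + 1) = f z"
    and lim: "(f \<longlongrightarrow> 0) Im_top"
  shows "((\<lambda>z. of_real (Im z) ^ M * f z) \<longlongrightarrow> 0) Im_top"
proof -
  define c where "c = 2 * of_real pi * \<i>"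
  have c0: "c \<noteq> 0" by (simp add: c_def)
  define r where "r = exp (- 2 * pi * y0)"
  have r: "r > 0" by (simp add: r_def)
  have ImL: "Im (w / c) = - ln (norm s) / (2 * pi)" if "exp w = s" for w s
  proof -
    have "norm s = exp (Re w)" using that by auto
    then show ?thesis by (simp add: c_def Im_divide power2_eq_square field_simps)
  qed
  have up: "Im (w / c) > y0" if "exp w = s" "norm s < r" for w s
  proof -
    have "norm s > 0" using that(1) by auto
    then have "ln (norm s) < ln r" using that(2) r by (simp add: ln_less_cancel_iff del: norm_eq_zero zero_less_norm_iff)
    then have "ln (norm s) < - 2 * pi * y0" by (simp add: r_def)
    then show ?thesis unfolding ImL[OF that(1)] by (simp add: field_simps)
  qed
  have same: "f (w / c) = f (w' / c)" if ww: "exp w = exp w'" "norm (exp w) < r" for w w'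
  proof -
    obtain n :: int where n: "w = w' + (of_int (2 * n) * pi) * \<i>" using ww(1) by (auto simp: exp_eq)
    have "w / c = w' / c + of_int n" unfolding n by (simp add: c_def field_simps)
    moreover have "Im (w' / c) > y0" using up[of w' "exp w"] ww by simp
    ultimately show ?thesis using periodic_int[of y0 f "w' / c" n] per by simp
  qed
  \<comment> \<open>The choice of the principal branch is harmless: by periodicity of
    \<open>f\<close> every logarithm of \<open>s\<close> gives the same value.\<close>
  define g where "g = (\<lambda>s. f (Ln s / c))"
  have gexp: "g (exp (c * z)) = f z" if "Im z > y0" for z
  proof -
    have "norm (exp (c * z)) < r" using that by (simp add: c_def r_def)
    then have "f (Ln (exp (c * z)) / c) = f ((c * z) / c)" by (intro same) auto
    then show ?thesis using c0 by (simp add: g_def)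
  qed
  have "g field_differentiable (at s)" if s: "s \<noteq> 0" "norm s < r" for s
  proof -
    have fd: "f field_differentiable (at z)" if "Im z > y0" for z
      using holomorphic_on_imp_differentiable_at[OF hol open_upper] that by blast
    \<comment> \<open>At points of the branch cut the logarithm is replaced by Ln(-u) + i pi, which
      is holomorphic there and yields the same function \<open>g\<close>.\<close>
    define b where "b = (if s \<in> \<real>\<^sub>\<le>\<^sub>0 then -1 else (1::complex))"
    define b' where "b' = (if s \<in> \<real>\<^sub>\<le>\<^sub>0 then of_real pi * \<i> else 0)"
    have b: "b * s \<notin> \<real>\<^sub>\<le>\<^sub>0" "exp b' = b" "b * b = 1"
    proof -
      show "b * s \<notin> \<real>\<^sub>\<le>\<^sub>0" using s(1) by (auto simp: b_def complex_nonpos_Reals_iff complex_eq_iff)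
      show "exp b' = b" by (simp add: b_def b'_def)
      show "b * b = 1" by (simp add: b_def)
    qed
    define G where "G = (\<lambda>u. f ((Ln (b * u) + b') / c))"
    have eL: "exp (Ln (b * u) + b') = u" if "u \<noteq> 0" for u
    proof -
      have "b * u \<noteq> 0" using that b(3) by auto
      then have "exp (Ln (b * u) + b') = b * u * b" by (simp add: exp_add b(2))
      then show ?thesis using b(3) by (simp add: mult_ac)
    qed
    have "G field_differentiable (at s)"
    proof -
      have "(\<lambda>u. (Ln (b * u) + b') / c) field_differentiable (at s)"
        using b(1) by (intro field_differentiable_divide field_differentiable_add field_differentiable_const
            field_differentiable_compose[where g = Ln and f = "\<lambda>u. b * u", unfolded o_def] field_differentiable_mult field_differentiable_ident field_differentiable_at_Ln c0) auto
      moreover have "f field_differentiable (at ((Ln (b * s) + b') / c))"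
        by (rule fd, rule up[OF eL]) (use s in auto)
      ultimately show ?thesis unfolding G_def by (rule field_differentiable_compose[unfolded o_def])
    qed
    then obtain D where D: "(G has_field_derivative D) (at s)" by (auto simp: field_differentiable_def)
    have "G u = g u" if "u \<in> ball 0 r - {0}" for u
      unfolding G_def g_def using that eL[of u] by (intro same) auto
    then have "(g has_field_derivative D) (at s)"
      using s by (intro has_field_derivative_transform_within_open[OF D, of "ball 0 r - {0}"]) (auto intro: open_delete)
    then show ?thesis by (auto simp: field_differentiable_def)
  qed
  then have gh: "g holomorphic_on ball 0 r - {0}"
    unfolding holomorphic_on_def by (auto intro: field_differentiable_at_within)
  have g0: "g \<midarrow>0\<rightarrow> 0"
  proof (rule tendstoI)
    fix e :: real assume "e > 0"
    then have "eventually (\<lambda>z. dist (f z) 0 < e) Im_top" using lim by (simp add: tendsto_iff)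
    then obtain y1 where y1: "\<And>z. Im z > y1 \<Longrightarrow> dist (f z) 0 < e" unfolding eventually_Im_top by blast
    have "dist (g s) 0 < e" if s: "s \<noteq> 0" "dist s 0 < exp (- 2 * pi * y1)" for s
    proof -
      have "ln (norm s) < ln (exp (- 2 * pi * y1))" using s by (subst ln_less_cancel_iff) auto
      then have "ln (norm s) < - 2 * pi * y1" by simp
      then have "Im (Ln s / c) > y1" unfolding ImL[OF exp_Ln[OF s(1)]] by (simp add: field_simps)
      then show ?thesis unfolding g_def by (rule y1)
    qed
    then show "\<forall>\<^sub>F s in at 0. dist (g s) 0 < e"
      unfolding eventually_at by (intro exI[of _ "exp (- 2 * pi * y1)"]) auto
  qed
  let ?g = "\<lambda>s. if s = 0 then 0 else g s"
  have "?g holomorphic_on ball 0 r" using removable_singularity[OF gh open_ball g0] .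
  then obtain D where "(?g has_field_derivative D) (at 0)"
    using r holomorphic_on_imp_differentiable_at[of ?g "ball 0 r" 0] by (auto simp: field_differentiable_def)
  then have "((\<lambda>s. (?g s - ?g 0) / (s - 0)) \<longlongrightarrow> D) (at 0)"
    by (simp add: has_field_derivative_iff)
  \<comment> \<open>So \<open>f\<close> is exp(c z) times a factor that converges, and exp(c z)
    beats every power of Im z.\<close>
  then have gs: "((\<lambda>s. ?g s / s) \<longlongrightarrow> D) (at 0)" by simp
  have M0: "((\<lambda>z. of_real (Im z) ^ M * exp (c * z)) \<longlongrightarrow> 0) Im_top" for M
  proof (rule tendsto_norm_zero_cancel)
    have "((\<lambda>y::real. y ^ M * exp (- 2 * pi * y)) \<longlongrightarrow> 0) at_top"
    proof -
      have "((\<lambda>y::real. y ^ M / exp y) \<longlongrightarrow> 0) at_top" by (rule tendsto_power_div_exp_0)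
      then have 1: "((\<lambda>y::real. y ^ M * exp (- y)) \<longlongrightarrow> 0) at_top" by (simp add: exp_minus field_simps)
      show ?thesis
      proof (rule Lim_null_comparison[OF _ 1])
        have "norm (y ^ M * exp (- 2 * pi * y)) \<le> y ^ M * exp (- y)" if "y \<ge> 0" for y :: real
        proof -
          have "1 * y \<le> 2 * pi * y" using that pi_gt3 by (intro mult_right_mono) auto
          then show ?thesis using that by (simp add: abs_mult mult_left_mono)
        qed
        then show "\<forall>\<^sub>F y in at_top. norm (y ^ M * exp (- 2 * pi * y)) \<le> y ^ M * exp (- y)"
          by (intro eventually_mono[OF eventually_ge_at_top[of 0]]) auto
      qed
    qed
    from filterlim_compose[OF this filterlim_Im_top]
    have "((\<lambda>z. Im z ^ M * exp (- 2 * pi * Im z)) \<longlongrightarrow> 0) Im_top" .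
    then have "((\<lambda>z. norm (Im z ^ M * exp (- 2 * pi * Im z))) \<longlongrightarrow> 0) Im_top" by (rule tendsto_norm_zero)
    then show "((\<lambda>z. norm (of_real (Im z) ^ M * exp (c * z))) \<longlongrightarrow> 0) Im_top"
      by (simp add: norm_mult norm_power c_def abs_mult power_abs)
  qed
  have "((\<lambda>z. exp (c * z)) \<longlongrightarrow> 0) Im_top" using M0[of 0] by simp
  then have "filterlim (\<lambda>z. exp (c * z)) (at 0) Im_top" by (simp add: filterlim_at)
  from filterlim_compose[OF gs this]
  have "((\<lambda>z. g (exp (c * z)) / exp (c * z)) \<longlongrightarrow> D) Im_top" by simp
  from tendsto_mult[OF M0[of M] this]
  have lim': "((\<lambda>z. of_real (Im z) ^ M * exp (c * z) * (g (exp (c * z)) / exp (c * z))) \<longlongrightarrow> 0) Im_top" by simp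
  have ev: "eventually (\<lambda>z. of_real (Im z) ^ M * exp (c * z) * (g (exp (c * z)) / exp (c * z)) = of_real (Im z) ^ M * f z) Im_top"
    unfolding eventually_Im_top by (intro exI[of _ y0]) (use gexp in auto)
  from Lim_transform_eventually[OF lim' ev] show ?thesis .
qed

text \<open>Cauchy's estimate on discs of radius one, which stay in the half plane when Im z is
  large.\<close>

lemma deriv_tendsto_0:
  fixes f :: "complex \<Rightarrow> complex"
  assumes hol: "f holomorphic_on {z. Im z > y0}" and lim: "(f \<longlongrightarrow> a) Im_top"
  shows "(deriv f \<longlongrightarrow> 0) Im_top"
proof (rule tendstoI)
  fix e :: real assume e: "e > 0"
  then have "eventually (\<lambda>z. dist (f z) a < e / 2) Im_top" using lim half_gt_zero[OF e] unfolding tendsto_iff by blast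
  then obtain y1 where y1: "\<And>z. Im z > y1 \<Longrightarrow> dist (f z) a < e / 2" unfolding eventually_Im_top by blast
  have "dist (deriv f z) 0 < e" if z: "Im z > max y0 y1 + 1" for z
  proof -
    have Imw: "Im w > max y0 y1" if "w \<in> cball z 1" for w
    proof -
      have "\<bar>Im z - Im w\<bar> \<le> 1" using that abs_Im_le_cmod[of "z - w"] by (simp add: dist_norm)
      then show ?thesis using z by linarith
    qed
    have sub: "cball z 1 \<subseteq> {z. Im z > y0}" using Imw by fastforce
    have "cmod ((deriv ^^ 1) f z) \<le> fact 1 * (e / 2) / 1 ^ 1"
    proof (rule Cauchy_higher_deriv_bound[where y = a])
      show "f holomorphic_on ball z 1" using holomorphic_on_subset[OF hol] sub by (metis ball_subset_cball subset_trans)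
      show "continuous_on (cball z 1) f" using holomorphic_on_imp_continuous_on[OF holomorphic_on_subset[OF hol sub]] .
      show "f w \<in> ball a (e / 2)" if "w \<in> ball z 1" for w
        using y1[of w] Imw[of w] that by (auto simp: dist_commute)
    qed auto
    then show ?thesis using e by simp
  qed
  then show "\<forall>\<^sub>F z in Im_top. dist (deriv f z) 0 < e" unfolding eventually_Im_top by blast
qed

text \<open>Cramer's rule presents the entries of the inverse as quotients of determinants, so that
  inversion visibly preserves limits and holomorphy.\<close>

lemma matrix_inv_entry:
  fixes A :: "complex^'n::finite^'n"
  assumes "det A \<noteq> 0"
  shows "matrix_inv A $ i $ j = det (\<chi> r c. if c = i then axis j 1 $ r else A $ r $ c) / det A"
proof -
  have "invertible A" using assms by (simp add: invertible_det_nz)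
  then have "A *v column j (matrix_inv A) = axis j 1"
    by (simp add: matrix_vector_mult_column matrix_inv_mult) (simp add: column_def mat_def axis_def vec_eq_iff)
  then have "column j (matrix_inv A) = (\<chi> k. det (\<chi> r c. if c = k then axis j 1 $ r else A $ r $ c) / det A)"
    using cramer[OF assms, of "column j (matrix_inv A)" "axis j 1"] by simp
  from arg_cong[OF this, of "\<lambda>v. v $ i"] show ?thesis by (simp add: column_def)
qed

lemma tendsto_det:
  fixes f :: "'a \<Rightarrow> complex^'n::finite^'n"
  assumes "(f \<longlongrightarrow> A) F"
  shows "((\<lambda>x. det (f x)) \<longlongrightarrow> det A) F"
  unfolding det_def by (intro tendsto_sum tendsto_mult tendsto_const tendsto_prod tendsto_matrix_nth[OF assms])

lemma tendsto_matrix_inv: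
  fixes f :: "'a \<Rightarrow> complex^'n::finite^'n"
  assumes f: "(f \<longlongrightarrow> A) F" and A: "invertible A"
  shows "eventually (\<lambda>x. invertible (f x)) F" "((\<lambda>x. matrix_inv (f x)) \<longlongrightarrow> matrix_inv A) F"
proof -
  have dA: "det A \<noteq> 0" using A by (simp add: invertible_det_nz)
  have ev: "eventually (\<lambda>x. det (f x) \<noteq> 0) F"
    by (rule tendsto_imp_eventually_ne[OF tendsto_det[OF f] dA])
  then show "eventually (\<lambda>x. invertible (f x)) F" by (simp add: invertible_det_nz)
  show "((\<lambda>x. matrix_inv (f x)) \<longlongrightarrow> matrix_inv A) F"
  proof (rule tendsto_matrixI)
    fix i j
    let ?R = "\<lambda>A. (\<chi> r c. if c = i then axis j 1 $ r else A $ r $ c) :: complex^'n^'n"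
    have "((\<lambda>x. ?R (f x)) \<longlongrightarrow> ?R A) F"
    proof (rule tendsto_matrixI)
      fix r c show "((\<lambda>x. ?R (f x) $ r $ c) \<longlongrightarrow> ?R A $ r $ c) F"
        by (cases "c = i") (simp_all add: tendsto_matrix_nth[OF f])
    qed
    then have "((\<lambda>x. det (?R (f x)) / det (f x)) \<longlongrightarrow> det (?R A) / det A) F"
      by (intro tendsto_divide tendsto_det f dA)
    moreover have "eventually (\<lambda>x. det (?R (f x)) / det (f x) = matrix_inv (f x) $ i $ j) F"
      using ev by (rule eventually_mono) (simp add: matrix_inv_entry)
    ultimately show "((\<lambda>x. matrix_inv (f x) $ i $ j) \<longlongrightarrow> matrix_inv A $ i $ j) F"
      unfolding matrix_inv_entry[OF dA] by (rule Lim_transform_eventually)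
  qed
qed

definition hol_matrix :: "(complex \<Rightarrow> complex^'n::finite^'n) \<Rightarrow> complex set \<Rightarrow> bool" where
  "hol_matrix f S \<longleftrightarrow> (\<forall>i j. (\<lambda>z. f z $ i $ j) holomorphic_on S)"

lemma hol_matrix_const: "hol_matrix (\<lambda>z. A) S"
  by (simp add: hol_matrix_def)

lemma hol_matrix_mult: "hol_matrix f S \<Longrightarrow> hol_matrix g S \<Longrightarrow> hol_matrix (\<lambda>z. f z ** g z) S"
  unfolding hol_matrix_def by (auto simp: matrix_matrix_mult_def intro!: holomorphic_intros)

lemma hol_det: "hol_matrix f S \<Longrightarrow> (\<lambda>z. det (f z)) holomorphic_on S"
  unfolding hol_matrix_def det_def by (auto intro!: holomorphic_intros)

lemma hol_matrix_inv:
  assumes f: "hol_matrix f S" and inv: "\<And>z. z \<in> S \<Longrightarrow> invertible (f z)"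
  shows "hol_matrix (\<lambda>z. matrix_inv (f z)) S"
  unfolding hol_matrix_def
proof (intro allI)
  fix i j
  have d: "det (f z) \<noteq> 0" if "z \<in> S" for z using inv[OF that] by (simp add: invertible_det_nz)
  have "hol_matrix (\<lambda>z. \<chi> r c. if c = i then axis j 1 $ r else f z $ r $ c) S"
    unfolding hol_matrix_def
  proof (intro allI)
    fix r c
    show "(\<lambda>z. (\<chi> r c. if c = i then axis j 1 $ r else f z $ r $ c) $ r $ c) holomorphic_on S"
      using f by (cases "c = i") (auto simp: hol_matrix_def)
  qed
  then have "(\<lambda>z. det (\<chi> r c. if c = i then axis j 1 $ r else f z $ r $ c) / det (f z)) holomorphic_on S"
    by (intro holomorphic_on_divide hol_det f d)
  then show "(\<lambda>z. matrix_inv (f z) $ i $ j) holomorphic_on S"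
    by (rule holomorphic_transform) (simp add: matrix_inv_entry d)
qed

section \<open>Families of subspaces as images of projections along a fixed complement\<close>

definition is_proj :: "complex^'n::finite^'n \<Rightarrow> (complex^'n) set \<Rightarrow> (complex^'n) set \<Rightarrow> bool" where
  "is_proj P S C \<longleftrightarrow> (\<forall>v. P *v v \<in> S \<and> v - P *v v \<in> C) \<and> (\<forall>v\<in>S. P *v v = v) \<and> (\<forall>v\<in>C. P *v v = 0)"

lemma is_proj_unique:
  assumes "is_proj P S C" "is_proj P' S C"
  shows "P = P'"
proof -
  have "P *v v = P' *v v" for v
  proof -
    have "P' *v (P *v v) = P *v v" "P' *v (v - P *v v) = 0" using assms by (auto simp: is_proj_def)
    then show ?thesis by (simp add: matrix_vector_mult_diff_distrib)
  qed
  then show ?thesis by (simp add: matrix_eq)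
qed

lemma is_proj_Int: "is_proj P S C \<Longrightarrow> v \<in> S \<Longrightarrow> v \<in> C \<Longrightarrow> v = 0"
  by (metis is_proj_def)

definition outer :: "complex^'n \<Rightarrow> complex^'n \<Rightarrow> complex^'n::finite^'n" where
  "outer u x = (\<chi> a b. u $ a * x $ b)"

lemma outer_mult: "outer u x *v v = (\<Sum>b\<in>UNIV. x $ b * v $ b) *s u"
  by (simp add: vec_eq_iff outer_def matrix_vector_mult_def sum_distrib_left sum_distrib_right mult_ac)

text \<open>The \<open>x i\<close> are coordinate functionals of the basis formed by the frame and a
  basis of \<open>C\<close>.\<close>

lemma dual_frame:
  fixes b0 :: "nat \<Rightarrow> complex^'n::finite"
  assumes ind: "vec.independent (b0 ` {..<d})" "inj_on b0 {..<d}" and C: "vec.subspace C"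
    and SC: "vec.span (b0 ` {..<d}) \<inter> C = {0}" and UN: "splus (vec.span (b0 ` {..<d})) C = UNIV"
  obtains x :: "nat \<Rightarrow> complex^'n" where "\<And>i l. i < d \<Longrightarrow> l < d \<Longrightarrow> (\<Sum>b\<in>UNIV. x i $ b * b0 l $ b) = (if i = l then 1 else 0)"
    "\<And>i v. i < d \<Longrightarrow> v \<in> C \<Longrightarrow> (\<Sum>b\<in>UNIV. x i $ b * v $ b) = 0"
proof -
  let ?S = "vec.span (b0 ` {..<d})"
  obtain Bc where Bc: "Bc \<subseteq> C" "vec.independent Bc" "C \<subseteq> vec.span Bc" "card Bc = vec.dim C"
    using vec.basis_exists by blast
  let ?B = "b0 ` {..<d} \<union> Bc"
  have sC: "C = vec.span Bc" using Bc C vec.span_minimal by blast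
  have spanB: "vec.span ?B = UNIV" using UN unfolding vec.span_Un sC splus_def by auto
  have finBc: "finite Bc" by (rule vec.finiteI_independent[OF Bc(2)])
  have dS: "vec.dim ?S = d"
    using vec.dim_span_eq_card_independent[OF ind(1)] card_image[OF ind(2)] by simp
  have "vec.dim (UNIV :: (complex^'n) set) = vec.dim ?S + vec.dim C"
    using dim_splus[OF vec.subspace_span C, of "b0 ` {..<d}"] SC UN by simp
  then have "card ?B \<le> vec.dim (UNIV :: (complex^'n) set)"
    using card_Un_le[of "b0 ` {..<d}" Bc] card_image[OF ind(2)] Bc(4) dS by simp
  then have indB: "vec.independent ?B"
    using spanB finBc by (intro vec.card_le_dim_spanning[of _ UNIV]) auto
  \<comment> \<open>Any index will do: a functional is realised as row \<open>a\<close> of an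
    endomorphism with values in that axis.\<close>
  define a :: 'n where "a = undefined"
  have "\<exists>x::complex^'n. (\<forall>l<d. (\<Sum>b\<in>UNIV. x $ b * b0 l $ b) = (if i = l then 1 else 0)) \<and> (\<forall>v\<in>C. (\<Sum>b\<in>UNIV. x $ b * v $ b) = 0)"
    if i: "i < d" for i
  proof -
    obtain T where T: "Vector_Spaces.linear (*s) (*s) T" "\<And>x. x \<in> ?B \<Longrightarrow> T x = (if x = b0 i then axis a 1 else 0 :: complex^'n)"
      using vec.linear_independent_extend[OF indB, of "\<lambda>x. if x = b0 i then axis a 1 else 0"] by auto
    define x where "x = matrix T $ a"
    have Tx: "T v $ a = (\<Sum>b\<in>UNIV. x $ b * v $ b)" for v
    proof -
      have "T v = matrix T *v v" using matrix_works[OF T(1)] by simp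
      then show ?thesis by (simp add: x_def matrix_vector_mult_def)
    qed
    have "(\<Sum>b\<in>UNIV. x $ b * b0 l $ b) = (if i = l then 1 else 0)" if l: "l < d" for l
    proof -
      have "b0 l = b0 i \<longleftrightarrow> i = l" using ind(2) i l by (auto simp: inj_on_def)
      then show ?thesis using T(2)[of "b0 l"] l by (simp add: Tx[symmetric])
    qed
    moreover have "(\<Sum>b\<in>UNIV. x $ b * v $ b) = 0" if v: "v \<in> C" for v
    proof -
      have "b0 i \<notin> Bc"
      proof
        assume "b0 i \<in> Bc"
        then have "b0 i \<in> ?S \<inter> C" using Bc(1) i by (auto intro: vec.span_base)
        then have "b0 i = 0" using SC by auto
        moreover have "b0 i \<in> b0 ` {..<d}" using i by auto
        ultimately show False using ind(1) vec.dependent_zero by metis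
      qed
      then have "T y = 0" if "y \<in> Bc" for y using T(2)[of y] that by auto
      then have "T v = 0" using vec.linear_eq_0_on_span[OF T(1), of Bc v] v sC by blast
      then show ?thesis by (simp add: Tx[symmetric])
    qed
    ultimately show ?thesis by blast
  qed
  then obtain x :: "nat \<Rightarrow> complex^'n" where "\<And>i. i < d \<Longrightarrow> (\<forall>l<d. (\<Sum>b\<in>UNIV. x i $ b * b0 l $ b) = (if i = l then 1 else 0)) \<and> (\<forall>v\<in>C. (\<Sum>b\<in>UNIV. x i $ b * v $ b) = 0)"
    by metis
  then show ?thesis using that by blast
qed

lemma is_proj_exists:
  fixes S C :: "(complex^'n::finite) set"
  assumes S: "vec.subspace S" and C: "vec.subspace C" and SC: "S \<inter> C = {0}" and UN: "splus S C = UNIV"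
  shows "\<exists>P. is_proj P S C"
proof -
  define f where "f = (\<lambda>v. THE s. s \<in> S \<and> v - s \<in> C)"
  have uniq: "s = s'" if "s \<in> S" "v - s \<in> C" "s' \<in> S" "v - s' \<in> C" for s s' v
  proof -
    have "s - s' \<in> S" using that vec.subspace_diff[OF S] by blast
    moreover have "s - s' = (v - s') - (v - s)" by simp
    then have "s - s' \<in> C" using that vec.subspace_diff[OF C] by metis
    ultimately have "s - s' \<in> S \<inter> C" by blast
    then have "s - s' = 0" unfolding SC by blast
    then show ?thesis by simp
  qed
  have f: "f v \<in> S \<and> v - f v \<in> C" for v
  proof -
    obtain s c where "s \<in> S" "c \<in> C" "v = s + c" using UN unfolding splus_def by blast
    then have s: "s \<in> S \<and> v - s \<in> C" by simp
    then have "\<exists>!s. s \<in> S \<and> v - s \<in> C"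
    proof (rule ex1I)
      fix t assume "t \<in> S \<and> v - t \<in> C"
      then show "t = s" using uniq[of t v s] s by blast
    qed
    then show ?thesis unfolding f_def by (rule theI')
  qed
  have feq: "f v = s" if "s \<in> S" "v - s \<in> C" for v s
    by (rule uniq[of "f v" v s]) (use f that in auto)
  have "Vector_Spaces.linear (*s) (*s) f"
  unfolding Vector_Spaces.linear_iff
  proof (intro conjI allI)
    fix x y show "f (x + y) = f x + f y"
      by (rule feq) (use f[of x] f[of y] vec.subspace_add[OF S] vec.subspace_add[OF C, of "x - f x" "y - f y"] in \<open>auto simp: algebra_simps\<close>)
  next
    fix c x show "f (c *s x) = c *s f x"
      by (rule feq) (use f[of x] vec.subspace_scale[OF S] vec.subspace_scale[OF C, of "x - f x" c] in \<open>auto simp: vec.scale_right_diff_distrib\<close>)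
  qed (rule vec.vector_space_axioms)+
  then have m: "matrix f *v v = f v" for v by (rule matrix_works)
  have "f v = v" if "v \<in> S" for v by (rule feq) (use that vec.subspace_0[OF C] in auto)
  moreover have "f v = 0" if "v \<in> C" for v by (rule feq) (use that vec.subspace_0[OF S] in auto)
  ultimately have "is_proj (matrix f) S C" unfolding is_proj_def m using f by blast
  then show ?thesis by blast
qed

text \<open>For \<open>x\<close> dual to \<open>b0\<close>, this is the map that sends each
  \<open>b0 i\<close> to \<open>b i\<close> and fixes the complement pointwise. It depends affinely
  on the frame \<open>b\<close>.\<close>

definition frame_map :: "nat \<Rightarrow> (nat \<Rightarrow> complex^'n) \<Rightarrow> (nat \<Rightarrow> complex^'n) \<Rightarrow> (nat \<Rightarrow> complex^'n) \<Rightarrow> complex^'n::finite^'n" where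
  "frame_map d x b0 b = mat 1 + (\<Sum>i<d. outer (b i - b0 i) (x i))"

lemma frame_map_entry: "frame_map d x b0 b $ k $ l = mat 1 $ k $ l + (\<Sum>i<d. (b i $ k - b0 i $ k) * x i $ l)"
  by (simp add: frame_map_def outer_def)

lemma sum_matrix_vec: "(\<Sum>l\<in>A. X l) *v v = (\<Sum>l\<in>A. X l *v (v :: complex^'n::finite))"
  for X :: "nat \<Rightarrow> complex^'n^'n"
  by (induction A rule: infinite_finite_induct) (auto simp: matrix_vector_mult_add_rdistrib)

text \<open>The frame map carries the decomposition for \<open>b0\<close> to the one for
  \<open>b\<close>, so conjugating by it gives the new projection, which inherits continuity and
  holomorphy from the frame.\<close>

lemma frame_map_proj:
  fixes x b0 b :: "nat \<Rightarrow> complex^'n::finite"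
  assumes x1: "\<And>i l. i < d \<Longrightarrow> l < d \<Longrightarrow> (\<Sum>b\<in>UNIV. x i $ b * b0 l $ b) = (if i = l then 1 else 0)"
    and x2: "\<And>i v. i < d \<Longrightarrow> v \<in> C \<Longrightarrow> (\<Sum>b\<in>UNIV. x i $ b * v $ b) = 0"
    and P: "is_proj P (vec.span (b0 ` {..<d})) C" and inv: "invertible (frame_map d x b0 b)" (is "invertible ?G")
  shows "is_proj (?G ** P ** matrix_inv ?G) (vec.span (b ` {..<d})) C"
proof -
  have Gb: "?G *v b0 l = b l" if "l < d" for l
  proof -
    have "(\<Sum>i<d. outer (b i - b0 i) (x i)) *v b0 l = (\<Sum>i<d. (if i = l then 1 else 0) *s (b i - b0 i))"
      unfolding sum_matrix_vec outer_mult by (rule sum.cong) (auto simp: x1 that)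
    also have "\<dots> = (\<Sum>i<d. if i = l then b i - b0 i else 0)" by (rule sum.cong) auto
    also have "\<dots> = b l - b0 l" using that by simp
    finally show ?thesis by (simp add: frame_map_def matrix_vector_mult_add_rdistrib)
  qed
  have Gc: "?G *v v = v" if "v \<in> C" for v
  proof -
    have "(\<Sum>i<d. outer (b i - b0 i) (x i)) *v v = (\<Sum>i<d. 0 *s (b i - b0 i))"
      unfolding sum_matrix_vec outer_mult by (rule sum.cong) (auto simp: x2 that)
    then show ?thesis by (simp add: frame_map_def matrix_vector_mult_add_rdistrib)
  qed
  let ?i = "matrix_inv ?G"
  note c = matrix_inv_cancel[OF inv]
  have "(*v) ?G ` b0 ` {..<d} = b ` {..<d}" using Gb by (force simp: image_iff)
  then have im: "vec.span (b ` {..<d}) = (*v) ?G ` vec.span (b0 ` {..<d})"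
    using vec.linear_span_image[OF matrix_vector_mul_linear_gen, of ?G "b0 ` {..<d}"] by simp
  have ic: "?i *v v = v" if "v \<in> C" for v using Gc[OF that] c(1)[of v] by simp
  have e: "(?G ** P ** ?i) *v v = ?G *v (P *v (?i *v v))" for v by (simp only: matrix_vector_mul_assoc matrix_mul_assoc)
  show ?thesis unfolding is_proj_def e
  proof (intro conjI allI ballI)
    fix v show "?G *v (P *v (?i *v v)) \<in> vec.span (b ` {..<d})" unfolding im using P by (auto simp: is_proj_def)
    have "?i *v v - P *v (?i *v v) \<in> C" using P by (auto simp: is_proj_def)
    then have "?G *v (?i *v v - P *v (?i *v v)) \<in> C" using Gc by simp
    then show "v - ?G *v (P *v (?i *v v)) \<in> C" by (simp add: matrix_vector_mult_diff_distrib c)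
  next
    fix v assume "v \<in> vec.span (b ` {..<d})"
    then obtain w where w: "w \<in> vec.span (b0 ` {..<d})" "v = ?G *v w" unfolding im by blast
    then show "?G *v (P *v (?i *v v)) = v" using P by (simp add: c is_proj_def)
  next
    fix v assume "v \<in> C"
    then show "?G *v (P *v (?i *v v)) = 0" using P by (simp add: ic is_proj_def)
  qed
qed

text \<open>Frames are not canonical, but the projection along a fixed complement is. Convergence in
  the Grassmannian thus becomes convergence of matrices.\<close>

lemma subspace_tendsto_proj:
  fixes S0 :: "(complex^'n::finite) set"
  assumes lim: "subspace_tendsto S S0 L" and C: "vec.subspace C" and P0: "is_proj P0 S0 C"
    and UN: "splus S0 C = UNIV"
  shows "\<exists>P. eventually (\<lambda>x. is_proj (P x) (S x) C) L \<and> (P \<longlongrightarrow> P0) L"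
proof -
  obtain d b b0 where *: "vec.dim S0 = d \<and> vec.independent (b0 ` {..<d}) \<and> inj_on b0 {..<d}
       \<and> vec.span (b0 ` {..<d}) = S0
       \<and> (\<forall>i<d. ((\<lambda>x. b i x) \<longlongrightarrow> b0 i) L)
       \<and> (\<forall>\<^sub>F x in L. vec.span ((\<lambda>i. b i x) ` {..<d}) = S x)"
    using lim unfolding subspace_tendsto_def by (elim exE) (rule that)
  then have ind: "vec.independent (b0 ` {..<d})" "inj_on b0 {..<d}" and S0: "vec.span (b0 ` {..<d}) = S0"
    and b: "\<forall>i<d. ((\<lambda>x. b i x) \<longlongrightarrow> b0 i) L" and S: "\<forall>\<^sub>F x in L. vec.span ((\<lambda>i. b i x) ` {..<d}) = S x"
    by auto
  have "vec.span (b0 ` {..<d}) \<inter> C = {0}" unfolding S0 using is_proj_Int[OF P0] vec.subspace_0[OF C] S0 vec.span_zero by blast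
  then obtain x :: "nat \<Rightarrow> complex^'n" where x: "\<And>i l. i < d \<Longrightarrow> l < d \<Longrightarrow> (\<Sum>b\<in>UNIV. x i $ b * b0 l $ b) = (if i = l then 1 else 0)"
    "\<And>i v. i < d \<Longrightarrow> v \<in> C \<Longrightarrow> (\<Sum>b\<in>UNIV. x i $ b * v $ b) = 0"
    using dual_frame[OF ind C] UN S0 by metis
  define G where "G = (\<lambda>y. frame_map d x b0 (\<lambda>i. b i y))"
  have Gl: "(G \<longlongrightarrow> mat 1) L"
  proof (rule tendsto_matrixI)
    fix k l
    have "((\<lambda>y. mat 1 $ k $ l + (\<Sum>i<d. (b i y $ k - b0 i $ k) * x i $ l)) \<longlongrightarrow> mat 1 $ k $ l + (\<Sum>i<d. (b0 i $ k - b0 i $ k) * x i $ l)) L"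
      by (intro tendsto_add tendsto_const tendsto_sum tendsto_mult tendsto_diff tendsto_vec_nth b[rule_format]) auto
    then show "((\<lambda>y. G y $ k $ l) \<longlongrightarrow> mat 1 $ k $ l) L" by (simp add: G_def frame_map_entry)
  qed
  have inv1: "invertible (mat 1 :: complex^'n^'n)" "matrix_inv (mat 1) = (mat 1 :: complex^'n^'n)"
  proof -
    show i: "invertible (mat 1 :: complex^'n^'n)" unfolding invertible_def by (intro exI[of _ "mat 1"]) simp
    show "matrix_inv (mat 1) = (mat 1 :: complex^'n^'n)" using matrix_inv_mult(1)[OF i] by simp
  qed
  note Gi = tendsto_matrix_inv[OF Gl inv1(1), unfolded inv1(2)]
  define P where "P = (\<lambda>y. G y ** P0 ** matrix_inv (G y))"
  have "(P \<longlongrightarrow> mat 1 ** P0 ** mat 1) L" unfolding P_def by (intro tendsto_matrix_mult Gl Gi tendsto_const)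
  moreover have "eventually (\<lambda>y. is_proj (P y) (S y) C) L"
    using S Gi(1)
  proof eventually_elim
    case (elim y)
    have "is_proj (P y) (vec.span ((\<lambda>i. b i y) ` {..<d})) C"
      unfolding P_def G_def by (rule frame_map_proj[OF x]) (use P0 S0 elim in \<open>auto simp: G_def\<close>)
    then show ?case using elim by simp
  qed
  ultimately show ?thesis by auto
qed

lemma dim_Int_le_of_complement:
  fixes S S0 V :: "(complex^'n::finite) set"
  assumes "vec.subspace S" "vec.subspace V" "vec.subspace D" "D \<subseteq> V" "S \<inter> D = {0}"
    and "vec.dim S0 + vec.dim D = vec.dim V"
  shows "vec.dim (S \<inter> V) \<le> vec.dim S0"
proof -
  have sI: "vec.subspace (S \<inter> V)" using assms by (intro vec.subspace_inter)
  have "S \<inter> V \<inter> D \<subseteq> {0}" using assms(5) by blast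
  then have "vec.dim (S \<inter> V \<inter> D) = 0" by (simp add: vec.dim_eq_0)
  then have "vec.dim (splus (S \<inter> V) D) = vec.dim (S \<inter> V) + vec.dim D" using dim_splus[OF sI assms(3)] by linarith
  moreover have "splus (S \<inter> V) D \<subseteq> V" unfolding splus_def using assms(2,4) vec.subspace_add by blast
  then have "vec.dim (splus (S \<inter> V) D) \<le> vec.dim V" by (rule vec.dim_subset)
  ultimately show ?thesis using assms(6) by simp
qed

text \<open>The complement \<open>C\<close> of \<open>S0\<close> is made to contain a complement
  \<open>D\<close> of \<open>S0 \<inter> V\<close> in \<open>V\<close>. A subspace near
  \<open>S0\<close> still misses \<open>C\<close>, hence \<open>D\<close>, and this bounds the
  dimension of its intersection with \<open>V\<close>: semicontinuity.\<close>

lemma complement_through: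
  fixes S0 V :: "(complex^'n::finite) set"
  assumes S0: "vec.subspace S0" and V: "vec.subspace V"
  obtains C D where "vec.subspace C" "vec.subspace D" "D \<subseteq> C" "D \<subseteq> V" "S0 \<inter> C = {0}" "splus S0 C = UNIV"
    "vec.dim (S0 \<inter> V) + vec.dim D = vec.dim V"
proof -
  have sI: "vec.subspace (S0 \<inter> V)" using assms by (intro vec.subspace_inter)
  obtain D where D: "vec.subspace D" "D \<subseteq> V" "S0 \<inter> V \<inter> D = {0}" "vec.dim (S0 \<inter> V) + vec.dim D = vec.dim V"
    using subspace_complement[OF sI V] by (metis Int_lower2)
  have sSD: "vec.subspace (splus S0 D)" by (rule subspace_splus[OF S0 D(1)])
  obtain E where E: "vec.subspace E" "splus S0 D \<inter> E = {0}" "splus (splus S0 D) E = UNIV"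
    using subspace_complement[OF sSD vec.subspace_UNIV] by (metis subset_UNIV)
  have "S0 \<inter> splus D E = {0}"
  proof -
    have "v = 0" if v: "v \<in> S0" "v \<in> splus D E" for v
    proof -
      obtain x e where xe: "x \<in> D" "e \<in> E" "v = x + e" using v(2) unfolding splus_def by blast
      have "- x \<in> D" using vec.subspace_neg[OF D(1) xe(1)] .
      moreover have "e = v + - x" using xe(3) by simp
      ultimately have "e \<in> splus S0 D" unfolding splus_def using v(1) by blast
      then have "e = 0" using E(2) xe(2) by blast
      then have "v \<in> D" using xe by simp
      then have "v \<in> S0 \<inter> V \<inter> D" using v(1) D(2) by blast
      then show ?thesis using D(3) by blast
    qed
    moreover have "0 \<in> splus D E" by (rule vec.subspace_0[OF subspace_splus[OF D(1) E(1)]])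
    ultimately show ?thesis using vec.subspace_0[OF S0] by blast
  qed
  moreover have "splus S0 (splus D E) = UNIV"
  proof -
    have "v \<in> splus S0 (splus D E)" for v
    proof -
      have "v \<in> splus (splus S0 D) E" using E(3) by simp
      then obtain s x e where "s \<in> S0" "x \<in> D" "e \<in> E" "v = (s + x) + e" unfolding splus_def by blast
      then show ?thesis unfolding splus_def using add.assoc by blast
    qed
    then show ?thesis by blast
  qed
  moreover have "D \<subseteq> splus D E"
  proof
    fix x assume "x \<in> D"
    then have "x + 0 \<in> splus D E" unfolding splus_def using vec.subspace_0[OF E(1)] by blast
    then show "x \<in> splus D E" by simp
  qed
  ultimately show ?thesis using that[OF subspace_splus[OF D(1) E(1)] D(1)] D by blast
qed

lemma is_proj_splus: "is_proj P S C \<Longrightarrow> splus S C = UNIV"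
proof -
  assume P: "is_proj P S C"
  have "v \<in> splus S C" for v
  proof -
    have "P *v v + (v - P *v v) \<in> splus S C" using P unfolding is_proj_def splus_def by blast
    then show ?thesis by simp
  qed
  then show ?thesis by blast
qed

section \<open>The weight filtration in the limit\<close>

locale variation =
  fixes F :: "complex \<Rightarrow> 'n::finite filt" and W G M :: "'n filt" and N :: "complex^'n^'n"
  assumes mhsF: "\<And>z. Im z > 0 \<Longrightarrow> is_mhs (F z) W"
    and hor: "hol_horizontal F {z. Im z > 0}"
    and mono: "\<And>z. Im z > 0 \<Longrightarrow> F (z + 1) = filt_act (nil_exp N) (F z)"
    and Nreal: "real_matrix N" and Nnil: "nilpotent_mat N" and NW: "\<And>k v. v \<in> W k \<Longrightarrow> N *v v \<in> W k"
    and lim: "filt_tendsto (\<lambda>z. filt_act (nexp N (- z)) (F z)) G Im_top"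
    and rel: "rel_weight_filt N W M" and mhsG: "is_mhs G M"
begin

sublocale g: mhs G M by unfold_locales (rule mhsG)

definition Ft :: "complex \<Rightarrow> 'n filt" where "Ft z = filt_act (nexp N (- z)) (F z)"

lemma Ft_eq: "Ft z a = (*v) (nexp N (- z)) ` F z a"
  by (simp add: Ft_def filt_act_def)

lemma subF: "Im z > 0 \<Longrightarrow> vec.subspace (F z a)"
  using mhs.sF[OF mhs.intro[OF mhsF]] .

lemma subFt: "Im z > 0 \<Longrightarrow> vec.subspace (Ft z a)"
  unfolding Ft_eq by (intro subspace_matrix_image subF)

lemma Ft_mono: "Im z > 0 \<Longrightarrow> a \<le> b \<Longrightarrow> Ft z b \<subseteq> Ft z a"
  unfolding Ft_eq using decr_filt_mono[OF mhs.filtF[OF mhs.intro[OF mhsF]]] by (intro image_mono) blast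

lemma subW: "vec.subspace (W k)" and filtW: "incr_filt W"
proof -
  have "incr_filt W" using mhs.filtW[OF mhs.intro[OF mhsF[of \<i>]]] by simp
  then show "incr_filt W" "vec.subspace (W k)" by (auto intro: incr_filt_subspace)
qed

lemma Ft_periodic:
  assumes "Im z > 0"
  shows "Ft (z + 1) a = Ft z a"
proof -
  have "nil_exp N = nexp N 1" unfolding nexp_def by (rule arg_cong[of _ _ nil_exp]) (simp add: vec_eq_iff)
  then have "Ft (z + 1) a = (*v) (nexp N (- (z + 1)) ** nexp N 1) ` F z a"
    unfolding Ft_eq mono[OF assms] filt_act_def by (auto simp: image_image matrix_vector_mul_assoc)
  also have "nexp N (- (z + 1)) ** nexp N 1 = nexp N (- z)" using nexp_add[OF Nnil, of "- (z + 1)" 1] by simp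
  finally show ?thesis by (simp add: Ft_eq)
qed

lemma dim_Ft_W: "vec.dim (Ft z a \<inter> W m) = vec.dim (F z a \<inter> W m)"
proof -
  have W: "nexp N w *v v \<in> W m" if "v \<in> W m" for v w by (rule nil_exp_preserves[OF subW NW that])
  have "Ft z a \<inter> W m = (*v) (nexp N (- z)) ` (F z a \<inter> W m)"
  proof
    show "(*v) (nexp N (- z)) ` (F z a \<inter> W m) \<subseteq> Ft z a \<inter> W m" unfolding Ft_eq using W by auto
    show "Ft z a \<inter> W m \<subseteq> (*v) (nexp N (- z)) ` (F z a \<inter> W m)"
    proof
      fix x assume x: "x \<in> Ft z a \<inter> W m"
      then obtain v where v: "v \<in> F z a" "x = nexp N (- z) *v v" unfolding Ft_eq by auto
      have "nexp N z *v x = v" by (simp add: v(2) matrix_vector_mul_assoc nexp_inverse[OF Nnil])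
      then have "v \<in> W m" using W[of x z] x by auto
      then show "x \<in> (*v) (nexp N (- z)) ` (F z a \<inter> W m)" using v by auto
    qed
  qed
  then show ?thesis by (simp add: dim_matrix_image[OF invertible_nexp[OF Nnil]])
qed

lemma lim_sub: "subspace_tendsto (\<lambda>z. Ft z a) (G a) Im_top"
  using lim unfolding filt_tendsto_def Ft_def by blast

lemma nexp_hol: "(\<lambda>z. nexp N (- z) $ k $ l) holomorphic_on A"
  unfolding nexp_entry by (intro holomorphic_intros) auto

lemma frame:
  assumes "Im z0 > 0"
  obtains A d and b :: "nat \<Rightarrow> complex \<Rightarrow> complex^'n" where "open A" "z0 \<in> A"
    "\<And>i j. i < d \<Longrightarrow> (\<lambda>w. b i w $ j) holomorphic_on A"
    "\<And>z. z \<in> A \<Longrightarrow> vec.independent ((\<lambda>i. b i z) ` {..<d})" "\<And>z. z \<in> A \<Longrightarrow> inj_on (\<lambda>i. b i z) {..<d}"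
    "\<And>z. z \<in> A \<Longrightarrow> vec.span ((\<lambda>i. b i z) ` {..<d}) = F z a"
    "\<And>z i. z \<in> A \<Longrightarrow> i < d \<Longrightarrow> vderiv (b i) z \<in> F z (a - 1)"
proof -
  have "\<exists>A (d::nat) b. open A \<and> z0 \<in> A \<and> A \<subseteq> {z. Im z > 0}
      \<and> (\<forall>i<d. \<forall>j. (\<lambda>w. b i w $ j) holomorphic_on A)
      \<and> (\<forall>z\<in>A. vec.independent ((\<lambda>i. b i z) ` {..<d}) \<and> inj_on (\<lambda>i. b i z) {..<d}
               \<and> vec.span ((\<lambda>i. b i z) ` {..<d}) = F z a
               \<and> (\<forall>i<d. vderiv (b i) z \<in> F z (a - 1)))"
    using hor assms unfolding hol_horizontal_def by simp
  then obtain A d and b :: "nat \<Rightarrow> complex \<Rightarrow> complex^'n" where "open A \<and> z0 \<in> A \<and> A \<subseteq> {z. Im z > 0}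
      \<and> (\<forall>i<d. \<forall>j. (\<lambda>w. b i w $ j) holomorphic_on A)
      \<and> (\<forall>z\<in>A. vec.independent ((\<lambda>i. b i z) ` {..<d}) \<and> inj_on (\<lambda>i. b i z) {..<d}
               \<and> vec.span ((\<lambda>i. b i z) ` {..<d}) = F z a
               \<and> (\<forall>i<d. vderiv (b i) z \<in> F z (a - 1)))"
    by (elim exE) (rule that)
  then show ?thesis using that[of A d b] by simp
qed

text \<open>Near any point, \<open>Pr\<close> is its value there conjugated by a holomorphic frame
  map, hence holomorphic. Projections are unique, so no choice of frame enters and \<open>Pr\<close>
  inherits the periodicity of \<open>Ft\<close>.\<close>

lemma proj_family:
  assumes C: "vec.subspace C" and P0: "is_proj P0 (G a) C"
  obtains y0 Pr where "y0 \<ge> 0" "\<And>z. Im z > y0 \<Longrightarrow> is_proj (Pr z) (Ft z a) C" "hol_matrix Pr {z. Im z > y0}"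
    "\<And>z. Im z > y0 \<Longrightarrow> Pr (z + 1) = Pr z" "(Pr \<longlongrightarrow> P0) Im_top"
proof -
  obtain Pr where Pr: "eventually (\<lambda>z. is_proj (Pr z) (Ft z a) C) Im_top" "(Pr \<longlongrightarrow> P0) Im_top"
    using subspace_tendsto_proj[OF lim_sub C P0 is_proj_splus[OF P0]] by blast
  obtain y1 where y1: "\<And>z. Im z > y1 \<Longrightarrow> is_proj (Pr z) (Ft z a) C" using Pr(1) unfolding eventually_Im_top by blast
  define y0 where "y0 = max 0 y1"
  have pr: "is_proj (Pr z) (Ft z a) C" if "Im z > y0" for z using y1 that by (simp add: y0_def)
  have per: "Pr (z + 1) = Pr z" if z: "Im z > y0" for z
    using is_proj_unique[of "Pr (z + 1)" "Ft z a" C "Pr z"] pr[of z] pr[of "z + 1"] z Ft_periodic[of z a] by (simp add: y0_def)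
  have "(\<lambda>z. Pr z $ k $ l) field_differentiable (at z0)" if z0: "Im z0 > y0" for z0 k l
  proof -
    have z0': "Im z0 > 0" using z0 by (simp add: y0_def)
    obtain A d and b :: "nat \<Rightarrow> complex \<Rightarrow> complex^'n" where A: "open A" "z0 \<in> A"
      and bh: "\<And>i j. i < d \<Longrightarrow> (\<lambda>w. b i w $ j) holomorphic_on A"
      and bi: "\<And>z. z \<in> A \<Longrightarrow> vec.independent ((\<lambda>i. b i z) ` {..<d})" "\<And>z. z \<in> A \<Longrightarrow> inj_on (\<lambda>i. b i z) {..<d}"
      and b: "\<And>z. z \<in> A \<Longrightarrow> vec.span ((\<lambda>i. b i z) ` {..<d}) = F z a"
      and bd: "\<And>z i. z \<in> A \<Longrightarrow> i < d \<Longrightarrow> vderiv (b i) z \<in> F z (a - 1)"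
      by (rule frame[OF z0', where a = a]) (rule that)
    define c where "c = (\<lambda>i z. nexp N (- z) *v b i z)"
    have cspan: "vec.span ((\<lambda>i. c i z) ` {..<d}) = Ft z a" if "z \<in> A" for z
    proof -
      have "(\<lambda>i. c i z) ` {..<d} = (*v) (nexp N (- z)) ` (\<lambda>i. b i z) ` {..<d}" by (simp add: c_def image_image)
      then show ?thesis unfolding Ft_eq using b[OF that]
        vec.linear_span_image[OF matrix_vector_mul_linear_gen, of "nexp N (- z)" "(\<lambda>i. b i z) ` {..<d}"] by simp
    qed
    let ?c0 = "\<lambda>i. c i z0"
    have injn: "inj ((*v) (nexp N (- z0)))" using matrix_inv_cancel(1)[OF invertible_nexp[OF Nnil]] by (metis injI)
    have cind: "vec.independent (?c0 ` {..<d})"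
    proof -
      have "?c0 ` {..<d} = (*v) (nexp N (- z0)) ` (\<lambda>i. b i z0) ` {..<d}" by (simp add: c_def image_image)
      then show ?thesis using vec.linear_independent_injective_image[OF matrix_vector_mul_linear_gen bi(1)[OF A(2)] inj_on_subset[OF injn]] by simp
    qed
    have cinj: "inj_on ?c0 {..<d}"
      using bi(2)[OF A(2)] injn unfolding c_def inj_on_def by blast
    have SC: "vec.span (?c0 ` {..<d}) \<inter> C = {0}"
      unfolding cspan[OF A(2)] using is_proj_Int[OF pr[OF z0]] vec.subspace_0[OF C] vec.subspace_0[OF subFt[OF z0']] by blast
    have UN: "splus (vec.span (?c0 ` {..<d})) C = UNIV" unfolding cspan[OF A(2)] by (rule is_proj_splus[OF pr[OF z0]])
    obtain x :: "nat \<Rightarrow> complex^'n" where x: "\<And>i l. i < d \<Longrightarrow> l < d \<Longrightarrow> (\<Sum>b\<in>UNIV. x i $ b * ?c0 l $ b) = (if i = l then 1 else 0)"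
      "\<And>i v. i < d \<Longrightarrow> v \<in> C \<Longrightarrow> (\<Sum>b\<in>UNIV. x i $ b * v $ b) = 0"
      using dual_frame[OF cind cinj C SC UN] by metis
    \<comment> \<open>It equals 1 at \<open>z0\<close> and is therefore invertible on the
      neighbourhood \<open>A'\<close>, where it transports the projection.\<close>
    define H where "H = (\<lambda>z. frame_map d x ?c0 (\<lambda>i. c i z))"
    have Hh: "hol_matrix H A"
      unfolding hol_matrix_def H_def frame_map_entry c_def matrix_vector_mult_def
      by (auto intro!: holomorphic_intros nexp_hol bh)
    have H1: "H z0 = mat 1" by (simp add: H_def frame_map_def outer_def vec_eq_iff)
    define A' where "A' = (A \<inter> (\<lambda>z. det (H z)) -` (- {0})) \<inter> {z. Im z > y0}"
    have "continuous_on A (\<lambda>z. det (H z))" by (rule holomorphic_on_imp_continuous_on[OF hol_det[OF Hh]])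
    then have "open (A \<inter> (\<lambda>z. det (H z)) -` (- {0}))" by (rule continuous_open_preimage) (use A in auto)
    then have A': "open A'" unfolding A'_def by (rule open_Int) (rule open_upper)
    have z0A: "z0 \<in> A'" using A z0 H1 by (simp add: A'_def)
    have "Pr z = H z ** Pr z0 ** matrix_inv (H z)" if z: "z \<in> A'" for z
    proof (rule is_proj_unique)
      show "is_proj (Pr z) (Ft z a) C" using pr z by (simp add: A'_def)
      have "is_proj (H z ** Pr z0 ** matrix_inv (H z)) (vec.span ((\<lambda>i. c i z) ` {..<d})) C"
        unfolding H_def
        by (rule frame_map_proj[OF x]) (use pr[OF z0] cspan[OF A(2)] z in \<open>auto simp: A'_def H_def invertible_det_nz\<close>)
      then show "is_proj (H z ** Pr z0 ** matrix_inv (H z)) (Ft z a) C" using cspan z by (simp add: A'_def)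
    qed
    moreover have "hol_matrix (\<lambda>z. H z ** Pr z0 ** matrix_inv (H z)) A'"
    proof -
      have "hol_matrix H A'" using Hh unfolding hol_matrix_def A'_def by (blast intro: holomorphic_on_subset)
      then show ?thesis by (intro hol_matrix_mult hol_matrix_const hol_matrix_inv) (auto simp: A'_def invertible_det_nz)
    qed
    then have "(\<lambda>z. (H z ** Pr z0 ** matrix_inv (H z)) $ k $ l) holomorphic_on A'" by (simp add: hol_matrix_def)
    ultimately have "(\<lambda>z. Pr z $ k $ l) holomorphic_on A'" by (auto elim!: holomorphic_transform)
    then show ?thesis using A' z0A by (rule holomorphic_on_imp_differentiable_at)
  qed
  then have "hol_matrix Pr {z. Im z > y0}"
    unfolding hol_matrix_def holomorphic_on_def by (auto intro: field_differentiable_at_within)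
  then show ?thesis using that[of y0 Pr] pr per Pr(2) by (simp add: y0_def)
qed

lemma proj_G_exists: "\<exists>P C. vec.subspace C \<and> is_proj P (G a) C"
proof -
  obtain C where C: "vec.subspace C" "G a \<inter> C = {0}" "splus (G a) C = UNIV"
    using subspace_complement[OF g.sF vec.subspace_UNIV] by (metis subset_UNIV)
  then show ?thesis using is_proj_exists[OF g.sF C] by blast
qed

text \<open>Let D be the derivative of the projection onto \<open>Ft z a\<close>. Horizontality says
  that D + N maps \<open>Ft z a\<close> into \<open>Ft z (a - 1)\<close>; as D tends to 0, the same
  holds for N in the limit.\<close>

lemma N_G:
  assumes v: "v \<in> G a"
  shows "N *v v \<in> G (a - 1)"
proof -
  obtain P C where PC: "vec.subspace C" "is_proj P (G a) C" using proj_G_exists by blast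
  obtain P1 C1 where PC1: "vec.subspace C1" "is_proj P1 (G (a - 1)) C1" using proj_G_exists by blast
  obtain y0 Pr where y0: "y0 \<ge> 0" and pr: "\<And>z. Im z > y0 \<Longrightarrow> is_proj (Pr z) (Ft z a) C" and h: "hol_matrix Pr {z. Im z > y0}"
    and l: "(Pr \<longlongrightarrow> P) Im_top" using proj_family[OF PC] by metis
  obtain y1 Pr1 where y1: "y1 \<ge> 0" and pr1: "\<And>z. Im z > y1 \<Longrightarrow> is_proj (Pr1 z) (Ft z (a - 1)) C1" and l1: "(Pr1 \<longlongrightarrow> P1) Im_top"
    using proj_family[OF PC1] by metis
  define D where "D = (\<lambda>z. (\<chi> i j. deriv (\<lambda>w. Pr w $ i $ j) z) :: complex^'n^'n)"
  have D0: "(D \<longlongrightarrow> 0) Im_top"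
  proof (rule tendsto_matrixI)
    fix i j
    have "(deriv (\<lambda>w. Pr w $ i $ j) \<longlongrightarrow> 0) Im_top"
      by (rule deriv_tendsto_0[where ?y0.0 = y0, OF _ tendsto_matrix_nth[OF l]]) (use h in \<open>simp add: hol_matrix_def\<close>)
    then show "((\<lambda>z. D z $ i $ j) \<longlongrightarrow> 0 $ i $ j) Im_top" by (simp add: D_def)
  qed
  have key: "Pr1 z ** ((D z + N) ** Pr z) = (D z + N) ** Pr z" if z: "Im z > max y0 y1" for z
  proof -
    have z0: "Im z > 0" "Im z > y0" "Im z > y1" using z y0 by auto
    obtain A d and b :: "nat \<Rightarrow> complex \<Rightarrow> complex^'n" where A: "open A" "z \<in> A"
      and bh: "\<And>i j. i < d \<Longrightarrow> (\<lambda>w. b i w $ j) holomorphic_on A"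
      and bi: "\<And>z. z \<in> A \<Longrightarrow> vec.independent ((\<lambda>i. b i z) ` {..<d})" "\<And>z. z \<in> A \<Longrightarrow> inj_on (\<lambda>i. b i z) {..<d}"
      and b: "\<And>z. z \<in> A \<Longrightarrow> vec.span ((\<lambda>i. b i z) ` {..<d}) = F z a"
      and bd: "\<And>z i. z \<in> A \<Longrightarrow> i < d \<Longrightarrow> vderiv (b i) z \<in> F z (a - 1)"
      by (rule frame[OF z0(1), where a = a]) (rule that)
    define c where "c = (\<lambda>i w. nexp N (- w) *v b i w)"
    have cF: "c i w \<in> Ft w a" if "w \<in> A" "i < d" for i w
    proof -
      have "b i w \<in> F w a" using b[OF that(1)] that(2) vec.span_base[of "b i w" "(\<lambda>i. b i w) ` {..<d}"] by auto
      then show ?thesis unfolding Ft_eq c_def by blast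
    qed
    have cD: "(D z + N) *v c i z \<in> Ft z (a - 1)" if i: "i < d" for i
    proof -
      \<comment> \<open>The derivative of the untwisted frame vector \<open>c i\<close>, as
        \<open>dc\<close> confirms. Horizontality places its first term in the step
        \<open>a - 1\<close>.\<close>
      define v' where "v' = nexp N (- z) *v vderiv (b i) z - N *v c i z"
      have db: "((\<lambda>w. b i w $ m) has_field_derivative vderiv (b i) z $ m) (at z)" for m
        unfolding vderiv_def using holomorphic_derivI[OF bh[OF i] A] by simp
      have dn: "((\<lambda>w. nexp N (- w) $ k $ m) has_field_derivative - (N ** nexp N (- z)) $ k $ m) (at z)" for k m
      proof -
        have "((\<lambda>w. nexp N (- w) $ k $ m) has_field_derivative (N ** nexp N (- z)) $ k $ m * (- 1)) (at z)"
          by (rule DERIV_chain2[where g = uminus, OF nexp_deriv[OF Nnil]]) (auto intro!: derivative_eq_intros)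
        then show ?thesis by simp
      qed
      have dc: "((\<lambda>w. c i w $ k) has_field_derivative v' $ k) (at z)" for k
      proof -
        have "((\<lambda>w. \<Sum>m\<in>UNIV. nexp N (- w) $ k $ m * b i w $ m) has_field_derivative
           (\<Sum>m\<in>UNIV. - (N ** nexp N (- z)) $ k $ m * b i z $ m + vderiv (b i) z $ m * nexp N (- z) $ k $ m)) (at z)"
          by (rule DERIV_sum) (rule DERIV_mult[OF dn db])
        also have "(\<Sum>m\<in>UNIV. - (N ** nexp N (- z)) $ k $ m * b i z $ m + vderiv (b i) z $ m * nexp N (- z) $ k $ m)
           = (nexp N (- z) *v vderiv (b i) z) $ k - ((N ** nexp N (- z)) *v b i z) $ k"
          by (simp only: matrix_vector_mult_def vec_lambda_beta sum.distrib) (simp add: sum_negf mult.commute)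
        also have "\<dots> = v' $ k" by (simp add: v'_def c_def matrix_vector_mul_assoc)
        finally show ?thesis by (simp add: c_def matrix_vector_mult_def)
      qed
      have dP: "((\<lambda>w. Pr w $ k $ m) has_field_derivative D z $ k $ m) (at z)" for k m
        using holomorphic_derivI[of "\<lambda>w. Pr w $ k $ m", OF _ open_upper[of y0]] h z0 by (simp add: D_def hol_matrix_def)
      \<comment> \<open>Differentiates Pr c = c, which holds near \<open>z\<close> because
        \<open>c i w\<close> lies in \<open>Ft w a\<close>.\<close>
      have eq: "D z *v c i z + Pr z *v v' = v'"
      proof -
        have "(D z *v c i z + Pr z *v v') $ k = v' $ k" for k
        proof -
          have "((\<lambda>w. \<Sum>m\<in>UNIV. Pr w $ k $ m * c i w $ m) has_field_derivative (\<Sum>m\<in>UNIV. D z $ k $ m * c i z $ m + v' $ m * Pr z $ k $ m)) (at z)"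
            by (rule DERIV_sum) (rule DERIV_mult[OF dP dc])
          moreover have "((\<lambda>w. \<Sum>m\<in>UNIV. Pr w $ k $ m * c i w $ m) has_field_derivative v' $ k) (at z)"
          proof (rule has_field_derivative_transform_within_open[OF dc])
            show "open (A \<inter> {z. Im z > y0})" "z \<in> A \<inter> {z. Im z > y0}" using A z0 open_upper by auto
            fix w assume w: "w \<in> A \<inter> {z. Im z > y0}"
            have "Pr w *v c i w = c i w" using pr[of w] cF[of w i] w i by (simp add: is_proj_def)
            from arg_cong[OF this, of "\<lambda>v. v $ k"]
            show "c i w $ k = (\<Sum>m\<in>UNIV. Pr w $ k $ m * c i w $ m)" by (simp add: matrix_vector_mult_def)
          qed
          ultimately have "(\<Sum>m\<in>UNIV. D z $ k $ m * c i z $ m + v' $ m * Pr z $ k $ m) = v' $ k" by (rule DERIV_unique)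
          then show ?thesis by (simp add: matrix_vector_mult_def sum.distrib mult.commute)
        qed
        then show ?thesis by (simp add: vec_eq_iff)
      qed
      have "(D z + N) *v c i z = nexp N (- z) *v vderiv (b i) z - Pr z *v v'"
        using eq by (simp add: matrix_vector_mult_add_rdistrib v'_def algebra_simps)
      moreover have "nexp N (- z) *v vderiv (b i) z \<in> Ft z (a - 1)" unfolding Ft_eq using bd[OF A(2) i] by blast
      moreover have "Pr z *v v' \<in> Ft z a" using pr[OF z0(2)] by (simp add: is_proj_def)
      then have "Pr z *v v' \<in> Ft z (a - 1)" using Ft_mono[OF z0(1), of "a - 1" a] by auto
      ultimately show ?thesis using vec.subspace_diff[OF subFt[OF z0(1)]] by simp
    qed
    have "Ft z a \<subseteq> {v. (D z + N) *v v \<in> Ft z (a - 1)}"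
    proof -
      have "Ft z a = vec.span ((*v) (nexp N (- z)) ` (\<lambda>i. b i z) ` {..<d})"
        using vec.linear_span_image[OF matrix_vector_mul_linear_gen, of "nexp N (- z)" "(\<lambda>i. b i z) ` {..<d}"] b[OF A(2)] by (simp add: Ft_eq)
      also have "\<dots> \<subseteq> {v. (D z + N) *v v \<in> Ft z (a - 1)}"
      proof (rule vec.span_minimal)
        show "(*v) (nexp N (- z)) ` (\<lambda>i. b i z) ` {..<d} \<subseteq> {v. (D z + N) *v v \<in> Ft z (a - 1)}" using cD by (auto simp: c_def)
        show "vec.subspace {v. (D z + N) *v v \<in> Ft z (a - 1)}"
          using subFt[OF z0(1), of "a - 1"] vec.subspace_0 vec.subspace_add vec.subspace_scale
          by (intro vec.subspaceI) (auto simp: matrix_vector_right_distrib matrix_vector_mult_smult)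
      qed
      finally show ?thesis .
    qed
    then have "(D z + N) *v (Pr z *v u) \<in> Ft z (a - 1)" for u using pr[OF z0(2)] by (auto simp: is_proj_def)
    then have "Pr1 z *v ((D z + N) *v (Pr z *v u)) = (D z + N) *v (Pr z *v u)" for u
      using pr1[OF z0(3)] by (simp add: is_proj_def)
    then show ?thesis by (simp add: matrix_eq matrix_vector_mul_assoc)
  qed
  have t1: "((\<lambda>z. Pr1 z ** ((D z + N) ** Pr z)) \<longlongrightarrow> P1 ** ((0 + N) ** P)) Im_top"
    by (intro tendsto_matrix_mult tendsto_add tendsto_const l l1 D0)
  have t2: "((\<lambda>z. (D z + N) ** Pr z) \<longlongrightarrow> (0 + N) ** P) Im_top"
    by (intro tendsto_matrix_mult tendsto_add tendsto_const l D0)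
  have "eventually (\<lambda>z. (D z + N) ** Pr z = Pr1 z ** ((D z + N) ** Pr z)) Im_top"
    unfolding eventually_Im_top by (intro exI[of _ "max y0 y1"] allI impI) (rule key[symmetric])
  from tendsto_unique[OF Im_top_neq_bot t1 Lim_transform_eventually[OF t2 this]]
  have "P1 ** ((0 + N) ** P) = (0 + N) ** P" .
  then have "P1 *v (N *v (P *v v)) = N *v (P *v v)" by (simp add: matrix_vector_mul_assoc)
  moreover have "P *v v = v" using PC v by (simp add: is_proj_def)
  ultimately show ?thesis using PC1(2) by (metis is_proj_def)
qed

lemma dim_le: "eventually (\<lambda>z. vec.dim (Ft z a \<inter> W m) \<le> vec.dim (G a \<inter> W m)) Im_top"
proof -
  obtain C D where C: "vec.subspace C" "vec.subspace D" "D \<subseteq> C" "D \<subseteq> W m" "G a \<inter> C = {0}" "splus (G a) C = UNIV"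
    "vec.dim (G a \<inter> W m) + vec.dim D = vec.dim (W m)"
    using complement_through[OF g.sF subW] by metis
  obtain P where P: "is_proj P (G a) C" using is_proj_exists[OF g.sF C(1) C(5,6)] by blast
  obtain y0 Pr where y0: "y0 \<ge> 0" and pr: "\<And>z. Im z > y0 \<Longrightarrow> is_proj (Pr z) (Ft z a) C"
    using proj_family[OF C(1) P] by metis
  have "vec.dim (Ft z a \<inter> W m) \<le> vec.dim (G a \<inter> W m)" if z: "Im z > y0" for z
  proof -
    have z0: "Im z > 0" using z y0 by simp
    have "Ft z a \<inter> D = {0}"
      using is_proj_Int[OF pr[OF z]] C(3) vec.subspace_0[OF subFt[OF z0]] vec.subspace_0[OF C(2)] by blast
    then show ?thesis by (rule dim_Int_le_of_complement[OF subFt[OF z0] subW C(2) C(4) _ C(7)])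
  qed
  then show ?thesis unfolding eventually_Im_top by blast
qed

text \<open>Only finitely many pairs of indices are nontrivial, so one height serves for all of
  them.\<close>

lemma dim_le_all: "eventually (\<lambda>z. \<forall>m a. vec.dim (Ft z a \<inter> W m) \<le> vec.dim (G a \<inter> W m)) Im_top"
proof -
  obtain a1 b1 where ab1: "a1 < b1" "\<And>k. k \<le> a1 \<Longrightarrow> W k = {0}" "\<And>k. k \<ge> b1 \<Longrightarrow> W k = UNIV" using incr_filt_bounds[OF filtW] by metis
  obtain a2 b2 where ab2: "a2 < b2" "\<And>k. k \<le> a2 \<Longrightarrow> G k = UNIV" "\<And>k. k \<ge> b2 \<Longrightarrow> G k = {0}" using decr_filt_bounds[OF g.filtF] by metis
  have "eventually (\<lambda>z. \<forall>m\<in>{a1..b1}. \<forall>a\<in>{a2..b2}. vec.dim (Ft z a \<inter> W m) \<le> vec.dim (G a \<inter> W m)) Im_top"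
    by (intro eventually_ball_finite ballI dim_le) auto
  moreover have "eventually (\<lambda>z. Im z > 0) Im_top" unfolding eventually_Im_top by blast
  ultimately show ?thesis
  proof eventually_elim
    case (elim z)
    \<comment> \<open>The inequality at the index where \<open>G\<close> vanishes, with
      \<open>W b1\<close> everything; it disposes of all larger indices.\<close>
    have b: "Ft z b2 \<subseteq> {0}"
    proof -
      have "vec.dim (Ft z b2 \<inter> W b1) \<le> vec.dim (G b2 \<inter> W b1)" using elim ab1(1) ab2(1) by auto
      then show ?thesis using ab1(3)[of b1] ab2(3)[of b2] by simp
    qed
    show ?case
    proof (intro allI)
      fix m a
      consider "a \<le> a2" | "a \<ge> b2" | "a \<in> {a2..b2}" by fastforce
      then show "vec.dim (Ft z a \<inter> W m) \<le> vec.dim (G a \<inter> W m)"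
      proof cases
        case 1
        then show ?thesis using ab2 by (auto intro: vec.dim_subset)
      next
        case 2
        then have "Ft z a \<inter> W m \<subseteq> {0}" using Ft_mono[of z b2 a] elim b by blast
        then show ?thesis by (simp add: vec.dim_eq_0[THEN iffD2])
      next
        case 3
        consider "m \<le> a1" | "m \<ge> b1" | "m \<in> {a1..b1}" by fastforce
        then show ?thesis
        proof cases
          case 1
          then show ?thesis using ab1 by (simp add: vec.dim_eq_0[THEN iffD2])
        next
          case m: 2
          have "vec.dim (Ft z a \<inter> W b1) \<le> vec.dim (G a \<inter> W b1)" using bspec[OF bspec[OF elim(1), of b1] 3] ab1(1) by simp
          then show ?thesis using ab1(3)[of b1] ab1(3)[OF m] by simp
        next
          case m: 3
          then show ?thesis using elim 3 by blast
        qed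
      qed
    qed
  qed
qed

text \<open>Semicontinuity gives one inequality; attainment of the maximal degree leaves no room for
  a strict one.\<close>

lemma dim_eq_all: "eventually (\<lambda>z. \<forall>m a. vec.dim (Ft z a \<inter> W m) = vec.dim (G a \<inter> W m)) Im_top"
proof -
  have "eventually (\<lambda>z. Im z > 0) Im_top" unfolding eventually_Im_top by blast
  with dim_le_all show ?thesis
  proof eventually_elim
    case (elim z)
    show ?case
    proof (intro allI)
      fix m a
      have "vec.dim (F z a \<inter> W m) \<le> vec.dim (G a \<inter> W m)" for a using elim dim_Ft_W by metis
      then have "vec.dim (F z a \<inter> W m) = vec.dim (G a \<inter> W m)"
        using weight_filtration_sub_mhs(2)[OF mhsG mhsF rel NW, of z m a] elim by blast
      then show "vec.dim (Ft z a \<inter> W m) = vec.dim (G a \<inter> W m)" by (simp add: dim_Ft_W)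
    qed
  qed
qed

lemma sub_mhs_all: "sub_mhs G M (W m)"
proof -
  obtain y0 where y0: "\<And>z. Im z > y0 \<Longrightarrow> \<forall>m a. vec.dim (Ft z a \<inter> W m) \<le> vec.dim (G a \<inter> W m)"
    using dim_le_all unfolding eventually_Im_top by blast
  define z where "z = Complex 0 (max y0 0 + 1)"
  have z: "Im z > y0" "Im z > 0" by (auto simp: z_def)
  have "vec.dim (F z a \<inter> W m) \<le> vec.dim (G a \<inter> W m)" for a using y0[OF z(1)] dim_Ft_W by metis
  then show ?thesis using weight_filtration_sub_mhs(1)[OF mhsG mhsF[OF z(2)] rel NW, of m] by blast
qed

lemma limit_basis_exists:
  "\<exists>B p q j. limit_mhs G M B p q W N j \<and> (\<forall>k i. j k = j i - 1 \<longrightarrow> (matrix_inv B ** N ** B) $ k $ i = 0)"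
proof -
  obtain B p q j where B: "invertible B" "\<And>i. column i B \<in> g.D (p i) (q i)" "\<And>m. W m = coord_span B (\<lambda>i. j i \<le> m)"
    using g.adapted_basis[OF filtW sub_mhs_all] by metis
  have cW: "vcnj v \<in> W k" if "v \<in> W k" for v k using mhs.cnjW[OF mhs.intro[OF mhsF[of \<i>]]] that by simp
  interpret limit_mhs G M B p q W N j
    by unfold_locales (use B filtW cW Nreal NW N_G rel in auto)
  show ?thesis using basis_without_weight_minus_1 by blast
qed

end

section \<open>The conjugate limit Hodge filtration\<close>

text \<open>The counterpart of \<open>coord_span\<close> for vectors already written in
  coordinates.\<close>

definition csp :: "('n \<Rightarrow> bool) \<Rightarrow> (complex^'n::finite) set" where
  "csp P = {x. \<forall>i. \<not> P i \<longrightarrow> x $ i = 0}"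

lemma subspace_csp: "vec.subspace (csp P)"
  by (auto intro!: vec.subspaceI simp: csp_def)

lemma csp_map:
  fixes A :: "complex^'n::finite^'n"
  assumes A: "\<And>k i. P i \<Longrightarrow> A $ k $ i \<noteq> 0 \<Longrightarrow> Q k" and x: "x \<in> csp P"
  shows "A *v x \<in> csp Q"
proof -
  have "(A *v x) $ k = 0" if "\<not> Q k" for k
  proof (rule mat_vec_zero)
    fix l show "A $ k $ l * x $ l = 0" using A[of l k] that x by (auto simp: csp_def)
  qed
  then show ?thesis by (simp add: csp_def)
qed

lemma csp_axis: "P i \<Longrightarrow> axis i 1 \<in> csp P"
  by (auto simp: csp_def axis_def)

lemma invertible_image_eq:
  fixes T :: "complex^'n::finite^'n"
  assumes "invertible T" "vec.subspace S" "\<And>x. x \<in> S \<Longrightarrow> T *v x \<in> S"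
  shows "(*v) T ` S = S"
  using vec.subspace_dim_equal[OF subspace_matrix_image[OF assms(2)] assms(2), of T] assms dim_matrix_image[OF assms(1), of S]
  by auto

lemma invertible_unipotent:
  fixes A :: "complex^'n::finite^'n" and f :: "'n \<Rightarrow> int"
  assumes A: "\<And>k i. A $ k $ i \<noteq> 0 \<Longrightarrow> f k < f i"
  shows "invertible (mat 1 + A)"
proof -
  have "x = 0" if x: "(mat 1 + A) *v x = 0" for x
  proof (rule ccontr)
    assume "x \<noteq> 0"
    then have ne: "f ` {i. x $ i \<noteq> 0} \<noteq> {}" by (auto simp: vec_eq_iff)
    define J where "J = Max (f ` {i. x $ i \<noteq> 0})"
    have "J \<in> f ` {i. x $ i \<noteq> 0}" unfolding J_def using ne by (intro Max_in) auto
    then obtain k where k: "x $ k \<noteq> 0" "f k = J" by auto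
    have le: "f l \<le> J" if "x $ l \<noteq> 0" for l unfolding J_def using that by (intro Max_ge) auto
    have "(A *v x) $ k = 0"
    proof (rule mat_vec_zero)
      fix l show "A $ k $ l * x $ l = 0" using A[of k l] le[of l] k(2) by fastforce
    qed
    moreover have "((mat 1 + A) *v x) $ k = 0" using x by simp
    ultimately show False using k by (simp add: matrix_vector_mult_add_rdistrib)
  qed
  then show ?thesis using matrix_left_invertible_ker[of "mat 1 + A"] by (auto simp: invertible_left_inverse)
qed

lemma mcnj_mult: "mcnj (A ** B) = mcnj A ** mcnj B" for A B :: "complex^'n::finite^'n"
  by (simp add: mcnj_def matrix_matrix_mult_def vec_eq_iff)

lemma mcnj_mcnj [simp]: "mcnj (mcnj A) = A"
  by (simp add: mcnj_def vec_eq_iff)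

lemma mcnj_nth [simp]: "mcnj A $ i $ j = cnj (A $ i $ j)"
  by (simp add: mcnj_def)

lemma mcnj_mat1 [simp]: "mcnj (mat 1) = mat 1"
  by (simp add: mcnj_def vec_eq_iff mat_def)

lemma invertible_mcnj: "invertible A \<Longrightarrow> invertible (mcnj A)" for A :: "complex^'n::finite^'n"
  unfolding invertible_def by (metis mcnj_mult mcnj_mat1)

context good_basis
begin

text \<open>The matrix of complex conjugation in the basis \<open>B\<close>: the coordinates of
  \<open>vcnj v\<close> are \<open>S\<close> applied to the conjugated coordinates of
  \<open>v\<close>. That conjugation is an involution becomes S conj(S) = 1.\<close>

definition S :: "complex^'n^'n" where "S = Bi ** mcnj B"

lemma BS: "B ** S = mcnj B"
  by (simp add: S_def matrix_mul_assoc)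

lemma S_S: "S ** mcnj S = mat 1" "mcnj S ** S = mat 1"
proof -
  have "B ** (S ** mcnj S) = mcnj (mcnj B)" by (metis BS mcnj_mult matrix_mul_assoc)
  then have "B ** (S ** mcnj S) = B" by simp
  then have "Bi ** (B ** (S ** mcnj S)) = Bi ** B" by simp
  then show 1: "S ** mcnj S = mat 1" by (simp add: matrix_mul_assoc)
  from arg_cong[OF this, of mcnj] show "mcnj S ** S = mat 1" by (simp add: mcnj_mult)
qed

lemma S_column: "column i S = Bi *v vcnj (column i B)"
proof -
  have "vcnj (column i B) = column i (mcnj B)" by (simp add: vec_eq_iff column_def)
  then show ?thesis by (simp add: S_def matrix_vector_mult_column)
qed

lemma S_entry:
  assumes "S $ k $ i \<noteq> 0"
  shows "((p k = q i \<and> q k = p i) \<or> (p k < q i \<and> q k < p i)) \<and> j k \<le> j i"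
proof -
  have e: "S $ k $ i = (Bi *v vcnj (column i B)) $ k" using S_column[of i] by (simp add: column_def vec_eq_iff)
  have "(p k = q i \<and> q k = p i) \<or> (p k < q i \<and> q k < p i)"
    using vcnj_piece[OF col[of i]] assms unfolding e cs_iff by blast
  moreover have "j k \<le> j i" using cnjW0[OF col_W[of i]] assms unfolding e W0_eq cs_iff by blast
  ultimately show ?thesis by blast
qed

lemma n_S: "n ** S = S ** mcnj n"
proof -
  have Bn: "B ** n = N ** B" by (simp add: n_def co_def matrix_mul_assoc)
  have "B ** (n ** S) = N ** mcnj B" by (metis BS Bn matrix_mul_assoc)
  also have "\<dots> = mcnj (N ** B)" by (simp add: mcnj_mult mcnj_real[OF Nreal])
  also have "\<dots> = B ** (S ** mcnj n)" by (metis BS Bn matrix_mul_assoc mcnj_mult)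
  finally have "Bi ** (B ** (n ** S)) = Bi ** (B ** (S ** mcnj n))" by simp
  then show ?thesis by (simp add: matrix_mul_assoc)
qed

lemma mcnj_S_n: "mcnj S ** n = mcnj n ** mcnj S"
  using arg_cong[OF n_S, of mcnj] by (simp add: mcnj_mult)

definition sw :: "'n \<Rightarrow> 'n \<Rightarrow> bool" where "sw l i \<longleftrightarrow> p l = q i \<and> q l = p i"

text \<open>U = sum over (p,q) of conj(pi_qp) pi_pq for the projections pi_pq of the limit bigrading:
  it carries the bigrading to its complex conjugate, is unipotent, and commutes with N since
  both families of projections are shifted by N in the same way.\<close>

definition U :: "complex^'n^'n" where
  "U = (\<chi> k i. \<Sum>l\<in>UNIV. if sw l i then S $ k $ l * mcnj S $ l $ i else 0)"

lemma U_nz: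
  assumes "U $ k $ i \<noteq> 0"
  obtains l where "sw l i" "S $ k $ l \<noteq> 0" "mcnj S $ l $ i \<noteq> 0"
proof -
  have "(\<Sum>l\<in>UNIV. if sw l i then S $ k $ l * mcnj S $ l $ i else 0) \<noteq> 0" using assms by (simp add: U_def)
  then obtain l where "(if sw l i then S $ k $ l * mcnj S $ l $ i else 0) \<noteq> 0"
    by (elim sum.not_neutral_contains_not_neutral)
  then show ?thesis using that[of l] by (auto split: if_splits)
qed

lemma mcnj_S_entry:
  assumes "mcnj S $ k $ i \<noteq> 0"
  shows "((p k = q i \<and> q k = p i) \<or> (p k < q i \<and> q k < p i)) \<and> j k \<le> j i"
  using S_entry[of k i] assms by simp

text \<open>Between equal labels \<open>(p, q)\<close> the condition \<open>sw\<close> holds for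
  every contributing index, so the sum is an entry of S conj(S) = 1. Between different labels the
  factor \<open>S\<close> lowers both \<open>p\<close> and \<open>q\<close> after the
  exchange.\<close>

lemma U_entry:
  assumes nz: "U $ k $ i \<noteq> 0" and ki: "k \<noteq> i"
  shows "p k < p i \<and> q k < q i \<and> j k \<le> j i"
proof -
  obtain l where l: "sw l i" "S $ k $ l \<noteq> 0" "mcnj S $ l $ i \<noteq> 0" using U_nz[OF nz] .
  have jj: "j k \<le> j i" using S_entry[OF l(2)] mcnj_S_entry[OF l(3)] by linarith
  have "\<not> (p k = p i \<and> q k = q i)"
  proof
    assume same: "p k = p i \<and> q k = q i"
    have "(if sw m i then S $ k $ m * mcnj S $ m $ i else 0) = S $ k $ m * mcnj S $ m $ i" for m
    proof (cases "sw m i")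
      case False
      have "S $ k $ m = 0 \<or> mcnj S $ m $ i = 0"
        using S_entry[of k m] mcnj_S_entry[of m i] False same unfolding sw_def by force
      then show ?thesis using False by auto
    qed simp
    then have "U $ k $ i = (S ** mcnj S) $ k $ i" by (simp add: U_def matrix_matrix_mult_def)
    then show False using nz ki by (simp add: S_S mat_def)
  qed
  then show ?thesis using S_entry[OF l(2)] l(1) jj unfolding sw_def by auto
qed

lemma U_diag: "U $ i $ i = 1"
proof -
  have "(if sw m i then S $ i $ m * mcnj S $ m $ i else 0) = S $ i $ m * mcnj S $ m $ i" for m
  proof (cases "sw m i")
    case False
    have "S $ i $ m = 0 \<or> mcnj S $ m $ i = 0"
      using S_entry[of i m] mcnj_S_entry[of m i] False unfolding sw_def by force
    then show ?thesis using False by auto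
  qed simp
  then have "U $ i $ i = (S ** mcnj S) $ i $ i" by (simp add: U_def matrix_matrix_mult_def)
  then show ?thesis by (simp add: S_S mat_def)
qed

lemma U_invertible: "invertible U"
proof -
  have "U = mat 1 + (U - mat 1)" by simp
  moreover have "invertible (mat 1 + (U - mat 1))"
  proof (rule invertible_unipotent[of _ p])
    fix k i assume "(U - mat 1) $ k $ i \<noteq> 0"
    then have "U $ k $ i \<noteq> 0 \<and> k \<noteq> i" using U_diag by (cases "k = i") (auto simp: mat_def)
    then show "p k < p i" using U_entry by blast
  qed
  ultimately show ?thesis by metis
qed

lemma U_n: "U ** n = n ** U"
proof -
  have "(U ** n) $ k $ i = (n ** U) $ k $ i" for k i
  proof -
    \<comment> \<open>The labels of the middle index when the exchange \<open>sw\<close> is combined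
      with the shift by \<open>n\<close>; they are the same whether the shift comes before or after
      the exchange.\<close>
    let ?t = "\<lambda>m. p m = q i - 1 \<and> q m = p i - 1"
    have "(U ** n) $ k $ i = (\<Sum>r\<in>UNIV. \<Sum>m\<in>UNIV. (if sw m r then S $ k $ m * mcnj S $ m $ r else 0) * n $ r $ i)"
      by (simp add: matrix_matrix_mult_def U_def sum_distrib_right)
    also have "\<dots> = (\<Sum>r\<in>UNIV. \<Sum>m\<in>UNIV. if ?t m then S $ k $ m * (mcnj S $ m $ r * n $ r $ i) else 0)"
    proof (intro sum.cong refl)
      fix r m
      show "(if sw m r then S $ k $ m * mcnj S $ m $ r else 0) * n $ r $ i = (if ?t m then S $ k $ m * (mcnj S $ m $ r * n $ r $ i) else 0)"
        using n_entry[of r i] by (cases "n $ r $ i = 0") (auto simp: sw_def)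
    qed
    also have "\<dots> = (\<Sum>m\<in>UNIV. \<Sum>r\<in>UNIV. if ?t m then S $ k $ m * (mcnj S $ m $ r * n $ r $ i) else 0)" by (rule sum.swap)
    also have "\<dots> = (\<Sum>m\<in>UNIV. if ?t m then S $ k $ m * (mcnj S ** n) $ m $ i else 0)"
      by (intro sum.cong refl) (auto simp: matrix_matrix_mult_def sum_distrib_left)
    also have "\<dots> = (\<Sum>m\<in>UNIV. if ?t m then S $ k $ m * (mcnj n ** mcnj S) $ m $ i else 0)" by (simp only: mcnj_S_n)
    also have "\<dots> = (\<Sum>m\<in>UNIV. \<Sum>l\<in>UNIV. if ?t m then S $ k $ m * (mcnj n $ m $ l * mcnj S $ l $ i) else 0)"
      by (intro sum.cong refl) (auto simp: matrix_matrix_mult_def sum_distrib_left)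
    also have "\<dots> = (\<Sum>m\<in>UNIV. \<Sum>l\<in>UNIV. if sw l i then (S $ k $ m * mcnj n $ m $ l) * mcnj S $ l $ i else 0)"
    proof (intro sum.cong refl)
      fix m l
      show "(if ?t m then S $ k $ m * (mcnj n $ m $ l * mcnj S $ l $ i) else 0) = (if sw l i then (S $ k $ m * mcnj n $ m $ l) * mcnj S $ l $ i else 0)"
        using n_entry[of m l] by (cases "n $ m $ l = 0") (auto simp: sw_def)
    qed
    also have "\<dots> = (\<Sum>l\<in>UNIV. \<Sum>m\<in>UNIV. if sw l i then (S $ k $ m * mcnj n $ m $ l) * mcnj S $ l $ i else 0)" by (rule sum.swap)
    also have "\<dots> = (\<Sum>l\<in>UNIV. if sw l i then (S ** mcnj n) $ k $ l * mcnj S $ l $ i else 0)"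
      by (intro sum.cong refl) (auto simp: matrix_matrix_mult_def sum_distrib_right)
    also have "\<dots> = (\<Sum>l\<in>UNIV. if sw l i then (n ** S) $ k $ l * mcnj S $ l $ i else 0)" by (simp only: n_S)
    also have "\<dots> = (\<Sum>l\<in>UNIV. \<Sum>m\<in>UNIV. n $ k $ m * (if sw l i then S $ m $ l * mcnj S $ l $ i else 0))"
      by (intro sum.cong refl) (auto simp: matrix_matrix_mult_def sum_distrib_right mult.assoc)
    also have "\<dots> = (\<Sum>m\<in>UNIV. \<Sum>l\<in>UNIV. n $ k $ m * (if sw l i then S $ m $ l * mcnj S $ l $ i else 0))" by (rule sum.swap)
    also have "\<dots> = (n ** U) $ k $ i" by (simp add: matrix_matrix_mult_def U_def sum_distrib_left)
    finally show ?thesis .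
  qed
  then show ?thesis by (simp add: vec_eq_iff)
qed

text \<open>\<open>U\<close> is \<open>S\<close> times the part of conj(S) that exchanges labels,
  and this part carries q \<ge> a into p \<ge> a and q < a into p < a. The conjugate of
  \<open>G a\<close> is \<open>S\<close> applied to p \<ge> a, so the two halves together give both
  inclusions.\<close>

lemma vcnj_G: "(*v) Bi ` vcnj ` G a = (*v) U ` csp (\<lambda>i. q i \<ge> a)"
proof -
  have "(*v) Bi ` vcnj ` G a = (*v) S ` csp (\<lambda>i. p i \<ge> a)"
  proof -
    have "(*v) Bi ` vcnj ` G a = (\<lambda>x. Bi *v vcnj (B *v x)) ` csp (\<lambda>i. p i \<ge> a)"
      unfolding F_eq coord_span_def csp_def by (simp add: image_image)
    also have "\<dots> = (\<lambda>x. S *v vcnj x) ` csp (\<lambda>i. p i \<ge> a)"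
      by (simp add: vcnj_matrix_vector_mult S_def matrix_vector_mul_assoc)
    also have "\<dots> = (*v) S ` vcnj ` csp (\<lambda>i. p i \<ge> a)" by (simp add: image_image)
    also have "vcnj ` csp (\<lambda>i. p i \<ge> a) = csp (\<lambda>i. p i \<ge> a)"
    proof
      show "vcnj ` csp (\<lambda>i. p i \<ge> a) \<subseteq> csp (\<lambda>i. p i \<ge> a)" by (auto simp: csp_def)
      show "csp (\<lambda>i. p i \<ge> a) \<subseteq> vcnj ` csp (\<lambda>i. p i \<ge> a)"
      proof
        fix x :: "complex^'n" assume "x \<in> csp (\<lambda>i. p i \<ge> a)"
        then have "vcnj x \<in> csp (\<lambda>i. p i \<ge> a)" by (auto simp: csp_def)
        then show "x \<in> vcnj ` csp (\<lambda>i. p i \<ge> a)" by (metis image_eqI vcnj_vcnj)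
      qed
    qed
    finally show ?thesis .
  qed
  define T where "T = mcnj S ** U"
  have ST: "S ** T = U" by (simp add: T_def matrix_mul_assoc S_S)
  have Te: "p l = q i" if "T $ l $ i \<noteq> 0" for l i
  proof -
    have "T $ l $ i = (\<Sum>k\<in>UNIV. \<Sum>m\<in>UNIV. mcnj S $ l $ k * (if sw m i then S $ k $ m * mcnj S $ m $ i else 0))"
      by (simp add: T_def matrix_matrix_mult_def U_def sum_distrib_left)
    also have "\<dots> = (\<Sum>m\<in>UNIV. \<Sum>k\<in>UNIV. mcnj S $ l $ k * (if sw m i then S $ k $ m * mcnj S $ m $ i else 0))" by (rule sum.swap)
    also have "\<dots> = (\<Sum>m\<in>UNIV. if sw m i then (mcnj S ** S) $ l $ m * mcnj S $ m $ i else 0)"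
      by (intro sum.cong refl) (auto simp: matrix_matrix_mult_def sum_distrib_right mult.assoc)
    also have "\<dots> = (if sw l i then mcnj S $ l $ i else 0)"
    proof -
      have "(\<Sum>m\<in>UNIV. if sw m i then (mcnj S ** S) $ l $ m * mcnj S $ m $ i else 0)
          = (\<Sum>m\<in>UNIV. if m = l then (if sw l i then mcnj S $ l $ i else 0) else 0)"
        by (intro sum.cong refl) (auto simp: S_S mat_def)
      then show ?thesis by simp
    qed
    finally show ?thesis using that by (auto simp: sw_def split: if_splits)
  qed
  have SU: "S *v (T *v x) = U *v x" for x by (simp add: matrix_vector_mul_assoc ST)
  have "(*v) S ` csp (\<lambda>i. p i \<ge> a) = (*v) U ` csp (\<lambda>i. q i \<ge> a)"
  proof
    show "(*v) U ` csp (\<lambda>i. q i \<ge> a) \<subseteq> (*v) S ` csp (\<lambda>i. p i \<ge> a)"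
    proof
      fix y assume "y \<in> (*v) U ` csp (\<lambda>i. q i \<ge> a)"
      then obtain x where x: "x \<in> csp (\<lambda>i. q i \<ge> a)" "y = S *v (T *v x)" by (auto simp: SU)
      have "T *v x \<in> csp (\<lambda>i. p i \<ge> a)" by (rule csp_map[OF _ x(1)]) (use Te in force)
      then show "y \<in> (*v) S ` csp (\<lambda>i. p i \<ge> a)" using x(2) by blast
    qed
    show "(*v) S ` csp (\<lambda>i. p i \<ge> a) \<subseteq> (*v) U ` csp (\<lambda>i. q i \<ge> a)"
    proof
      fix y assume "y \<in> (*v) S ` csp (\<lambda>i. p i \<ge> a)"
      then obtain z where z: "z \<in> csp (\<lambda>i. p i \<ge> a)" "y = S *v z" by blast
      define x where "x = matrix_inv U *v y"
      define x1 where "x1 = (\<chi> i. if q i \<ge> a then x $ i else 0)"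
      define x2 where "x2 = x - x1"
      have Ux: "U *v x = y" by (simp add: x_def matrix_inv_cancel[OF U_invertible])
      have x1: "x1 \<in> csp (\<lambda>i. q i \<ge> a)" by (simp add: x1_def csp_def)
      have x2: "x2 \<in> csp (\<lambda>i. q i < a)" by (simp add: x1_def x2_def csp_def)
      have T1: "T *v x1 \<in> csp (\<lambda>i. p i \<ge> a)" by (rule csp_map[OF _ x1]) (use Te in force)
      have T2: "T *v x2 \<in> csp (\<lambda>i. p i < a)" by (rule csp_map[OF _ x2]) (use Te in force)
      have "S *v (T *v x2) = S *v (z - T *v x1)"
        unfolding matrix_vector_mult_diff_distrib SU x2_def Ux z(2) ..
      then have "mcnj S *v (S *v (T *v x2)) = mcnj S *v (S *v (z - T *v x1))" by simp
      moreover have "mcnj S *v (S *v v) = v" for v by (simp add: matrix_vector_mul_assoc S_S)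
      ultimately have "T *v x2 = z - T *v x1" by simp
      then have "T *v x2 \<in> csp (\<lambda>i. p i \<ge> a)" using vec.subspace_diff[OF subspace_csp z(1) T1] by simp
      then have "(T *v x2) $ i = 0" for i using T2 unfolding csp_def by (cases "p i \<ge> a") auto
      then have "T *v x2 = 0" by (simp add: vec_eq_iff)
      then have "U *v x2 = 0" using SU[of x2] by simp
      then have "x2 = 0" using matrix_inv_cancel(1)[OF U_invertible, of x2] by simp
      then have "x = x1" by (simp add: x2_def)
      then show "y \<in> (*v) U ` csp (\<lambda>i. q i \<ge> a)" using x1 Ux by blast
    qed
  qed
  then show ?thesis using \<open>(*v) Bi ` vcnj ` G a = (*v) S ` csp (\<lambda>i. p i \<ge> a)\<close> by simp
qed

section \<open>Maps preserving W, and filtrations modulo two weights\<close>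

abbreviation "Wc m \<equiv> csp (\<lambda>i. j i \<le> m)"

definition low :: "complex^'n^'n \<Rightarrow> bool" where
  "low T \<longleftrightarrow> (\<forall>k i. T $ k $ i \<noteq> 0 \<longrightarrow> j k \<le> j i)"

lemma low_Wc: "low T \<Longrightarrow> x \<in> Wc m \<Longrightarrow> T *v x \<in> Wc m"
  by (rule csp_map[of "\<lambda>i. j i \<le> m"]) (auto simp: low_def, force)

lemma lowI:
  assumes "\<And>m x. x \<in> Wc m \<Longrightarrow> T *v x \<in> Wc m"
  shows "low T"
  unfolding low_def
proof (intro allI impI)
  fix k i assume "T $ k $ i \<noteq> 0"
  moreover have "T *v axis i 1 \<in> Wc (j i)" by (rule assms, rule csp_axis) simp
  ultimately show "j k \<le> j i" by (auto simp: csp_def matrix_vector_mult_axis column_def)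
qed

lemma low_mult: "low A \<Longrightarrow> low C \<Longrightarrow> low (A ** C)"
  by (rule lowI) (simp add: low_Wc flip: matrix_vector_mul_assoc)

lemma low_nexp: "low A \<Longrightarrow> low (nexp A x)"
  by (rule lowI, rule nil_exp_preserves[OF subspace_csp]) (auto intro: low_Wc)

lemma low_image: "invertible T \<Longrightarrow> low T \<Longrightarrow> (*v) T ` Wc m = Wc m"
  by (rule invertible_image_eq[OF _ subspace_csp]) (auto intro: low_Wc)

lemma low_inv:
  assumes "invertible T" "low T"
  shows "low (matrix_inv T)"
proof (rule lowI)
  fix m x assume "x \<in> Wc m"
  then obtain y where "y \<in> Wc m" "x = T *v y" using low_image[OF assms, of m] by blast
  then show "matrix_inv T *v x \<in> Wc m" by (simp add: matrix_inv_cancel[OF assms(1)])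
qed

text \<open>Conjugation exchanges the bigrading of (F(z),W) only modulo two steps of W, so Y(z) preserves
  the conjugate filtration only after adding W_(m-2).\<close>

definition Ks :: "(complex^'n) set \<Rightarrow> int \<Rightarrow> (complex^'n) set" where
  "Ks A m = splus (A \<inter> Wc m) (Wc (m - 2))"

lemma Ks_image:
  assumes T: "invertible T" "low T"
  shows "(*v) T ` Ks A m = Ks ((*v) T ` A) m"
proof
  show "(*v) T ` Ks A m \<subseteq> Ks ((*v) T ` A) m"
  proof
    fix y assume "y \<in> (*v) T ` Ks A m"
    then obtain a b where ab: "a \<in> A" "a \<in> Wc m" "b \<in> Wc (m - 2)" "y = T *v (a + b)" unfolding Ks_def splus_def by blast
    have "T *v a \<in> (*v) T ` A \<inter> Wc m" "T *v b \<in> Wc (m - 2)" using ab low_Wc[OF T(2)] by auto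
    then show "y \<in> Ks ((*v) T ` A) m" unfolding Ks_def splus_def ab(4) matrix_vector_right_distrib by blast
  qed
  show "Ks ((*v) T ` A) m \<subseteq> (*v) T ` Ks A m"
  proof
    fix y assume "y \<in> Ks ((*v) T ` A) m"
    then obtain a b where ab: "a \<in> A" "T *v a \<in> Wc m" "b \<in> Wc (m - 2)" "y = T *v a + b" unfolding Ks_def splus_def by blast
    have "a \<in> Wc m" using low_Wc[OF low_inv[OF T] ab(2)] by (simp add: matrix_inv_cancel[OF T(1)])
    moreover obtain b' where b': "b' \<in> Wc (m - 2)" "b = T *v b'" using low_image[OF T, of "m - 2"] ab(3) by blast
    ultimately have "a + b' \<in> Ks A m" unfolding Ks_def splus_def using ab(1) by blast
    moreover have "y = T *v (a + b')" by (simp add: ab(4) b'(2) matrix_vector_right_distrib)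
    ultimately show "y \<in> (*v) T ` Ks A m" by blast
  qed
qed

text \<open>\<open>Ks\<close> sees a map only through its action on W_m modulo W_(m-2). This is what
  permits replacing \<open>n\<close> by \<open>n0\<close>.\<close>

lemma Ks_cong:
  assumes T: "invertible T" "low T" and T': "low T'" and d: "\<And>m x. x \<in> Wc m \<Longrightarrow> T *v x - T' *v x \<in> Wc (m - 2)"
  shows "Ks ((*v) T ` A) m \<subseteq> Ks ((*v) T' ` A) m"
proof
  fix y assume "y \<in> Ks ((*v) T ` A) m"
  then obtain a b where ab: "a \<in> A" "T *v a \<in> Wc m" "b \<in> Wc (m - 2)" "y = T *v a + b" unfolding Ks_def splus_def by blast
  have a: "a \<in> Wc m" using low_Wc[OF low_inv[OF T] ab(2)] by (simp add: matrix_inv_cancel[OF T(1)])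
  have "T' *v a \<in> (*v) T' ` A \<inter> Wc m" using ab(1) low_Wc[OF T' a] by blast
  moreover have "(T *v a - T' *v a) + b \<in> Wc (m - 2)" using d[OF a] ab(3) vec.subspace_add[OF subspace_csp] by blast
  moreover have "y = T' *v a + ((T *v a - T' *v a) + b)" by (simp add: ab(4))
  ultimately show "y \<in> Ks ((*v) T' ` A) m" unfolding Ks_def splus_def by blast
qed

lemma low_n: "low n" and low_n0: "low n0" and low_E: "low E"
  unfolding low_def using n_entry n0_entry E_entry by auto

lemma low_U: "low U"
  unfolding low_def using U_entry by (metis order_refl)

lemma nil_n: "nilpotent_mat n" and nil_n0: "nilpotent_mat n0" and nil_E: "nilpotent_mat E"
proof -
  show "nilpotent_mat n" by (rule nilpotent_hom_deg[of p "-1"]) (use n_entry in \<open>auto simp: hom_deg_def\<close>)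
  show "nilpotent_mat n0" by (rule nilpotent_hom_deg[of p "-1"]) (use n0_entry in \<open>auto simp: hom_deg_def\<close>)
  show "nilpotent_mat E" by (rule nilpotent_hom_deg[of p 1]) (use E_entry in \<open>auto simp: hom_deg_def\<close>)
qed

text \<open>In the chosen basis n - n0 = n2 drops two steps of \<open>W\<close>. A part of
  \<open>n\<close> of degree -1 would spoil the congruence.\<close>

lemma mpow_n_n0: "x \<in> Wc m \<Longrightarrow> mpow n l *v x - mpow n0 l *v x \<in> Wc (m - 2)"
proof (induction l)
  case 0
  then show ?case using vec.subspace_0[OF subspace_csp] by simp
next
  case (Suc l)
  have n2: "n2 *v y \<in> Wc (m - 2)" if "y \<in> Wc m" for y
    by (rule csp_map[OF _ that]) (use n2_entry in force)
  have pow: "mpow n0 l *v x \<in> Wc m" by (induction l) (use Suc low_Wc[OF low_n0] in \<open>auto simp flip: matrix_vector_mul_assoc\<close>)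
  have "mpow n (Suc l) *v x - mpow n0 (Suc l) *v x = n *v (mpow n l *v x - mpow n0 l *v x) + n2 *v (mpow n0 l *v x)"
  proof -
    have "n *v y = n0 *v y + n2 *v y" for y using n_split by (metis matrix_vector_mult_add_rdistrib)
    from this[of "mpow n0 l *v x"] show ?thesis
      by (simp add: matrix_vector_mult_diff_distrib flip: matrix_vector_mul_assoc)
  qed
  also have "\<dots> \<in> Wc (m - 2)"
    by (intro vec.subspace_add[OF subspace_csp] low_Wc[OF low_n] n2 pow Suc)
  finally show ?case .
qed

lemma nexp_n_n0:
  assumes "x \<in> Wc m"
  shows "nexp n z *v x - nexp n0 z *v x \<in> Wc (m - 2)"
proof -
  have "nexp n z *v x - nexp n0 z *v x = (\<Sum>l\<le>CARD('n). (z ^ l / fact l) *s (mpow n l *v x - mpow n0 l *v x))"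
    unfolding nexp_vec by (simp add: sum_subtractf vec.scale_right_diff_distrib)
  also have "\<dots> \<in> Wc (m - 2)"
    by (intro vec.subspace_sum[OF subspace_csp] vec.subspace_scale[OF subspace_csp] mpow_n_n0 assms)
  finally show ?thesis .
qed

text \<open>The Weyl element \<open>w\<close> negates \<open>h\<close> and preserves 2q - h = q - p
  + j, which neither \<open>E\<close> nor \<open>n0\<close> changes; so it carries the label
  \<open>q\<close> to j - p. In exp(x n0) = exp(E/x) w exp(E/x) the right factor preserves the
  filtration by \<open>q\<close>, because \<open>E\<close> raises \<open>q\<close>. The growing
  factor exp(x n0) is thereby traded for exp(E/x), which tends to 1.\<close>

lemma weyl_filtration:
  assumes x: "x \<noteq> 0"
  shows "(*v) (nexp n0 x) ` csp (\<lambda>i. q i \<ge> a) = (*v) (nexp E (1 / x)) ` csp (\<lambda>i. j i - p i \<ge> a)"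
proof -
  let ?H = "diagm (\<lambda>i. of_int (h i)) :: complex^'n^'n"
  define w where "w = nexp E (- 1 / x) ** nexp n0 x ** nexp E (- 1 / x)"
  have wH: "w ** ?H = - (?H ** w)"
    unfolding w_def
  proof (rule weyl_intertwine[OF nil_E nil_n0 x E_n0])
    show "mbr ?H E = 2 *\<^sub>R E" using diagm_weight[of E h 2] E_h by (simp add: hom_deg_def)
    show "mbr ?H n0 = (-2) *\<^sub>R n0" using diagm_weight[of n0 h "-2"] n0_h by (simp add: hom_deg_def del: scaleR_minus_left)
  qed
  let ?K = "diagm (\<lambda>i. of_int (2 * q i - h i)) :: complex^'n^'n"
  have KE: "mbr E ?K = 0" and Kn: "mbr n0 ?K = 0"
  proof -
    have "mbr ?K E = (of_int 0 :: real) *\<^sub>R E" by (rule diagm_weight) (use E_entry in \<open>force simp: h_def\<close>)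
    then show "mbr E ?K = 0" using mbr_anticomm[of E ?K] by simp
    have "mbr ?K n0 = (of_int 0 :: real) *\<^sub>R n0" by (rule diagm_weight) (use n0_entry in \<open>force simp: h_def\<close>)
    then show "mbr n0 ?K = 0" using mbr_anticomm[of n0 ?K] by simp
  qed
  have cE: "nexp E z ** ?K = ?K ** nexp E z" for z
    unfolding nexp_def by (rule nil_exp_commute[OF nilpotent_csmult[OF nil_E]]) (simp only: mbr_csmult KE, simp add: vec_eq_iff)
  have cn: "nexp n0 z ** ?K = ?K ** nexp n0 z" for z
    unfolding nexp_def by (rule nil_exp_commute[OF nilpotent_csmult[OF nil_n0]]) (simp only: mbr_csmult Kn, simp add: vec_eq_iff)
  have wK: "w ** ?K = ?K ** w"
  proof -
    have "w ** ?K = nexp E (- 1 / x) ** (nexp n0 x ** (nexp E (- 1 / x) ** ?K))" by (simp only: w_def matrix_mul_assoc)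
    also have "\<dots> = nexp E (- 1 / x) ** ((nexp n0 x ** ?K) ** nexp E (- 1 / x))" unfolding cE by (simp only: matrix_mul_assoc)
    also have "\<dots> = (nexp E (- 1 / x) ** ?K) ** nexp n0 x ** nexp E (- 1 / x)" unfolding cn by (simp only: matrix_mul_assoc)
    also have "\<dots> = ?K ** w" unfolding cE by (simp only: w_def matrix_mul_assoc)
    finally show ?thesis .
  qed
  have we: "j k - p k = q i" if nz: "w $ k $ i \<noteq> 0" for k i
  proof -
    have "w $ k $ i * of_int (2 * q i - h i) = of_int (2 * q k - h k) * w $ k $ i"
      using arg_cong[OF wK, of "\<lambda>A. A $ k $ i"] by (simp add: diagm_mult)
    then have "(of_int (2 * q i - h i) :: complex) = of_int (2 * q k - h k)" using nz by simp
    then have 1: "2 * q i - h i = 2 * q k - h k" by (simp only: of_int_eq_iff)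
    have "w $ k $ i * of_int (h i) = - (of_int (h k) * w $ k $ i)"
      using arg_cong[OF wH, of "\<lambda>A. A $ k $ i"] by (simp add: diagm_mult)
    then have "(of_int (h i) :: complex) = of_int (- h k)" using nz by (simp add: field_simps) (metis mult_minus_left mult_cancel_right mult.commute)
    then have 2: "h i = - h k" by (simp only: of_int_eq_iff)
    show ?thesis using 1 2 by (simp add: h_def)
  qed
  have winv: "invertible w"
    unfolding w_def by (intro invertible_mult invertible_nexp nil_E nil_n0)
  let ?Q = "\<lambda>i. q i \<ge> a" and ?P = "\<lambda>i. j i - p i \<ge> a"
  have w1: "w *v y \<in> csp ?P" if "y \<in> csp ?Q" for y by (rule csp_map[OF _ that]) (use we in force)
  have w2: "w *v y \<in> csp (\<lambda>i. j i - p i < a)" if "y \<in> csp (\<lambda>i. q i < a)" for y by (rule csp_map[OF _ that]) (use we in force)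
  have wim: "(*v) w ` csp ?Q = csp ?P"
  proof
    show "(*v) w ` csp ?Q \<subseteq> csp ?P" using w1 by blast
    show "csp ?P \<subseteq> (*v) w ` csp ?Q"
    proof
      fix y assume y: "y \<in> csp ?P"
      define u where "u = matrix_inv w *v y"
      have wu: "w *v u = y" by (simp add: u_def matrix_inv_cancel[OF winv])
      define u1 where "u1 = (\<chi> i. if ?Q i then u $ i else 0)"
      define u2 where "u2 = u - u1"
      have u1: "u1 \<in> csp ?Q" by (simp add: u1_def csp_def)
      have u2: "u2 \<in> csp (\<lambda>i. q i < a)" by (simp add: u1_def u2_def csp_def)
      have "w *v u2 = y - w *v u1" by (simp add: u2_def matrix_vector_mult_diff_distrib wu)
      then have "w *v u2 \<in> csp ?P" using vec.subspace_diff[OF subspace_csp y w1[OF u1]] by simp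
      then have "(w *v u2) $ i = 0" for i using w2[OF u2] unfolding csp_def by (cases "?P i") auto
      then have "w *v u2 = 0" by (simp add: vec_eq_iff)
      then have "u2 = 0" using matrix_inv_cancel(1)[OF winv, of u2] by simp
      then show "y \<in> (*v) w ` csp ?Q" using wu u1 by (auto simp: u2_def)
    qed
  qed
  have EQ: "(*v) (nexp E z) ` csp ?Q = csp ?Q" for z
  proof (rule invertible_image_eq[OF invertible_nexp[OF nil_E] subspace_csp], rule nil_exp_preserves[OF subspace_csp])
    fix y assume "y \<in> csp ?Q"
    then show "E *v y \<in> csp ?Q" by (rule csp_map[rotated]) (use E_entry in force)
  qed
  have "nexp n0 x = nexp E (1 / x) ** w ** nexp E (1 / x)"
  proof -
    have "nexp E (1 / x) ** w ** nexp E (1 / x) = (nexp E (1 / x) ** nexp E (- (1 / x))) ** nexp n0 x ** (nexp E (- (1 / x)) ** nexp E (1 / x))"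
      by (simp only: w_def matrix_mul_assoc minus_divide_left)
    then show ?thesis by (simp add: nexp_inverse[OF nil_E])
  qed
  then have "(*v) (nexp n0 x) ` csp ?Q = (*v) (nexp E (1 / x)) ` (*v) w ` (*v) (nexp E (1 / x)) ` csp ?Q"
    by (simp add: image_image matrix_vector_mul_assoc matrix_mul_assoc)
  then show ?thesis by (simp only: EQ wim)
qed

definition PK :: "int \<Rightarrow> int \<Rightarrow> 'n \<Rightarrow> bool" where
  "PK a m i \<longleftrightarrow> (j i \<le> m \<and> j i - p i \<ge> a) \<or> j i \<le> m - 2"

lemma Ks_csp: "Ks (csp (\<lambda>i. j i - p i \<ge> a)) m = csp (PK a m)"
proof
  show "Ks (csp (\<lambda>i. j i - p i \<ge> a)) m \<subseteq> csp (PK a m)"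
    unfolding Ks_def splus_def csp_def PK_def by auto
  show "csp (PK a m) \<subseteq> Ks (csp (\<lambda>i. j i - p i \<ge> a)) m"
  proof
    fix x assume x: "x \<in> csp (PK a m)"
    define x2 where "x2 = (\<chi> i. if j i \<le> m - 2 then x $ i else 0)"
    have "x - x2 \<in> csp (\<lambda>i. j i - p i \<ge> a) \<inter> Wc m" using x by (auto simp: csp_def PK_def x2_def)
    moreover have "x2 \<in> Wc (m - 2)" by (simp add: x2_def csp_def)
    moreover have "x = (x - x2) + x2" by simp
    ultimately show "x \<in> Ks (csp (\<lambda>i. j i - p i \<ge> a)) m" unfolding Ks_def splus_def by blast
  qed
qed

lemma U_PK: "(*v) U ` csp (PK a m) = csp (PK a m)"
proof (rule invertible_image_eq[OF U_invertible subspace_csp])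
  fix x assume x: "x \<in> csp (PK a m)"
  show "U *v x \<in> csp (PK a m)"
  proof (rule csp_map[OF _ x])
    fix k i assume i: "PK a m i" and nz: "U $ k $ i \<noteq> 0"
    show "PK a m k"
    proof (cases "k = i")
      case False
      then have e: "p k < p i \<and> j k \<le> j i" using U_entry[OF nz] by simp
      show ?thesis
      proof (cases "j k \<le> m - 2")
        \<comment> \<open>Here \<open>j\<close> drops by at most one, and the drop of
          \<open>p\<close> makes up for it, so j - p does not decrease.\<close>
        case F: False
        then have "j i \<le> m \<and> j i - p i \<ge> a" "j i - 1 \<le> j k" using i e by (auto simp: PK_def)
        then show ?thesis using e by (auto simp: PK_def)
      qed (simp add: PK_def)
    qed (use i in simp)
  qed
qed

text \<open>The conjugate filtration is displayed as the image under \<open>h'\<close> of a fixed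
  coordinate filtration. Since \<open>U\<close> commutes with exp(x n), that exponential can be
  moved past the conjugated \<open>g\<close> and \<open>U\<close> to act on the filtration by
  \<open>q\<close>, where the Weyl element turns it into exp(E/x). The last factor
  \<open>matrix_inv U\<close> preserves the coordinate filtration; it is there to make
  \<open>h'\<close> tend to 1 instead of to \<open>U\<close>.\<close>

lemma Ks_limit:
  assumes g: "invertible g" "low g" and x: "x \<noteq> 0"
  defines "h' \<equiv> (nexp n x ** g ** nexp n (- x)) ** U ** nexp E (1 / x) ** matrix_inv U"
  shows "Ks ((*v) (nexp n x) ` (*v) g ` (*v) Bi ` vcnj ` G a) m = (*v) h' ` csp (PK a m)"
    and "invertible h'" and "low h'"
proof -
  let ?A = "csp (\<lambda>i. q i \<ge> a)"
  let ?G = "nexp n x ** g ** nexp n (- x)"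
  have inn: "invertible (nexp n z)" "low (nexp n z)" for z by (rule invertible_nexp[OF nil_n], rule low_nexp[OF low_n])
  have in0: "invertible (nexp n0 z)" "low (nexp n0 z)" for z by (rule invertible_nexp[OF nil_n0], rule low_nexp[OF low_n0])
  have inE: "invertible (nexp E z)" "low (nexp E z)" for z by (rule invertible_nexp[OF nil_E], rule low_nexp[OF low_E])
  have inG: "invertible ?G" "low ?G" by (intro invertible_mult inn g, intro low_mult inn g)
  have GU: "invertible (?G ** U)" "low (?G ** U)" by (intro invertible_mult inG U_invertible, intro low_mult inG low_U)
  show "invertible h'" "low h'" unfolding h'_def
    by (intro invertible_mult GU inE invertible_matrix_inv U_invertible, intro low_mult GU inE low_inv U_invertible low_U)
  have Un: "U ** nexp n x = nexp n x ** U"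
  proof -
    have "mbr n U = 0" using U_n by (simp add: mbr_def)
    then have "mbr (csmult x n) U = 0" unfolding mbr_csmult by (simp add: vec_eq_iff)
    from nil_exp_commute[OF nilpotent_csmult[OF nil_n] this] show ?thesis by (simp add: nexp_def)
  qed
  have "nexp n x ** g ** U = (?G ** U) ** nexp n x"
  proof -
    have "(?G ** U) ** nexp n x = nexp n x ** g ** (nexp n (- x) ** nexp n x) ** U"
      by (simp add: Un flip: matrix_mul_assoc)
    then show ?thesis by (simp add: nexp_inverse[OF nil_n])
  qed
  then have "(*v) (nexp n x) ` (*v) g ` (*v) Bi ` vcnj ` G a = (*v) (?G ** U) ` (*v) (nexp n x) ` ?A"
    unfolding vcnj_G by (simp add: image_image matrix_vector_mul_assoc matrix_mul_assoc)
  then have "Ks ((*v) (nexp n x) ` (*v) g ` (*v) Bi ` vcnj ` G a) m = (*v) (?G ** U) ` Ks ((*v) (nexp n x) ` ?A) m"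
    by (simp only: Ks_image[OF GU])
  also have "Ks ((*v) (nexp n x) ` ?A) m = Ks ((*v) (nexp n0 x) ` ?A) m"
  proof (rule antisym)
    show "Ks ((*v) (nexp n x) ` ?A) m \<subseteq> Ks ((*v) (nexp n0 x) ` ?A) m"
      by (rule Ks_cong[OF inn in0(2)]) (rule nexp_n_n0)
    show "Ks ((*v) (nexp n0 x) ` ?A) m \<subseteq> Ks ((*v) (nexp n x) ` ?A) m"
    proof (rule Ks_cong[OF in0 inn(2)])
      fix m y assume "y \<in> Wc m"
      from vec.subspace_neg[OF subspace_csp nexp_n_n0[OF this, of x]]
      show "nexp n0 x *v y - nexp n x *v y \<in> Wc (m - 2)" by simp
    qed
  qed
  also have "\<dots> = Ks ((*v) (nexp E (1 / x)) ` csp (\<lambda>i. j i - p i \<ge> a)) m" by (simp only: weyl_filtration[OF x])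
  also have "\<dots> = (*v) (nexp E (1 / x)) ` csp (PK a m)" by (simp only: Ks_image[OF inE, symmetric] Ks_csp)
  also have "csp (PK a m) = (*v) (matrix_inv U) ` csp (PK a m)"
  proof -
    have "(*v) (matrix_inv U) ` csp (PK a m) = (*v) (matrix_inv U) ` (*v) U ` csp (PK a m)" by (simp only: U_PK)
    then show ?thesis by (simp add: image_image matrix_inv_cancel[OF U_invertible])
  qed
  finally show "Ks ((*v) (nexp n x) ` (*v) g ` (*v) Bi ` vcnj ` G a) m = (*v) h' ` csp (PK a m)"
    unfolding h'_def by (simp add: image_image matrix_vector_mul_assoc matrix_mul_assoc)
qed

end

section \<open>Convergence of the grading\<close>

lemma Y_FW_props:
  assumes "is_mhs F W"
  shows "v \<in> W m \<Longrightarrow> Y_FW F W *v v - of_int m *s v \<in> W (m - 1)"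
    and "v \<in> F a \<Longrightarrow> Y_FW F W *v v \<in> F a"
    and "v \<in> F a \<inter> W m \<Longrightarrow> \<exists>w\<in>F a \<inter> W m. Y_FW F W *v vcnj v - vcnj w \<in> W (m - 2)"
proof -
  obtain B p q where "mhs_basis F W B p q" using mhs_basis_exists[OF assms] by blast
  then interpret mhs_basis F W B p q .
  show "v \<in> W m \<Longrightarrow> Y_FW F W *v v - of_int m *s v \<in> W (m - 1)" using Ylab_W by (simp add: Y_FW_eq)
  show "v \<in> F a \<Longrightarrow> Y_FW F W *v v \<in> F a" using Ylab_F by (simp add: Y_FW_eq)
  show "v \<in> F a \<inter> W m \<Longrightarrow> \<exists>w\<in>F a \<inter> W m. Y_FW F W *v vcnj v - vcnj w \<in> W (m - 2)"
    using Ylab_vcnj by (simp add: Y_FW_eq)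
qed

lemma tendsto_0_mult_bounded:
  fixes f g :: "'a \<Rightarrow> complex"
  assumes f: "(f \<longlongrightarrow> 0) L" and g: "\<And>x. norm (g x) \<le> K"
  shows "((\<lambda>x. f x * g x) \<longlongrightarrow> 0) L"
proof (rule Lim_null_comparison)
  show "\<forall>\<^sub>F x in L. norm (f x * g x) \<le> norm (f x) * K"
    using g by (intro always_eventually allI) (simp add: norm_mult mult_left_mono)
  show "((\<lambda>x. norm (f x) * K) \<longlongrightarrow> 0) L"
    using tendsto_mult_right[OF tendsto_norm_zero[OF f], of K] by simp
qed

lemma norm_entry_le: "norm (A $ k $ i) \<le> norm (A :: complex^'n::finite^'m::finite)"
  by (meson component_le_norm_cart norm_nth_le order_trans Finite_Cartesian_Product.norm_nth_le)

lemma matrix_mult3_entry: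
  fixes A :: "complex^'m::finite^'k::finite" and X :: "complex^'n::finite^'m" and C :: "complex^'l::finite^'n"
  shows "(A ** X ** C) $ k $ i = (\<Sum>s\<in>UNIV. \<Sum>r\<in>UNIV. A $ k $ r * C $ s $ i * X $ r $ s)"
proof -
  have "(A ** X ** C) $ k $ i = (\<Sum>s\<in>UNIV. \<Sum>r\<in>UNIV. A $ k $ r * X $ r $ s * C $ s $ i)"
    by (simp add: matrix_matrix_mult_def sum_distrib_right)
  then show ?thesis by (simp add: mult_ac)
qed

text \<open>The middle factor is only bounded, so neither product need converge; just their
  difference does.\<close>

lemma tendsto_sandwich_bounded:
  fixes A C X :: "'a \<Rightarrow> complex^'n::finite^'n"
  assumes A: "(A \<longlongrightarrow> A0) L" and C: "(C \<longlongrightarrow> C0) L" and X: "\<And>x. norm (X x) \<le> K"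
  shows "((\<lambda>x. A x ** X x ** C x - A0 ** X x ** C0) \<longlongrightarrow> 0) L"
proof (rule tendsto_matrixI)
  fix k i
  have e: "(A x ** X x ** C x - A0 ** X x ** C0) $ k $ i
      = (\<Sum>s\<in>UNIV. \<Sum>r\<in>UNIV. (A x $ k $ r * C x $ s $ i - A0 $ k $ r * C0 $ s $ i) * X x $ r $ s)" for x
    by (simp add: matrix_mult3_entry sum_subtractf left_diff_distrib)
  have "((\<lambda>x. (A x $ k $ r * C x $ s $ i - A0 $ k $ r * C0 $ s $ i) * X x $ r $ s) \<longlongrightarrow> 0) L" for r s
  proof (rule tendsto_0_mult_bounded)
    have "((\<lambda>x. A x $ k $ r * C x $ s $ i - A0 $ k $ r * C0 $ s $ i) \<longlongrightarrow> A0 $ k $ r * C0 $ s $ i - A0 $ k $ r * C0 $ s $ i) L"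
      by (intro tendsto_diff tendsto_mult tendsto_const tendsto_matrix_nth A C)
    then show "((\<lambda>x. A x $ k $ r * C x $ s $ i - A0 $ k $ r * C0 $ s $ i) \<longlongrightarrow> 0) L" by simp
    show "norm (X x $ r $ s) \<le> K" for x using norm_entry_le[of "X x" r s] X[of x] by linarith
  qed
  then have "((\<lambda>x. \<Sum>s\<in>UNIV. \<Sum>r\<in>UNIV. (A x $ k $ r * C x $ s $ i - A0 $ k $ r * C0 $ s $ i) * X x $ r $ s) \<longlongrightarrow> 0) L"
    by (intro tendsto_null_sum)
  then show "((\<lambda>x. (A x ** X x ** C x - A0 ** X x ** C0) $ k $ i) \<longlongrightarrow> 0 $ k $ i) L" by (simp only: e zero_index)
qed

text \<open>Decay faster than any power of Im z. Conjugation by exponentials of nilpotent matrices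
  multiplies entries by polynomials in Im z, so rapid terms still tend to 0 afterwards.\<close>

definition rapid :: "(complex \<Rightarrow> complex^'n::finite^'n) \<Rightarrow> bool" where
  "rapid X \<longleftrightarrow> (\<forall>M k i. ((\<lambda>z. of_real (Im z) ^ M * X z $ k $ i) \<longlongrightarrow> 0) Im_top)"

lemma rapid_mult:
  assumes "rapid X"
  shows "rapid (\<lambda>z. A ** X z)" "rapid (\<lambda>z. X z ** A)"
proof -
  have 1: "((\<lambda>z. \<Sum>l\<in>UNIV. A $ k $ l * (of_real (Im z) ^ M * X z $ l $ i)) \<longlongrightarrow> 0) Im_top" for M k i
    using assms unfolding rapid_def by (intro tendsto_null_sum tendsto_mult_right_zero) blast
  have 2: "((\<lambda>z. \<Sum>l\<in>UNIV. (of_real (Im z) ^ M * X z $ k $ l) * A $ l $ i) \<longlongrightarrow> 0) Im_top" for M k i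
    using assms unfolding rapid_def by (intro tendsto_null_sum tendsto_mult_left_zero) blast
  show "rapid (\<lambda>z. A ** X z)" unfolding rapid_def using 1
    by (simp add: matrix_matrix_mult_def sum_distrib_left mult_ac)
  show "rapid (\<lambda>z. X z ** A)" unfolding rapid_def using 2
    by (simp add: matrix_matrix_mult_def sum_distrib_left mult_ac)
qed

lemma rapid_mcnj:
  assumes "rapid X"
  shows "rapid (\<lambda>z. mcnj (X z))"
  unfolding rapid_def
proof (intro allI)
  fix M k i
  have "((\<lambda>z. cnj (of_real (Im z) ^ M * X z $ k $ i)) \<longlongrightarrow> cnj 0) Im_top"
    using assms unfolding rapid_def by (intro tendsto_cnj) blast
  then show "((\<lambda>z. of_real (Im z) ^ M * mcnj (X z) $ k $ i) \<longlongrightarrow> 0) Im_top" by simp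
qed

lemma rapid_nexp:
  fixes A :: "complex^'n::finite^'n"
  assumes X: "rapid X"
  shows "((\<lambda>z. nexp A (c * of_real (Im z)) ** X z ** nexp A (c' * of_real (Im z))) \<longlongrightarrow> 0) Im_top"
proof (rule tendsto_matrixI)
  fix k i
  let ?n = "CARD('n)"
  have e: "(nexp A (c * of_real (Im z)) ** X z ** nexp A (c' * of_real (Im z))) $ k $ i
    = (\<Sum>s\<in>UNIV. \<Sum>r\<in>UNIV. \<Sum>l\<le>?n. \<Sum>l'\<le>?n. (c ^ l / fact l * mpow A l $ k $ r * (c' ^ l' / fact l' * mpow A l' $ s $ i))
         * (of_real (Im z) ^ (l + l') * X z $ r $ s))" for z
  proof -
    have "(nexp A (c * of_real (Im z)) ** X z ** nexp A (c' * of_real (Im z))) $ k $ i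
      = (\<Sum>s\<in>UNIV. \<Sum>r\<in>UNIV. nexp A (c * of_real (Im z)) $ k $ r * nexp A (c' * of_real (Im z)) $ s $ i * X z $ r $ s)"
      by (rule matrix_mult3_entry)
    also have "\<dots> = (\<Sum>s\<in>UNIV. \<Sum>r\<in>UNIV. \<Sum>l\<le>?n. \<Sum>l'\<le>?n. (c ^ l / fact l * mpow A l $ k $ r * (c' ^ l' / fact l' * mpow A l' $ s $ i))
         * (of_real (Im z) ^ (l + l') * X z $ r $ s))"
      unfolding nexp_entry sum_product unfolding sum_distrib_right
      by (intro sum.cong refl) (simp add: power_mult_distrib power_add mult_ac)
    finally show ?thesis .
  qed
  have "((\<lambda>z. \<Sum>s\<in>UNIV. \<Sum>r\<in>UNIV. \<Sum>l\<le>?n. \<Sum>l'\<le>?n. (c ^ l / fact l * mpow A l $ k $ r * (c' ^ l' / fact l' * mpow A l' $ s $ i))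
         * (of_real (Im z) ^ (l + l') * X z $ r $ s)) \<longlongrightarrow> 0) Im_top"
    using X unfolding rapid_def by (intro tendsto_null_sum tendsto_mult_right_zero) blast
  then show "((\<lambda>z. (nexp A (c * of_real (Im z)) ** X z ** nexp A (c' * of_real (Im z))) $ k $ i) \<longlongrightarrow> 0 $ k $ i) Im_top"
    by (simp only: e zero_index)
qed

locale variation_basis = v: variation F W G M N + b: good_basis G M B p q W N j
  for F :: "complex \<Rightarrow> 'n::finite filt" and W G M :: "'n filt" and N B :: "complex^'n^'n" and p q j :: "'n \<Rightarrow> int"
begin

lemma nexp_W: "v \<in> W m \<Longrightarrow> nexp N z *v v \<in> W m"
  by (rule nil_exp_preserves[OF v.subW v.NW])

lemma nexp_cancel: "nexp N (- z) *v (nexp N z *v v) = v" "nexp N z *v (nexp N (- z) *v v) = v"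
  by (simp_all add: matrix_vector_mul_assoc nexp_inverse[OF v.Nnil])

definition Yz :: "complex \<Rightarrow> complex^'n^'n" where
  "Yz z = nexp N (- z) ** Y_FW (F z) W ** nexp N z"

lemma Yz_vec: "Yz z *v v = nexp N (- z) *v (Y_FW (F z) W *v (nexp N z *v v))"
  by (simp add: Yz_def matrix_vector_mul_assoc matrix_mul_assoc)

definition y :: "complex \<Rightarrow> complex^'n^'n" where "y z = b.co (Yz z)"

abbreviation "J \<equiv> diagm (\<lambda>i. of_int (j i)) :: complex^'n^'n"

lemma y_lower:
  assumes z: "Im z > 0" and ki: "\<not> j k < j i"
  shows "(y z - J) $ k $ i = 0"
proof -
  let ?c = "column i B" and ?e = "nexp N z *v column i B"
  have e: "?e \<in> W (j i)" by (rule nexp_W[OF b.col_W])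
  have "nexp N (- z) *v (Y_FW (F z) W *v ?e - of_int (j i) *s ?e) \<in> W (j i - 1)"
    by (rule nexp_W[OF Y_FW_props(1)[OF v.mhsF[OF z] e]])
  then have "Yz z *v ?c - of_int (j i) *s ?c \<in> W (j i - 1)"
    by (simp add: Yz_vec matrix_vector_mult_diff_distrib matrix_vector_mult_smult nexp_cancel)
  then have "(b.Bi *v (Yz z *v ?c - of_int (j i) *s ?c)) $ k = 0"
    using ki unfolding b.W0_eq b.cs_iff by auto
  then have "y z $ k $ i = of_int (j i) * axis i 1 $ k"
    by (simp add: y_def matrix_vector_mult_diff_distrib matrix_vector_mult_smult b.co_entry b.Bi_column)
  then show ?thesis by (auto simp: diagm_def axis_def)
qed

lemma low_y: "Im z > 0 \<Longrightarrow> b.low (y z)"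
  unfolding b.low_def
proof (intro allI impI)
  fix k i assume z: "Im z > 0" and nz: "y z $ k $ i \<noteq> 0"
  show "j k \<le> j i"
  proof (rule ccontr)
    assume "\<not> j k \<le> j i"
    then show False using y_lower[OF z, of k i] nz by (cases "k = i") (simp_all add: diagm_def)
  qed
qed

definition P0 :: "int \<Rightarrow> complex^'n^'n" where
  "P0 a = b.un (diagm (\<lambda>i. if p i \<ge> a then 1 else 0))"

text \<open>A complement made of vectors of the adapted basis, hence compatible with
  \<open>W\<close>; this makes the projections onto \<open>Ft z a\<close> along it preserve
  \<open>W\<close>.\<close>

definition C0 :: "int \<Rightarrow> (complex^'n) set" where
  "C0 a = coord_span B (\<lambda>i. p i < a)"

lemma P0_coord: "(b.Bi *v (P0 a *v v)) $ i = (if p i \<ge> a then (b.Bi *v v) $ i else 0)"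
  by (simp add: P0_def b.un_vec)

lemma P0_proj: "is_proj (P0 a) (G a) (C0 a)"
proof -
  have eq: "u = v" if "\<And>i. (b.Bi *v u) $ i = (b.Bi *v v) $ i" for u v
    using that by (metis b.Bi(2) vec_eq_iff)
  show ?thesis unfolding is_proj_def C0_def b.F_eq
    by (auto simp: b.cs_iff P0_coord matrix_vector_mult_diff_distrib intro!: eq)
qed

lemma P0_low: "v \<in> W m \<Longrightarrow> P0 a *v v \<in> W m"
  unfolding b.W0_eq b.cs_iff by (simp add: P0_coord)

text \<open>By equality of dimensions, \<open>Ft z a\<close> and \<open>C0 a\<close> decompose each
  \<open>W m\<close>, not only the whole space, so the projection acts within
  \<open>W m\<close>.\<close>

lemma proj_W:
  assumes dim: "\<And>m. vec.dim (v.Ft z a \<inter> W m) = vec.dim (G a \<inter> W m)" and z: "Im z > 0"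
    and P: "is_proj P (v.Ft z a) (C0 a)" and u: "u \<in> W m"
  shows "P *v u \<in> W m"
proof -
  have GW: "G a \<inter> W m = coord_span B (\<lambda>i. p i \<ge> a \<and> j i \<le> m)" unfolding b.F_eq b.W0_eq by (auto simp: b.cs_iff)
  have CW: "C0 a \<inter> W m = coord_span B (\<lambda>i. p i < a \<and> j i \<le> m)" unfolding C0_def b.W0_eq by (auto simp: b.cs_iff)
  have s1: "vec.subspace (v.Ft z a \<inter> W m)" by (intro vec.subspace_inter v.subFt[OF z] v.subW)
  have s2: "vec.subspace (C0 a \<inter> W m)" unfolding C0_def by (intro vec.subspace_inter subspace_coord_span v.subW)
  have "{i. j i \<le> m} = {i. p i \<ge> a \<and> j i \<le> m} \<union> {i. p i < a \<and> j i \<le> m}" by auto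
  then have "card {i. j i \<le> m} = card {i. p i \<ge> a \<and> j i \<le> m} + card {i. p i < a \<and> j i \<le> m}"
    by (simp add: card_Un_disjoint disjoint_iff)
  then have dims: "vec.dim (W m) = vec.dim (v.Ft z a \<inter> W m) + vec.dim (C0 a \<inter> W m)"
    unfolding dim GW CW by (simp add: b.W0_eq dim_coord_span[OF b.inv])
  have "(v.Ft z a \<inter> W m) \<inter> (C0 a \<inter> W m) \<subseteq> {0}" using is_proj_Int[OF P] by blast
  then have "vec.dim ((v.Ft z a \<inter> W m) \<inter> (C0 a \<inter> W m)) = 0" by (simp only: vec.dim_eq_0)
  then have "vec.dim (splus (v.Ft z a \<inter> W m) (C0 a \<inter> W m)) = vec.dim (W m)"
    using dim_splus[OF s1 s2] dims by linarith
  moreover have "splus (v.Ft z a \<inter> W m) (C0 a \<inter> W m) \<subseteq> W m"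
    unfolding splus_def using vec.subspace_add[OF v.subW] by blast
  ultimately have "splus (v.Ft z a \<inter> W m) (C0 a \<inter> W m) = W m"
    using vec.subspace_dim_equal[OF subspace_splus[OF s1 s2] v.subW] by simp
  then obtain s c where sc: "s \<in> v.Ft z a" "s \<in> W m" "c \<in> C0 a" "u = s + c" using u unfolding splus_def by blast
  have "P *v u = s" using P sc unfolding is_proj_def by (simp add: matrix_vector_right_distrib)
  then show ?thesis using sc by simp
qed

text \<open>Y(z) is not known to be bounded a priori, so the estimates are made for a normalised multiple;
  once nu (y - J) tends to 0, so does y - J.\<close>

definition nu :: "complex \<Rightarrow> real" where "nu z = 1 / (1 + norm (y z - J))"

definition X :: "complex \<Rightarrow> complex^'n^'n" where "X z = nu z *\<^sub>R y z"

lemma X_bounded: "norm (X z) \<le> norm J + 1"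
proof -
  have "1 + norm (y z - J) > 0" by (simp add: add_pos_nonneg)
  then have n: "0 \<le> nu z" "nu z \<le> 1" "nu z * norm (y z - J) \<le> 1" by (simp_all add: nu_def divide_le_eq)
  have "X z = nu z *\<^sub>R J + nu z *\<^sub>R (y z - J)" by (simp add: X_def scaleR_diff_right)
  then have "norm (X z) \<le> norm (nu z *\<^sub>R J) + norm (nu z *\<^sub>R (y z - J))" by (metis norm_triangle_ineq)
  also have "norm (nu z *\<^sub>R J) \<le> norm J" using n by (simp add: mult_left_le_one_le)
  finally show ?thesis using n by simp
qed

lemma good_projections:
  obtains y0 Pr where "y0 \<ge> 0" "\<And>z. Im z > y0 \<Longrightarrow> is_proj (Pr z) (v.Ft z a) (C0 a)"
    "\<And>z u m. Im z > y0 \<Longrightarrow> u \<in> W m \<Longrightarrow> Pr z *v u \<in> W m" "(Pr \<longlongrightarrow> P0 a) Im_top" "rapid (\<lambda>z. Pr z - P0 a)"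
proof -
  have C: "vec.subspace (C0 a)" unfolding C0_def by (rule subspace_coord_span)
  obtain y0 Pr where y0: "y0 \<ge> 0" and pr: "\<And>z. Im z > y0 \<Longrightarrow> is_proj (Pr z) (v.Ft z a) (C0 a)"
    and hol: "hol_matrix Pr {z. Im z > y0}" and per: "\<And>z. Im z > y0 \<Longrightarrow> Pr (z + 1) = Pr z" and l: "(Pr \<longlongrightarrow> P0 a) Im_top"
    by (rule v.proj_family[OF C P0_proj]) (rule that)
  obtain y1 where y1: "\<And>z. Im z > y1 \<Longrightarrow> \<forall>m a. vec.dim (v.Ft z a \<inter> W m) = vec.dim (G a \<inter> W m)"
    using v.dim_eq_all unfolding eventually_Im_top by blast
  have "rapid (\<lambda>z. Pr z - P0 a)" unfolding rapid_def
  proof (intro allI)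
    fix M k i
    have "((\<lambda>z. (Pr z $ k $ i - P0 a $ k $ i)) \<longlongrightarrow> P0 a $ k $ i - P0 a $ k $ i) Im_top"
      by (intro tendsto_diff tendsto_const tendsto_matrix_nth l)
    then have "((\<lambda>z. of_real (Im z) ^ M * (Pr z $ k $ i - P0 a $ k $ i)) \<longlongrightarrow> 0) Im_top"
      using hol per by (intro periodic_decay[of _ y0]) (auto simp: hol_matrix_def intro!: holomorphic_intros)
    then show "((\<lambda>z. of_real (Im z) ^ M * (Pr z - P0 a) $ k $ i) \<longlongrightarrow> 0) Im_top" by simp
  qed
  moreover have "Pr z *v u \<in> W m" if "Im z > max y0 y1" "u \<in> W m" for z u m
    by (rule proj_W[OF _ _ pr that(2)]) (use y1 that y0 in auto)
  ultimately show ?thesis using that[of "max y0 y1" Pr] pr l y0 by auto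
qed

text \<open>The grading preserves the step a = p i of \<open>Ft\<close>, so (1 - Pr) X Pr = 0. In
  the limit \<open>Pr\<close> becomes the coordinate projection onto p \<ge> a, which keeps column
  \<open>i\<close> and whose complement keeps row \<open>k\<close>.\<close>

lemma entry_F:
  assumes ki: "p k < p i"
  shows "((\<lambda>z. X z $ k $ i) \<longlongrightarrow> 0) Im_top"
proof -
  define a where "a = p i"
  obtain y0 Pr where y0: "y0 \<ge> 0" and pr: "\<And>z. Im z > y0 \<Longrightarrow> is_proj (Pr z) (v.Ft z a) (C0 a)"
    and l: "(Pr \<longlongrightarrow> P0 a) Im_top" using good_projections[of a] by metis
  let ?D = "diagm (\<lambda>i. if p i \<ge> a then 1 else 0) :: complex^'n^'n"
  have cl: "((\<lambda>z. b.co (Pr z)) \<longlongrightarrow> ?D) Im_top"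
  proof -
    have "((\<lambda>z. b.co (Pr z)) \<longlongrightarrow> b.co (P0 a)) Im_top" unfolding b.co_def by (intro tendsto_matrix_mult tendsto_const l)
    then show ?thesis by (simp add: P0_def)
  qed
  have 0: "(mat 1 - b.co (Pr z)) ** X z ** b.co (Pr z) = 0" if z: "Im z > y0" for z
  proof -
    have z0: "Im z > 0" using z y0 by simp
    have "Yz z *v u \<in> v.Ft z a" if u: "u \<in> v.Ft z a" for u
    proof -
      obtain w where w: "w \<in> F z a" "u = nexp N (- z) *v w" using u unfolding v.Ft_eq by blast
      have "Yz z *v u = nexp N (- z) *v (Y_FW (F z) W *v w)" by (simp add: Yz_vec w(2) nexp_cancel)
      then show ?thesis unfolding v.Ft_eq using Y_FW_props(2)[OF v.mhsF[OF z0] w(1)] by blast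
    qed
    then have "Pr z *v (Yz z *v (Pr z *v u)) = Yz z *v (Pr z *v u)" for u using pr[OF z] by (auto simp: is_proj_def)
    then have "Pr z ** (Yz z ** Pr z) = Yz z ** Pr z" by (simp add: matrix_eq matrix_vector_mul_assoc)
    then have "b.co (Pr z) ** (y z ** b.co (Pr z)) = y z ** b.co (Pr z)" unfolding y_def by (simp flip: b.co_mult)
    then have "(mat 1 - b.co (Pr z)) ** y z ** b.co (Pr z) = 0" by (simp add: mm_simps flip: matrix_mul_assoc)
    then show ?thesis by (simp add: X_def mm_simps)
  qed
  have "((\<lambda>z. (mat 1 - b.co (Pr z)) ** X z ** b.co (Pr z) - (mat 1 - ?D) ** X z ** ?D) \<longlongrightarrow> 0) Im_top"
    by (rule tendsto_sandwich_bounded[OF _ cl X_bounded]) (intro tendsto_diff tendsto_const cl)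
  then have "((\<lambda>z. ((mat 1 - b.co (Pr z)) ** X z ** b.co (Pr z) - (mat 1 - ?D) ** X z ** ?D) $ k $ i) \<longlongrightarrow> 0 $ k $ i) Im_top"
    by (rule tendsto_matrix_nth)
  moreover have "eventually (\<lambda>z. ((mat 1 - b.co (Pr z)) ** X z ** b.co (Pr z) - (mat 1 - ?D) ** X z ** ?D) $ k $ i = - X z $ k $ i) Im_top"
    unfolding eventually_Im_top
  proof (intro exI[of _ y0] allI impI)
    fix z assume "Im z > y0"
    have "(mat 1 - ?D) = diagm (\<lambda>i. if p i \<ge> a then 0 else 1)" by (simp add: vec_eq_iff mat_def diagm_def)
    then have "((mat 1 - ?D) ** X z ** ?D) $ k $ i = X z $ k $ i" using ki by (simp add: diagm_mult a_def)
    then show "((mat 1 - b.co (Pr z)) ** X z ** b.co (Pr z) - (mat 1 - ?D) ** X z ** ?D) $ k $ i = - X z $ k $ i"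
      using 0[OF \<open>Im z > y0\<close>] by simp
  qed
  ultimately have "((\<lambda>z. - X z $ k $ i) \<longlongrightarrow> 0) Im_top" using Lim_transform_eventually by fastforce
  from tendsto_minus[OF this] show ?thesis by simp
qed

lemma Wc_iff: "b.Bi *v u \<in> b.Wc m \<longleftrightarrow> u \<in> W m"
  unfolding b.W0_eq b.cs_iff csp_def by blast

lemma nexp_co: "b.Bi *v (nexp N x *v u) = nexp b.n x *v (b.Bi *v u)"
  unfolding nexp_vec by (simp add: vec.linear_sum[OF matrix_vector_mul_linear_gen] matrix_vector_mult_smult b.n_pow_co)

lemma y_Ks:
  fixes a :: int
  assumes z: "Im z > 0"
  defines "Psi \<equiv> (*v) b.Bi ` (*v) (nexp N (- z)) ` vcnj ` F z a"
  assumes x: "x \<in> b.Ks Psi m"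
  shows "y z *v x \<in> b.Ks Psi m"
proof -
  obtain u w where uw: "u \<in> Psi" "u \<in> b.Wc m" "w \<in> b.Wc (m - 2)" "x = u + w"
    using x unfolding b.Ks_def splus_def by blast
  obtain f where f: "f \<in> F z a" "u = b.Bi *v (nexp N (- z) *v vcnj f)" using uw(1) unfolding Psi_def by blast
  have "nexp N (- z) *v vcnj f \<in> W m" using uw(2) f(2) Wc_iff by simp
  then have "vcnj f \<in> W m" using nexp_W[of "nexp N (- z) *v vcnj f" m z] by (simp add: nexp_cancel)
  then have "f \<in> F z a \<inter> W m" using f(1) b.cnjW0[of "vcnj f" m] by simp
  then obtain g where g: "g \<in> F z a \<inter> W m" "Y_FW (F z) W *v vcnj f - vcnj g \<in> W (m - 2)"
    using Y_FW_props(3)[OF v.mhsF[OF z]] by blast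
  have "y z *v u = b.Bi *v (Yz z *v (nexp N (- z) *v vcnj f))" by (simp add: y_def f(2) b.co_vec)
  also have "\<dots> = b.Bi *v (nexp N (- z) *v (Y_FW (F z) W *v vcnj f))" by (simp add: Yz_vec nexp_cancel)
  finally have yu: "y z *v u = b.Bi *v (nexp N (- z) *v vcnj g) + b.Bi *v (nexp N (- z) *v (Y_FW (F z) W *v vcnj f - vcnj g))"
    by (simp add: matrix_vector_mult_diff_distrib)
  have "b.Bi *v (nexp N (- z) *v vcnj g) \<in> Psi" unfolding Psi_def using g(1) by blast
  moreover have "b.Bi *v (nexp N (- z) *v vcnj g) \<in> b.Wc m"
    unfolding Wc_iff using g(1) by (intro nexp_W b.cnjW0) blast
  moreover have "b.Bi *v (nexp N (- z) *v (Y_FW (F z) W *v vcnj f - vcnj g)) + y z *v w \<in> b.Wc (m - 2)"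
    by (intro vec.subspace_add[OF subspace_csp] b.low_Wc[OF low_y[OF z]] uw(3)) (simp add: Wc_iff nexp_W g(2))
  moreover have "y z *v x = b.Bi *v (nexp N (- z) *v vcnj g) +
     (b.Bi *v (nexp N (- z) *v (Y_FW (F z) W *v vcnj f - vcnj g)) + y z *v w)"
    by (simp add: uw(4) matrix_vector_right_distrib yu add.assoc)
  ultimately show ?thesis unfolding b.Ks_def splus_def by blast
qed

text \<open>After a change of coordinates \<open>hh z\<close>, which tends to 1, the grading
  preserves the coordinate subspace of \<open>b.PK a m\<close>, which contains the label
  \<open>i\<close> but not \<open>k\<close>. The transformed entry is therefore exactly zero, and
  the entry of the bounded matrix \<open>X\<close> tends to 0.\<close>

lemma entry_Phi:
  assumes jk: "j k = j i - 1" and pk: "p i \<le> p k"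
  shows "((\<lambda>z. X z $ k $ i) \<longlongrightarrow> 0) Im_top"
proof -
  \<comment> \<open>The last step containing \<open>i\<close>. For \<open>k\<close> one has j k - p
    k \<le> a - 1, while j k = m - 1 keeps it out of W_(m-2).\<close>
  define a where "a = j i - p i"
  define m where "m = j i"
  obtain y0 Pr where y0: "y0 \<ge> 0" and pr: "\<And>z. Im z > y0 \<Longrightarrow> is_proj (Pr z) (v.Ft z a) (C0 a)"
    and PW: "\<And>z u m. Im z > y0 \<Longrightarrow> u \<in> W m \<Longrightarrow> Pr z *v u \<in> W m"
    and l: "(Pr \<longlongrightarrow> P0 a) Im_top" and rap: "rapid (\<lambda>z. Pr z - P0 a)"
    by (rule good_projections[of a]) (rule that)
  have P0P0: "P0 a ** P0 a = P0 a"
  proof -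
    have "P0 a *v (P0 a *v u) = P0 a *v u" for u using P0_proj[of a] by (simp add: is_proj_def)
    then show ?thesis by (simp add: matrix_eq flip: matrix_vector_mul_assoc)
  qed
  \<comment> \<open>It agrees with \<open>Pr z\<close> on \<open>G a\<close>, hence carries
    \<open>G a\<close> to \<open>Ft z a\<close>, and it differs from 1 by a rapidly decreasing
    term.\<close>
  define g where "g = (\<lambda>z. mat 1 + (Pr z - P0 a) ** P0 a)"
  have gvec: "g z *v u = u + Pr z *v (P0 a *v u) - P0 a *v u" for z u
  proof -
    have "g z = mat 1 + (Pr z ** P0 a - P0 a)" by (simp add: g_def mm_simps P0P0)
    then show ?thesis by (simp add: matrix_vector_mult_add_rdistrib matrix_vector_mult_diff_rdistrib flip: matrix_vector_mul_assoc)
  qed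
  have gl: "(g \<longlongrightarrow> mat 1) Im_top"
  proof -
    have "(g \<longlongrightarrow> mat 1 + (P0 a - P0 a) ** P0 a) Im_top"
      unfolding g_def by (intro tendsto_add tendsto_matrix_mult tendsto_diff tendsto_const l)
    then show ?thesis by simp
  qed
  have inv1: "invertible (mat 1 :: complex^'n^'n)" unfolding invertible_def by (intro exI[of _ "mat 1"]) simp
  obtain y1 where y1: "\<And>z. Im z > y1 \<Longrightarrow> invertible (g z)"
    using tendsto_matrix_inv(1)[OF gl inv1] unfolding eventually_Im_top by blast
  have gG: "(*v) (g z) ` G a = v.Ft z a" if z: "Im z > max y0 y1" for z
  proof
    have P: "is_proj (Pr z) (v.Ft z a) (C0 a)" using pr z by simp
    have gG1: "g z *v u = Pr z *v u" if "u \<in> G a" for u using that P0_proj[of a] by (simp add: gvec is_proj_def)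
    show "(*v) (g z) ` G a \<subseteq> v.Ft z a" using gG1 P by (auto simp: is_proj_def)
    show "v.Ft z a \<subseteq> (*v) (g z) ` G a"
    proof
      fix w assume w: "w \<in> v.Ft z a"
      define u where "u = P0 a *v w"
      have u: "u \<in> G a" "w - u \<in> C0 a" using P0_proj[of a] by (auto simp: u_def is_proj_def)
      have "Pr z *v (w - u) = 0" "Pr z *v w = w" using P u(2) w by (auto simp: is_proj_def)
      then have "Pr z *v u = w" by (simp add: matrix_vector_mult_diff_distrib)
      then show "w \<in> (*v) (g z) ` G a" using gG1[OF u(1)] u(1) by (metis image_eqI)
    qed
  qed
  define gh where "gh = (\<lambda>z. b.co (mcnj (g z)))"
  have ghi: "invertible (gh z)" if "Im z > max y0 y1" for z
    unfolding gh_def b.co_def using y1 that by (intro invertible_mult invertible_matrix_inv b.inv invertible_mcnj) auto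
  have ghlow: "b.low (gh z)" if z: "Im z > max y0 y1" for z
  proof (rule b.lowI)
    fix m x assume x: "x \<in> b.Wc m"
    define u where "u = B *v x"
    have u: "u \<in> W m" using Wc_iff[of u m] x by (simp add: u_def)
    have "g z *v vcnj u \<in> W m"
      unfolding gvec using z b.cnjW0[OF u]
      by (intro vec.subspace_diff[OF v.subW] vec.subspace_add[OF v.subW] PW P0_low) auto
    from b.cnjW0[OF this] have "mcnj (g z) *v u \<in> W m" by (simp add: vcnj_matrix_vector_mult)
    then have "b.Bi *v (mcnj (g z) *v u) \<in> b.Wc m" by (simp add: Wc_iff)
    then show "gh z *v x \<in> b.Wc m" by (simp add: gh_def u_def b.co_def matrix_vector_mul_assoc matrix_mul_assoc)
  qed
  \<comment> \<open>Equal to -2i Im z: the exponent left when e^(-zN) meets the conjugate of e^(zN),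
    \<open>N\<close> being real.\<close>
  define x where "x = (\<lambda>z. cnj z - z)"
  have xe: "x z = (- 2 * \<i>) * of_real (Im z)" for z by (simp add: x_def complex_eq_iff)
  have x0: "x z \<noteq> 0" if "Im z > max y0 y1" for z using that y0 by (auto simp: x_def complex_eq_iff)
  define hh where "hh = (\<lambda>z. (nexp b.n (x z) ** gh z ** nexp b.n (- x z)) ** b.U ** nexp b.E (1 / x z) ** matrix_inv b.U)"
  have Psi: "(*v) b.Bi ` (*v) (nexp N (- z)) ` vcnj ` F z a = (*v) (nexp b.n (x z)) ` (*v) (gh z) ` (*v) b.Bi ` vcnj ` G a"
    if z: "Im z > max y0 y1" for z
  proof -
    have "F z a = (*v) (nexp N z) ` (*v) (g z) ` G a"
      unfolding gG[OF z] v.Ft_eq by (simp add: image_image nexp_cancel)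
    then have "(*v) b.Bi ` (*v) (nexp N (- z)) ` vcnj ` F z a
        = (\<lambda>u. b.Bi *v (nexp N (- z) *v vcnj (nexp N z *v (g z *v u)))) ` G a" by (simp add: image_image)
    also have "\<dots> = (\<lambda>u. nexp b.n (x z) *v (gh z *v (b.Bi *v vcnj u))) ` G a"
    proof (rule image_cong[OF refl])
      fix u
      have "nexp N (- z) *v vcnj (nexp N z *v (g z *v u)) = (nexp N (- z) ** nexp N (cnj z)) *v (mcnj (g z) *v vcnj u)"
        by (simp only: vcnj_matrix_vector_mult mcnj_nexp[OF v.Nreal]) (simp add: matrix_vector_mul_assoc matrix_mul_assoc)
      also have "nexp N (- z) ** nexp N (cnj z) = nexp N (x z)"
        using nexp_add[OF v.Nnil, of "- z" "cnj z"] by (simp add: x_def)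
      finally have eq: "nexp N (- z) *v vcnj (nexp N z *v (g z *v u)) = nexp N (x z) *v (mcnj (g z) *v vcnj u)" .
      show "b.Bi *v (nexp N (- z) *v vcnj (nexp N z *v (g z *v u))) = nexp b.n (x z) *v (gh z *v (b.Bi *v vcnj u))"
        unfolding eq nexp_co gh_def by (simp only: b.co_vec)
    qed
    also have "\<dots> = (*v) (nexp b.n (x z)) ` (*v) (gh z) ` (*v) b.Bi ` vcnj ` G a" by (simp add: image_image)
    finally show ?thesis .
  qed
  have zero: "(matrix_inv (hh z) ** X z ** hh z) $ k $ i = 0" if z: "Im z > max y0 y1" for z
  proof -
    have z0: "Im z > 0" using z y0 by simp
    note K = b.Ks_limit[OF ghi[OF z] ghlow[OF z] x0[OF z]]
    have hK: "(*v) (hh z) ` csp (b.PK a m) = b.Ks ((*v) b.Bi ` (*v) (nexp N (- z)) ` vcnj ` F z a) m"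
      unfolding Psi[OF z] using K(1)[of a m] by (simp add: hh_def)
    have hi: "invertible (hh z)" using K(2) by (simp add: hh_def)
    have Pi: "b.PK a m i" by (simp add: b.PK_def a_def m_def)
    have nPk: "\<not> b.PK a m k" using jk pk by (simp add: b.PK_def a_def m_def)
    have "hh z *v axis i 1 \<in> b.Ks ((*v) b.Bi ` (*v) (nexp N (- z)) ` vcnj ` F z a) m"
      using hK csp_axis[of "b.PK a m" i] Pi by blast
    then have "y z *v (hh z *v axis i 1) \<in> (*v) (hh z) ` csp (b.PK a m)" unfolding hK by (rule y_Ks[OF z0])
    then obtain t where t: "t \<in> csp (b.PK a m)" "y z *v (hh z *v axis i 1) = hh z *v t" by blast
    have "(matrix_inv (hh z) ** y z ** hh z) *v axis i 1 = matrix_inv (hh z) *v (y z *v (hh z *v axis i 1))"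
      by (simp only: matrix_vector_mul_assoc matrix_mul_assoc)
    also have "\<dots> = t" unfolding t(2) by (rule matrix_inv_cancel(1)[OF hi])
    finally have "(matrix_inv (hh z) ** y z ** hh z) $ k $ i = t $ k" by (simp add: matrix_vector_mult_axis column_def vec_eq_iff)
    also have "\<dots> = 0" using t(1) nPk by (simp add: csp_def)
    finally show ?thesis by (simp add: X_def mm_simps)
  qed
  have hl: "(hh \<longlongrightarrow> mat 1) Im_top"
  proof -
    \<comment> \<open>The conjugating exponentials grow polynomially in Im z. The rapid decay
      absorbs this growth, which mere convergence of \<open>Pr\<close> could not do.\<close>
    have "rapid (\<lambda>z. b.co (mcnj ((Pr z - P0 a) ** P0 a)))"
      unfolding b.co_def by (intro rapid_mult rapid_mcnj rap)
    from rapid_nexp[OF this, of b.n "- 2 * \<i>" "2 * \<i>"]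
    have r0: "((\<lambda>z. nexp b.n (x z) ** b.co (mcnj ((Pr z - P0 a) ** P0 a)) ** nexp b.n (- x z)) \<longlongrightarrow> 0) Im_top"
      by (simp add: xe)
    have ghe: "gh z = mat 1 + b.co (mcnj ((Pr z - P0 a) ** P0 a))" for z
    proof -
      have "mcnj (g z) = mat 1 + mcnj ((Pr z - P0 a) ** P0 a)" by (simp add: g_def vec_eq_iff mat_def)
      then show ?thesis by (simp add: gh_def b.co_def mm_simps)
    qed
    have "nexp b.n (x z) ** gh z ** nexp b.n (- x z)
       = mat 1 + nexp b.n (x z) ** b.co (mcnj ((Pr z - P0 a) ** P0 a)) ** nexp b.n (- x z)" for z
      by (simp add: ghe mm_simps nexp_inverse[OF b.nil_n])
    then have 1: "((\<lambda>z. nexp b.n (x z) ** gh z ** nexp b.n (- x z)) \<longlongrightarrow> mat 1) Im_top"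
      using tendsto_add[OF tendsto_const[of "mat 1"] r0] by simp
    have "((\<lambda>z. 1 / x z) \<longlongrightarrow> 0) Im_top"
    proof -
      have "((\<lambda>z. inverse (Im z)) \<longlongrightarrow> 0) Im_top"
        by (rule filterlim_compose[OF tendsto_inverse_0_at_top[OF filterlim_ident] filterlim_Im_top])
      then have "((\<lambda>z. (1 / (- 2 * \<i>)) * of_real (inverse (Im z))) \<longlongrightarrow> (1 / (- 2 * \<i>)) * of_real 0) Im_top"
        by (intro tendsto_mult tendsto_const tendsto_of_real)
      then show ?thesis by (simp add: xe field_simps)
    qed
    then have 2: "((\<lambda>z. nexp b.E (1 / x z)) \<longlongrightarrow> mat 1) Im_top" by (rule nexp_tendsto_1)
    have "(hh \<longlongrightarrow> mat 1 ** b.U ** mat 1 ** matrix_inv b.U) Im_top"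
      unfolding hh_def by (intro tendsto_matrix_mult tendsto_const 1 2)
    then show ?thesis by (simp add: matrix_inv_mult[OF b.U_invertible])
  qed
  have "matrix_inv (mat 1) = (mat 1 :: complex^'n^'n)" using matrix_inv_mult(1)[OF inv1] by simp
  then have hil: "((\<lambda>z. matrix_inv (hh z)) \<longlongrightarrow> mat 1) Im_top" using tendsto_matrix_inv(2)[OF hl inv1] by simp
  have "((\<lambda>z. matrix_inv (hh z) ** X z ** hh z - mat 1 ** X z ** mat 1) \<longlongrightarrow> 0) Im_top"
    by (rule tendsto_sandwich_bounded[OF hil hl X_bounded])
  from tendsto_matrix_nth[OF this, of k i]
  have t: "((\<lambda>z. (matrix_inv (hh z) ** X z ** hh z - X z) $ k $ i) \<longlongrightarrow> 0) Im_top" by simp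
  have "eventually (\<lambda>z. (matrix_inv (hh z) ** X z ** hh z - X z) $ k $ i = - X z $ k $ i) Im_top"
    unfolding eventually_Im_top by (intro exI[of _ "max y0 y1"]) (simp add: zero)
  from Lim_transform_eventually[OF t this] have "((\<lambda>z. - X z $ k $ i) \<longlongrightarrow> 0) Im_top" .
  from tendsto_minus[OF this] show ?thesis by simp
qed

lemma Yz_tendsto: "(Yz \<longlongrightarrow> b.Y) Im_top"
proof -
  let ?b = "\<lambda>z. nu z *\<^sub>R (y z - J)"
  have ent: "((\<lambda>z. ?b z $ k $ i) \<longlongrightarrow> 0) Im_top" for k i
  proof (cases "j k < j i")
    case False
    have "eventually (\<lambda>z. 0 = ?b z $ k $ i) Im_top"
      unfolding eventually_Im_top using y_lower[OF _ False] by (intro exI[of _ 0]) simp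
    then show ?thesis by (rule Lim_transform_eventually[OF tendsto_const])
  next
    case True
    then have "k \<noteq> i" by auto
    then have e: "?b z $ k $ i = X z $ k $ i" for z by (simp add: X_def diagm_def)
    show ?thesis
    proof (cases "p k < p i")
      case True
      then show ?thesis unfolding e by (rule entry_F)
    next
      case pk: False
      have "j k \<noteq> j i - 2" using b.level[of k i] pk by auto
      then have "j k = j i - 1" using True b.width[of i k] by simp
      then show ?thesis unfolding e using pk by (intro entry_Phi) auto
    qed
  qed
  have "(?b \<longlongrightarrow> 0) Im_top" by (rule tendsto_matrixI) (use ent in simp)
  then have t: "((\<lambda>z. norm (?b z)) \<longlongrightarrow> 0) Im_top" by (rule tendsto_norm_zero)
  \<comment> \<open>With r = norm (y z - J), the normalised norm is t = r/(1+r), and r = t/(1-t) is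
    continuous at t = 0. This removes the normalisation.\<close>
  have "norm (y z - J) = norm (?b z) / (1 - norm (?b z))" for z
  proof -
    have n: "1 + norm (y z - J) > 0" by (simp add: add_pos_nonneg)
    then have e: "norm (?b z) = norm (y z - J) / (1 + norm (y z - J))" by (simp add: nu_def)
    have "1 - norm (?b z) = 1 / (1 + norm (y z - J))" unfolding e using n by (simp add: field_simps)
    then show ?thesis unfolding e using n by simp
  qed
  moreover have "((\<lambda>z. norm (?b z) / (1 - norm (?b z))) \<longlongrightarrow> 0 / (1 - 0)) Im_top"
    by (intro tendsto_divide tendsto_diff tendsto_const t) simp
  ultimately have "((\<lambda>z. norm (y z - J)) \<longlongrightarrow> 0) Im_top" by simp
  then have "((\<lambda>z. y z - J) \<longlongrightarrow> 0) Im_top" by (rule tendsto_norm_zero_cancel)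
  from tendsto_add[OF this tendsto_const[of J]] have "(y \<longlongrightarrow> J) Im_top" by simp
  then have "((\<lambda>z. b.un (y z)) \<longlongrightarrow> b.un J) Im_top" unfolding b.un_def by (intro tendsto_matrix_mult tendsto_const)
  then show ?thesis by (simp add: y_def b.Y_def)
qed

end

section \<open>Labels of the adapted basis for types (I) and (II)\<close>

context variation
begin

text \<open>The number of labels with p \<ge> a and j \<le> m is the dimension of F^a \<inter> W_m
  at a single point \<open>z\<close>, so the type determines the labels by counting. Type (I) leaves
  only two adjacent values of \<open>j\<close>. For type (II) the extreme values of \<open>j\<close>
  are 2k and 2k-2, and the counts force p = k and p = k-1 there.\<close>

lemma good_basis_of_type:
  assumes ty: "(\<exists>k. \<forall>z. Im z > 0 \<longrightarrow> type_I (F z) W k) \<or> (\<exists>k. \<forall>z. Im z > 0 \<longrightarrow> type_II (F z) W k)"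
  shows "\<exists>B p q j. good_basis G M B p q W N j"
proof -
  obtain B p q j where L: "limit_mhs G M B p q W N j" and n1: "\<And>k i. j k = j i - 1 \<Longrightarrow> (matrix_inv B ** N ** B) $ k $ i = 0"
    using limit_basis_exists by blast
  interpret b: limit_mhs G M B p q W N j by (rule L)
  obtain y0 where y0: "\<And>z. Im z > y0 \<Longrightarrow> \<forall>m a. vec.dim (Ft z a \<inter> W m) = vec.dim (G a \<inter> W m)"
    using dim_eq_all unfolding eventually_Im_top by blast
  define z where "z = Complex 0 (max y0 0 + 1)"
  have z: "Im z > y0" "Im z > 0" by (auto simp: z_def)
  interpret f: mhs "F z" W by unfold_locales (rule mhsF[OF z(2)])
  have dF: "vec.dim (F z a \<inter> W m) = card {i. p i \<ge> a \<and> j i \<le> m}" for a m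
  proof -
    have "G a \<inter> W m = coord_span B (\<lambda>i. p i \<ge> a \<and> j i \<le> m)" unfolding b.F_eq b.W0_eq by (auto simp: b.cs_iff)
    then have "vec.dim (G a \<inter> W m) = card {i. p i \<ge> a \<and> j i \<le> m}" by (simp add: dim_coord_span[OF b.inv])
    then show ?thesis using y0[OF z(1)] dim_Ft_W[of z a m] by simp
  qed
  have dW: "vec.dim (W m) = card {i. j i \<le> m}" for m by (simp add: b.W0_eq dim_coord_span[OF b.inv])
  have top: "j i \<le> m" if "W m = UNIV" for i m
  proof -
    have "column i B \<in> W m" using that by simp
    then have "(b.Bi *v column i B) $ i = 0 \<or> j i \<le> m" unfolding b.W0_eq b.cs_iff by blast
    then show ?thesis by (simp add: b.Bi_column axis_def)
  qed
  have bot: "j i > m" if "W m = {0}" for i m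
  proof (rule ccontr)
    assume "\<not> j i > m"
    then have "column i B = 0" using b.monoW0[OF _ b.col_W[of i], of m] that by simp
    then have "axis i 1 = (0 :: complex^'n)" using b.Bi_column[of i] by simp
    then show False by (simp add: axis_eq_0_iff)
  qed
  show ?thesis
  proof (cases "\<exists>k. \<forall>z. Im z > 0 \<longrightarrow> type_I (F z) W k")
    case True
    then obtain k where "type_I (F z) W k" using z(2) by blast
    then obtain I where I: "deligne_bigrading (F z) W I" and Ity: "\<And>a b. I a b \<noteq> {0} \<Longrightarrow> a + b = k \<or> a + b = k - 1"
      unfolding type_I_def by blast
    have Wm: "W m = vec.span (\<Union>{I a b | a b. a + b \<le> m})" for m using I unfolding deligne_bigrading_def by blast
    have sI: "vec.subspace (I a b)" for a b using I unfolding deligne_bigrading_def by blast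
    have "(\<Union>a b. I a b) \<subseteq> W k"
    proof (intro UN_least)
      fix a b show "I a b \<subseteq> W k"
      proof (cases "I a b = {0}")
        case False
        then have "a + b \<le> k" using Ity by fastforce
        then have "I a b \<subseteq> \<Union>{I a b | a b. a + b \<le> k}" by blast
        then show ?thesis unfolding Wm by (rule subset_trans) (rule vec.span_superset)
      qed (simp add: vec.subspace_0[OF subW])
    qed
    then have "vec.span (\<Union>a b. I a b) \<subseteq> W k" by (rule vec.span_minimal[OF _ subW])
    then have Wk: "W k = UNIV" using I unfolding deligne_bigrading_def by blast
    have "\<Union>{I a b | a b. a + b \<le> k - 2} \<subseteq> {0}" using Ity by fastforce
    then have "W (k - 2) \<subseteq> {0}" unfolding Wm using vec.span_minimal[OF _ vec.subspace_single_0] by blast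
    then have Wk2: "W (k - 2) = {0}" using vec.subspace_0[OF subW] by blast
    have jr: "j i \<le> k" "j i \<ge> k - 1" for i using top[OF Wk, of i] bot[OF Wk2, of i] by auto
    have "good_basis G M B p q W N j"
    proof unfold_locales
      fix a i
      show "j a = j i - 1 \<Longrightarrow> b.n $ a $ i = 0" using n1 by (simp add: b.n_def b.co_def)
      show "j i - j a \<le> 2" using jr[of i] jr[of a] by simp
      show "j a = j i - 2 \<Longrightarrow> p a < p i \<and> (\<forall>l. j l = j i \<longrightarrow> p l = p i) \<and> (\<forall>l. j l = j a \<longrightarrow> p l = p a)"
        using jr[of i] jr[of a] by simp
    qed
    then show ?thesis by blast
  next
    case False
    then obtain k where "type_II (F z) W k" using ty z(2) by blast
    then obtain I where I: "deligne_bigrading (F z) W I"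
      and Ity: "\<And>a b. I a b \<noteq> {0} \<Longrightarrow> a + b = 2 * k - 1 \<or> (a, b) = (k, k) \<or> (a, b) = (k - 1, k - 1)"
      unfolding type_II_def by blast
    have Wm: "W m = vec.span (\<Union>{I a b | a b. a + b \<le> m})" for m using I unfolding deligne_bigrading_def by blast
    have Fm: "F z m = vec.span (\<Union>{I a b | a b. a \<ge> m})" for m using I unfolding deligne_bigrading_def by blast
    have IW: "I a b \<subseteq> W m" if "a + b \<le> m" for a b m
    proof -
      have "I a b \<subseteq> \<Union>{I a b | a b. a + b \<le> m}" using that by blast
      then show ?thesis unfolding Wm by (rule subset_trans) (rule vec.span_superset)
    qed
    have IF: "I a b \<subseteq> F z m" if "a \<ge> m" for a b m
    proof -
      have "I a b \<subseteq> \<Union>{I a b | a b. a \<ge> m}" using that by blast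
      then show ?thesis unfolding Fm by (rule subset_trans) (rule vec.span_superset)
    qed
    have I0: "I a b \<subseteq> A" if "vec.subspace A" "I a b = {0}" for a b A using that vec.subspace_0 by auto
    have span: "vec.span (\<Union>a b. I a b) = UNIV" using I unfolding deligne_bigrading_def by blast
    have "(\<Union>a b. I a b) \<subseteq> W (2 * k)"
    proof (intro UN_least)
      fix a b show "I a b \<subseteq> W (2 * k)" using I0[OF subW] IW[of a b "2 * k"] Ity[of a b] by fastforce
    qed
    then have "vec.span (\<Union>a b. I a b) \<subseteq> W (2 * k)" by (rule vec.span_minimal[OF _ subW])
    then have Wk: "W (2 * k) = UNIV" using span by blast
    have "\<Union>{I a b | a b. a + b \<le> 2 * k - 3} \<subseteq> {0}" using Ity by fastforce
    then have "W (2 * k - 3) \<subseteq> {0}" unfolding Wm using vec.span_minimal[OF _ vec.subspace_single_0] by blast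
    then have Wk3: "W (2 * k - 3) = {0}" using vec.subspace_0[OF subW] by blast
    have jr: "j i \<le> 2 * k" "j i \<ge> 2 * k - 2" for i using top[OF Wk, of i] bot[OF Wk3, of i] by auto
    have cF: "card {i. p i \<ge> a \<and> j i = 2 * k} = vec.dim (F z a) - vec.dim (F z a \<inter> W (2 * k - 1))" for a
    proof -
      have "{i. p i \<ge> a \<and> j i \<le> 2 * k} = {i. p i \<ge> a \<and> j i = 2 * k} \<union> {i. p i \<ge> a \<and> j i \<le> 2 * k - 1}" by auto
      then have "card {i. p i \<ge> a \<and> j i \<le> 2 * k} = card {i. p i \<ge> a \<and> j i = 2 * k} + card {i. p i \<ge> a \<and> j i \<le> 2 * k - 1}"
        by (simp add: card_Un_disjoint disjoint_iff)
      then show ?thesis using dF[of a "2 * k"] dF[of a "2 * k - 1"] Wk by simp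
    qed
    \<comment> \<open>F^(k+1) is spanned by pieces of weight 2k-1, because the only piece of weight
      2k is I^{k,k}.\<close>
    have up: "p i \<le> k" if "j i = 2 * k" for i
    proof -
      have "\<Union>{I a b | a b. a \<ge> k + 1} \<subseteq> W (2 * k - 1)"
      proof
        fix x assume "x \<in> \<Union>{I a b | a b. a \<ge> k + 1}"
        then obtain a b where ab: "x \<in> I a b" "a \<ge> k + 1" by blast
        show "x \<in> W (2 * k - 1)"
        proof (cases "I a b = {0}")
          case False
          then have "a + b = 2 * k - 1" using Ity[of a b] ab(2) by auto
          then show ?thesis using IW[of a b "2 * k - 1"] ab(1) by auto
        qed (use ab(1) vec.subspace_0[OF subW] in auto)
      qed
      then have "F z (k + 1) \<subseteq> W (2 * k - 1)" unfolding Fm by (rule vec.span_minimal[OF _ subW])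
      then have "card {i. p i \<ge> k + 1 \<and> j i = 2 * k} = 0" using cF[of "k + 1"] by (simp add: Int_absorb2)
      then have "{i. p i \<ge> k + 1 \<and> j i = 2 * k} = {}" by simp
      then have "\<not> (p i \<ge> k + 1 \<and> j i = 2 * k)" by blast
      then show ?thesis using that by linarith
    qed
    \<comment> \<open>F^k and W_(2k-1) together span everything, so F^k fills the whole top graded
      piece and every label with j = 2k is counted.\<close>
    have lo: "p i \<ge> k" if "j i = 2 * k" for i
    proof -
      have "(\<Union>a b. I a b) \<subseteq> splus (F z k) (W (2 * k - 1))"
      proof (intro UN_least subsetI)
        fix a b x assume x: "x \<in> I a b"
        have "x \<in> F z k \<or> x \<in> W (2 * k - 1)"
        proof (cases "I a b = {0}")
          case True
          then show ?thesis using x vec.subspace_0[OF subW] by auto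
        next
          case False
          then consider "a + b = 2 * k - 1" | "a = k" | "a = k - 1 \<and> b = k - 1" using Ity[of a b] by auto
          then show ?thesis using IW[of a b "2 * k - 1"] IF[of k a b] x by cases auto
        qed
        then have "x + 0 \<in> splus (F z k) (W (2 * k - 1)) \<or> 0 + x \<in> splus (F z k) (W (2 * k - 1))"
          unfolding splus_def using vec.subspace_0[OF subW] vec.subspace_0[OF f.sF] by blast
        then show "x \<in> splus (F z k) (W (2 * k - 1))" by simp
      qed
      then have "vec.span (\<Union>a b. I a b) \<subseteq> splus (F z k) (W (2 * k - 1))"
        by (rule vec.span_minimal) (intro subspace_splus f.sF subW)
      then have "splus (F z k) (W (2 * k - 1)) = W (2 * k)" using span Wk by blast
      then have "vec.dim (W (2 * k)) + vec.dim (F z k \<inter> W (2 * k - 1)) = vec.dim (F z k) + vec.dim (W (2 * k - 1))"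
        using dim_splus[OF f.sF subW, of k "2 * k - 1"] by simp
      moreover have "vec.dim (F z k \<inter> W (2 * k - 1)) \<le> vec.dim (F z k)" by (rule vec.dim_subset) simp
      moreover have "card {i. j i \<le> 2 * k} = card {i. j i = 2 * k} + card {i. j i \<le> 2 * k - 1}"
      proof -
        have "{i. j i \<le> 2 * k} = {i. j i = 2 * k} \<union> {i. j i \<le> 2 * k - 1}" by auto
        then show ?thesis by (simp add: card_Un_disjoint disjoint_iff)
      qed
      ultimately have "card {i. p i \<ge> k \<and> j i = 2 * k} = card {i. j i = 2 * k}" using cF[of k] dW by simp
      then have "{i. p i \<ge> k \<and> j i = 2 * k} = {i. j i = 2 * k}" by (intro card_subset_eq) auto
      then show ?thesis using that by blast
    qed
    \<comment> \<open>The lower bound holds since W_(2k-2) lies in F^(k-1). For the upper bound,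
      conjugation keeps W_(2k-2) inside F^(k-1), and F^k is opposed to conj F^(k-1) in weight 2k-2,
      so F^k meets W_(2k-2) in zero.\<close>
    have lev: "p i = k - 1" if ji: "j i = 2 * k - 2" for i
    proof -
      have "\<Union>{I a b | a b. a + b \<le> 2 * k - 2} \<subseteq> F z (k - 1)"
      proof
        fix x assume "x \<in> \<Union>{I a b | a b. a + b \<le> 2 * k - 2}"
        then obtain a b where ab: "x \<in> I a b" "a + b \<le> 2 * k - 2" by blast
        show "x \<in> F z (k - 1)"
        proof (cases "I a b = {0}")
          case False
          then have "a = k - 1" using Ity[of a b] ab(2) by auto
          then show ?thesis using IF[of "k - 1" a b] ab(1) by auto
        qed (use ab(1) vec.subspace_0[OF f.sF] in auto)
      qed
      then have WF: "W (2 * k - 2) \<subseteq> F z (k - 1)" unfolding Wm by (rule vec.span_minimal[OF _ f.sF])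
      have "card {i. p i \<ge> k - 1 \<and> j i \<le> 2 * k - 2} = card {i. j i \<le> 2 * k - 2}"
        using dF[of "k - 1" "2 * k - 2"] dW[of "2 * k - 2"] WF by (simp add: Int_absorb1)
      then have "{i. p i \<ge> k - 1 \<and> j i \<le> 2 * k - 2} = {i. j i \<le> 2 * k - 2}" by (intro card_subset_eq) auto
      then have "i \<in> {i. p i \<ge> k - 1 \<and> j i \<le> 2 * k - 2} \<longleftrightarrow> i \<in> {i. j i \<le> 2 * k - 2}" by (rule arg_cong)
      then have 1: "p i \<ge> k - 1" using ji by simp
      have "F z k \<inter> W (2 * k - 2) \<subseteq> {0}"
      proof
        fix x assume x: "x \<in> F z k \<inter> W (2 * k - 2)"
        have "vcnj x \<in> F z (2 * k - 2 - k + 1)" using f.cnjW[of x "2 * k - 2"] WF x by auto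
        then have "x \<in> W (2 * k - 2 - 1)"
          using f.opposed_Int[of x k "2 * k - 2" "vcnj x"] x vec.subspace_0[OF subW] by simp
        then show "x \<in> {0}" using Wk3 by simp
      qed
      then have "card {i. p i \<ge> k \<and> j i \<le> 2 * k - 2} = 0" using dF[of k "2 * k - 2"] vec.dim_eq_0 by metis
      then have "{i. p i \<ge> k \<and> j i \<le> 2 * k - 2} = {}" by simp
      then have "\<not> (p i \<ge> k \<and> j i \<le> 2 * k - 2)" by blast
      then have "p i < k" using ji by linarith
      then show ?thesis using 1 by simp
    qed
    have pk: "p i = k" if "j i = 2 * k" for i using up[OF that] lo[OF that] by simp
    have "good_basis G M B p q W N j"
    proof unfold_locales
      fix a i
      show "j a = j i - 1 \<Longrightarrow> b.n $ a $ i = 0" using n1 by (simp add: b.n_def b.co_def)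
      show "j i - j a \<le> 2" using jr[of i] jr[of a] by simp
      assume ai: "j a = j i - 2"
      have i: "j i = 2 * k" "j a = 2 * k - 2" using ai jr[of i] jr[of a] by auto
      show "p a < p i \<and> (\<forall>l. j l = j i \<longrightarrow> p l = p i) \<and> (\<forall>l. j l = j a \<longrightarrow> p l = p a)"
        using pk lev i by auto
    qed
    then show ?thesis by blast
  qed
qed

end

theorem theorem4p15:
  fixes W :: "'n::finite filt" and Q :: "int \<Rightarrow> complex^'n^'n" and fdim :: "int \<Rightarrow> nat"
    and F :: "complex \<Rightarrow> 'n filt" and N :: "complex^'n^'n"
    and Finf :: "'n filt" and rW :: "'n filt"
  assumes W: "rational_incr_filt W"
    and Q: "graded_forms W Q"
    and period_map: "\<forall>z. Im z > 0 \<longrightarrow> in_M W Q fdim (F z)"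
    and holo: "hol_horizontal F {z. Im z > 0}"
    and monodromy: "\<forall>z. Im z > 0 \<longrightarrow> F (z + 1) = filt_act (nil_exp N) (F z)"
    and N_gR: "in_gR W Q N" and N_nil: "nilpotent_mat N"
    and limit_filt: "filt_tendsto (\<lambda>z. filt_act (nil_exp (csmult (- z) N)) (F z)) Finf
                       (filtercomap Im at_top)"
    and rW: "rel_weight_filt N W rW"
    and limit_mhs: "is_mhs Finf rW"
    and var_type: "(\<exists>k. \<forall>z. Im z > 0 \<longrightarrow> type_I (F z) W k) \<or>
              (\<exists>k. \<forall>z. Im z > 0 \<longrightarrow> type_II (F z) W k)"
  shows "\<exists>Yinf. ((\<lambda>z. nil_exp (csmult (- z) N) ** Y_FW (F z) W ** nil_exp (csmult z N))
                   \<longlongrightarrow> Yinf) (filtercomap Im at_top)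
           \<and> Yinf = Y_deligne Finf W N rW"
proof -
  have v: "variation F W Finf rW N"
  proof
    show "is_mhs (F z) W" if "Im z > 0" for z using period_map that by (simp add: in_M_def)
    show "F (z + 1) = filt_act (nil_exp N) (F z)" if "Im z > 0" for z using monodromy that by simp
    show "N *v u \<in> W k" if "u \<in> W k" for k u using N_gR that by (auto simp: in_gR_def)
    show "real_matrix N" using N_gR by (simp add: in_gR_def)
    show "filt_tendsto (\<lambda>z. filt_act (nexp N (- z)) (F z)) Finf Im_top" using limit_filt by (simp add: nexp_def)
  qed (fact holo N_nil rW limit_mhs)+
  then obtain B p q j where "good_basis Finf rW B p q W N j"
    using variation.good_basis_of_type[OF v var_type] by blast
  then interpret variation_basis F W Finf rW N B p q j
    using v by (simp add: variation_basis_def)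
  show ?thesis
    using Yz_tendsto unfolding Yz_def nexp_def b.Y_deligne_eq by blast
qed

end
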